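(* Let $1\le p<\infty$ and $s\ge 0$. (i) Let $I$ be a closed ideal in $M^{p,1}_s(\mathbf{R}^n)$ and let $g\in M^{p',\infty}_{-s}(\mathbf{R}^n)$. Then $$\iint_{\mathbf{R}^{2n}} V_\phi f(x,\xi)\,\overline{V_\psi g(x,\xi)}\,dx\,d\xi=0\quad\text{for all } f\in I$$ holds for every pair $\phi,\psi\in\mathcal{S}(\mathbf{R}^n)$ with $\langle\psi,\phi\rangle\ne 0$ if and only if $$\int_{\mathbf{R}^n}\big[V_\phi f(x,\cdot)*V_{\overline{\psi}}\,\overline{g}(x,\cdot)\big](\xi)\,dx=0\quad\text{for all } f\in I,\ \xi\in\mathbf{R}^n$$ holds for every pair $\phi,\psi\in\mathcal{S}(\mathbf{R}^n)$ with $\langle\psi,\phi\rangle\neq 0$. (ii) The closed ideals in $M^{p,1}_s(\mathbf{R}^n)$ coincide with the closed modulation invariant subspaces of $M^{p,1}_s(\mathbf{R}^n)$; that is, a closed linear subspace of $M^{p,1}_s(\mathbf{R}^n)$ is an ideal if and only if it is modulation invariant.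
   Context: $p'$ is the conjugate exponent of $p$; $\langle \xi\rangle=(1+|\xi|^2)^{1/2}$; $\langle F,G\rangle=\int F\overline{G}\,dt$ (extended by duality). For $f\in\mathcal{S}'(\mathbf{R}^n)$ and $\phi\in\mathcal{S}(\mathbf{R}^n)$, the short-time Fourier transform is $V_\phi f(x,\xi)=\langle f,M_\xi T_x\phi\rangle=\int_{\mathbf{R}^n} f(t)\overline{\phi(t-x)}e^{-it\xi}\,dt$ (by duality), with $(T_xh)(t)=h(t-x)$, $(M_\xi h)(t)=e^{it\xi}h(t)$. The modulation space $M^{p,q}_s(\mathbf{R}^n)$ consists of all $f\in\mathcal{S}'(\mathbf{R}^n)$ with $\|f\|_{M^{p,q}_s}=\big(\int\langle\xi\rangle^{sq}(\int|V_{\phi_0}f(x,\xi)|^p\,dx)^{q/p}d\xi\big)^{1/q}<\infty$ (usual modification for infinite exponents), for a fixed window $\phi_0\in\mathcal{S}\setminus\{0\}$; different windows give equivalent norms. For $s\ge0$, $M^{p,1}_s(\mathbf{R}^n)$ consists of continuous functions and is an algebra under pointwise multiplication with $\|fg\|_{M^{p,1}_s}\le c\|f\|_{M^{p,1}_s}\|g\|_{M^{p,1}_s}$. A linear subspace $I$ of $M^{p,1}_s$ is an ideal if $fg\in I$ whenever $f\in M^{p,1}_s$, $g\in I$; a closed ideal is an ideal that is a closed subset. A subspace $M$ of $M^{p,1}_s$ is modulation invariant if $M_\eta f\in M$ (where $M_\eta f(x)=e^{ix\eta}f(x)$) whenever $f\in M$, $\eta\in\mathbf{R}^n$. The convolution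 $*$ in (i) is taken over $\mathbf{R}^n$ in the second (frequency) variable, for fixed $x$. *)

theory Defs
  imports "HOL-Probability.Essential_Supremum"
begin

section \<open>Schwartz functions and tempered distributions\<close>

definition japanese :: "'a::euclidean_space \<Rightarrow> real"
  where "japanese \<xi> = sqrt (1 + (norm \<xi>)\<^sup>2)"

primrec iter_deriv :: "'a::euclidean_space list \<Rightarrow> ('a \<Rightarrow> complex) \<Rightarrow> 'a \<Rightarrow> complex"
  where
    "iter_deriv [] h = h"
  | "iter_deriv (b # bs) h = (\<lambda>x. frechet_derivative (iter_deriv bs h) (at x) b)"

text \<open>A list of basis vectors plays the role of a multi-index. If all the iterated partial
  derivatives are differentiable everywhere, then they are all continuous, so that the first
  condition below says that \<open>h\<close> is smooth.\<close>

definition schwartz :: "('a::euclidean_space \<Rightarrow> complex) set"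
  where "schwartz = {h. \<forall>bs. set bs \<subseteq> Basis \<longrightarrow>
    (\<forall>x. iter_deriv bs h differentiable (at x)) \<and>
    (\<forall>N::nat. bounded (range (\<lambda>x. japanese x ^ N *\<^sub>R iter_deriv bs h x)))}"

definition schwartz_seminorm :: "nat \<Rightarrow> ('a::euclidean_space \<Rightarrow> complex) \<Rightarrow> real"
  where "schwartz_seminorm N h =
    (SUP (bs, x) \<in> {bs. set bs \<subseteq> Basis \<and> length bs \<le> N} \<times> UNIV.
      japanese x ^ N * cmod (iter_deriv bs h x))"

text \<open>Distributions are complex linear (not antilinear) functionals on Schwartz functions. To make
  equality of functionals the right notion, they are required to vanish outside the Schwartz space.\<close>

type_synonym 'a distr = "('a \<Rightarrow> complex) \<Rightarrow> complex"

definition tempered_distr :: "'a::euclidean_space distr set"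
  where "tempered_distr = {f.
    (\<forall>\<theta>. \<theta> \<notin> schwartz \<longrightarrow> f \<theta> = 0) \<and>
    (\<forall>\<theta>\<^sub>1\<in>schwartz. \<forall>\<theta>\<^sub>2\<in>schwartz. \<forall>a b.
      f (\<lambda>x. a * \<theta>\<^sub>1 x + b * \<theta>\<^sub>2 x) = a * f \<theta>\<^sub>1 + b * f \<theta>\<^sub>2) \<and>
    (\<exists>C N. \<forall>\<theta>\<in>schwartz. cmod (f \<theta>) \<le> C * schwartz_seminorm N \<theta>)}"

definition distr_of_fun :: "('a::euclidean_space \<Rightarrow> complex) \<Rightarrow> 'a distr"
  where "distr_of_fun F = (\<lambda>\<theta>. if \<theta> \<in> schwartz then LINT x|lborel. F x * \<theta> x else 0)"

section \<open>Time-frequency shifts and the short-time Fourier transform\<close>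

definition translate :: "'a::euclidean_space \<Rightarrow> ('a \<Rightarrow> complex) \<Rightarrow> 'a \<Rightarrow> complex"
  where "translate x h = (\<lambda>t. h (t - x))"

definition modulate :: "'a::euclidean_space \<Rightarrow> ('a \<Rightarrow> complex) \<Rightarrow> 'a \<Rightarrow> complex"
  where "modulate \<xi> h = (\<lambda>t. cis (t \<bullet> \<xi>) * h t)"

definition L2_pairing :: "('a::euclidean_space \<Rightarrow> complex) \<Rightarrow> ('a \<Rightarrow> complex) \<Rightarrow> complex"
  where "L2_pairing F G = (LINT t|lborel. F t * cnj (G t))"

text \<open>The extension of \<^const>\<open>L2_pairing\<close> by duality to a distribution in the first argument.\<close>

definition distr_pairing :: "'a::euclidean_space distr \<Rightarrow> ('a \<Rightarrow> complex) \<Rightarrow> complex"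
  where "distr_pairing f h = f (\<lambda>t. cnj (h t))"

definition STFT ::
    "('a::euclidean_space \<Rightarrow> complex) \<Rightarrow> 'a distr \<Rightarrow> 'a \<Rightarrow> 'a \<Rightarrow> complex"
  where "STFT \<phi> f x \<xi> = distr_pairing f (modulate \<xi> (translate x \<phi>))"

text \<open>Modulation and complex conjugation of distributions, extending the corresponding pointwise
  operations on functions by duality.\<close>

definition distr_modulate :: "'a::euclidean_space \<Rightarrow> 'a distr \<Rightarrow> 'a distr"
  where "distr_modulate \<eta> f = (\<lambda>\<theta>. f (modulate \<eta> \<theta>))"

definition distr_cnj :: "'a::euclidean_space distr \<Rightarrow> 'a distr"
  where "distr_cnj f = (\<lambda>\<theta>. cnj (f (\<lambda>t. cnj (\<theta> t))))"

definition convol ::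
    "('a::euclidean_space \<Rightarrow> complex) \<Rightarrow> ('a \<Rightarrow> complex) \<Rightarrow> 'a \<Rightarrow> complex"
  where "convol F G \<xi> = (LINT \<eta>|lborel. F \<eta> * G (\<xi> - \<eta>))"

section \<open>Modulation spaces\<close>

definition conj_exponent :: "ennreal \<Rightarrow> ennreal"
  where "conj_exponent p = inverse (1 - inverse p)"

lemma conj_exponent:
  assumes "1 \<le> p"
  shows "inverse p + inverse (conj_exponent p) = 1"
proof -
  have "inverse (inverse x) = x" for x :: ennreal
  proof (cases x)
    case (real r)
    then show ?thesis by (cases "r = 0") (simp_all add: inverse_ennreal)
  qed simp
  moreover have "inverse p \<le> 1"
  proof (cases p)
    case (real r)
    then have "1 \<le> r" using assms by simp
    then show ?thesis using real by (simp add: inverse_ennreal field_simps)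
  qed simp
  ultimately show ?thesis
    by (simp add: conj_exponent_def add_diff_inverse_ennreal)
qed

definition ennreal_powr :: "ennreal \<Rightarrow> real \<Rightarrow> ennreal"
  where "ennreal_powr a r = (if a = \<infinity> then \<infinity> else ennreal (enn2real a powr r))"

definition Lebesgue_norm :: "ennreal \<Rightarrow> ('a::euclidean_space \<Rightarrow> ennreal) \<Rightarrow> ennreal"
  where "Lebesgue_norm p h =
    (if p = \<infinity> then esssup lborel h
     else ennreal_powr (\<integral>\<^sup>+x. ennreal_powr (h x) (enn2real p) \<partial>lborel) (1 / enn2real p))"

text \<open>The spaces depend on the window \<open>\<phi>\<^sub>0\<close> only up to equivalence of norms.\<close>

definition modulation_norm :: "('a::euclidean_space \<Rightarrow> complex) \<Rightarrow> ennreal \<Rightarrow> ennreal \<Rightarrow> real \<Rightarrow>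
    'a distr \<Rightarrow> ennreal"
  where "modulation_norm \<phi>\<^sub>0 p q s f =
    Lebesgue_norm q (\<lambda>\<xi>. ennreal (japanese \<xi> powr s) *
      Lebesgue_norm p (\<lambda>x. ennreal (cmod (STFT \<phi>\<^sub>0 f x \<xi>))))"

definition modulation_space :: "('a::euclidean_space \<Rightarrow> complex) \<Rightarrow> ennreal \<Rightarrow> ennreal \<Rightarrow> real \<Rightarrow>
    'a distr set"
  where "modulation_space \<phi>\<^sub>0 p q s = {f \<in> tempered_distr. modulation_norm \<phi>\<^sub>0 p q s f < \<infinity>}"

text \<open>For \<open>s \<ge> 0\<close> each element of \<open>M\<^sup>p\<^sup>,\<^sup>1\<^sub>s\<close> is given by a unique continuous function, and
  the product of two such elements is the distribution given by the pointwise product.\<close>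

definition cont_fun :: "'a::euclidean_space distr \<Rightarrow> 'a \<Rightarrow> complex"
  where "cont_fun f = (THE F. continuous_on UNIV F \<and> distr_of_fun F = f)"

definition pointwise_mult :: "'a::euclidean_space distr \<Rightarrow> 'a distr \<Rightarrow> 'a distr"
  where "pointwise_mult f g = distr_of_fun (\<lambda>x. cont_fun f x * cont_fun g x)"

section \<open>Closed ideals and modulation invariant subspaces of \<open>M\<^sup>p\<^sup>,\<^sup>1\<^sub>s\<close>\<close>

definition linear_subspace ::
    "('a::euclidean_space \<Rightarrow> complex) \<Rightarrow> ennreal \<Rightarrow> real \<Rightarrow> 'a distr set \<Rightarrow> bool"
  where "linear_subspace \<phi>\<^sub>0 p s I \<longleftrightarrow>
    I \<subseteq> modulation_space \<phi>\<^sub>0 p 1 s \<and> (\<lambda>\<theta>. 0) \<in> I \<and>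
    (\<forall>f\<in>I. \<forall>g\<in>I. \<forall>a b. (\<lambda>\<theta>. a * f \<theta> + b * g \<theta>) \<in> I)"

definition norm_closed ::
    "('a::euclidean_space \<Rightarrow> complex) \<Rightarrow> ennreal \<Rightarrow> real \<Rightarrow> 'a distr set \<Rightarrow> bool"
  where "norm_closed \<phi>\<^sub>0 p s I \<longleftrightarrow>
    (\<forall>f\<in>modulation_space \<phi>\<^sub>0 p 1 s.
      (\<forall>\<epsilon>>0. \<exists>g\<in>I. modulation_norm \<phi>\<^sub>0 p 1 s (\<lambda>\<theta>. f \<theta> - g \<theta>) < \<epsilon>) \<longrightarrow> f \<in> I)"

definition ideal ::
    "('a::euclidean_space \<Rightarrow> complex) \<Rightarrow> ennreal \<Rightarrow> real \<Rightarrow> 'a distr set \<Rightarrow> bool"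
  where "ideal \<phi>\<^sub>0 p s I \<longleftrightarrow> linear_subspace \<phi>\<^sub>0 p s I \<and>
    (\<forall>f\<in>modulation_space \<phi>\<^sub>0 p 1 s. \<forall>g\<in>I. pointwise_mult f g \<in> I)"

definition modulation_invariant :: "'a::euclidean_space distr set \<Rightarrow> bool"
  where "modulation_invariant I \<longleftrightarrow> (\<forall>f\<in>I. \<forall>\<eta>. distr_modulate \<eta> f \<in> I)"

end

theory Submission
  imports Defs "HOL-Probability.Sinc_Integral" "HOL-Probability.Characteristic_Functions"
begin

text \<open>Both parts rest on one fact: for a closed linear subspace \<open>I\<close> of \<open>M\<^sup>p\<^sup>,\<^sup>1\<^sub>s\<close>, being an ideal and
  being invariant under modulations \<open>M\<^sub>\<eta>\<close> are the same.

  Let \<open>I\<close> be a closed ideal and \<open>f \<in> I\<close>. The character \<open>M\<^sub>\<eta> 1\<close> does not belong to \<open>M\<^sup>p\<^sup>,\<^sup>1\<^sub>s\<close>, but for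
  dilated cut-offs \<open>\<chi>\<^sub>k \<rightarrow> 1\<close> the functions \<open>M\<^sub>\<eta> \<chi>\<^sub>k\<close> do. Since \<open>\<chi>\<^sub>k f \<rightarrow> f\<close> in norm
  (\<open>cutoff_approximation\<close>), \<open>M\<^sub>\<eta> f\<close> is the limit of \<open>(M\<^sub>\<eta> \<chi>\<^sub>k) f \<in> I\<close>
  (\<open>closed_ideal_modulation_invariant\<close>).

  Conversely, let \<open>I\<close> be closed and modulation invariant, and let \<open>g \<in> I\<close>. If \<open>h\<close> is a superposition of
  characters, \<open>h = \<integral> a(\<eta>) M\<^sub>\<eta> 1 d\<eta>\<close> with \<open>\<integral> \<bar>a(\<eta>)\<bar> \<langle>\<eta>\<rangle>\<^sup>s d\<eta> < \<infinity>\<close>, then \<open>h g = \<integral> a(\<eta>) M\<^sub>\<eta> g d\<eta>\<close> is a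
  limit in norm of finite linear combinations of modulations of \<open>g\<close>, hence belongs to \<open>I\<close>
  (\<open>frequency_superposition_in_closed_subspace\<close>). An element \<open>f\<close> of \<open>M\<^sup>p\<^sup>,\<^sup>1\<^sub>s\<close> need not have this form, but
  \<open>\<chi>\<^sub>k f\<close> has, because its Fourier transform is a slice of a short-time Fourier transform of \<open>f\<close>. So
  \<open>\<chi>\<^sub>k f g \<in> I\<close>, and \<open>\<chi>\<^sub>k f g \<rightarrow> f g\<close> (\<open>modulation_invariant_closed_ideal\<close>).

  The equivalence of the two orthogonality conditions is then a change of variables. The transform of
  \<open>M\<^sub>-\<^sub>\<zeta> f\<close> is that of \<open>f\<close> shifted by \<open>\<zeta>\<close> in frequency, and the transform of the conjugate of \<open>g\<close>
  with respect to the conjugate of \<open>\<psi>\<close> is the conjugate of \<open>V\<^sub>\<psi> g(x, -\<xi>)\<close>. Therefore the integrated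
  convolution of \<open>f\<close> at \<open>\<zeta>\<close> is the pairing of \<open>M\<^sub>-\<^sub>\<zeta> f\<close> with \<open>g\<close> (\<open>convolution_pairing_eq\<close>). If all
  pairings with elements of the modulation invariant space \<open>I\<close> vanish, so do all convolutions; the
  converse is the case \<open>\<zeta> = 0\<close>. The use of Fubini's theorem is justified by Hoelder's inequality
  (\<open>STFT_product_integrable\<close>).

  All estimates come from one pointwise bound (\<open>STFT_change_of_window\<close>): \<open>\<bar>V\<^sub>\<psi> f\<bar>\<close> is at most a constant
  times \<open>\<bar>V\<^sub>\<phi> f\<bar>\<close> smeared by a rapidly decaying kernel on phase space. It follows from the reconstruction
  formula (\<open>distr_reconstruction\<close>), which writes a test function as an integral of time-frequency shifts
  of \<open>\<phi>\<close> and moves the distribution under that integral. The integral is a limit of finite sums in a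
  seminorm that controls the distribution, so no integration theory for functions with values in the
  Schwartz space is needed. Smearing is bounded in the mixed norms by Minkowski's inequality
  (\<open>mixed_norm_smear\<close>), so the norm does not depend on the window up to constants. Integrated in \<open>x\<close>, the
  bound yields \<open>\<bar>V\<^sub>\<psi> f(x, \<xi>)\<bar> \<le> \<sigma>(\<xi>)\<close> with \<open>\<integral> \<sigma>(\<xi>) \<langle>\<xi>\<rangle>\<^sup>s d\<xi> < \<infinity>\<close> (\<open>STFT_frequency_majorant\<close>), which gives
  the algebra property. The smeared transform also dominates all frequency shifts of \<open>V\<^sub>\<phi> f\<close> by
  bounded amounts, which is what the dominated convergence arguments require.\<close>

section \<open>Lebesgue norms\<close>

lemma ennreal_powr_0 [simp]: "ennreal_powr 0 r = 0"
  by (simp add: ennreal_powr_def)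

lemma ennreal_powr_top [simp]: "ennreal_powr top r = top"
  by (simp add: ennreal_powr_def)

lemma ennreal_powr_ennreal: "0 \<le> a \<Longrightarrow> ennreal_powr (ennreal a) r = ennreal (a powr r)"
  by (simp add: ennreal_powr_def)

lemma ennreal_powr_mono: "0 \<le> r \<Longrightarrow> a \<le> b \<Longrightarrow> ennreal_powr a r \<le> ennreal_powr b r"
  by (cases a; cases b) (auto simp: ennreal_powr_ennreal powr_mono2 top_unique)

lemma ennreal_powr_mult: "0 < r \<Longrightarrow> ennreal_powr (a * b) r = ennreal_powr a r * ennreal_powr b r"
  by (cases a; cases b)
     (auto simp: ennreal_powr_ennreal powr_mult ennreal_mult[symmetric] ennreal_mult_top
        ennreal_top_mult simp del: ennreal_mult'' ennreal_mult')

lemma ennreal_powr_powr_inverse [simp]: "0 < r \<Longrightarrow> ennreal_powr (ennreal_powr a r) (1 / r) = a"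
  by (cases a) (auto simp: ennreal_powr_ennreal powr_powr)

lemma ennreal_powr_inverse_powr [simp]: "0 < r \<Longrightarrow> ennreal_powr (ennreal_powr a (1 / r)) r = a"
  by (cases a) (auto simp: ennreal_powr_ennreal powr_powr)

lemma ennreal_powr_one [simp]: "ennreal_powr a 1 = a"
  by (cases a) (auto simp: ennreal_powr_ennreal)

lemma ennreal_powr_eq_0_iff [simp]: "ennreal_powr a r = 0 \<longleftrightarrow> a = 0"
  by (cases a) (auto simp: ennreal_powr_ennreal)

lemma ennreal_powr_eq_top_iff [simp]: "ennreal_powr a r = top \<longleftrightarrow> a = top"
  by (cases a) (auto simp: ennreal_powr_ennreal)

lemma ennreal_powr_measurable [measurable]:
  "h \<in> borel_measurable M \<Longrightarrow> (\<lambda>x. ennreal_powr (h x) r) \<in> borel_measurable M"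
proof -
  assume h[measurable]: "h \<in> borel_measurable M"
  have "h -` {\<infinity>} \<inter> space M \<in> sets M" by (rule measurable_sets[OF h]) simp
  moreover have "{x \<in> space M. h x = \<infinity>} = h -` {\<infinity>} \<inter> space M" by auto
  ultimately have [simp]: "{x \<in> space M. h x = \<infinity>} \<in> sets M" by simp
  show ?thesis unfolding ennreal_powr_def by (intro measurable_If) auto
qed

lemma ennreal_powr_tendsto_0:
  assumes "0 < r" and u: "(u \<longlongrightarrow> 0) F"
  shows "((\<lambda>k. ennreal_powr (u k) r) \<longlongrightarrow> 0) F"
proof (rule order_tendstoI)
  fix e :: ennreal assume "0 < e"
  define c where "c = ennreal_powr e (1 / r)"
  have "c \<noteq> 0" using \<open>0 < e\<close> by (simp add: c_def)
  then have "0 < c" by (simp add: zero_less_iff_neq_zero)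
  have "eventually (\<lambda>k. u k < c) F" using u \<open>0 < c\<close> by (rule order_tendstoD)
  then show "eventually (\<lambda>k. ennreal_powr (u k) r < e) F"
  proof eventually_elim
    case (elim k)
    have "\<not> e \<le> ennreal_powr (u k) r"
    proof
      assume "e \<le> ennreal_powr (u k) r"
      then have "c \<le> ennreal_powr (ennreal_powr (u k) r) (1 / r)"
        unfolding c_def using \<open>0 < r\<close> by (intro ennreal_powr_mono) auto
      with elim \<open>0 < r\<close> show False by simp
    qed
    then show ?case by simp
  qed
qed simp

lemma Lebesgue_norm_eq:
  "1 \<le> r \<Longrightarrow> Lebesgue_norm (ennreal r) h
     = ennreal_powr (\<integral>\<^sup>+x. ennreal_powr (h x) r \<partial>lborel) (1 / r)"
  by (simp add: Lebesgue_norm_def)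

lemma Lebesgue_norm_1: "Lebesgue_norm 1 h = (\<integral>\<^sup>+x. h x \<partial>lborel)"
  by (simp add: Lebesgue_norm_def)

lemma Lebesgue_norm_powr:
  "1 \<le> r \<Longrightarrow> ennreal_powr (Lebesgue_norm (ennreal r) h) r = (\<integral>\<^sup>+x. ennreal_powr (h x) r \<partial>lborel)"
  by (simp add: Lebesgue_norm_eq)

lemma Lebesgue_norm_le_iff:
  assumes "1 \<le> r"
  shows "Lebesgue_norm (ennreal r) h \<le> c
    \<longleftrightarrow> (\<integral>\<^sup>+x. ennreal_powr (h x) r \<partial>lborel) \<le> ennreal_powr c r"
proof
  assume "Lebesgue_norm (ennreal r) h \<le> c"
  then have "ennreal_powr (Lebesgue_norm (ennreal r) h) r \<le> ennreal_powr c r"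
    using assms by (intro ennreal_powr_mono) auto
  then show "(\<integral>\<^sup>+x. ennreal_powr (h x) r \<partial>lborel) \<le> ennreal_powr c r"
    using assms by (simp add: Lebesgue_norm_powr)
next
  assume "(\<integral>\<^sup>+x. ennreal_powr (h x) r \<partial>lborel) \<le> ennreal_powr c r"
  then have "Lebesgue_norm (ennreal r) h \<le> ennreal_powr (ennreal_powr c r) (1 / r)"
    unfolding Lebesgue_norm_eq[OF assms] using assms by (intro ennreal_powr_mono) auto
  then show "Lebesgue_norm (ennreal r) h \<le> c" using assms by simp
qed

lemma Lebesgue_norm_mono_AE:
  assumes "1 \<le> r" and "AE x in lborel. h x \<le> k x"
  shows "Lebesgue_norm (ennreal r) h \<le> Lebesgue_norm (ennreal r) k"
  using assms unfolding Lebesgue_norm_eq[OF assms(1)]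
  by (intro ennreal_powr_mono nn_integral_mono_AE) (auto elim!: eventually_mono intro!: ennreal_powr_mono)

lemma Lebesgue_norm_mono:
  assumes "1 \<le> r" and "\<And>x. h x \<le> k x"
  shows "Lebesgue_norm (ennreal r) h \<le> Lebesgue_norm (ennreal r) k"
  using assms by (intro Lebesgue_norm_mono_AE) auto

lemma Lebesgue_norm_cmult:
  assumes "1 \<le> r" and [measurable]: "h \<in> borel_measurable lborel"
  shows "Lebesgue_norm (ennreal r) (\<lambda>x. c * h x) = c * Lebesgue_norm (ennreal r) h"
  using assms(1)
  by (simp add: Lebesgue_norm_eq ennreal_powr_mult nn_integral_cmult)

lemma nn_integral_lborel_shift:
  fixes h :: "'a::euclidean_space \<Rightarrow> ennreal"
  assumes [measurable]: "h \<in> borel_measurable borel"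
  shows "(\<integral>\<^sup>+x. h (x + c) \<partial>lborel) = (\<integral>\<^sup>+x. h x \<partial>lborel)"
proof -
  have "(\<integral>\<^sup>+x. h x \<partial>lborel) = (\<integral>\<^sup>+x. h x \<partial>distr lborel borel ((+) c))"
    by (simp add: lborel_distr_plus)
  also have "\<dots> = (\<integral>\<^sup>+x. h (c + x) \<partial>lborel)" by (subst nn_integral_distr) auto
  finally show ?thesis by (simp add: add.commute)
qed

lemma Lebesgue_norm_shift:
  assumes "1 \<le> r" and [measurable]: "h \<in> borel_measurable borel"
  shows "Lebesgue_norm (ennreal r) (\<lambda>x. h (x + c)) = Lebesgue_norm (ennreal r) h"
  using assms(1) nn_integral_lborel_shift[of "\<lambda>x. ennreal_powr (h x) r" c]
  by (simp add: Lebesgue_norm_eq)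

lemma Lebesgue_norm_measurable [measurable (raw)]:
  fixes K :: "'b \<Rightarrow> 'a::euclidean_space \<Rightarrow> ennreal"
  assumes "1 \<le> r" and [measurable]: "(\<lambda>(\<eta>, x). K \<eta> x) \<in> borel_measurable (M \<Otimes>\<^sub>M lborel)"
  shows "(\<lambda>\<eta>. Lebesgue_norm (ennreal r) (K \<eta>)) \<in> borel_measurable M"
  unfolding Lebesgue_norm_eq[OF assms(1)] by measurable

lemma Lebesgue_norm_tendsto_0:
  assumes r: "1 \<le> r" and [measurable]: "\<And>k. u k \<in> borel_measurable lborel"
    "H \<in> borel_measurable lborel"
    and le: "\<And>k x. u k x \<le> H x" and fin: "Lebesgue_norm (ennreal r) H < top"
    and lim: "\<And>x. (\<lambda>k. u k x) \<longlonglongrightarrow> 0"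
  shows "(\<lambda>k. Lebesgue_norm (ennreal r) (u k)) \<longlonglongrightarrow> 0"
proof -
  have "(\<lambda>k. \<integral>\<^sup>+x. ennreal_powr (u k x) r \<partial>lborel) \<longlonglongrightarrow> (\<integral>\<^sup>+x. 0 \<partial>(lborel :: 'a measure))"
  proof (rule nn_integral_dominated_convergence[where w = "\<lambda>x. ennreal_powr (H x) r"])
    show "(\<integral>\<^sup>+x. ennreal_powr (H x) r \<partial>lborel) < \<infinity>"
      using fin r by (simp add: Lebesgue_norm_powr[symmetric] less_top[symmetric])
  qed (use r le lim in \<open>auto intro!: ennreal_powr_mono ennreal_powr_tendsto_0\<close>)
  then show ?thesis
    using r by (simp add: Lebesgue_norm_eq ennreal_powr_tendsto_0)
qed

text \<open>The graph of \<open>t \<mapsto> t\<^sup>r\<close> lies above its tangent at \<open>m\<close>. Multiplied out, this is Young's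
  inequality for the weights \<open>1/r\<close> and \<open>1 - 1/r\<close>.\<close>

lemma powr_tangent_bound:
  fixes k m r :: real
  assumes "1 \<le> r" "0 \<le> k" "0 < m"
  shows "r * m powr (r - 1) * k \<le> k powr r + (r - 1) * m powr r"
proof (cases "k = 0")
  case False
  then have "(k powr r) powr (1 / r) * (m powr r) powr (1 - 1 / r)
      \<le> (1 / r) * k powr r + (1 - 1 / r) * m powr r"
    using assms by (intro Youngs_inequality_0) auto
  moreover have "r * (1 - 1 / r) = r - 1" using assms by (simp add: field_simps)
  ultimately have "k * m powr (r - 1) \<le> (1 / r) * k powr r + (1 - 1 / r) * m powr r"
    using assms by (simp add: powr_powr)
  then have "r * (k * m powr (r - 1)) \<le> r * ((1 / r) * k powr r + (1 - 1 / r) * m powr r)"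
    using assms by (intro mult_left_mono) auto
  also have "\<dots> = k powr r + (r - 1) * m powr r"
    using assms by (simp add: field_simps)
  finally show ?thesis by (simp add: mult_ac)
qed (use assms in auto)

text \<open>The tangent inequality at the mean value is integrated against \<open>u\<close>. A total mass below 1 is
  enough because the tangent at \<open>m > 0\<close> has a nonpositive constant term.\<close>

lemma jensen_ennreal_powr:
  assumes r: "1 \<le> r" and [measurable]: "k \<in> borel_measurable M" "u \<in> borel_measurable M"
    and u: "(\<integral>\<^sup>+x. u x \<partial>M) \<le> 1"
  shows "ennreal_powr (\<integral>\<^sup>+x. k x * u x \<partial>M) r \<le> (\<integral>\<^sup>+x. ennreal_powr (k x) r * u x \<partial>M)"
    (is "?L \<le> ?R")
proof (cases "?R = top")
  case False
  define m where "m = (\<integral>\<^sup>+x. k x * u x \<partial>M)"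
  \<comment> \<open>\<open>k \<le> 1 + k\<^sup>r\<close>, so the mean is finite if the right-hand side is.\<close>
  have "m \<le> (\<integral>\<^sup>+x. u x + ennreal_powr (k x) r * u x \<partial>M)"
    unfolding m_def
  proof (rule nn_integral_mono)
    fix x
    have "k x \<le> 1 + ennreal_powr (k x) r"
    proof (cases "k x")
      case (real a)
      have "a \<le> 1 + a powr r"
      proof (cases "a \<le> 1")
        case False
        then have "a powr 1 \<le> a powr r" using r by (intro powr_mono) auto
        then show ?thesis using False by simp
      qed (simp add: add_increasing2)
      then have "ennreal a \<le> ennreal (1 + a powr r)" by (rule ennreal_leI)
      then show ?thesis using real by (simp add: ennreal_powr_ennreal)
    qed simp
    then have "k x * u x \<le> (1 + ennreal_powr (k x) r) * u x" by (intro mult_right_mono) auto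
    then show "k x * u x \<le> u x + ennreal_powr (k x) r * u x" by (simp add: distrib_right)
  qed
  also have "\<dots> = (\<integral>\<^sup>+x. u x \<partial>M) + ?R" by (rule nn_integral_add) auto
  also have "\<dots> < top" using False u le_less_trans[OF u ennreal_one_less_top] by (simp add: less_top)
  finally obtain a where a: "m = ennreal a" "0 \<le> a" by (cases m) auto
  show ?thesis
  proof (cases "a = 0")
    case False
    then have "0 < a" using a by simp
    have "ennreal (r * a powr r) = ennreal (r * a powr (r - 1)) * m"
      using \<open>0 < a\<close> r by (simp add: a(1) ennreal_mult[symmetric] powr_diff)
    also have "\<dots> = (\<integral>\<^sup>+x. ennreal (r * a powr (r - 1)) * (k x * u x) \<partial>M)"
      unfolding m_def by (rule nn_integral_cmult[symmetric]) auto
    also have "\<dots> \<le> (\<integral>\<^sup>+x. ennreal_powr (k x) r * u x + ennreal ((r - 1) * a powr r) * u x \<partial>M)"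
    proof (rule nn_integral_mono)
      fix x
      have "ennreal (r * a powr (r - 1)) * k x \<le> ennreal_powr (k x) r + ennreal ((r - 1) * a powr r)"
      proof (cases "k x")
        case (real b)
        then show ?thesis using powr_tangent_bound[OF r, of b a] \<open>0 < a\<close> r
          by (simp add: ennreal_powr_ennreal ennreal_mult[symmetric] ennreal_plus[symmetric]
              ennreal_leI del: ennreal_plus)
      qed simp
      then have "ennreal (r * a powr (r - 1)) * k x * u x
        \<le> (ennreal_powr (k x) r + ennreal ((r - 1) * a powr r)) * u x"
        by (rule mult_right_mono) auto
      then show "ennreal (r * a powr (r - 1)) * (k x * u x)
        \<le> ennreal_powr (k x) r * u x + ennreal ((r - 1) * a powr r) * u x"
        by (simp add: distrib_right mult.assoc)
    qed
    also have "\<dots> = ?R + ennreal ((r - 1) * a powr r) * (\<integral>\<^sup>+x. u x \<partial>M)"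
      by (subst nn_integral_add) (auto simp: nn_integral_cmult)
    also have "\<dots> \<le> ?R + ennreal ((r - 1) * a powr r) * 1"
      using u by (intro add_left_mono mult_left_mono) auto
    finally have *: "ennreal (r * a powr r) \<le> ?R + ennreal ((r - 1) * a powr r)" by simp
    obtain R where R: "?R = ennreal R" "0 \<le> R" using \<open>?R \<noteq> top\<close> by (cases ?R) auto
    from * have "r * a powr r \<le> R + (r - 1) * a powr r"
      unfolding R(1) using R(2) r
      by (metis ennreal_le_iff ennreal_plus add_nonneg_nonneg mult_nonneg_nonneg powr_ge_zero diff_ge_0_iff_ge)
    then have "a powr r \<le> R" by (simp add: algebra_simps)
    then show ?thesis using a R unfolding m_def[symmetric]
      by (simp add: ennreal_powr_ennreal)
  qed (use a in \<open>simp add: m_def[symmetric]\<close>)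
qed simp

text \<open>Minkowski's inequality for integrals. Duality is avoided: let \<open>N(\<eta>)\<close> be the norm of \<open>K(\<cdot>, \<eta>)\<close>
  and \<open>A\<close> the integral of \<open>N\<close>. Then \<open>\<integral> K d\<eta> / A\<close> is the mean of the normalised functions \<open>K(\<cdot>, \<eta>) /
  N(\<eta>)\<close> with respect to the weight \<open>N / A\<close>, and Jensen's inequality bounds its norm by 1.\<close>

lemma Lebesgue_norm_integral_le:
  fixes K :: "'a::euclidean_space \<Rightarrow> 'b \<Rightarrow> ennreal"
  assumes r: "1 \<le> r" and "sigma_finite_measure M"
    and K: "(\<lambda>(x, \<eta>). K x \<eta>) \<in> borel_measurable (lborel \<Otimes>\<^sub>M M)"
  shows "Lebesgue_norm (ennreal r) (\<lambda>x. \<integral>\<^sup>+\<eta>. K x \<eta> \<partial>M)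
     \<le> (\<integral>\<^sup>+\<eta>. Lebesgue_norm (ennreal r) (\<lambda>x. K x \<eta>) \<partial>M)" (is "?L \<le> ?R")
proof (cases "?R = top")
  case False
  interpret M: sigma_finite_measure M by fact
  interpret MM: pair_sigma_finite lborel M ..
  note K[measurable]
  have [measurable]: "(\<lambda>(\<eta>, x). K x \<eta>) \<in> borel_measurable (M \<Otimes>\<^sub>M lborel)"
    using K by (subst measurable_pair_swap_iff) (simp add: case_prod_beta')
  define N where "N \<eta> = Lebesgue_norm (ennreal r) (\<lambda>x. K x \<eta>)" for \<eta>
  have [measurable]: "N \<in> borel_measurable M"
    unfolding N_def using r by measurable
  obtain e where e[measurable]: "e \<in> borel_measurable M" and efin: "integral\<^sup>N M e \<noteq> \<infinity>"
    and epos: "\<And>x. x \<in> space M \<Longrightarrow> 0 < e x \<and> e x < \<infinity>"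
    using M.Ex_finite_integrable_function by blast
  have main: "?L \<le> ?R + ennreal \<epsilon> * (1 + integral\<^sup>N M e)" if \<epsilon>: "0 < \<epsilon>" for \<epsilon> :: real
  proof -
    \<comment> \<open>\<open>e\<close> is positive and integrable: it keeps the denominator \<open>N'\<close> away from 0.\<close>
    define N' where "N' \<eta> = N \<eta> + ennreal \<epsilon> * e \<eta>" for \<eta>
    have [measurable]: "N' \<in> borel_measurable M" unfolding N'_def by measurable
    define A where "A = integral\<^sup>N M N' + ennreal \<epsilon>"
    have IN': "integral\<^sup>N M N' = ?R + ennreal \<epsilon> * integral\<^sup>N M e"
      unfolding N'_def N_def[symmetric] by (subst nn_integral_add) (auto simp: nn_integral_cmult)
    have A: "A = ?R + ennreal \<epsilon> * (1 + integral\<^sup>N M e)"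
      unfolding A_def IN' by (simp add: distrib_left add_ac)
    have Afin: "A \<noteq> top" using False efin by (auto simp: A ennreal_mult_eq_top_iff)
    have Apos: "A \<noteq> 0" using \<epsilon> by (simp add: A_def)
    have AEfin: "AE \<eta> in M. N' \<eta> \<noteq> \<infinity>"
    proof (rule nn_integral_noteq_infinite)
      show "integral\<^sup>N M N' \<noteq> \<infinity>" using Afin by (auto simp: A_def)
    qed simp
    have pos: "N' \<eta> \<noteq> 0" if "\<eta> \<in> space M" for \<eta>
      using epos[OF that] \<epsilon> by (auto simp: N'_def)
    define u where "u \<eta> = N' \<eta> * inverse A" for \<eta>
    have [measurable]: "u \<in> borel_measurable M" unfolding u_def by measurable
    have "(\<integral>\<^sup>+\<eta>. u \<eta> \<partial>M) = integral\<^sup>N M N' * inverse A"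
      unfolding u_def by (rule nn_integral_multc) auto
    also have "\<dots> \<le> A * inverse A" by (intro mult_right_mono) (auto simp: A_def)
    also have "\<dots> = 1" using Afin Apos
      by (metis divide_ennreal_def ennreal_divide_self less_top)
    finally have u1: "(\<integral>\<^sup>+\<eta>. u \<eta> \<partial>M) \<le> 1" .
    define t where "t x = (\<integral>\<^sup>+\<eta>. K x \<eta> \<partial>M)" for x
    have [measurable]: "t \<in> borel_measurable lborel" unfolding t_def by measurable
    have tx: "ennreal_powr (inverse A * t x) r
      \<le> (\<integral>\<^sup>+\<eta>. ennreal_powr (K x \<eta> * inverse (N' \<eta>)) r * u \<eta> \<partial>M)" for x
    proof -
      have "inverse A * t x = (\<integral>\<^sup>+\<eta>. inverse A * K x \<eta> \<partial>M)"
        unfolding t_def by (rule nn_integral_cmult[symmetric]) auto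
      also have "\<dots> = (\<integral>\<^sup>+\<eta>. K x \<eta> * inverse (N' \<eta>) * u \<eta> \<partial>M)"
      proof (rule nn_integral_cong_AE)
        show "AE \<eta> in M. inverse A * K x \<eta> = K x \<eta> * inverse (N' \<eta>) * u \<eta>"
          using AEfin AE_space
        proof eventually_elim
          case (elim \<eta>)
          then have "inverse (N' \<eta>) * N' \<eta> = 1" using pos
            by (metis divide_ennreal_def ennreal_divide_self less_top mult.commute
                infinity_ennreal_def)
          then show ?case unfolding u_def by (metis (no_types) mult.assoc mult.commute mult.right_neutral)
        qed
      qed
      finally show ?thesis using r u1 by (simp add: jensen_ennreal_powr)
    qed
    have "(\<integral>\<^sup>+x. ennreal_powr (inverse A * t x) r \<partial>lborel)
      \<le> (\<integral>\<^sup>+x. (\<integral>\<^sup>+\<eta>. ennreal_powr (K x \<eta> * inverse (N' \<eta>)) r * u \<eta> \<partial>M) \<partial>lborel)"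
      by (intro nn_integral_mono tx)
    also have "\<dots> = (\<integral>\<^sup>+\<eta>. (\<integral>\<^sup>+x. ennreal_powr (K x \<eta> * inverse (N' \<eta>)) r * u \<eta> \<partial>lborel) \<partial>M)"
      by (rule MM.Fubini'[symmetric]) measurable
    also have "\<dots> \<le> (\<integral>\<^sup>+\<eta>. u \<eta> \<partial>M)"
    proof (rule nn_integral_mono_AE)
      show "AE \<eta> in M. (\<integral>\<^sup>+x. ennreal_powr (K x \<eta> * inverse (N' \<eta>)) r * u \<eta> \<partial>lborel) \<le> u \<eta>"
        using AEfin AE_space
      proof eventually_elim
        case (elim \<eta>)
        have [measurable]: "(\<lambda>x. K x \<eta>) \<in> borel_measurable lborel" using K elim by measurable
        have "(\<integral>\<^sup>+x. ennreal_powr (K x \<eta> * inverse (N' \<eta>)) r * u \<eta> \<partial>lborel)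
          = (\<integral>\<^sup>+x. ennreal_powr (K x \<eta>) r \<partial>lborel) * ennreal_powr (inverse (N' \<eta>)) r * u \<eta>"
          using r by (simp add: ennreal_powr_mult nn_integral_multc)
        also have "(\<integral>\<^sup>+x. ennreal_powr (K x \<eta>) r \<partial>lborel) = ennreal_powr (N \<eta>) r"
          unfolding N_def using r by (simp add: Lebesgue_norm_powr)
        also have "\<dots> * ennreal_powr (inverse (N' \<eta>)) r \<le> ennreal_powr (N' \<eta>) r * ennreal_powr (inverse (N' \<eta>)) r"
          using r by (intro mult_right_mono ennreal_powr_mono) (auto simp: N'_def)
        also have "\<dots> = ennreal_powr (N' \<eta> * inverse (N' \<eta>)) r"
          using r by (simp add: ennreal_powr_mult)
        also have "N' \<eta> * inverse (N' \<eta>) = 1" using elim pos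
          by (metis divide_ennreal_def ennreal_divide_self less_top infinity_ennreal_def)
        also have "ennreal_powr 1 r = 1" using ennreal_powr_ennreal[of 1 r] by simp
        finally show ?case by (simp add: mult_right_mono)
      qed
    qed
    also have "\<dots> \<le> ennreal_powr 1 r" using u1 ennreal_powr_ennreal[of 1 r] by simp
    finally have "Lebesgue_norm (ennreal r) (\<lambda>x. inverse A * t x) \<le> 1"
      using r by (simp add: Lebesgue_norm_le_iff)
    then have "inverse A * Lebesgue_norm (ennreal r) t \<le> 1"
      using r by (simp add: Lebesgue_norm_cmult)
    then have "A * (inverse A * Lebesgue_norm (ennreal r) t) \<le> A * 1"
      by (rule mult_left_mono) simp
    moreover have "A * inverse A = 1" using Afin Apos
      by (metis divide_ennreal_def ennreal_divide_self less_top)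
    ultimately have "Lebesgue_norm (ennreal r) t \<le> A"
      by (metis mult.assoc mult.left_neutral mult.right_neutral)
    then show ?thesis unfolding t_def A .
  qed
  show ?thesis
  proof (rule ennreal_le_epsilon)
    fix \<delta> :: real assume "0 < \<delta>"
    obtain c where c: "1 + integral\<^sup>N M e = ennreal c" "0 \<le> c"
      using efin by (cases "1 + integral\<^sup>N M e") auto
    have "1 \<le> ennreal c" unfolding c(1)[symmetric] by simp
    then have "1 \<le> c" using c(2) by (simp add: ennreal_le_iff2 flip: ennreal_1)
    have "?L \<le> ?R + ennreal (\<delta> / c) * ennreal c"
      using main[of "\<delta> / c"] \<open>0 < \<delta>\<close> \<open>1 \<le> c\<close> unfolding c(1) by simp
    also have "ennreal (\<delta> / c) * ennreal c = ennreal \<delta>"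
      using \<open>0 < \<delta>\<close> \<open>1 \<le> c\<close> by (simp add: ennreal_mult[symmetric])
    finally show "?L \<le> ?R + ennreal \<delta>" .
  qed
qed simp

text \<open>After the weight has been normalised to mass at most 1, this is Jensen's inequality. The
  constant depends on \<open>w\<close> only through its bound and its mass, so that it serves all translates of a
  weight at once.\<close>

lemma integral_weight_le_Lebesgue_norm:
  fixes B W :: ennreal
  assumes r: "1 \<le> r" and "B < top" "W < top"
  obtains C where "C < top"
    "\<And>w k :: 'a::euclidean_space \<Rightarrow> ennreal. w \<in> borel_measurable lborel \<Longrightarrow> k \<in> borel_measurable lborel \<Longrightarrow>
      (\<And>x. w x \<le> B) \<Longrightarrow> (\<integral>\<^sup>+x. w x \<partial>lborel) \<le> W \<Longrightarrow>
      (\<integral>\<^sup>+x. k x * w x \<partial>lborel) \<le> C * Lebesgue_norm (ennreal r) k"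
proof
  \<comment> \<open>adding 1 allows for weights of mass 0\<close>
  let ?W = "W + 1"
  have WW: "?W * inverse ?W = 1" using assms(3)
    by (metis add_eq_0_iff_both_eq_0 divide_ennreal_def ennreal_add_eq_top ennreal_divide_self
        ennreal_one_neq_top less_top zero_neq_one)
  let ?C = "?W * ennreal_powr (B * inverse ?W) (1 / r)"
  have "inverse ?W \<noteq> top" using assms by auto
  then show "?C < top"
    using assms by (simp add: less_top[symmetric] ennreal_mult_eq_top_iff)
  fix w k :: "'a \<Rightarrow> ennreal"
  assume [measurable]: "w \<in> borel_measurable lborel" "k \<in> borel_measurable lborel"
    and w: "\<And>x. w x \<le> B" "(\<integral>\<^sup>+x. w x \<partial>lborel) \<le> W"
  define u where "u x = w x * inverse ?W" for x
  have [measurable]: "u \<in> borel_measurable lborel" unfolding u_def by measurable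
  have "(\<integral>\<^sup>+x. u x \<partial>lborel) = (\<integral>\<^sup>+x. w x \<partial>lborel) * inverse ?W"
    unfolding u_def by (rule nn_integral_multc) auto
  also have "\<dots> \<le> ?W * inverse ?W" using w(2) by (intro mult_right_mono) (auto intro: order_trans)
  finally have u: "(\<integral>\<^sup>+x. u x \<partial>lborel) \<le> 1" by (simp add: WW)
  have "ennreal_powr (\<integral>\<^sup>+x. k x * u x \<partial>lborel) r \<le> (\<integral>\<^sup>+x. ennreal_powr (k x) r * u x \<partial>lborel)"
    using r u by (intro jensen_ennreal_powr) auto
  also have "\<dots> \<le> (\<integral>\<^sup>+x. ennreal_powr (k x) r * (B * inverse ?W) \<partial>lborel)"
    using w(1) by (intro nn_integral_mono mult_left_mono mult_right_mono) (auto simp: u_def intro!: mult_right_mono)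
  also have "\<dots> = ennreal_powr (Lebesgue_norm (ennreal r) k) r * (B * inverse ?W)"
    using r by (simp add: nn_integral_multc Lebesgue_norm_powr)
  finally have "ennreal_powr (ennreal_powr (\<integral>\<^sup>+x. k x * u x \<partial>lborel) r) (1 / r)
     \<le> ennreal_powr (ennreal_powr (Lebesgue_norm (ennreal r) k) r * (B * inverse ?W)) (1 / r)"
    using r by (intro ennreal_powr_mono) auto
  then have *: "(\<integral>\<^sup>+x. k x * u x \<partial>lborel)
      \<le> Lebesgue_norm (ennreal r) k * ennreal_powr (B * inverse ?W) (1 / r)"
    using r by (simp add: ennreal_powr_mult[of "1/r"])
  have "(\<integral>\<^sup>+x. k x * w x \<partial>lborel) = (\<integral>\<^sup>+x. ?W * (k x * u x) \<partial>lborel)"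
    using WW by (intro nn_integral_cong) (metis u_def mult.assoc mult.commute mult.right_neutral)
  also have "\<dots> = ?W * (\<integral>\<^sup>+x. k x * u x \<partial>lborel)" by (rule nn_integral_cmult) auto
  also have "\<dots> \<le> ?W * (Lebesgue_norm (ennreal r) k * ennreal_powr (B * inverse ?W) (1 / r))"
    by (intro mult_left_mono *) auto
  finally show "(\<integral>\<^sup>+x. k x * w x \<partial>lborel) \<le> ?C * Lebesgue_norm (ennreal r) k"
    by (simp add: mult_ac)
qed

lemma conj_exponent_ennreal:
  "1 < r \<Longrightarrow> conj_exponent (ennreal r) = ennreal (r / (r - 1))"
proof -
  assume r: "1 < r"
  have "1 - inverse (ennreal r) = ennreal (1 - 1 / r)"
    using r by (simp add: inverse_ennreal ennreal_minus inverse_eq_divide flip: ennreal_1)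
  also have "inverse \<dots> = ennreal (r / (r - 1))"
    using r by (subst inverse_ennreal) (auto simp: field_simps)
  finally show ?thesis by (simp add: conj_exponent_def)
qed

lemma Lebesgue_norm_eq_0:
  assumes "1 \<le> r" "h \<in> borel_measurable lborel" "Lebesgue_norm (ennreal r) h = 0"
  shows "AE x in lborel. h x = 0"
  using assms by (simp add: Lebesgue_norm_eq nn_integral_0_iff_AE)

text \<open>For \<open>r > 1\<close> both norms are normalised to 1 and Young's inequality is integrated; for \<open>r = 1\<close>
  the dual norm is an essential supremum.\<close>

lemma Hoelder_inequality:
  fixes a b :: "'a::euclidean_space \<Rightarrow> ennreal"
  assumes r: "1 \<le> r" and [measurable]: "a \<in> borel_measurable lborel" "b \<in> borel_measurable lborel"
  shows "(\<integral>\<^sup>+x. a x * b x \<partial>lborel)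
     \<le> Lebesgue_norm (ennreal r) a * Lebesgue_norm (conj_exponent (ennreal r)) b"
proof (cases "r = 1")
  case True
  then have c: "conj_exponent (ennreal r) = \<infinity>" by (simp add: conj_exponent_def)
  have "(\<integral>\<^sup>+x. a x * b x \<partial>lborel) \<le> (\<integral>\<^sup>+x. a x * esssup lborel b \<partial>lborel)"
    using esssup_AE[of b lborel]
    by (intro nn_integral_mono_AE) (auto elim!: eventually_mono intro!: mult_left_mono)
  also have "\<dots> = Lebesgue_norm (ennreal r) a * Lebesgue_norm (conj_exponent (ennreal r)) b"
    unfolding c using True by (simp add: nn_integral_multc Lebesgue_norm_1) (simp add: Lebesgue_norm_def)
  finally show ?thesis .
next
  case False
  then have r1: "1 < r" using r by simp
  define q where "q = r / (r - 1)"
  have q: "1 < q" "1 / r + 1 / q = 1" using r1 by (auto simp: q_def field_simps)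
  have c: "conj_exponent (ennreal r) = ennreal q" using r1 by (simp add: conj_exponent_ennreal q_def)
  let ?a = "Lebesgue_norm (ennreal r) a" and ?b = "Lebesgue_norm (ennreal q) b"
  have zero: ?thesis if "?a = 0 \<or> ?b = 0"
  proof -
    have "AE x in lborel. a x = 0 \<or> b x = 0"
      using that
    proof
      assume "?a = 0"
      from Lebesgue_norm_eq_0[OF r _ this] show ?thesis by auto
    next
      assume "?b = 0"
      from Lebesgue_norm_eq_0[OF _ _ this] q show ?thesis by auto
    qed
    then have "(\<integral>\<^sup>+x. a x * b x \<partial>lborel) = (\<integral>\<^sup>+x. 0 \<partial>(lborel :: 'a measure))"
      by (intro nn_integral_cong_AE) auto
    then show ?thesis by simp
  qed
  show ?thesis
  proof (cases "?a = 0 \<or> ?b = 0 \<or> ?a = top \<or> ?b = top")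
    case True
    then show ?thesis using zero by (auto simp: c ennreal_mult_top ennreal_top_mult)
  next
    case False
    then have inv: "?a * inverse ?a = 1" "?b * inverse ?b = 1"
      by (metis divide_ennreal_def ennreal_divide_self less_top)+
    define A B where "A x = inverse ?a * a x" and "B x = inverse ?b * b x" for x
    have [measurable]: "A \<in> borel_measurable lborel" "B \<in> borel_measurable lborel"
      unfolding A_def B_def by measurable
    have "Lebesgue_norm (ennreal r) A \<le> 1" "Lebesgue_norm (ennreal q) B \<le> 1"
      using r q inv Lebesgue_norm_cmult[of r a "inverse ?a"] Lebesgue_norm_cmult[of q b "inverse ?b"]
      unfolding A_def B_def by (simp_all add: mult.commute[of "inverse ?a" ?a] mult.commute[of "inverse ?b" ?b])
    then have AB: "(\<integral>\<^sup>+x. ennreal_powr (A x) r \<partial>lborel) \<le> 1" "(\<integral>\<^sup>+x. ennreal_powr (B x) q \<partial>lborel) \<le> 1"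
      using r q ennreal_powr_ennreal[of 1 r] ennreal_powr_ennreal[of 1 q]
      by (simp_all add: Lebesgue_norm_le_iff)
    have "(\<integral>\<^sup>+x. A x * B x \<partial>lborel)
      \<le> (\<integral>\<^sup>+x. ennreal (1 / r) * ennreal_powr (A x) r + ennreal (1 / q) * ennreal_powr (B x) q \<partial>lborel)"
    proof (rule nn_integral_mono)
      fix x
      show "A x * B x \<le> ennreal (1 / r) * ennreal_powr (A x) r + ennreal (1 / q) * ennreal_powr (B x) q"
      proof (cases "A x"; cases "B x")
        fix \<alpha> \<beta> assume ab: "A x = ennreal \<alpha>" "0 \<le> \<alpha>" "B x = ennreal \<beta>" "0 \<le> \<beta>"
        have "\<alpha> * \<beta> \<le> \<alpha> powr r / r + \<beta> powr q / q"
          using Youngs_inequality[OF r1 q(1,2) ab(2,4)] .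
        then show ?thesis unfolding ab using ab r1 q
          by (simp add: ennreal_powr_ennreal ennreal_mult[symmetric] ennreal_plus[symmetric]
              ennreal_leI del: ennreal_plus)
      qed (use r1 q in \<open>auto simp: ennreal_mult_top\<close>)
    qed
    also have "\<dots> = ennreal (1 / r) * (\<integral>\<^sup>+x. ennreal_powr (A x) r \<partial>lborel)
       + ennreal (1 / q) * (\<integral>\<^sup>+x. ennreal_powr (B x) q \<partial>lborel)"
      by (subst nn_integral_add) (auto simp: nn_integral_cmult)
    also have "\<dots> \<le> ennreal (1 / r) * 1 + ennreal (1 / q) * 1"
      using AB by (intro add_mono mult_left_mono) auto
    also have "\<dots> = ennreal (1 / r + 1 / q)" using r1 q(1) by (simp add: ennreal_plus)
    finally have le1: "(\<integral>\<^sup>+x. A x * B x \<partial>lborel) \<le> 1" using q by simp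
    have "(\<integral>\<^sup>+x. a x * b x \<partial>lborel) = (\<integral>\<^sup>+x. ?a * ?b * (A x * B x) \<partial>lborel)"
    proof (rule nn_integral_cong)
      fix x
      have "?a * ?b * (A x * B x) = (?a * inverse ?a) * (?b * inverse ?b) * (a x * b x)"
        unfolding A_def B_def by (simp only: mult_ac)
      then show "a x * b x = ?a * ?b * (A x * B x)" using inv by simp
    qed
    also have "\<dots> = ?a * ?b * (\<integral>\<^sup>+x. A x * B x \<partial>lborel)" by (rule nn_integral_cmult) auto
    also have "\<dots> \<le> ?a * ?b * 1" using le1 by (rule mult_left_mono) auto
    finally show ?thesis by (simp add: c)
  qed
qed

section \<open>Polynomial weights\<close>

lemma japanese_ge_1: "1 \<le> japanese x"
  by (simp add: japanese_def)

lemma japanese_pos [simp]: "0 < japanese x"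
  using japanese_ge_1[of x] by simp

lemma japanese_nonneg [simp]: "0 \<le> japanese x"
  using japanese_ge_1[of x] by simp

lemma japanese_neq_0 [simp]: "japanese x \<noteq> 0"
  using japanese_pos[of x] by (simp del: japanese_pos)

lemma japanese_minus [simp]: "japanese (- x) = japanese x"
  by (simp add: japanese_def)

lemma japanese_commute: "japanese (x - y) = japanese (y - x)"
  by (simp add: japanese_def norm_minus_commute)

lemma norm_le_japanese: "norm x \<le> japanese x"
  unfolding japanese_def by (rule real_le_rsqrt) simp

lemma japanese_continuous [continuous_intros]:
  "continuous_on A f \<Longrightarrow> continuous_on A (\<lambda>x. japanese (f x))"
  unfolding japanese_def by (intro continuous_intros)

lemma japanese_measurable [measurable]: "japanese \<in> borel_measurable borel"
  by (intro borel_measurable_continuous_onI continuous_intros)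

text \<open>The constant \<open>\<surd>2\<close> would do; with 2 no roots appear in the powers of this bound.\<close>

lemma japanese_add_le: "japanese (x + y) \<le> 2 * japanese x * japanese y"
proof -
  have "(norm (x + y))\<^sup>2 \<le> (norm x + norm y)\<^sup>2"
    by (intro power_mono norm_triangle_ineq) auto
  also have "\<dots> \<le> 2 * (norm x)\<^sup>2 + 2 * (norm y)\<^sup>2"
    using sum_squares_bound[of "norm x" "norm y"] by (simp add: power2_sum)
  finally have "1 + (norm (x + y))\<^sup>2 \<le> 4 * ((1 + (norm x)\<^sup>2) * (1 + (norm y)\<^sup>2))"
    by (simp add: algebra_simps) (smt (verit) mult_nonneg_nonneg zero_le_power2)
  then have "japanese (x + y) \<le> sqrt (4 * ((1 + (norm x)\<^sup>2) * (1 + (norm y)\<^sup>2)))"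
    unfolding japanese_def by (rule real_sqrt_le_mono)
  also have "\<dots> = 2 * japanese x * japanese y"
    by (simp add: japanese_def real_sqrt_mult)
  finally show ?thesis .
qed

definition decay :: "nat \<Rightarrow> 'a::euclidean_space \<Rightarrow> real"
  where "decay N x = 1 / japanese x ^ N"

lemma decay_pos [simp]: "0 < decay N x"
  by (simp add: decay_def)

lemma decay_nonneg [simp]: "0 \<le> decay N x"
  using decay_pos[of N x] by linarith

lemma decay_le_1: "decay N x \<le> 1"
  by (simp add: decay_def japanese_ge_1)

lemma decay_antimono: "M \<le> N \<Longrightarrow> decay N x \<le> decay M x"
  unfolding decay_def by (intro divide_left_mono power_increasing japanese_ge_1) auto

lemma decay_minus [simp]: "decay N (- x) = decay N x"
  by (simp add: decay_def)

lemma decay_commute: "decay N (x - y) = decay N (y - x)"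
  by (simp add: decay_def japanese_commute[of x])

lemma decay_add: "decay (M + N) x = decay M x * decay N x"
  by (simp add: decay_def power_add)

lemma japanese_power_mult_decay [simp]: "japanese x ^ N * decay N x = 1"
  by (simp add: decay_def power_eq_0_iff)

lemma decay_measurable [measurable]: "decay N \<in> borel_measurable borel"
  unfolding decay_def by measurable

text \<open>Peetre's inequality for negative powers: a translation costs a power of its length.\<close>

lemma decay_peetre: "decay N x \<le> (2 * japanese y) ^ N * decay N (x + y)"
proof -
  have "japanese (x + y) ^ N \<le> (2 * japanese y) ^ N * japanese x ^ N"
    using power_mono[OF japanese_add_le[of x y], of N] by (simp add: power_mult_distrib mult_ac)
  then show ?thesis by (simp add: decay_def divide_simps)
qed

lemma nn_integral_inverse_1_plus_square: "(\<integral>\<^sup>+x. ennreal (inverse (1 + x\<^sup>2)) \<partial>lborel) < (top :: ennreal)"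
proof -
  have "integrable lborel (\<lambda>x::real. inverse (1 + x\<^sup>2))"
    using integrable_inverse_1_plus_square by (simp add: set_integrable_def)
  then show ?thesis by (simp add: integrable_iff_bounded)
qed

text \<open>Any exponent above the dimension would do. With twice the dimension the function is dominated
  by a product of one-dimensional Cauchy densities.\<close>

lemma decay_integrable:
  assumes "2 * DIM('a) \<le> N"
  shows "integrable lborel (decay N :: 'a::euclidean_space \<Rightarrow> real)"
proof (rule integrableI_bounded)
  have "(\<integral>\<^sup>+x. ennreal (norm (decay N x)) \<partial>(lborel :: 'a measure))
     \<le> (\<integral>\<^sup>+x. (\<Prod>b\<in>Basis. ennreal (inverse (1 + (x \<bullet> b)\<^sup>2))) \<partial>(lborel :: 'a measure))"
  proof (rule nn_integral_mono)
    fix x :: 'a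
    have "(\<Prod>b\<in>Basis. 1 + (x \<bullet> b)\<^sup>2) \<le> (\<Prod>b\<in>(Basis :: 'a set). 1 + (norm x)\<^sup>2)"
    proof (rule prod_mono)
      fix b :: 'a assume "b \<in> Basis"
      then have "\<bar>x \<bullet> b\<bar> \<le> \<bar>norm x\<bar>" using Basis_le_norm[of b x] by simp
      then show "0 \<le> 1 + (x \<bullet> b)\<^sup>2 \<and> 1 + (x \<bullet> b)\<^sup>2 \<le> 1 + (norm x)\<^sup>2"
        using power_mono[of "\<bar>x \<bullet> b\<bar>" "norm x" 2] by simp
    qed
    also have "\<dots> = japanese x ^ (2 * DIM('a))"
      by (simp add: japanese_def power_mult)
    finally have le: "(\<Prod>b\<in>Basis. 1 + (x \<bullet> b)\<^sup>2) \<le> japanese x ^ (2 * DIM('a))" .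
    have pos: "0 < (\<Prod>b\<in>Basis. 1 + (x \<bullet> b)\<^sup>2)" by (intro prod_pos) (simp add: add_pos_nonneg)
    have "decay N x \<le> decay (2 * DIM('a)) x" using assms by (rule decay_antimono)
    also have "\<dots> \<le> inverse (\<Prod>b\<in>Basis. 1 + (x \<bullet> b)\<^sup>2)"
      unfolding decay_def inverse_eq_divide using le pos by (intro divide_left_mono) auto
    also have "\<dots> = (\<Prod>b\<in>Basis. inverse (1 + (x \<bullet> b)\<^sup>2))" by (simp add: prod_inversef[symmetric] o_def)
    finally have "ennreal (norm (decay N x)) \<le> ennreal (\<Prod>b\<in>Basis. inverse (1 + (x \<bullet> b)\<^sup>2))"
      by (simp add: ennreal_leI)
    then show "ennreal (norm (decay N x)) \<le> (\<Prod>b\<in>Basis. ennreal (inverse (1 + (x \<bullet> b)\<^sup>2)))"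
      by (subst prod_ennreal) auto
  qed
  also have "\<dots> = (\<Prod>b\<in>(Basis :: 'a set). (\<integral>\<^sup>+x. ennreal (inverse (1 + x\<^sup>2)) \<partial>lborel))"
    by (rule nn_integral_lborel_prod) auto
  also have "\<dots> < top"
    using nn_integral_inverse_1_plus_square by (simp add: power_less_top_ennreal)
  finally show "(\<integral>\<^sup>+x. ennreal (norm (decay N x)) \<partial>(lborel :: 'a measure)) < \<infinity>" by simp
qed simp

section \<open>The mixed norms\<close>

text \<open>The norm of \<open>M\<^sup>p\<^sup>,\<^sup>1\<^sub>s\<close> as a functional of functions on phase space. This makes it applicable
  to majorants that are not themselves short-time Fourier transforms.\<close>

definition mixed_norm :: "real \<Rightarrow> real \<Rightarrow> ('a::euclidean_space \<Rightarrow> 'a \<Rightarrow> ennreal) \<Rightarrow> ennreal"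
  where "mixed_norm r s K =
    (\<integral>\<^sup>+\<xi>. ennreal (japanese \<xi> powr s) * Lebesgue_norm (ennreal r) (\<lambda>x. K x \<xi>) \<partial>lborel)"

lemma modulation_norm_eq:
  "modulation_norm \<phi>\<^sub>0 (ennreal r) 1 s f = mixed_norm r s (\<lambda>x \<xi>. ennreal (cmod (STFT \<phi>\<^sub>0 f x \<xi>)))"
  by (simp add: modulation_norm_def mixed_norm_def Lebesgue_norm_1)

lemma measurable_slices:
  assumes K: "case_prod K \<in> borel_measurable (borel \<Otimes>\<^sub>M borel)"
  shows "(\<lambda>\<xi>. K x \<xi>) \<in> borel_measurable borel" "(\<lambda>x. K x \<xi>) \<in> borel_measurable borel"
  using measurable_compose[OF measurable_Pair1' K, of x] measurable_compose[OF measurable_Pair2' K, of \<xi>]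
  by auto

context
  fixes r s :: real
  assumes r: "1 \<le> r"
begin

lemma mixed_norm_mono:
  assumes "\<And>x \<xi>. K x \<xi> \<le> L x \<xi>"
  shows "mixed_norm r s K \<le> mixed_norm r s L"
  unfolding mixed_norm_def
  by (intro nn_integral_mono mult_left_mono Lebesgue_norm_mono r assms) auto

lemma Lebesgue_norm_slice_measurable:
  assumes K[measurable]: "case_prod K \<in> borel_measurable (borel \<Otimes>\<^sub>M borel)"
  shows "(\<lambda>\<xi>. Lebesgue_norm (ennreal r) (\<lambda>x. K x \<xi>)) \<in> borel_measurable borel"
proof (rule Lebesgue_norm_measurable[OF r])
  show "(\<lambda>(\<xi>, x). K x \<xi>) \<in> borel_measurable (borel \<Otimes>\<^sub>M lborel)" by measurable
qed

lemma mixed_norm_cmult: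
  assumes K[measurable]: "case_prod K \<in> borel_measurable (borel \<Otimes>\<^sub>M borel)"
  shows "mixed_norm r s (\<lambda>x \<xi>. c * K x \<xi>) = c * mixed_norm r s K"
proof -
  note [measurable] = Lebesgue_norm_slice_measurable[OF K]
  have "mixed_norm r s (\<lambda>x \<xi>. c * K x \<xi>)
    = (\<integral>\<^sup>+\<xi>. c * (ennreal (japanese \<xi> powr s) * Lebesgue_norm (ennreal r) (\<lambda>x. K x \<xi>)) \<partial>lborel)"
    unfolding mixed_norm_def using measurable_slices[OF K]
    by (intro nn_integral_cong) (simp add: Lebesgue_norm_cmult r mult_ac)
  also have "\<dots> = c * mixed_norm r s K"
    unfolding mixed_norm_def by (rule nn_integral_cmult) measurable
  finally show ?thesis .
qed

text \<open>Translations in \<open>x\<close> are isometries; translations in frequency change the weight by a bounded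
  factor.\<close>

lemma mixed_norm_shift:
  assumes s: "0 \<le> s" and K[measurable]: "case_prod K \<in> borel_measurable (borel \<Otimes>\<^sub>M borel)"
  shows "mixed_norm r s (\<lambda>x \<xi>. K (x + y) (\<xi> + \<eta>)) \<le> ennreal ((2 * japanese \<eta>) powr s) * mixed_norm r s K"
proof -
  note [measurable] = Lebesgue_norm_slice_measurable[OF K]
  let ?N = "\<lambda>\<xi>. Lebesgue_norm (ennreal r) (\<lambda>x. K x \<xi>)"
  have "mixed_norm r s (\<lambda>x \<xi>. K (x + y) (\<xi> + \<eta>))
    = (\<integral>\<^sup>+\<xi>. ennreal (japanese \<xi> powr s) * ?N (\<xi> + \<eta>) \<partial>lborel)"
    unfolding mixed_norm_def using measurable_slices[OF K] Lebesgue_norm_shift[OF r, of "\<lambda>x. K x (_ + \<eta>)" y]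
    by (intro nn_integral_cong) auto
  also have "\<dots> \<le> (\<integral>\<^sup>+\<xi>. ennreal ((2 * japanese \<eta>) powr s) * (ennreal (japanese (\<xi> + \<eta>) powr s) * ?N (\<xi> + \<eta>)) \<partial>lborel)"
  proof (rule nn_integral_mono)
    fix \<xi>
    have "japanese \<xi> powr s \<le> (2 * japanese (\<xi> + \<eta>) * japanese (- \<eta>)) powr s"
      using s japanese_add_le[of "\<xi> + \<eta>" "- \<eta>"] by (intro powr_mono2) auto
    also have "\<dots> = (2 * japanese \<eta>) powr s * japanese (\<xi> + \<eta>) powr s"
      by (simp add: powr_mult[symmetric] mult_ac)
    finally have "ennreal (japanese \<xi> powr s) \<le> ennreal ((2 * japanese \<eta>) powr s) * ennreal (japanese (\<xi> + \<eta>) powr s)"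
      by (simp add: ennreal_mult[symmetric] ennreal_leI)
    then show "ennreal (japanese \<xi> powr s) * ?N (\<xi> + \<eta>)
       \<le> ennreal ((2 * japanese \<eta>) powr s) * (ennreal (japanese (\<xi> + \<eta>) powr s) * ?N (\<xi> + \<eta>))"
      by (metis (no_types, lifting) mult.assoc mult_right_mono zero_le)
  qed
  also have "\<dots> = ennreal ((2 * japanese \<eta>) powr s) * (\<integral>\<^sup>+\<xi>. ennreal (japanese (\<xi> + \<eta>) powr s) * ?N (\<xi> + \<eta>) \<partial>lborel)"
    by (rule nn_integral_cmult) measurable
  also have "(\<integral>\<^sup>+\<xi>. ennreal (japanese (\<xi> + \<eta>) powr s) * ?N (\<xi> + \<eta>) \<partial>lborel) = mixed_norm r s K"
    unfolding mixed_norm_def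
    using nn_integral_lborel_shift[of "\<lambda>\<xi>. ennreal (japanese \<xi> powr s) * ?N \<xi>" \<eta>] by simp
  finally show ?thesis .
qed

text \<open>Minkowski's inequality in \<open>x\<close> for each frequency, followed by Tonelli's theorem in the
  frequency.\<close>

lemma mixed_norm_integral_le:
  fixes K :: "'a::euclidean_space \<Rightarrow> 'a \<Rightarrow> 'b \<Rightarrow> ennreal"
  assumes M: "sigma_finite_measure M"
    and K[measurable]: "(\<lambda>((x, \<xi>), \<eta>). K x \<xi> \<eta>) \<in> borel_measurable ((borel \<Otimes>\<^sub>M borel) \<Otimes>\<^sub>M M)"
  shows "mixed_norm r s (\<lambda>x \<xi>. \<integral>\<^sup>+\<eta>. K x \<xi> \<eta> \<partial>M) \<le> (\<integral>\<^sup>+\<eta>. mixed_norm r s (\<lambda>x \<xi>. K x \<xi> \<eta>) \<partial>M)"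
proof -
  interpret M: sigma_finite_measure M by fact
  interpret MM: pair_sigma_finite lborel M ..
  have [measurable]: "(\<lambda>(x, \<eta>). K x \<xi> \<eta>) \<in> borel_measurable (lborel \<Otimes>\<^sub>M M)" for \<xi>
    using measurable_compose[OF _ K, of "\<lambda>(x, \<eta>). ((x, \<xi>), \<eta>)" "lborel \<Otimes>\<^sub>M M"]
    by (simp add: case_prod_beta')
  have "(\<lambda>((\<xi>, \<eta>), x). K x \<xi> \<eta>) \<in> borel_measurable ((lborel \<Otimes>\<^sub>M M) \<Otimes>\<^sub>M lborel)"
    using measurable_compose[OF _ K, of "\<lambda>((\<xi>, \<eta>), x). ((x, \<xi>), \<eta>)" "(lborel \<Otimes>\<^sub>M M) \<Otimes>\<^sub>M lborel"]
    by (simp add: case_prod_beta')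
  then have [measurable]: "(\<lambda>(\<xi>, \<eta>). Lebesgue_norm (ennreal r) (\<lambda>x. K x \<xi> \<eta>)) \<in> borel_measurable (lborel \<Otimes>\<^sub>M M)"
    using Lebesgue_norm_measurable[OF r, of "\<lambda>(\<xi>, \<eta>) x. K x \<xi> \<eta>" "lborel \<Otimes>\<^sub>M M"]
    by (simp add: case_prod_beta')
  have "mixed_norm r s (\<lambda>x \<xi>. \<integral>\<^sup>+\<eta>. K x \<xi> \<eta> \<partial>M)
    \<le> (\<integral>\<^sup>+\<xi>. ennreal (japanese \<xi> powr s) * (\<integral>\<^sup>+\<eta>. Lebesgue_norm (ennreal r) (\<lambda>x. K x \<xi> \<eta>) \<partial>M) \<partial>lborel)"
    unfolding mixed_norm_def
    by (intro nn_integral_mono mult_left_mono Lebesgue_norm_integral_le r M) auto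
  also have "\<dots> = (\<integral>\<^sup>+\<xi>. (\<integral>\<^sup>+\<eta>. ennreal (japanese \<xi> powr s) * Lebesgue_norm (ennreal r) (\<lambda>x. K x \<xi> \<eta>) \<partial>M) \<partial>lborel)"
    by (intro nn_integral_cong nn_integral_cmult[symmetric]) measurable
  also have "\<dots> = (\<integral>\<^sup>+\<eta>. mixed_norm r s (\<lambda>x \<xi>. K x \<xi> \<eta>) \<partial>M)"
    unfolding mixed_norm_def by (rule MM.Fubini'[symmetric]) measurable
  finally show ?thesis .
qed

text \<open>Dominated convergence twice: in \<open>x\<close> at almost every frequency, then in the frequency.\<close>

lemma mixed_norm_tendsto_0:
  assumes u[measurable]: "\<And>k. case_prod (u k) \<in> borel_measurable (borel \<Otimes>\<^sub>M borel)"
    and H[measurable]: "case_prod H \<in> borel_measurable (borel \<Otimes>\<^sub>M borel)"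
    and le: "\<And>k x \<xi>. u k x \<xi> \<le> H x \<xi>" and fin: "mixed_norm r s H < top"
    and lim: "\<And>x \<xi>. (\<lambda>k. u k x \<xi>) \<longlonglongrightarrow> 0"
  shows "(\<lambda>k. mixed_norm r s (u k)) \<longlonglongrightarrow> 0"
proof -
  note [measurable] = Lebesgue_norm_slice_measurable[OF u] Lebesgue_norm_slice_measurable[OF H]
  have "(\<lambda>k. mixed_norm r s (u k)) \<longlonglongrightarrow> (\<integral>\<^sup>+\<xi>. 0 \<partial>(lborel :: 'a measure))"
    unfolding mixed_norm_def
  proof (rule nn_integral_dominated_convergence[where
        w = "\<lambda>\<xi>. ennreal (japanese \<xi> powr s) * Lebesgue_norm (ennreal r) (\<lambda>x. H x \<xi>)"])
    show "(\<integral>\<^sup>+\<xi>. ennreal (japanese \<xi> powr s) * Lebesgue_norm (ennreal r) (\<lambda>x. H x \<xi>) \<partial>lborel) < \<infinity>"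
      using fin by (simp add: mixed_norm_def)
    then have "AE \<xi> in lborel. ennreal (japanese \<xi> powr s) * Lebesgue_norm (ennreal r) (\<lambda>x. H x \<xi>) \<noteq> \<infinity>"
      by (intro nn_integral_noteq_infinite) auto
    then show "AE \<xi> in lborel. (\<lambda>k. ennreal (japanese \<xi> powr s) * Lebesgue_norm (ennreal r) (\<lambda>x. u k x \<xi>)) \<longlonglongrightarrow> 0"
    proof eventually_elim
      case (elim \<xi>)
      have "Lebesgue_norm (ennreal r) (\<lambda>x. H x \<xi>) < top"
        using elim by (simp add: ennreal_mult_eq_top_iff less_top)
      then have "(\<lambda>k. Lebesgue_norm (ennreal r) (\<lambda>x. u k x \<xi>)) \<longlonglongrightarrow> 0"
        using measurable_slices[OF u] measurable_slices[OF H] le lim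
        by (intro Lebesgue_norm_tendsto_0[OF r, where H = "\<lambda>x. H x \<xi>"]) auto
      then have "(\<lambda>k. ennreal (japanese \<xi> powr s) * Lebesgue_norm (ennreal r) (\<lambda>x. u k x \<xi>)) \<longlonglongrightarrow> ennreal (japanese \<xi> powr s) * 0"
        by (intro tendsto_mult_ennreal tendsto_const) auto
      then show ?case by simp
    qed
  qed (use le in \<open>auto intro!: mult_left_mono Lebesgue_norm_mono r\<close>)
  then show ?thesis by simp
qed

end

lemma fst_borel_measurable [measurable]: "fst \<in> borel_measurable (borel :: ('a::euclidean_space \<times> 'a) measure)"
  by (intro borel_measurable_continuous_onI continuous_intros)

lemma snd_borel_measurable [measurable]: "snd \<in> borel_measurable (borel :: ('a::euclidean_space \<times> 'a) measure)"
  by (intro borel_measurable_continuous_onI continuous_intros)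

lemma nn_integral_lborel_pair:
  fixes h :: "'a::euclidean_space \<Rightarrow> 'a \<Rightarrow> ennreal"
  assumes "case_prod h \<in> borel_measurable (borel \<Otimes>\<^sub>M borel)"
  shows "(\<integral>\<^sup>+z. h (fst z) (snd z) \<partial>lborel) = (\<integral>\<^sup>+x. (\<integral>\<^sup>+\<xi>. h x \<xi> \<partial>lborel) \<partial>lborel)"
    "(\<integral>\<^sup>+z. h (fst z) (snd z) \<partial>lborel) = (\<integral>\<^sup>+\<xi>. (\<integral>\<^sup>+x. h x \<xi> \<partial>lborel) \<partial>lborel)"
proof -
  have h[measurable]: "case_prod h \<in> borel_measurable (lborel \<Otimes>\<^sub>M lborel)"
    using assms by (simp cong: measurable_cong_sets)
  have "(\<integral>\<^sup>+z. h (fst z) (snd z) \<partial>lborel) = (\<integral>\<^sup>+z. case_prod h z \<partial>(lborel \<Otimes>\<^sub>M lborel))"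
    by (simp add: lborel_prod case_prod_beta)
  also have eq: "\<dots> = (\<integral>\<^sup>+x. (\<integral>\<^sup>+\<xi>. h x \<xi> \<partial>lborel) \<partial>lborel)"
    by (subst lborel.nn_integral_fst[symmetric]) auto
  finally show "(\<integral>\<^sup>+z. h (fst z) (snd z) \<partial>lborel) = (\<integral>\<^sup>+x. (\<integral>\<^sup>+\<xi>. h x \<xi> \<partial>lborel) \<partial>lborel)" .
  also have "\<dots> = (\<integral>\<^sup>+\<xi>. (\<integral>\<^sup>+x. h x \<xi> \<partial>lborel) \<partial>lborel)"
    by (rule lborel_pair.Fubini'[symmetric]) measurable
  finally show "(\<integral>\<^sup>+z. h (fst z) (snd z) \<partial>lborel) = (\<integral>\<^sup>+\<xi>. (\<integral>\<^sup>+x. h x \<xi> \<partial>lborel) \<partial>lborel)" .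
qed

section \<open>Smearing by a polynomially decaying kernel\<close>

text \<open>Convolution on phase space with the even kernel \<open>\<langle>x\<rangle>\<^sup>-\<^sup>N \<langle>\<xi>\<rangle>\<^sup>-\<^sup>N\<close>.\<close>

definition smear :: "nat \<Rightarrow> ('a::euclidean_space \<Rightarrow> 'a \<Rightarrow> ennreal) \<Rightarrow> 'a \<Rightarrow> 'a \<Rightarrow> ennreal"
  where "smear N K y \<omega> =
    (\<integral>\<^sup>+z. K (fst z) (snd z) * ennreal (decay N (fst z - y) * decay N (snd z - \<omega>)) \<partial>lborel)"

lemma smear_shifted:
  assumes [measurable]: "case_prod K \<in> borel_measurable (borel \<Otimes>\<^sub>M borel)"
  shows "smear N K y \<omega>
    = (\<integral>\<^sup>+z. K (fst z + y) (snd z + \<omega>) * ennreal (decay N (fst z) * decay N (snd z)) \<partial>lborel)"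
  unfolding smear_def
  using nn_integral_lborel_shift[of "\<lambda>z. K (fst z) (snd z) * ennreal (decay N (fst z - y) * decay N (snd z - \<omega>))" "(y, \<omega>)"]
  by simp

lemma smear_measurable:
  assumes [measurable]: "case_prod K \<in> borel_measurable (borel \<Otimes>\<^sub>M borel)"
  shows "case_prod (smear N K) \<in> borel_measurable (borel \<Otimes>\<^sub>M borel)"
  unfolding smear_def by measurable

text \<open>A smeared function absorbs frequency shifts. This is how one integrable function dominates a
  whole family of modulations.\<close>

lemma smear_shift_le:
  assumes [measurable]: "case_prod K \<in> borel_measurable (borel \<Otimes>\<^sub>M borel)"
  shows "smear N K y (\<omega> - \<zeta>) \<le> ennreal ((2 * japanese \<zeta>) ^ N) * smear N K y \<omega>"
proof -
  have "smear N K y (\<omega> - \<zeta>) \<le> (\<integral>\<^sup>+z. ennreal ((2 * japanese \<zeta>) ^ N) *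
     (K (fst z) (snd z) * ennreal (decay N (fst z - y) * decay N (snd z - \<omega>))) \<partial>lborel)"
    unfolding smear_def
  proof (rule nn_integral_mono)
    fix z :: "'a \<times> 'a"
    have "decay N (snd z - (\<omega> - \<zeta>)) \<le> (2 * japanese \<zeta>) ^ N * decay N (snd z - \<omega>)"
      using decay_peetre[of N "snd z - (\<omega> - \<zeta>)" "- \<zeta>"] by (simp add: algebra_simps)
    then have "decay N (fst z - y) * decay N (snd z - (\<omega> - \<zeta>))
      \<le> (2 * japanese \<zeta>) ^ N * (decay N (fst z - y) * decay N (snd z - \<omega>))"
      using mult_left_mono[of _ _ "decay N (fst z - y)"] by (simp add: mult_ac)
    then have "ennreal (decay N (fst z - y) * decay N (snd z - (\<omega> - \<zeta>)))
      \<le> ennreal ((2 * japanese \<zeta>) ^ N) * ennreal (decay N (fst z - y) * decay N (snd z - \<omega>))"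
      by (simp add: ennreal_mult[symmetric] ennreal_leI)
    then show "K (fst z) (snd z) * ennreal (decay N (fst z - y) * decay N (snd z - (\<omega> - \<zeta>)))
      \<le> ennreal ((2 * japanese \<zeta>) ^ N) * (K (fst z) (snd z) * ennreal (decay N (fst z - y) * decay N (snd z - \<omega>)))"
      using mult_left_mono[of _ _ "K (fst z) (snd z)"] by (simp only: mult.left_commute) auto
  qed
  also have "\<dots> = ennreal ((2 * japanese \<zeta>) ^ N) * smear N K y \<omega>"
    unfolding smear_def by (rule nn_integral_cmult) measurable
  finally show ?thesis .
qed

text \<open>The kernel is even. In a pairing, the smearing of one factor can thus be moved to the other,
  whose norm it preserves up to a constant.\<close>

lemma smear_selfadjoint:
  assumes [measurable]: "case_prod K \<in> borel_measurable (borel \<Otimes>\<^sub>M borel)"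
    "case_prod L \<in> borel_measurable (borel \<Otimes>\<^sub>M borel)"
  shows "(\<integral>\<^sup>+z. L (fst z) (snd z) * smear N K (fst z) (snd z) \<partial>lborel)
    = (\<integral>\<^sup>+z. smear N L (fst z) (snd z) * K (fst z) (snd z) \<partial>lborel)"
proof -
  have "(\<integral>\<^sup>+z. L (fst z) (snd z) * smear N K (fst z) (snd z) \<partial>lborel)
    = (\<integral>\<^sup>+z. (\<integral>\<^sup>+z'. L (fst z) (snd z) * (K (fst z') (snd z') * ennreal (decay N (fst z' - fst z) * decay N (snd z' - snd z))) \<partial>lborel) \<partial>lborel)"
    unfolding smear_def by (intro nn_integral_cong nn_integral_cmult[symmetric]) measurable
  also have "\<dots> = (\<integral>\<^sup>+z'. (\<integral>\<^sup>+z. L (fst z) (snd z) * (K (fst z') (snd z') * ennreal (decay N (fst z' - fst z) * decay N (snd z' - snd z))) \<partial>lborel) \<partial>lborel)"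
    by (rule lborel_pair.Fubini') measurable
  also have "\<dots> = (\<integral>\<^sup>+z'. smear N L (fst z') (snd z') * K (fst z') (snd z') \<partial>lborel)"
  proof (rule nn_integral_cong)
    fix z' :: "'a \<times> 'a"
    have "(\<integral>\<^sup>+z. L (fst z) (snd z) * (K (fst z') (snd z') * ennreal (decay N (fst z' - fst z) * decay N (snd z' - snd z))) \<partial>lborel)
      = (\<integral>\<^sup>+z. L (fst z) (snd z) * ennreal (decay N (fst z - fst z') * decay N (snd z - snd z')) * K (fst z') (snd z') \<partial>lborel)"
      by (intro nn_integral_cong)
         (simp add: mult_ac decay_commute[of N "fst z'"] decay_commute[of N "snd z'"])
    also have "\<dots> = smear N L (fst z') (snd z') * K (fst z') (snd z')"
      unfolding smear_def by (rule nn_integral_multc) measurable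
    finally show "(\<integral>\<^sup>+z. L (fst z) (snd z) * (K (fst z') (snd z') * ennreal (decay N (fst z' - fst z) * decay N (snd z' - snd z))) \<partial>lborel)
      = smear N L (fst z') (snd z') * K (fst z') (snd z')" .
  qed
  finally show ?thesis .
qed

lemma nn_integral_decay:
  assumes N: "2 * DIM('a) \<le> N"
  shows "(\<integral>\<^sup>+\<xi>. ennreal (decay N \<xi>) \<partial>(lborel :: 'a::euclidean_space measure)) < top"
  using decay_integrable[where 'a = 'a, OF N] by (simp add: integrable_iff_bounded)

lemma nn_integral_decay_powr:
  assumes s: "0 \<le> s" and N: "2 * DIM('a) + nat \<lceil>s\<rceil> \<le> N"
  shows "(\<integral>\<^sup>+\<xi>. ennreal (decay N \<xi> * (2 * japanese \<xi>) powr s) \<partial>(lborel :: 'a::euclidean_space measure)) < top"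
proof -
  have "(\<integral>\<^sup>+\<xi>. ennreal (decay N \<xi> * (2 * japanese \<xi>) powr s) \<partial>(lborel :: 'a measure))
    \<le> (\<integral>\<^sup>+\<xi>. ennreal (2 powr s) * ennreal (decay (2 * DIM('a)) \<xi>) \<partial>(lborel :: 'a measure))"
  proof (rule nn_integral_mono)
    fix \<xi> :: 'a
    let ?m = "nat \<lceil>s\<rceil>"
    have "japanese \<xi> powr s \<le> japanese \<xi> powr real ?m"
      using s by (intro powr_mono japanese_ge_1) linarith
    then have "japanese \<xi> powr s \<le> japanese \<xi> ^ ?m" by (simp add: powr_realpow)
    moreover have "decay N \<xi> \<le> decay (2 * DIM('a)) \<xi> * decay ?m \<xi>"
      using decay_antimono[OF N] by (simp add: decay_add)
    ultimately have "decay N \<xi> * japanese \<xi> powr s \<le> (decay (2 * DIM('a)) \<xi> * decay ?m \<xi>) * japanese \<xi> ^ ?m"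
      by (intro mult_mono) auto
    also have "\<dots> = decay (2 * DIM('a)) \<xi>" by (simp add: mult.assoc mult.commute[of "decay ?m \<xi>"])
    finally have "2 powr s * (decay N \<xi> * japanese \<xi> powr s) \<le> 2 powr s * decay (2 * DIM('a)) \<xi>"
      by (intro mult_left_mono) auto
    then show "ennreal (decay N \<xi> * (2 * japanese \<xi>) powr s) \<le> ennreal (2 powr s) * ennreal (decay (2 * DIM('a)) \<xi>)"
      by (simp add: ennreal_mult[symmetric] ennreal_leI powr_mult mult_ac)
  qed
  also have "\<dots> = ennreal (2 powr s) * (\<integral>\<^sup>+\<xi>. ennreal (decay (2 * DIM('a)) \<xi>) \<partial>(lborel :: 'a measure))"
    by (rule nn_integral_cmult) measurable
  also have "\<dots> < top"
    using decay_integrable[where 'a = 'a, of "2 * DIM('a)"]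
    by (simp add: integrable_iff_bounded ennreal_mult_less_top)
  finally show ?thesis .
qed

context
  fixes r s :: real
  assumes r: "1 \<le> r"
begin

text \<open>A smeared function is an average of its phase space translates, so Minkowski's inequality
  applies. The exponent leaves room for both integrability and the growth of the weight.\<close>

lemma mixed_norm_smear:
  assumes s: "0 \<le> s" and N: "2 * DIM('a) + nat \<lceil>s\<rceil> \<le> N"
  obtains C where "C < top"
    "\<And>K :: 'a::euclidean_space \<Rightarrow> 'a \<Rightarrow> ennreal. case_prod K \<in> borel_measurable (borel \<Otimes>\<^sub>M borel) \<Longrightarrow>
      mixed_norm r s (smear N K) \<le> C * mixed_norm r s K"
proof
  let ?c = "\<lambda>z :: 'a \<times> 'a. ennreal (decay N (fst z) * decay N (snd z)) * ennreal ((2 * japanese (snd z)) powr s)"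
  let ?C = "\<integral>\<^sup>+z. ?c z \<partial>lborel"
  have "?C = (\<integral>\<^sup>+x. (\<integral>\<^sup>+\<xi>. ennreal (decay N x) * ennreal (decay N \<xi> * (2 * japanese \<xi>) powr s) \<partial>(lborel :: 'a measure)) \<partial>(lborel :: 'a measure))"
    by (subst nn_integral_lborel_pair(1)[symmetric]) (auto simp: ennreal_mult mult_ac intro!: nn_integral_cong)
  also have "\<dots> = (\<integral>\<^sup>+x. ennreal (decay N x) \<partial>(lborel :: 'a measure)) * (\<integral>\<^sup>+\<xi>. ennreal (decay N \<xi> * (2 * japanese \<xi>) powr s) \<partial>(lborel :: 'a measure))"
    by (simp add: nn_integral_cmult nn_integral_multc)
  also have "\<dots> < top"
    using nn_integral_decay_powr[OF s N] nn_integral_decay[where 'a = 'a, of N] N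
    by (simp add: ennreal_mult_less_top)
  finally show "?C < top" .
  fix K :: "'a \<Rightarrow> 'a \<Rightarrow> ennreal"
  assume K[measurable]: "case_prod K \<in> borel_measurable (borel \<Otimes>\<^sub>M borel)"
  have "mixed_norm r s (smear N K) = mixed_norm r s (\<lambda>y \<omega>.
      \<integral>\<^sup>+z. ennreal (decay N (fst z) * decay N (snd z)) * K (y + fst z) (\<omega> + snd z) \<partial>lborel)"
    unfolding smear_shifted[OF K] by (simp add: mult.commute add.commute)
  also have "\<dots> \<le> (\<integral>\<^sup>+z. mixed_norm r s (\<lambda>y \<omega>. ennreal (decay N (fst z) * decay N (snd z)) * K (y + fst z) (\<omega> + snd z)) \<partial>lborel)"
    by (rule mixed_norm_integral_le[OF r sigma_finite_lborel]) (unfold case_prod_beta', measurable)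
  also have "\<dots> \<le> (\<integral>\<^sup>+z. ?c z * mixed_norm r s K \<partial>lborel)"
  proof (rule nn_integral_mono)
    fix z :: "'a \<times> 'a"
    have "mixed_norm r s (\<lambda>y \<omega>. ennreal (decay N (fst z) * decay N (snd z)) * K (y + fst z) (\<omega> + snd z))
      = ennreal (decay N (fst z) * decay N (snd z)) * mixed_norm r s (\<lambda>y \<omega>. K (y + fst z) (\<omega> + snd z))"
      by (rule mixed_norm_cmult[OF r]) measurable
    also have "\<dots> \<le> ennreal (decay N (fst z) * decay N (snd z)) * (ennreal ((2 * japanese (snd z)) powr s) * mixed_norm r s K)"
      by (intro mult_left_mono mixed_norm_shift[OF r s K]) auto
    finally show "mixed_norm r s (\<lambda>y \<omega>. ennreal (decay N (fst z) * decay N (snd z)) * K (y + fst z) (\<omega> + snd z))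
       \<le> ?c z * mixed_norm r s K" by (simp add: mult.assoc)
  qed
  also have "\<dots> = ?C * mixed_norm r s K" by (rule nn_integral_multc) measurable
  finally show "mixed_norm r s (smear N K) \<le> ?C * mixed_norm r s K" .
qed

text \<open>In \<open>x\<close> the smearing is an integral against a bounded and integrable weight, which loses the
  dependence on \<open>y\<close>. Ultimately this is the embedding of \<open>M\<^sup>p\<^sup>,\<^sup>1\<close> into \<open>M\<^sup>\<infinity>\<^sup>,\<^sup>1\<close>.\<close>

lemma smear_sup_bound:
  assumes N: "2 * DIM('a) \<le> N"
  obtains C where "C < top"
    "\<And>(K :: 'a::euclidean_space \<Rightarrow> 'a \<Rightarrow> ennreal) y \<omega>. case_prod K \<in> borel_measurable (borel \<Otimes>\<^sub>M borel) \<Longrightarrow>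
      smear N K y \<omega> \<le> C * (\<integral>\<^sup>+\<xi>. Lebesgue_norm (ennreal r) (\<lambda>x. K x \<xi>) * ennreal (decay N (\<xi> - \<omega>)) \<partial>lborel)"
proof -
  let ?W = "\<integral>\<^sup>+x. ennreal (decay N x) \<partial>(lborel :: 'a measure)"
  have W: "?W < top" by (rule nn_integral_decay[OF N])
  obtain C where C: "C < top" and
    *: "\<And>w k :: 'a \<Rightarrow> ennreal. w \<in> borel_measurable lborel \<Longrightarrow> k \<in> borel_measurable lborel \<Longrightarrow>
      (\<And>x. w x \<le> 1) \<Longrightarrow> (\<integral>\<^sup>+x. w x \<partial>lborel) \<le> ?W \<Longrightarrow>
      (\<integral>\<^sup>+x. k x * w x \<partial>lborel) \<le> C * Lebesgue_norm (ennreal r) k"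
    using integral_weight_le_Lebesgue_norm[OF r ennreal_one_less_top W] by blast
  show ?thesis
  proof (rule that[OF C])
    fix K :: "'a \<Rightarrow> 'a \<Rightarrow> ennreal" and y \<omega>
    assume K[measurable]: "case_prod K \<in> borel_measurable (borel \<Otimes>\<^sub>M borel)"
    note [measurable] = Lebesgue_norm_slice_measurable[OF r K] measurable_slices[OF K]
    have "smear N K y \<omega> = (\<integral>\<^sup>+\<xi>. (\<integral>\<^sup>+x. K x \<xi> * ennreal (decay N (x - y) * decay N (\<xi> - \<omega>)) \<partial>lborel) \<partial>lborel)"
      unfolding smear_def by (rule nn_integral_lborel_pair(2)) measurable
    also have "\<dots> = (\<integral>\<^sup>+\<xi>. (\<integral>\<^sup>+x. K x \<xi> * ennreal (decay N (x - y)) \<partial>lborel) * ennreal (decay N (\<xi> - \<omega>)) \<partial>lborel)"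
    proof (rule nn_integral_cong)
      fix \<xi>
      have "(\<integral>\<^sup>+x. K x \<xi> * ennreal (decay N (x - y) * decay N (\<xi> - \<omega>)) \<partial>lborel)
        = (\<integral>\<^sup>+x. K x \<xi> * ennreal (decay N (x - y)) * ennreal (decay N (\<xi> - \<omega>)) \<partial>lborel)"
        by (simp add: ennreal_mult mult.assoc)
      also have "\<dots> = (\<integral>\<^sup>+x. K x \<xi> * ennreal (decay N (x - y)) \<partial>lborel) * ennreal (decay N (\<xi> - \<omega>))"
        by (rule nn_integral_multc) measurable
      finally show "(\<integral>\<^sup>+x. K x \<xi> * ennreal (decay N (x - y) * decay N (\<xi> - \<omega>)) \<partial>lborel)
        = (\<integral>\<^sup>+x. K x \<xi> * ennreal (decay N (x - y)) \<partial>lborel) * ennreal (decay N (\<xi> - \<omega>))" .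
    qed
    also have "\<dots> \<le> (\<integral>\<^sup>+\<xi>. C * Lebesgue_norm (ennreal r) (\<lambda>x. K x \<xi>) * ennreal (decay N (\<xi> - \<omega>)) \<partial>lborel)"
    proof (intro nn_integral_mono mult_right_mono)
      fix \<xi>
      have "(\<integral>\<^sup>+x. ennreal (decay N (x - y)) \<partial>lborel) \<le> ?W"
        using nn_integral_lborel_shift[of "\<lambda>x. ennreal (decay N (x - y))" y] by simp
      moreover have "ennreal (decay N (x - y)) \<le> 1" for x
        using decay_le_1[of N "x - y"] by (simp add: ennreal_leI flip: ennreal_1)
      ultimately show "(\<integral>\<^sup>+x. K x \<xi> * ennreal (decay N (x - y)) \<partial>lborel) \<le> C * Lebesgue_norm (ennreal r) (\<lambda>x. K x \<xi>)"
        by (intro *) auto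
    qed auto
    also have "\<dots> = C * (\<integral>\<^sup>+\<xi>. Lebesgue_norm (ennreal r) (\<lambda>x. K x \<xi>) * ennreal (decay N (\<xi> - \<omega>)) \<partial>lborel)"
      by (subst nn_integral_cmult[symmetric]) (auto simp: mult.assoc)
    finally show "smear N K y \<omega> \<le> C * (\<integral>\<^sup>+\<xi>. Lebesgue_norm (ennreal r) (\<lambda>x. K x \<xi>) * ennreal (decay N (\<xi> - \<omega>)) \<partial>lborel)" .
  qed
qed

end

section \<open>Iterated partial derivatives\<close>

definition smooth :: "('a::euclidean_space \<Rightarrow> complex) \<Rightarrow> bool"
  where "smooth h \<longleftrightarrow> (\<forall>bs. set bs \<subseteq> Basis \<longrightarrow> (\<forall>x. iter_deriv bs h differentiable (at x)))"

lemma smoothD: "smooth h \<Longrightarrow> set bs \<subseteq> Basis \<Longrightarrow> iter_deriv bs h differentiable (at x)"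
  by (simp add: smooth_def)

lemma smooth_has_derivative:
  "smooth h \<Longrightarrow> set bs \<subseteq> Basis \<Longrightarrow>
    (iter_deriv bs h has_derivative frechet_derivative (iter_deriv bs h) (at x)) (at x)"
  using frechet_derivative_works smoothD by blast

lemma smooth_continuous: "smooth h \<Longrightarrow> set bs \<subseteq> Basis \<Longrightarrow> continuous_on A (iter_deriv bs h)"
  by (meson continuous_at_imp_continuous_on differentiable_imp_continuous_within smoothD)

lemma iter_deriv_append: "iter_deriv (as @ bs) h = iter_deriv as (iter_deriv bs h)"
  by (induction as) auto

text \<open>The \<open>2\<^sup>k\<close> ways to distribute \<open>k\<close> successive derivatives over two factors. Working with lists
  instead of multi-indices makes binomial coefficients unnecessary.\<close>

fun leibniz_splits :: "'a list \<Rightarrow> ('a list \<times> 'a list) list"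
  where
    "leibniz_splits [] = [([], [])]"
  | "leibniz_splits (b # bs) = concat (map (\<lambda>(as, cs). [(b # as, cs), (as, b # cs)]) (leibniz_splits bs))"

lemma leibniz_splits_sub:
  "(as, cs) \<in> set (leibniz_splits bs) \<Longrightarrow>
    set as \<subseteq> set bs \<and> set cs \<subseteq> set bs \<and> length as + length cs = length bs"
  by (induction bs arbitrary: as cs) fastforce+

lemma length_leibniz_splits: "length (leibniz_splits bs) = 2 ^ length bs"
  by (induction bs) (auto simp: length_concat o_def case_prod_beta' sum_list_triv)

lemma has_derivative_sum_list:
  assumes "\<And>i. i \<in> set xs \<Longrightarrow> (f i has_derivative f' i) (at x)"
  shows "((\<lambda>y. \<Sum>i\<leftarrow>xs. f i y) has_derivative (\<lambda>h. \<Sum>i\<leftarrow>xs. f' i h)) (at x)"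
  using assms by (induction xs) (auto intro!: has_derivative_add)

lemma norm_sum_list_le:
  assumes "\<And>i. i \<in> set xs \<Longrightarrow> norm (f i) \<le> B"
  shows "norm (\<Sum>i\<leftarrow>xs. f i) \<le> real (length xs) * B"
  using assms
proof (induction xs)
  case (Cons a xs)
  then have "norm (f a + (\<Sum>i\<leftarrow>xs. f i)) \<le> B + real (length xs) * B"
    by (intro norm_triangle_mono) auto
  then show ?case by (simp add: algebra_simps)
qed simp

lemma iter_deriv_mult_aux:
  assumes "smooth f" "smooth g" "set bs \<subseteq> Basis"
  shows "((\<lambda>x. \<Sum>(as, cs)\<leftarrow>leibniz_splits bs. iter_deriv as f x * iter_deriv cs g x) has_derivative
    (\<lambda>h. \<Sum>(as, cs)\<leftarrow>leibniz_splits bs.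
        iter_deriv as f x * frechet_derivative (iter_deriv cs g) (at x) h
        + frechet_derivative (iter_deriv as f) (at x) h * iter_deriv cs g x)) (at x)"
  unfolding case_prod_beta'
proof (rule has_derivative_sum_list)
  fix i assume i: "i \<in> set (leibniz_splits bs)"
  then have "set (fst i) \<subseteq> Basis" "set (snd i) \<subseteq> Basis"
    using leibniz_splits_sub[of "fst i" "snd i" bs] assms(3) by auto
  then show "((\<lambda>x. iter_deriv (fst i) f x * iter_deriv (snd i) g x) has_derivative
    (\<lambda>h. iter_deriv (fst i) f x * frechet_derivative (iter_deriv (snd i) g) (at x) h
        + frechet_derivative (iter_deriv (fst i) f) (at x) h * iter_deriv (snd i) g x)) (at x)"
    using assms by (intro has_derivative_mult smooth_has_derivative) auto
qed

lemma iter_deriv_mult: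
  assumes "smooth f" "smooth g" "set bs \<subseteq> Basis"
  shows "iter_deriv bs (\<lambda>x. f x * g x)
    = (\<lambda>x. \<Sum>(as, cs)\<leftarrow>leibniz_splits bs. iter_deriv as f x * iter_deriv cs g x)"
  using assms(3)
proof (induction bs)
  case (Cons b bs)
  have expand: "(\<Sum>(as, cs)\<leftarrow>leibniz_splits (b # bs). iter_deriv as f x * iter_deriv cs g x)
    = (\<Sum>(as, cs)\<leftarrow>leibniz_splits bs. iter_deriv as f x * frechet_derivative (iter_deriv cs g) (at x) b
        + frechet_derivative (iter_deriv as f) (at x) b * iter_deriv cs g x)" for x
  proof -
    have "(\<Sum>(as, cs)\<leftarrow>concat (map (\<lambda>(as, cs). [(b # as, cs), (as, b # cs)]) L). iter_deriv as f x * iter_deriv cs g x)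
      = (\<Sum>(as, cs)\<leftarrow>L. iter_deriv as f x * frechet_derivative (iter_deriv cs g) (at x) b
        + frechet_derivative (iter_deriv as f) (at x) b * iter_deriv cs g x)" for L
      by (induction L) auto
    then show ?thesis by simp
  qed
  from Cons have IH: "iter_deriv bs (\<lambda>x. f x * g x)
    = (\<lambda>x. \<Sum>(as, cs)\<leftarrow>leibniz_splits bs. iter_deriv as f x * iter_deriv cs g x)" by simp
  show ?case
  proof
    fix x
    have "iter_deriv (b # bs) (\<lambda>x. f x * g x) x = frechet_derivative
      (\<lambda>x. \<Sum>(as, cs)\<leftarrow>leibniz_splits bs. iter_deriv as f x * iter_deriv cs g x) (at x) b"
      by (simp add: IH)
    also have "\<dots> = (\<Sum>(as, cs)\<leftarrow>leibniz_splits bs.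
        iter_deriv as f x * frechet_derivative (iter_deriv cs g) (at x) b
        + frechet_derivative (iter_deriv as f) (at x) b * iter_deriv cs g x)"
      using frechet_derivative_at[OF iter_deriv_mult_aux[OF assms(1,2), of bs x]] Cons.prems
      by (simp add: fun_eq_iff)
    finally show "iter_deriv (b # bs) (\<lambda>x. f x * g x) x
      = (\<Sum>(as, cs)\<leftarrow>leibniz_splits (b # bs). iter_deriv as f x * iter_deriv cs g x)"
      unfolding expand .
  qed
qed simp

lemma smooth_mult:
  assumes "smooth f" "smooth g"
  shows "smooth (\<lambda>x. f x * g x)"
  unfolding smooth_def
proof (intro allI impI)
  fix bs :: "'a list" and x assume bs: "set bs \<subseteq> Basis"
  show "iter_deriv bs (\<lambda>x. f x * g x) differentiable at x"
    unfolding iter_deriv_mult[OF assms bs]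
    using iter_deriv_mult_aux[OF assms bs] differentiable_def by blast
qed

text \<open>Both conjuncts are proved in one induction, since the derivative of the right-hand side is
  taken in each step. The case \<open>c = 1\<close> covers translations, the case \<open>a = 0\<close> dilations.\<close>

lemma iter_deriv_affine:
  assumes "smooth h" "set bs \<subseteq> Basis"
  shows "iter_deriv bs (\<lambda>t. h (c *\<^sub>R t + a)) = (\<lambda>t. of_real (c ^ length bs) * iter_deriv bs h (c *\<^sub>R t + a))
    \<and> (\<forall>t. (\<lambda>t. of_real (c ^ length bs) * iter_deriv bs h (c *\<^sub>R t + a)) differentiable at t)"
  using assms(2)
proof (induction bs)
  case Nil
  have "(\<lambda>t. h (c *\<^sub>R t + a)) differentiable at t" for t
    using differentiable_chain_at[of "\<lambda>t. c *\<^sub>R t + a" t h] smoothD[OF assms(1), of "[]"]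
    by (simp add: o_def)
  then show ?case by simp
next
  case (Cons b bs)
  then have bs: "set bs \<subseteq> Basis" "b \<in> Basis" and IH: "iter_deriv bs (\<lambda>t. h (c *\<^sub>R t + a))
     = (\<lambda>t. of_real (c ^ length bs) * iter_deriv bs h (c *\<^sub>R t + a))" by auto
  have "frechet_derivative (\<lambda>t. of_real (c ^ length bs) * iter_deriv bs h (c *\<^sub>R t + a)) (at t) b
    = of_real (c ^ length (b # bs)) * iter_deriv (b # bs) h (c *\<^sub>R t + a)" for t
  proof -
    let ?D = "frechet_derivative (iter_deriv bs h) (at (c *\<^sub>R t + a))"
    have D: "(iter_deriv bs h has_derivative ?D) (at (c *\<^sub>R t + a))"
      by (rule smooth_has_derivative[OF assms(1) bs(1)])
    have "((\<lambda>t. iter_deriv bs h (c *\<^sub>R t + a)) has_derivative (\<lambda>v. ?D (c *\<^sub>R v))) (at t)"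
      using has_derivative_compose[of "\<lambda>t. c *\<^sub>R t + a" "\<lambda>v. c *\<^sub>R v" t UNIV "iter_deriv bs h" ?D] D
      by (simp add: has_derivative_add_const has_derivative_scaleR_right has_derivative_ident)
    then have "((\<lambda>t. of_real (c ^ length bs) * iter_deriv bs h (c *\<^sub>R t + a)) has_derivative
        (\<lambda>v. of_real (c ^ length bs) * ?D (c *\<^sub>R v))) (at t)"
      by (rule has_derivative_mult_right)
    then have "frechet_derivative (\<lambda>t. of_real (c ^ length bs) * iter_deriv bs h (c *\<^sub>R t + a)) (at t)
       = (\<lambda>v. of_real (c ^ length bs) * ?D (c *\<^sub>R v))"
      by (rule frechet_derivative_at[symmetric])
    then show ?thesis
      using linear_cmul[OF has_derivative_linear[OF D]] by (simp add: scaleR_conv_of_real)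
  qed
  then have eq: "iter_deriv (b # bs) (\<lambda>t. h (c *\<^sub>R t + a))
    = (\<lambda>t. of_real (c ^ length (b # bs)) * iter_deriv (b # bs) h (c *\<^sub>R t + a))"
    unfolding iter_deriv.simps(2)[of _ _ "\<lambda>t. h (c *\<^sub>R t + a)"] IH by blast
  have "(\<lambda>t. iter_deriv (b # bs) h (c *\<^sub>R t + a)) differentiable at t" for t
    using differentiable_chain_at[of "\<lambda>t. c *\<^sub>R t + a" t "iter_deriv (b # bs) h"]
      smoothD[OF assms(1) Cons.prems]
    by (simp add: o_def)
  then have "(\<lambda>t. of_real (c ^ length (b # bs)) * iter_deriv (b # bs) h (c *\<^sub>R t + a)) differentiable at t" for t
    by (intro differentiable_mult) (simp_all del: iter_deriv.simps)
  with eq show ?case by blast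
qed

lemma smooth_affine: "smooth h \<Longrightarrow> smooth (\<lambda>t. h (c *\<^sub>R t + a))"
  using iter_deriv_affine[of h _ c a] unfolding smooth_def[of "\<lambda>t. h (c *\<^sub>R t + a)"] by simp

lemma iter_deriv_cnj:
  assumes "smooth h" "set bs \<subseteq> Basis"
  shows "iter_deriv bs (\<lambda>t. cnj (h t)) = (\<lambda>t. cnj (iter_deriv bs h t))"
  using assms(2)
proof (induction bs)
  case (Cons b bs)
  have "((\<lambda>t. cnj (iter_deriv bs h t)) has_derivative
     (\<lambda>v. cnj (frechet_derivative (iter_deriv bs h) (at t) v))) (at t)" for t
    using Cons.prems by (intro has_derivative_cnj smooth_has_derivative assms(1)) auto
  note D = frechet_derivative_at[OF this, symmetric]
  have "iter_deriv bs (\<lambda>t. cnj (h t)) = (\<lambda>t. cnj (iter_deriv bs h t))" using Cons by simp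
  then show ?case by (simp add: D)
qed simp

lemma smooth_cnj: 
  assumes "smooth h" shows "smooth (\<lambda>t. cnj (h t))"
  unfolding smooth_def
proof (intro allI impI)
  fix bs :: "'a list" and x assume bs: "set bs \<subseteq> Basis"
  show "iter_deriv bs (\<lambda>x. cnj (h x)) differentiable at x"
    unfolding iter_deriv_cnj[OF assms bs] 
    using has_derivative_cnj[OF smooth_has_derivative[OF assms bs]] differentiable_def by blast
qed

lemma iter_deriv_lincomb:
  assumes "smooth f" "smooth g" "set bs \<subseteq> Basis"
  shows "iter_deriv bs (\<lambda>t. a * f t + b * g t) = (\<lambda>t. a * iter_deriv bs f t + b * iter_deriv bs g t)"
  using assms(3)
proof (induction bs)
  case (Cons c bs)
  have "((\<lambda>t. a * iter_deriv bs f t + b * iter_deriv bs g t) has_derivative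
     (\<lambda>v. a * frechet_derivative (iter_deriv bs f) (at t) v + b * frechet_derivative (iter_deriv bs g) (at t) v)) (at t)" for t
    using Cons.prems
    by (intro has_derivative_add has_derivative_mult_right smooth_has_derivative assms) auto
  note D = frechet_derivative_at[OF this, symmetric]
  have "iter_deriv bs (\<lambda>t. a * f t + b * g t) = (\<lambda>t. a * iter_deriv bs f t + b * iter_deriv bs g t)"
    using Cons by simp
  then show ?case by (simp add: D)
qed simp

lemma smooth_lincomb: 
  assumes "smooth f" "smooth g" shows "smooth (\<lambda>t. a * f t + b * g t)"
  unfolding smooth_def
proof (intro allI impI)
  fix bs :: "'a list" and x assume bs: "set bs \<subseteq> Basis"
  show "iter_deriv bs (\<lambda>t. a * f t + b * g t) differentiable at x"
    unfolding iter_deriv_lincomb[OF assms bs] 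
    using smoothD[OF assms(1) bs] smoothD[OF assms(2) bs]
    by (intro differentiable_add differentiable_mult) auto
qed

lemma iter_deriv_cis:
  "iter_deriv bs (\<lambda>t. cis (t \<bullet> \<xi>)) = (\<lambda>t. (\<Prod>b\<leftarrow>bs. \<i> * of_real (b \<bullet> \<xi>)) * cis (t \<bullet> \<xi>))"
proof (induction bs)
  case (Cons b bs)
  have "((\<lambda>t. (\<Prod>b\<leftarrow>bs. \<i> * of_real (b \<bullet> \<xi>)) * cis (t \<bullet> \<xi>)) has_derivative
     (\<lambda>v. (\<Prod>b\<leftarrow>bs. \<i> * of_real (b \<bullet> \<xi>)) * ((v \<bullet> \<xi>) *\<^sub>R (\<i> * cis (t \<bullet> \<xi>))))) (at t)" for t
    by (intro has_derivative_mult_right has_derivative_cis has_derivative_inner_left has_derivative_ident)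
  from frechet_derivative_at[OF this] show ?case
    by (auto simp: Cons fun_eq_iff scaleR_conv_of_real mult_ac)
qed simp

lemma smooth_cis: "smooth (\<lambda>t. cis (t \<bullet> \<xi>))"
proof -
  have "(\<lambda>t. (\<Prod>b\<leftarrow>bs. \<i> * of_real (b \<bullet> \<xi>)) * cis (t \<bullet> \<xi>)) differentiable at t" for bs t
    using has_derivative_mult_right[OF has_derivative_cis[OF has_derivative_inner_left[OF has_derivative_ident]]]
      differentiable_def by blast
  then show ?thesis unfolding smooth_def iter_deriv_cis by blast
qed

lemma norm_prod_list_basis_le:
  assumes "set bs \<subseteq> Basis" "length bs \<le> n"
  shows "cmod (\<Prod>b\<leftarrow>bs. \<i> * of_real (b \<bullet> \<xi>)) \<le> japanese \<xi> ^ n"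
proof -
  have "cmod (\<Prod>b\<leftarrow>bs. \<i> * of_real (b \<bullet> \<xi>)) \<le> japanese \<xi> ^ length bs"
    using assms(1)
  proof (induction bs)
    case (Cons b bs)
    then have "cmod (\<i> * of_real (b \<bullet> \<xi>)) \<le> japanese \<xi>"
      using Basis_le_norm[of b \<xi>] norm_le_japanese[of \<xi>] by (simp add: norm_mult inner_commute)
    then show ?case using Cons by (simp only: list.map prod_list.Cons norm_mult length_Cons power_Suc)
      (intro mult_mono, auto)
  qed simp
  also have "\<dots> \<le> japanese \<xi> ^ n" using assms(2) by (intro power_increasing japanese_ge_1)
  finally show ?thesis .
qed

section \<open>Schwartz functions\<close>

lemma schwartz_iff:
  "h \<in> schwartz \<longleftrightarrow> smooth h \<and>
    (\<forall>bs N. set bs \<subseteq> Basis \<longrightarrow> (\<exists>B. \<forall>x. cmod (iter_deriv bs h x) \<le> B * decay N x))"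
proof -
  have "bounded (range (\<lambda>x. japanese x ^ N *\<^sub>R iter_deriv bs h x))
    \<longleftrightarrow> (\<exists>B. \<forall>x. cmod (iter_deriv bs h x) \<le> B * decay N x)" for bs N
  proof -
    have "cmod (japanese x ^ N *\<^sub>R iter_deriv bs h x) \<le> B \<longleftrightarrow> cmod (iter_deriv bs h x) \<le> B * decay N x" for B x
      by (simp add: decay_def field_simps)
    then show ?thesis unfolding bounded_iff by simp
  qed
  then show ?thesis unfolding schwartz_def smooth_def by auto
qed

lemma schwartz_smooth: "h \<in> schwartz \<Longrightarrow> smooth h"
  by (simp add: schwartz_iff)

lemma finite_multiindices: "finite {bs :: 'a::euclidean_space list. set bs \<subseteq> Basis \<and> length bs \<le> n}"
  by (rule finite_lists_length_le) simp

text \<open>Merges the separate bounds for finitely many multi-indices into one.\<close>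

lemma uniform_bound_finite:
  assumes "finite A" "\<And>a. a \<in> A \<Longrightarrow> \<exists>B. \<forall>x. u a x \<le> B * (v x :: real)" "\<And>x. 0 \<le> v x"
  obtains B where "0 \<le> B" "\<And>a x. a \<in> A \<Longrightarrow> u a x \<le> B * v x"
proof -
  obtain b where b: "\<And>a x. a \<in> A \<Longrightarrow> u a x \<le> b a * v x" using assms(2) by metis
  let ?B = "\<Sum>a\<in>A. \<bar>b a\<bar>"
  have "u a x \<le> ?B * v x" if "a \<in> A" for a x
  proof -
    have "b a \<le> ?B" using member_le_sum[OF that, of "\<lambda>a. \<bar>b a\<bar>"] assms(1) by simp
    then show ?thesis using b[OF that, of x] assms(3)[of x] mult_right_mono order_trans by blast
  qed
  then show ?thesis using that[of ?B] by (auto intro: sum_nonneg)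
qed

lemma schwartz_bound:
  assumes "h \<in> schwartz"
  obtains B where "0 \<le> B"
    "\<And>bs x. set bs \<subseteq> Basis \<Longrightarrow> length bs \<le> n \<Longrightarrow> cmod (iter_deriv bs h x) \<le> B * decay N x"
proof -
  obtain B where "0 \<le> B"
    "\<And>bs x. bs \<in> {bs. set bs \<subseteq> Basis \<and> length bs \<le> n} \<Longrightarrow> cmod (iter_deriv bs h x) \<le> B * decay N x"
    using assms uniform_bound_finite[OF finite_multiindices[of n], of "\<lambda>bs x. cmod (iter_deriv bs h x)" "decay N"]
    by (auto simp: schwartz_iff)
  then show ?thesis using that by auto
qed

lemma schwartz_bound0:
  assumes "h \<in> schwartz"
  obtains B where "0 \<le> B" "\<And>x. cmod (h x) \<le> B * decay N x"
proof -
  obtain B where "0 \<le> B" "\<And>bs x. set bs \<subseteq> Basis \<Longrightarrow> length bs \<le> 0 \<Longrightarrow> cmod (iter_deriv bs h x) \<le> B * decay N x"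
    using schwartz_bound[OF assms] by metis
  from that[OF this(1)] this(2)[of "[]"] show ?thesis by simp
qed

lemma schwartz_continuous: "h \<in> schwartz \<Longrightarrow> continuous_on A h"
  using smooth_continuous[of h "[]"] by (simp add: schwartz_smooth)

lemma schwartz_measurable: "h \<in> schwartz \<Longrightarrow> h \<in> borel_measurable borel"
  by (intro borel_measurable_continuous_onI schwartz_continuous)

lemma integrable_decay_bound:
  assumes [measurable]: "h \<in> borel_measurable borel"
    and N: "2 * DIM('a) \<le> N" and le: "\<And>x. cmod (h x) \<le> B * decay N (x - a)"
  shows "integrable lborel (h :: 'a::euclidean_space \<Rightarrow> complex)"
proof (rule Bochner_Integration.integrable_bound)
  have "integrable lborel (\<lambda>x :: 'a. decay N (- a + 1 *\<^sub>R x))"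
  proof -
    have "integrable (distr lborel borel ((+) (- a))) (decay N :: 'a \<Rightarrow> real)"
      using decay_integrable[OF N] by (simp add: lborel_distr_plus)
    then show ?thesis by (subst (asm) integrable_distr_eq) auto
  qed
  then show "integrable lborel (\<lambda>x. B * decay N (x - a))" by simp
  show "AE x in lborel. norm (h x) \<le> norm (B * decay N (x - a))"
    using order_trans[OF le abs_ge_self] by simp
qed simp

lemma schwartz_integrable: "(h :: 'a::euclidean_space \<Rightarrow> complex) \<in> schwartz \<Longrightarrow> integrable lborel h"
  using integrable_decay_bound[of h "2 * DIM('a)" _ 0] schwartz_bound0[of h] schwartz_measurable[of h]
  by (metis diff_zero order_refl)

lemma schwartz_mult_bounded:
  assumes f: "f \<in> schwartz" and g: "smooth g"
    and gb: "\<And>bs. set bs \<subseteq> Basis \<Longrightarrow> \<exists>B. \<forall>x. cmod (iter_deriv bs g x) \<le> B"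
  shows "(\<lambda>x. f x * g x) \<in> schwartz"
  unfolding schwartz_iff
proof (intro conjI allI impI)
  show "smooth (\<lambda>x. f x * g x)" using schwartz_smooth[OF f] g by (rule smooth_mult)
  fix bs :: "'a list" and N assume bs: "set bs \<subseteq> Basis"
  obtain B where B: "0 \<le> B"
    "\<And>bs' x. set bs' \<subseteq> Basis \<Longrightarrow> length bs' \<le> length bs \<Longrightarrow> cmod (iter_deriv bs' f x) \<le> B * decay N x"
    using schwartz_bound[OF f] by blast
  obtain C where C: "0 \<le> C"
    "\<And>bs' x. bs' \<in> {bs'. set bs' \<subseteq> Basis \<and> length bs' \<le> length bs} \<Longrightarrow> cmod (iter_deriv bs' g x) \<le> C * 1"
    using uniform_bound_finite[OF finite_multiindices[of "length bs"], of "\<lambda>bs x. cmod (iter_deriv bs g x)" "\<lambda>_. 1"] gb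
    by auto
  have "cmod (iter_deriv bs (\<lambda>x. f x * g x) x) \<le> real (length (leibniz_splits bs)) * (B * decay N x * C)" for x
    unfolding iter_deriv_mult[OF schwartz_smooth[OF f] g bs]
  proof (rule norm_sum_list_le, clarify)
    fix as cs assume "(as, cs) \<in> set (leibniz_splits bs)"
    with leibniz_splits_sub[OF this] bs
    show "cmod (iter_deriv as f x * iter_deriv cs g x) \<le> B * decay N x * C"
      unfolding norm_mult using B C by (intro mult_mono) auto
  qed
  then show "\<exists>B. \<forall>x. cmod (iter_deriv bs (\<lambda>x. f x * g x) x) \<le> B * decay N x"
    by (intro exI[of _ "real (length (leibniz_splits bs)) * (B * C)"]) (simp add: mult_ac)
qed

lemma schwartz_mult:
  assumes "f \<in> schwartz" "g \<in> schwartz"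
  shows "(\<lambda>x. f x * g x) \<in> schwartz"
proof (rule schwartz_mult_bounded[OF assms(1) schwartz_smooth[OF assms(2)]])
  fix bs :: "'a list" assume bs: "set bs \<subseteq> Basis"
  then obtain B where "\<And>x. cmod (iter_deriv bs g x) \<le> B * decay 0 x"
    using assms(2) unfolding schwartz_iff by blast
  then show "\<exists>B. \<forall>x. cmod (iter_deriv bs g x) \<le> B" by (auto simp: decay_def)
qed

lemma schwartz_modulate:
  assumes "f \<in> schwartz"
  shows "(\<lambda>x. cis (x \<bullet> \<xi>) * f x) \<in> schwartz"
proof -
  have "(\<lambda>x. f x * cis (x \<bullet> \<xi>)) \<in> schwartz"
  proof (rule schwartz_mult_bounded[OF assms smooth_cis])
    fix bs :: "'a list" assume "set bs \<subseteq> Basis"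
    then have "cmod (iter_deriv bs (\<lambda>x. cis (x \<bullet> \<xi>)) x) \<le> japanese \<xi> ^ length bs" for x
      using norm_prod_list_basis_le[of bs "length bs" \<xi>] by (simp add: iter_deriv_cis norm_mult)
    then show "\<exists>B. \<forall>x. cmod (iter_deriv bs (\<lambda>x. cis (x \<bullet> \<xi>)) x) \<le> B" by blast
  qed
  then show ?thesis by (simp add: mult.commute)
qed

lemma schwartz_cnj: "f \<in> schwartz \<Longrightarrow> (\<lambda>x. cnj (f x)) \<in> schwartz"
  unfolding schwartz_iff by (auto simp: smooth_cnj iter_deriv_cnj)

lemma schwartz_lincomb:
  assumes "f \<in> schwartz" "g \<in> schwartz"
  shows "(\<lambda>x. a * f x + b * g x) \<in> schwartz"
  unfolding schwartz_iff
proof (intro conjI allI impI)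
  show "smooth (\<lambda>x. a * f x + b * g x)" using assms by (intro smooth_lincomb schwartz_smooth)
  fix bs :: "'a list" and N assume bs: "set bs \<subseteq> Basis"
  obtain B C where BC: "\<And>x. cmod (iter_deriv bs f x) \<le> B * decay N x" "\<And>x. cmod (iter_deriv bs g x) \<le> C * decay N x"
    using assms bs unfolding schwartz_iff by blast
  have "cmod (a * iter_deriv bs f x + b * iter_deriv bs g x) \<le> (cmod a * B + cmod b * C) * decay N x" for x
  proof -
    have "cmod (a * iter_deriv bs f x + b * iter_deriv bs g x) \<le> cmod a * (B * decay N x) + cmod b * (C * decay N x)"
      using BC[of x] by (intro norm_triangle_mono) (auto simp: norm_mult intro!: mult_left_mono)
    then show ?thesis by (simp add: algebra_simps)
  qed
  then show "\<exists>B. \<forall>x. cmod (iter_deriv bs (\<lambda>x. a * f x + b * g x) x) \<le> B * decay N x"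
    unfolding iter_deriv_lincomb[OF assms[THEN schwartz_smooth] bs] by blast
qed

lemma schwartz_affine:
  assumes "f \<in> schwartz" "c \<noteq> 0"
  shows "(\<lambda>x. f (c *\<^sub>R x + a)) \<in> schwartz"
  unfolding schwartz_iff
proof (intro conjI allI impI)
  show "smooth (\<lambda>x. f (c *\<^sub>R x + a))" using assms by (intro smooth_affine schwartz_smooth)
  fix bs :: "'a list" and N assume bs: "set bs \<subseteq> Basis"
  obtain B where B: "0 \<le> B" "\<And>bs' x. set bs' \<subseteq> Basis \<Longrightarrow> length bs' \<le> length bs \<Longrightarrow> cmod (iter_deriv bs' f x) \<le> B * decay N x"
    using schwartz_bound[OF assms(1)] by blast
  let ?m = "max 1 \<bar>1 / c\<bar>"
  have dil: "japanese x \<le> ?m * japanese (c *\<^sub>R x)" for x :: 'a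
  proof -
    have "(norm x)\<^sup>2 = (\<bar>1 / c\<bar>)\<^sup>2 * (norm (c *\<^sub>R x))\<^sup>2" using assms(2) by (simp add: power_mult_distrib field_simps)
    also have "\<dots> \<le> ?m\<^sup>2 * (norm (c *\<^sub>R x))\<^sup>2" by (intro mult_right_mono power_mono) auto
    finally have "1 + (norm x)\<^sup>2 \<le> ?m\<^sup>2 * 1 + ?m\<^sup>2 * (norm (c *\<^sub>R x))\<^sup>2"
      by (intro add_mono) (auto simp: one_le_power)
    then have "japanese x \<le> sqrt (?m\<^sup>2 * (1 + (norm (c *\<^sub>R x))\<^sup>2))"
      unfolding japanese_def by (simp add: distrib_left)
    then show ?thesis by (simp add: japanese_def real_sqrt_mult)
  qed
  have dec: "decay N (c *\<^sub>R x + a) \<le> (2 * japanese a) ^ N * ?m ^ N * decay N x" for x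
  proof -
    have "japanese x \<le> 2 * japanese a * (?m * japanese (c *\<^sub>R x + a))"
    proof -
      have "?m * japanese (c *\<^sub>R x) \<le> ?m * (2 * japanese (c *\<^sub>R x + a) * japanese a)"
        using japanese_add_le[of "c *\<^sub>R x + a" "- a"] by (intro mult_left_mono) auto
      then show ?thesis using dil[of x] by (simp add: mult_ac)
    qed
    then have "japanese x ^ N \<le> (2 * japanese a * (?m * japanese (c *\<^sub>R x + a))) ^ N" by (intro power_mono) auto
    then show ?thesis by (simp add: decay_def field_simps power_mult_distrib)
  qed
  have "cmod (iter_deriv bs (\<lambda>x. f (c *\<^sub>R x + a)) x)
     \<le> (\<bar>c\<bar> ^ length bs * B * ((2 * japanese a) ^ N * ?m ^ N)) * decay N x" for x
  proof -
    have "cmod (iter_deriv bs f (c *\<^sub>R x + a)) \<le> B * ((2 * japanese a) ^ N * ?m ^ N * decay N x)"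
      using B(2)[OF bs order_refl] mult_left_mono[OF dec B(1)] by (rule order_trans)
    then have "\<bar>c\<bar> ^ length bs * cmod (iter_deriv bs f (c *\<^sub>R x + a)) \<le> \<bar>c\<bar> ^ length bs * (B * ((2 * japanese a) ^ N * ?m ^ N * decay N x))"
      by (intro mult_left_mono) auto
    then show ?thesis
      using iter_deriv_affine[OF schwartz_smooth[OF assms(1)] bs, of c a]
      by (simp add: norm_mult norm_power mult_ac)
  qed
  then show "\<exists>B. \<forall>x. cmod (iter_deriv bs (\<lambda>x. f (c *\<^sub>R x + a)) x) \<le> B * decay N x" by blast
qed

text \<open>The seminorm is a supremum and hence meaningless on unbounded sets. For test functions it is
  more convenient to ask for an explicit bound on the derivatives.\<close>

lemma tempered_bound:
  assumes "f \<in> tempered_distr"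
  obtains C N where "0 \<le> C"
    "\<And>\<theta> B. \<theta> \<in> schwartz \<Longrightarrow> (\<And>bs x. set bs \<subseteq> Basis \<Longrightarrow> length bs \<le> N \<Longrightarrow> cmod (iter_deriv bs \<theta> x) \<le> B * decay N x)
       \<Longrightarrow> cmod (f \<theta>) \<le> C * B"
proof -
  obtain C N where C: "\<And>\<theta>. \<theta> \<in> schwartz \<Longrightarrow> cmod (f \<theta>) \<le> C * schwartz_seminorm N \<theta>"
    using assms unfolding tempered_distr_def by blast
  show ?thesis
  proof (rule that[of "\<bar>C\<bar>" N])
    fix \<theta> :: "'a \<Rightarrow> complex" and B
    assume \<theta>: "\<theta> \<in> schwartz"
      and *: "\<And>bs x. set bs \<subseteq> Basis \<Longrightarrow> length bs \<le> N \<Longrightarrow> cmod (iter_deriv bs \<theta> x) \<le> B * decay N x"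
    have **: "japanese x ^ N * cmod (iter_deriv bs \<theta> x) \<le> B" if "set bs \<subseteq> Basis" "length bs \<le> N" for bs x
      using *[OF that, of x] by (simp add: decay_def field_simps)
    have "schwartz_seminorm N \<theta> \<le> B"
      unfolding schwartz_seminorm_def
      by (rule cSUP_least) (use ** in \<open>auto intro: exI[of _ "[]"]\<close>)
    moreover have "0 \<le> schwartz_seminorm N \<theta>"
      unfolding schwartz_seminorm_def
    proof (rule cSUP_upper2[where x = "([], 0)"])
      show "bdd_above ((\<lambda>(bs, x). japanese x ^ N * cmod (iter_deriv bs \<theta> x)) ` ({bs. set bs \<subseteq> Basis \<and> length bs \<le> N} \<times> UNIV))"
        using ** by (intro bdd_aboveI[of _ B]) auto
    qed auto
    ultimately have "C * schwartz_seminorm N \<theta> \<le> \<bar>C\<bar> * B"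
      by (intro mult_mono) auto
    then show "cmod (f \<theta>) \<le> \<bar>C\<bar> * B" using C[OF \<theta>] by linarith
  qed auto
qed

section \<open>Time-frequency shifted windows\<close>

text \<open>The conjugate of the shifted window \<open>M\<^sub>\<xi> T\<^sub>x \<phi>\<close>. Distributions are linear functionals, so \<open>V\<^sub>\<phi>
  f(x, \<xi>)\<close> is the value of \<open>f\<close> at this test function.\<close>

definition atom :: "('a::euclidean_space \<Rightarrow> complex) \<Rightarrow> 'a \<times> 'a \<Rightarrow> 'a \<Rightarrow> complex"
  where "atom \<phi> z = (\<lambda>t. cis (t \<bullet> (- snd z)) * cnj (\<phi> (t - fst z)))"

lemma STFT_atom: "STFT \<phi> f x \<xi> = f (atom \<phi> (x, \<xi>))"
  by (simp add: STFT_def distr_pairing_def modulate_def translate_def atom_def cis_cnj)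

lemma schwartz_translate: "\<phi> \<in> schwartz \<Longrightarrow> (\<lambda>t. \<phi> (t - x)) \<in> schwartz"
  using schwartz_affine[of \<phi> 1 "- x"] by simp

lemma atom_schwartz: "\<phi> \<in> schwartz \<Longrightarrow> atom \<phi> z \<in> schwartz"
  unfolding atom_def by (intro schwartz_modulate schwartz_cnj schwartz_translate)

lemma iter_deriv_atom:
  assumes \<phi>: "\<phi> \<in> schwartz" and bs: "set bs \<subseteq> Basis"
  shows "iter_deriv bs (atom \<phi> z) t = (\<Sum>(as, cs)\<leftarrow>leibniz_splits bs.
    (\<Prod>b\<leftarrow>as. \<i> * of_real (b \<bullet> (- snd z))) * cis (t \<bullet> (- snd z)) * cnj (iter_deriv cs \<phi> (t - fst z)))"
proof -
  have tr: "(\<lambda>t. cnj (\<phi> (t - fst z))) \<in> schwartz" "(\<lambda>t. \<phi> (t - fst z)) \<in> schwartz"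
    by (intro schwartz_cnj schwartz_translate \<phi>)+
  have "iter_deriv cs (\<lambda>t. cnj (\<phi> (t - fst z))) = (\<lambda>t. cnj (iter_deriv cs \<phi> (t - fst z)))"
    if "set cs \<subseteq> Basis" for cs
    using iter_deriv_affine[OF schwartz_smooth[OF \<phi>] that, of 1 "- fst z"]
    by (simp add: iter_deriv_cnj[OF schwartz_smooth[OF tr(2)] that])
  then have "iter_deriv cs (\<lambda>t. cnj (\<phi> (t - fst z))) t = cnj (iter_deriv cs \<phi> (t - fst z))"
    if "(as, cs) \<in> set (leibniz_splits bs)" for as cs
    using leibniz_splits_sub[OF that] bs by auto
  then show ?thesis
    unfolding atom_def iter_deriv_mult[OF smooth_cis schwartz_smooth[OF tr(1)] bs]
    unfolding iter_deriv_cis by (intro arg_cong[where f = sum_list] map_cong refl) (clarsimp simp del: inner_minus_right)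
qed

text \<open>By the Leibniz rule a derivative falls either on the character, which costs a power of the
  frequency, or on the window, where Peetre's inequality exchanges decay around \<open>x\<close> for decay around
  0.\<close>

lemma atom_bound:
  assumes \<phi>: "\<phi> \<in> schwartz"
  obtains B where "0 \<le> B"
    "\<And>z bs t. set bs \<subseteq> Basis \<Longrightarrow> length bs \<le> n \<Longrightarrow>
      cmod (iter_deriv bs (atom \<phi> z) t) \<le> B * japanese (fst z) ^ M * japanese (snd z) ^ n * decay M t"
proof -
  obtain B where B: "0 \<le> B"
    "\<And>bs x. set bs \<subseteq> Basis \<Longrightarrow> length bs \<le> n \<Longrightarrow> cmod (iter_deriv bs \<phi> x) \<le> B * decay M x"
    using schwartz_bound[OF \<phi>] by blast
  show ?thesis
  proof (rule that[of "2 ^ n * (B * 2 ^ M)"])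
    fix z :: "'a \<times> 'a" and bs :: "'a list" and t assume bs: "set bs \<subseteq> Basis" "length bs \<le> n"
    have "cmod (iter_deriv bs (atom \<phi> z) t)
      \<le> real (length (leibniz_splits bs)) * (japanese (snd z) ^ n * (B * ((2 * japanese (fst z)) ^ M * decay M t)))"
      unfolding iter_deriv_atom[OF \<phi> bs(1)]
    proof (rule norm_sum_list_le, clarify)
      fix as cs assume "(as, cs) \<in> set (leibniz_splits bs)"
      from leibniz_splits_sub[OF this] bs
      have as: "set as \<subseteq> Basis" "length as \<le> n" and cs: "set cs \<subseteq> Basis" "length cs \<le> n" by auto
      have "cmod (iter_deriv cs \<phi> (t - fst z)) \<le> B * decay M (t - fst z)" by (rule B(2)[OF cs])
      also have "\<dots> \<le> B * ((2 * japanese (fst z)) ^ M * decay M t)"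
        using decay_peetre[of M "t - fst z" "fst z"] B(1) by (intro mult_left_mono) auto
      finally show "cmod ((\<Prod>b\<leftarrow>as. \<i> * of_real (b \<bullet> (- snd z))) * cis (t \<bullet> (- snd z)) * cnj (iter_deriv cs \<phi> (t - fst z)))
        \<le> japanese (snd z) ^ n * (B * ((2 * japanese (fst z)) ^ M * decay M t))"
        unfolding norm_mult norm_cis mult_1_right complex_mod_cnj
        by (intro mult_mono norm_prod_list_basis_le[OF as, of "- snd z", unfolded japanese_minus]) auto
    qed
    also have "\<dots> \<le> 2 ^ n * (japanese (snd z) ^ n * (B * ((2 * japanese (fst z)) ^ M * decay M t)))"
      using bs B(1) by (intro mult_right_mono) (auto simp: length_leibniz_splits)
    also have "\<dots> = 2 ^ n * (B * 2 ^ M) * japanese (fst z) ^ M * japanese (snd z) ^ n * decay M t"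
      by (simp add: power_mult_distrib mult_ac)
    finally show "cmod (iter_deriv bs (atom \<phi> z) t) \<le> \<dots>" .
  qed (use B(1) in auto)
qed

lemma continuous_on_sum_list:
  fixes f :: "'i \<Rightarrow> 'b::topological_space \<Rightarrow> complex"
  assumes "\<And>i. i \<in> set xs \<Longrightarrow> continuous_on A (f i)"
  shows "continuous_on A (\<lambda>x. \<Sum>i\<leftarrow>xs. f i x)"
  using assms by (induction xs) (auto intro!: continuous_intros)

lemma continuous_on_prod_list:
  fixes f :: "'i \<Rightarrow> 'b::topological_space \<Rightarrow> complex"
  assumes "\<And>i. i \<in> set xs \<Longrightarrow> continuous_on A (f i)"
  shows "continuous_on A (\<lambda>x. \<Prod>i\<leftarrow>xs. f i x)"
  using assms by (induction xs) (auto intro!: continuous_intros)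

lemma iter_deriv_atom_continuous:
  assumes \<phi>: "\<phi> \<in> schwartz" and bs: "set bs \<subseteq> Basis"
  shows "continuous_on UNIV (\<lambda>(z, t). iter_deriv bs (atom \<phi> z) t)"
proof -
  define T where "T i w = (\<Prod>b\<leftarrow>fst i. \<i> * of_real (b \<bullet> (- snd (fst w)))) * cis (snd w \<bullet> (- snd (fst w)))
    * cnj (iter_deriv (snd i) \<phi> (snd w - fst (fst w)))" for i and w :: "('a \<times> 'a) \<times> 'a"
  have eq: "(\<lambda>(z, t). iter_deriv bs (atom \<phi> z) t) = (\<lambda>w. \<Sum>i\<leftarrow>leibniz_splits bs. T i w)"
    by (rule ext) (simp only: split_beta' iter_deriv_atom[OF \<phi> bs] T_def)
  have "continuous_on UNIV (T i)" if "i \<in> set (leibniz_splits bs)" for i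
  proof -
    have "set (snd i) \<subseteq> Basis" using leibniz_splits_sub[of "fst i" "snd i" bs] bs that by auto
    then have c: "continuous_on UNIV (iter_deriv (snd i) \<phi>)" by (intro smooth_continuous schwartz_smooth \<phi>)
    have 1: "continuous_on UNIV (\<lambda>w :: ('a \<times> 'a) \<times> 'a. \<Prod>b\<leftarrow>fst i. \<i> * complex_of_real (b \<bullet> (- snd (fst w))))"
      by (rule continuous_on_prod_list) (intro continuous_intros)
    have 2: "continuous_on UNIV (\<lambda>w :: ('a \<times> 'a) \<times> 'a. cis (snd w \<bullet> (- snd (fst w))))"
      by (intro continuous_intros)
    have 3: "continuous_on UNIV (\<lambda>w :: ('a \<times> 'a) \<times> 'a. cnj (iter_deriv (snd i) \<phi> (snd w - fst (fst w))))"
      by (intro continuous_on_cnj continuous_on_compose2[OF c] continuous_intros) auto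
    show ?thesis unfolding T_def by (rule continuous_on_mult[OF continuous_on_mult[OF 1 2] 3])
  qed
  then show ?thesis unfolding eq by (rule continuous_on_sum_list)
qed

text \<open>On a compact set of arguments \<open>t\<close> this is uniform continuity; outside of it both values are
  small.\<close>

lemma uniform_continuity_decay:
  fixes G :: "'b::euclidean_space \<Rightarrow> 'a::euclidean_space \<Rightarrow> complex"
  assumes G: "continuous_on UNIV (\<lambda>(z, t). G z t)" and B: "0 \<le> B"
    "\<And>z' t. dist z' z \<le> 1 \<Longrightarrow> cmod (G z' t) \<le> B * decay 1 t" and \<epsilon>: "0 < \<epsilon>"
  obtains \<delta> where "0 < \<delta>" "\<And>z' t. dist z' z < \<delta> \<Longrightarrow> cmod (G z' t - G z t) \<le> \<epsilon>"
proof -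
  \<comment> \<open>for \<open>\<bar>t\<bar> > T\<close> both values are at most \<open>B / T \<le> \<epsilon> / 2\<close>\<close>
  define T where "T = 2 * B / \<epsilon> + 1"
  have T: "0 < T" using B \<epsilon> by (auto simp: T_def intro!: add_nonneg_pos)
  have "uniformly_continuous_on (cball z 1 \<times> cball 0 T) (\<lambda>(z, t). G z t)"
    by (intro compact_uniformly_continuous compact_Times compact_cball continuous_on_subset[OF G]) auto
  then have "\<exists>d>0. \<forall>w \<in> cball z 1 \<times> cball 0 T. \<forall>w' \<in> cball z 1 \<times> cball 0 T. dist w' w < d \<longrightarrow>
      dist ((\<lambda>(z, t). G z t) w') ((\<lambda>(z, t). G z t) w) < \<epsilon>"
    using \<epsilon> unfolding uniformly_continuous_on_def by blast
  then obtain d where d: "0 < d" and d': "\<forall>w \<in> cball z 1 \<times> cball 0 T. \<forall>w' \<in> cball z 1 \<times> cball 0 T. dist w' w < d \<longrightarrow>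
      dist ((\<lambda>(z, t). G z t) w') ((\<lambda>(z, t). G z t) w) < \<epsilon>"
    by blast
  show ?thesis
  proof (rule that[of "min 1 d"])
    fix z' t assume z': "dist z' z < min 1 d"
    show "cmod (G z' t - G z t) \<le> \<epsilon>"
    proof (cases "norm t \<le> T")
      case True
      then have "dist (G z' t) (G z t) < \<epsilon>"
        using d'[rule_format, of "(z, t)" "(z', t)"] z' by (simp add: dist_Pair_Pair dist_commute)
      then show ?thesis by (simp add: dist_norm)
    next
      case False
      then have "T \<le> japanese t" using norm_le_japanese[of t] by simp
      then have "decay 1 t \<le> 1 / T" using T by (simp add: decay_def divide_simps)
      then have "2 * B * decay 1 t \<le> 2 * B * (1 / T)" using B by (intro mult_left_mono) auto
      also have "\<dots> \<le> \<epsilon>" using T \<epsilon> B by (simp add: T_def field_simps)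
      finally have "2 * B * decay 1 t \<le> \<epsilon>" .
      moreover have "cmod (G z' t - G z t) \<le> B * decay 1 t + B * decay 1 t"
        using B(2)[of z' t] B(2)[of z t] z' by (intro norm_triangle_le_diff add_mono) auto
      ultimately show ?thesis by simp
    qed
  qed (use d in auto)
qed

text \<open>One spare power of decay in \<open>atom_bound\<close> makes the difference vanish at infinity uniformly in
  the parameter, so that the previous lemma applies.\<close>

lemma atom_continuous:
  assumes \<phi>: "\<phi> \<in> schwartz" and \<epsilon>: "0 < \<epsilon>"
  obtains \<delta> where "0 < \<delta>"
    "\<And>z' bs t. dist z' z < \<delta> \<Longrightarrow> set bs \<subseteq> Basis \<Longrightarrow> length bs \<le> n \<Longrightarrow>
      cmod (iter_deriv bs (atom \<phi> z') t - iter_deriv bs (atom \<phi> z) t) \<le> \<epsilon> * decay M t"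
proof -
  let ?A = "{bs :: 'a list. set bs \<subseteq> Basis \<and> length bs \<le> n}"
  obtain B where B: "0 \<le> B"
    "\<And>z bs t. set bs \<subseteq> Basis \<Longrightarrow> length bs \<le> n \<Longrightarrow>
      cmod (iter_deriv bs (atom \<phi> z) t) \<le> B * japanese (fst z) ^ (M + 1) * japanese (snd z) ^ n * decay (M + 1) t"
    using atom_bound[OF \<phi>] by blast
  have "\<exists>\<delta>>0. \<forall>z' t. dist z' z < \<delta> \<longrightarrow> cmod (iter_deriv bs (atom \<phi> z') t - iter_deriv bs (atom \<phi> z) t) \<le> \<epsilon> * decay M t"
    if bs: "bs \<in> ?A" for bs
  proof -
    \<comment> \<open>the weight turns the claim into uniform continuity of \<open>G\<close>, which has one power of decay left\<close>
    define G where "G z t = japanese t ^ M * iter_deriv bs (atom \<phi> z) t" for z t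
    have "continuous_on UNIV (\<lambda>(z, t). G z t)"
      using iter_deriv_atom_continuous[OF \<phi>, of bs] bs
      unfolding G_def case_prod_beta' by (auto intro!: continuous_intros)
    moreover
    have jz: "japanese (a + b) \<le> 4 * japanese a" if "norm b \<le> 1" for a b :: 'a
    proof -
      have "(norm b)\<^sup>2 \<le> 1" using that by (simp add: power_le_one)
      then have "japanese b \<le> sqrt (2\<^sup>2)" unfolding japanese_def by (intro real_sqrt_le_mono) simp
      then have "2 * japanese a * japanese b \<le> 2 * japanese a * 2" by (intro mult_left_mono) auto
      then show ?thesis using japanese_add_le[of a b] by linarith
    qed
    let ?B = "B * (4 * japanese (fst z)) ^ (M + 1) * (4 * japanese (snd z)) ^ n"
    have "cmod (G z' t) \<le> ?B * decay 1 t" if "dist z' z \<le> 1" for z' t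
    proof -
      have "norm (fst z' - fst z) \<le> 1" "norm (snd z' - snd z) \<le> 1"
        using that dist_fst_le[of z' z] dist_snd_le[of z' z] by (simp_all add: dist_norm)
      then have j: "japanese (fst z') \<le> 4 * japanese (fst z)" "japanese (snd z') \<le> 4 * japanese (snd z)"
        using jz[of "fst z' - fst z" "fst z"] jz[of "snd z' - snd z" "snd z"] by simp_all
      have "cmod (G z' t) \<le> japanese t ^ M * (B * japanese (fst z') ^ (M + 1) * japanese (snd z') ^ n * decay (M + 1) t)"
      proof -
        have "cmod (iter_deriv bs (atom \<phi> z') t) \<le> B * japanese (fst z') ^ (M + 1) * japanese (snd z') ^ n * decay (M + 1) t"
          using bs by (intro B(2)) auto
        moreover have "\<bar>japanese t ^ M\<bar> = japanese t ^ M" by simp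
        ultimately show ?thesis unfolding G_def norm_mult norm_of_real by (simp only:) (rule mult_left_mono, simp_all)
      qed
      also have "\<dots> = B * japanese (fst z') ^ (M + 1) * japanese (snd z') ^ n * decay 1 t"
      proof -
        have "japanese t ^ M * decay (M + 1) t = decay 1 t" by (simp add: decay_def)
        moreover have "japanese t ^ M * (b * decay (M + 1) t) = b * (japanese t ^ M * decay (M + 1) t)" for b
          by (rule mult.left_commute)
        ultimately show ?thesis by simp
      qed
      also have "\<dots> \<le> ?B * decay 1 t"
        using B(1) j
        by (intro mult_right_mono[OF mult_mono[OF mult_left_mono]] power_mono) auto
      finally show ?thesis .
    qed
    moreover have "0 \<le> ?B" using B(1) by simp
    ultimately obtain \<delta> where \<delta>: "0 < \<delta>" "\<And>z' t. dist z' z < \<delta> \<Longrightarrow> cmod (G z' t - G z t) \<le> \<epsilon>"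
      using uniform_continuity_decay[of G ?B z \<epsilon>] \<epsilon> by blast
    have "cmod (iter_deriv bs (atom \<phi> z') t - iter_deriv bs (atom \<phi> z) t) \<le> \<epsilon> * decay M t" if "dist z' z < \<delta>" for z' t
    proof -
      have "japanese t ^ M * cmod (iter_deriv bs (atom \<phi> z') t - iter_deriv bs (atom \<phi> z) t) = cmod (G z' t - G z t)"
        unfolding G_def right_diff_distrib[symmetric] by (simp add: norm_mult norm_power)
      then show ?thesis using \<delta>(2)[OF that, of t] by (simp add: decay_def field_simps)
    qed
    then show ?thesis using \<delta>(1) by blast
  qed
  then have "\<forall>bs\<in>?A. \<exists>\<delta>. 0 < \<delta> \<and> (\<forall>z' t. dist z' z < \<delta> \<longrightarrow> cmod (iter_deriv bs (atom \<phi> z') t - iter_deriv bs (atom \<phi> z) t) \<le> \<epsilon> * decay M t)"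
    by blast
  from bchoice[OF this] obtain \<delta> where *: "\<forall>bs\<in>?A. 0 < \<delta> bs \<and>
      (\<forall>z' t. dist z' z < \<delta> bs \<longrightarrow> cmod (iter_deriv bs (atom \<phi> z') t - iter_deriv bs (atom \<phi> z) t) \<le> \<epsilon> * decay M t)" ..
  have \<delta>: "\<And>bs. bs \<in> ?A \<Longrightarrow> 0 < \<delta> bs"
    "\<And>bs z' t. bs \<in> ?A \<Longrightarrow> dist z' z < \<delta> bs \<Longrightarrow> cmod (iter_deriv bs (atom \<phi> z') t - iter_deriv bs (atom \<phi> z) t) \<le> \<epsilon> * decay M t"
    using * by blast+
  show ?thesis
  proof (rule that[of "Min (\<delta> ` ?A)"])
    have "[] \<in> ?A" by simp
    then have ne: "\<delta> ` ?A \<noteq> {}" by blast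
    show "0 < Min (\<delta> ` ?A)"
      using \<delta>(1) ne finite_multiindices by (subst Min_gr_iff) auto
    fix z' :: "'a \<times> 'a" and bs :: "'a list" and t
    assume *: "dist z' z < Min (\<delta> ` ?A)" "set bs \<subseteq> Basis" "length bs \<le> n"
    have "Min (\<delta> ` ?A) \<le> \<delta> bs" using * finite_multiindices by (intro Min_le) auto
    then show "cmod (iter_deriv bs (atom \<phi> z') t - iter_deriv bs (atom \<phi> z) t) \<le> \<epsilon> * decay M t"
      using * by (intro \<delta>(2)) auto
  qed
qed

section \<open>A bump function\<close>

text \<open>The functions \<open>u\<^sup>-\<^sup>k e\<^sup>-\<^sup>1\<^sup>/\<^sup>u\<close>, extended by 0 to the left. Their linear span is closed under
  differentiation.\<close>

definition flat :: "nat \<Rightarrow> real \<Rightarrow> real"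
  where "flat k u = (if 0 < u then exp (- 1 / u) / u ^ k else 0)"

text \<open>Vanishing of second order is enough to make the derivative at 0 exist and be 0.\<close>

lemma flat_le_square:
  obtains c where "\<And>u. \<bar>flat k u\<bar> \<le> c * u\<^sup>2"
proof -
  let ?m = "k + 2"
  have "\<bar>flat k u\<bar> \<le> real ?m ^ ?m * u\<^sup>2" for u
  proof (cases "0 < u")
    case True
    have "(1 / u / real ?m) ^ ?m \<le> (1 + 1 / u / real ?m) ^ ?m" using True by (intro power_mono) auto
    also have "\<dots> \<le> exp (1 / u)"
      using True by (intro exp_ge_one_plus_x_over_n_power_n) (auto intro: order_trans[of _ 0])
    finally have "1 / exp (1 / u) \<le> 1 / (1 / u / real ?m) ^ ?m"
      using True by (intro divide_left_mono) auto
    then have "exp (- 1 / u) \<le> (u * real ?m) ^ ?m"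
      by (simp add: exp_minus divide_simps power_divide power_mult_distrib mult_ac)
    then have "exp (- 1 / u) / u ^ k \<le> (u * real ?m) ^ ?m / u ^ k"
      using True by (intro divide_right_mono) auto
    also have "\<dots> = real ?m ^ ?m * u\<^sup>2"
      using True by (simp add: power_mult_distrib power_add power2_eq_square)
    finally show ?thesis using True by (simp add: flat_def)
  qed (simp add: flat_def)
  then show ?thesis using that by blast
qed

lemma flat_has_derivative: "(flat k has_real_derivative (flat (k + 2) u - real k * flat (k + 1) u)) (at u)"
proof -
  consider "u < 0" | "u = 0" | "0 < u" by linarith
  then show ?thesis
  proof cases
    case 1
    have "((\<lambda>_. 0) has_real_derivative 0) (at u)" by simp
    then have "(flat k has_real_derivative 0) (at u)"
      by (rule has_field_derivative_transform_within_open[where S = "{..<0}"]) (use 1 in \<open>auto simp: flat_def\<close>)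
    then show ?thesis using 1 by (simp add: flat_def)
  next
    case 2
    obtain c where c: "\<And>u. \<bar>flat k u\<bar> \<le> c * u\<^sup>2" using flat_le_square by blast
    have "((\<lambda>h. flat k h / h) \<longlongrightarrow> 0) (at 0)"
    proof (rule Lim_null_comparison[where g = "\<lambda>h. c * \<bar>h\<bar>"])
      show "eventually (\<lambda>h. norm (flat k h / h) \<le> c * \<bar>h\<bar>) (at 0)"
      proof (rule eventually_at_filter[THEN iffD2], rule always_eventually, intro allI impI)
        fix h :: real assume "h \<noteq> 0"
        moreover have "\<bar>flat k h\<bar> \<le> c * \<bar>h\<bar> * \<bar>h\<bar>"
          using c[of h] by (simp add: power2_eq_square mult.assoc flip: abs_mult)
        ultimately show "norm (flat k h / h) \<le> c * \<bar>h\<bar>"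
          using \<open>h \<noteq> 0\<close> by (simp add: abs_divide pos_divide_le_eq)
      qed
      show "((\<lambda>h. c * \<bar>h\<bar>) \<longlongrightarrow> 0) (at 0)" by (auto intro!: tendsto_eq_intros)
    qed
    then show ?thesis using 2 by (simp add: DERIV_def flat_def)
  next
    case 3
    define E where "E = exp (- 1 / u)"
    have 1: "((\<lambda>u. exp (- 1 / u)) has_real_derivative E / u\<^sup>2) (at u)"
      using 3 by (auto intro!: derivative_eq_intros simp: E_def power2_eq_square)
    have 2: "((\<lambda>u. u ^ k) has_real_derivative real k * u ^ (k - 1)) (at u)"
      using DERIV_pow[of k u] by simp
    have "E / u\<^sup>2 * u ^ k / (u ^ k * u ^ k) = E / u ^ (k + 2)"
      using 3 by (simp add: power_add power2_eq_square)
    moreover have "E * (real k * u ^ (k - 1)) / (u ^ k * u ^ k) = real k * (E / u ^ (k + 1))"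
      using 3 by (cases k) simp_all
    ultimately have "(E / u\<^sup>2 * u ^ k - E * (real k * u ^ (k - 1))) / (u ^ k * u ^ k)
        = flat (k + 2) u - real k * flat (k + 1) u"
      using 3 by (simp add: diff_divide_distrib flat_def E_def)
    then have "((\<lambda>u. exp (- 1 / u) / u ^ k) has_real_derivative (flat (k + 2) u - real k * flat (k + 1) u)) (at u)"
      using DERIV_divide[OF 1 2] 3 by (simp add: E_def)
    then show ?thesis
      by (rule has_field_derivative_transform_within_open[where S = "{0<..}"]) (use 3 in \<open>auto simp: flat_def\<close>)
  qed
qed

text \<open>An algebra that contains the bump functions and is stable under partial derivatives.
  Smoothness of all its members then follows by a single induction, without computing a higher
  derivative.\<close>

inductive_set bump_algebra :: "'a::euclidean_space \<Rightarrow> real \<Rightarrow> ('a \<Rightarrow> complex) set" for a \<rho> where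
  const: "(\<lambda>_. c) \<in> bump_algebra a \<rho>"
| coord: "(\<lambda>x. of_real ((x - a) \<bullet> b)) \<in> bump_algebra a \<rho>"
| flat: "(\<lambda>x. of_real (flat k (\<rho> - (x - a) \<bullet> (x - a)))) \<in> bump_algebra a \<rho>"
| add: "u \<in> bump_algebra a \<rho> \<Longrightarrow> v \<in> bump_algebra a \<rho> \<Longrightarrow> (\<lambda>x. u x + v x) \<in> bump_algebra a \<rho>"
| mult: "u \<in> bump_algebra a \<rho> \<Longrightarrow> v \<in> bump_algebra a \<rho> \<Longrightarrow> (\<lambda>x. u x * v x) \<in> bump_algebra a \<rho>"

lemma bump_algebra_deriv:
  assumes "u \<in> bump_algebra a \<rho>"
  shows "\<exists>u'. (\<forall>x. (u has_derivative u' x) (at x)) \<and> (\<forall>b. (\<lambda>x. u' x b) \<in> bump_algebra a \<rho>)"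
  using assms
proof induction
  case (const c)
  show ?case by (intro exI[of _ "\<lambda>_ _. 0"]) (auto intro: bump_algebra.const)
next
  case (coord b)
  show ?case
    by (intro exI[of _ "\<lambda>_ v. of_real (v \<bullet> b)"])
       (auto intro!: bump_algebra.const derivative_eq_intros)
next
  case (flat k)
  let ?q = "\<lambda>x. \<rho> - (x - a) \<bullet> (x - a)"
  let ?D = "\<lambda>x v. of_real ((flat (k + 2) (?q x) - real k * flat (k + 1) (?q x)) * (- 2 * ((x - a) \<bullet> v))) :: complex"
  have "((\<lambda>x. of_real (flat k (?q x))) has_derivative ?D x) (at x)" for x
  proof -
    have q: "(?q has_derivative (\<lambda>v. - 2 * ((x - a) \<bullet> v))) (at x)"
      by (auto intro!: derivative_eq_intros simp: inner_commute)
    have "((\<lambda>x. flat k (?q x)) has_derivative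
      (\<lambda>v. (flat (k + 2) (?q x) - real k * flat (k + 1) (?q x)) * (- 2 * ((x - a) \<bullet> v)))) (at x)"
      using has_derivative_compose[OF q flat_has_derivative[THEN has_field_derivative_imp_has_derivative]]
      by (simp add: mult_ac)
    then show ?thesis by (rule has_derivative_of_real)
  qed
  moreover have "(\<lambda>x. ?D x b) \<in> bump_algebra a \<rho>" for b
  proof -
    have "(\<lambda>x. (of_real (flat (k + 2) (?q x)) + (- of_real (real k)) * of_real (flat (k + 1) (?q x))) * ((- 2) * of_real ((x - a) \<bullet> b))) \<in> bump_algebra a \<rho>"
      by (intro bump_algebra.intros)
    then show ?thesis by simp
  qed
  ultimately have "(\<forall>x. ((\<lambda>x. of_real (flat k (?q x))) has_derivative ?D x) (at x)) \<and> (\<forall>b. (\<lambda>x. ?D x b) \<in> bump_algebra a \<rho>)"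
    by blast
  then show ?case by (rule exI[of _ ?D])
next
  case (add u v)
  then obtain u' v' where
    u: "\<And>x. (u has_derivative u' x) (at x)" "\<And>b. (\<lambda>x. u' x b) \<in> bump_algebra a \<rho>" and
    v: "\<And>x. (v has_derivative v' x) (at x)" "\<And>b. (\<lambda>x. v' x b) \<in> bump_algebra a \<rho>" by blast
  show ?case
    by (intro exI[of _ "\<lambda>x h. u' x h + v' x h"] conjI allI has_derivative_add bump_algebra.add u v)
next
  case (mult u v)
  then obtain u' v' where
    u: "\<And>x. (u has_derivative u' x) (at x)" "\<And>b. (\<lambda>x. u' x b) \<in> bump_algebra a \<rho>" and
    v: "\<And>x. (v has_derivative v' x) (at x)" "\<And>b. (\<lambda>x. v' x b) \<in> bump_algebra a \<rho>" by blast
  show ?case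
    by (intro exI[of _ "\<lambda>x h. u x * v' x h + u' x h * v x"] conjI allI has_derivative_mult
        bump_algebra.add bump_algebra.mult u v mult.hyps)
qed

lemma bump_algebra_iter_deriv:
  assumes "u \<in> bump_algebra a \<rho>"
  shows "iter_deriv bs u \<in> bump_algebra a \<rho>"
proof (induction bs)
  case (Cons b bs)
  obtain u' where u': "\<And>x. (iter_deriv bs u has_derivative u' x) (at x)"
    "\<And>b. (\<lambda>x. u' x b) \<in> bump_algebra a \<rho>"
    using bump_algebra_deriv[OF Cons] by blast
  then show ?case using frechet_derivative_at[OF u'(1)] by simp
qed (use assms in simp)

lemma bump_algebra_smooth: "u \<in> bump_algebra a \<rho> \<Longrightarrow> smooth u"
  unfolding smooth_def using bump_algebra_deriv[OF bump_algebra_iter_deriv] differentiable_def by blast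

lemma iter_deriv_vanish:
  assumes u: "smooth u" and X: "open X" "\<And>x. x \<in> X \<Longrightarrow> u x = 0" and bs: "set bs \<subseteq> Basis" and x: "x \<in> X"
  shows "iter_deriv bs u x = 0"
  using bs x
proof (induction bs arbitrary: x)
  case (Cons b bs)
  have "frechet_derivative (iter_deriv bs u) (at x) = frechet_derivative (\<lambda>_. 0) (at x)"
    using Cons by (intro frechet_derivative_transform_within_open[OF _ X(1)] smoothD[OF u]) auto
  then show ?case by simp
qed (use X in auto)

lemma schwartz_compact_support:
  assumes u: "smooth u" and R: "\<And>x. R < norm x \<Longrightarrow> u x = 0"
  shows "u \<in> schwartz"
  unfolding schwartz_iff
proof (intro conjI allI impI u)
  fix bs :: "'a list" and N assume bs: "set bs \<subseteq> Basis"
  have "continuous_on (cball 0 R) (\<lambda>x. japanese x ^ N * cmod (iter_deriv bs u x))"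
    by (intro continuous_intros smooth_continuous[OF u bs])
  then have "bounded ((\<lambda>x. japanese x ^ N * cmod (iter_deriv bs u x)) ` cball 0 R)"
    by (intro compact_imp_bounded compact_continuous_image compact_cball)
  then obtain B where "\<forall>x \<in> cball 0 R. \<bar>japanese x ^ N * cmod (iter_deriv bs u x)\<bar> \<le> B"
    unfolding bounded_iff by auto
  then have B: "\<And>x. x \<in> cball 0 R \<Longrightarrow> japanese x ^ N * cmod (iter_deriv bs u x) \<le> B" by fastforce
  have "japanese x ^ N * cmod (iter_deriv bs u x) \<le> \<bar>B\<bar>" for x
  proof (cases "norm x \<le> R")
    case False
    have "open {x :: 'a. R < norm x}" by (intro open_Collect_less continuous_intros)
    then have "iter_deriv bs u x = 0" using iter_deriv_vanish[OF u _ _ bs, of "{x. R < norm x}" x] R False by auto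
    then show ?thesis by simp
  qed (use B[of x] in auto)
  then show "\<exists>B. \<forall>x. cmod (iter_deriv bs u x) \<le> B * decay N x"
    by (intro exI[of _ "\<bar>B\<bar>"]) (simp add: decay_def field_simps)
qed

definition bump :: "'a::euclidean_space \<Rightarrow> real \<Rightarrow> 'a \<Rightarrow> real"
  where "bump a \<epsilon> x = flat 0 (\<epsilon>\<^sup>2 - (x - a) \<bullet> (x - a))"

lemma bump_pos_iff: "0 < \<epsilon> \<Longrightarrow> 0 < bump a \<epsilon> x \<longleftrightarrow> dist x a < \<epsilon>"
  unfolding bump_def flat_def dist_norm power2_norm_eq_inner[symmetric]
  by (auto intro: power_strict_mono power2_less_imp_less)

lemma bump_nonneg: "0 \<le> bump a \<epsilon> x"
  by (simp add: bump_def flat_def)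

lemma bump_eq_0: "0 < \<epsilon> \<Longrightarrow> \<epsilon> \<le> dist x a \<Longrightarrow> bump a \<epsilon> x = 0"
  using bump_pos_iff[of \<epsilon> a x] bump_nonneg[of a \<epsilon> x] by linarith

lemma bump_schwartz:
  assumes "0 < \<epsilon>"
  shows "(\<lambda>x. of_real (bump a \<epsilon> x)) \<in> schwartz"
proof (rule schwartz_compact_support[where R = "norm a + \<epsilon>"])
  show "smooth (\<lambda>x. of_real (bump a \<epsilon> x))"
    unfolding bump_def by (intro bump_algebra_smooth[of _ a "\<epsilon>\<^sup>2"] bump_algebra.flat)
  fix x :: 'a assume "norm a + \<epsilon> < norm x"
  then have "\<epsilon> \<le> dist x a" using norm_triangle_ineq2[of x a] by (simp add: dist_norm)
  then show "of_real (bump a \<epsilon> x) = (0::complex)" using assms by (simp add: bump_eq_0)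
qed

section \<open>Fourier transforms\<close>

lemma lborel_Fubini:
  fixes f :: "'a::euclidean_space \<Rightarrow> 'b::euclidean_space \<Rightarrow> complex"
  assumes f: "case_prod f \<in> borel_measurable (borel \<Otimes>\<^sub>M borel)"
    and fin: "(\<integral>\<^sup>+x. (\<integral>\<^sup>+y. ennreal (norm (f x y)) \<partial>lborel) \<partial>lborel) < top"
  shows "integrable (lborel \<Otimes>\<^sub>M lborel) (case_prod f)"
    and "(LINT x|lborel. (LINT y|lborel. f x y)) = (LINT y|lborel. (LINT x|lborel. f x y))"
proof -
  have m[measurable]: "case_prod f \<in> borel_measurable (lborel \<Otimes>\<^sub>M lborel)"
    using f by (simp cong: measurable_cong_sets)
  show i: "integrable (lborel \<Otimes>\<^sub>M lborel) (case_prod f)"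
  proof (rule integrableI_bounded[OF m])
    have "(\<integral>\<^sup>+z. ennreal (norm (case_prod f z)) \<partial>(lborel \<Otimes>\<^sub>M lborel))
      = (\<integral>\<^sup>+x. (\<integral>\<^sup>+y. ennreal (norm (f x y)) \<partial>lborel) \<partial>lborel)"
      by (subst lborel.nn_integral_fst[symmetric]) auto
    then show "(\<integral>\<^sup>+z. ennreal (norm (case_prod f z)) \<partial>(lborel \<Otimes>\<^sub>M lborel)) < \<infinity>" using fin by simp
  qed
  show "(LINT x|lborel. (LINT y|lborel. f x y)) = (LINT y|lborel. (LINT x|lborel. f x y))"
    by (rule lborel_pair.Fubini_integral[OF i, symmetric])
qed

lemma nn_integral_lborel_affine:
  fixes F :: "'a::euclidean_space \<Rightarrow> ennreal"
  assumes [measurable]: "F \<in> borel_measurable borel" and c: "c \<noteq> 0"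
  shows "(\<integral>\<^sup>+u. F u \<partial>lborel) = ennreal (\<bar>c\<bar> ^ DIM('a)) * (\<integral>\<^sup>+v. F (a + c *\<^sub>R v) \<partial>lborel)"
proof -
  have "(\<integral>\<^sup>+u. F u \<partial>lborel) = (\<integral>\<^sup>+u. F u \<partial>density (distr lborel borel (\<lambda>x. a + c *\<^sub>R x)) (\<lambda>_. ennreal (\<bar>c\<bar> ^ DIM('a))))"
    using lborel_affine[OF c, of a] by simp
  also have "\<dots> = ennreal (\<bar>c\<bar> ^ DIM('a)) * (\<integral>\<^sup>+v. F (a + c *\<^sub>R v) \<partial>lborel)"
    by (simp add: nn_integral_density nn_integral_distr nn_integral_cmult)
  finally show ?thesis .
qed

lemma integral_lborel_affine:
  fixes F :: "'a::euclidean_space \<Rightarrow> complex"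
  assumes [measurable]: "F \<in> borel_measurable borel" and c: "c \<noteq> 0"
  shows "(LINT u|lborel. F u) = \<bar>c\<bar> ^ DIM('a) *\<^sub>R (LINT v|lborel. F (a + c *\<^sub>R v))"
proof -
  have "(LINT u|lborel. F u) = (LINT u|density (distr lborel borel (\<lambda>x. a + c *\<^sub>R x)) (\<lambda>_. \<bar>c\<bar> ^ DIM('a)). F u)"
    using lborel_affine[OF c, of a] by simp
  also have "\<dots> = (LINT v|lborel. \<bar>c\<bar> ^ DIM('a) *\<^sub>R F (a + c *\<^sub>R v))"
    by (subst integral_density) (auto simp: integral_distr)
  finally show ?thesis by simp
qed

lemma integral_lborel_shift:
  fixes F :: "'a::euclidean_space \<Rightarrow> complex"
  assumes "F \<in> borel_measurable borel"
  shows "(LINT v|lborel. F (v + a)) = (LINT u|lborel. F u)"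
  using integral_lborel_affine[OF assms, of 1 a] by (simp add: add.commute)

lemma integrable_lborel_shift:
  fixes F :: "'a::euclidean_space \<Rightarrow> 'b::{banach, second_countable_topology}"
  assumes F: "integrable lborel F"
  shows "integrable lborel (\<lambda>v. F (v + a))"
proof -
  have "integrable (distr lborel borel ((+) a)) F" using F by (simp add: lborel_distr_plus)
  then show ?thesis by (subst (asm) integrable_distr_eq) (use F in \<open>auto simp: add.commute\<close>)
qed

text \<open>The normalisation agrees with the short-time Fourier transform, so that a factor \<open>(2\<pi>)\<^sup>n\<close>
  appears in the inversion formula.\<close>

definition fourier :: "('a::euclidean_space \<Rightarrow> complex) \<Rightarrow> 'a \<Rightarrow> complex"
  where "fourier h \<xi> = (LINT u|lborel. cis (u \<bullet> (- \<xi>)) * h u)"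

lemma cis_inner_measurable [measurable]:
  "f \<in> borel_measurable M \<Longrightarrow> g \<in> borel_measurable M \<Longrightarrow> (\<lambda>x. cis (f x \<bullet> g x)) \<in> borel_measurable M"
  for f :: "_ \<Rightarrow> 'a::euclidean_space"
  by (rule measurable_compose[where g = cis, OF borel_measurable_inner])
     (auto intro!: borel_measurable_continuous_onI continuous_intros)

lemma cnj_measurable [measurable]:
  "h \<in> borel_measurable N \<Longrightarrow> (\<lambda>x. cnj (h x)) \<in> borel_measurable N"
  by (rule measurable_compose[where g = cnj]) (auto intro!: borel_measurable_continuous_onI continuous_intros)

lemma integrable_cis_mult:
  fixes h :: "'a::euclidean_space \<Rightarrow> complex"
  assumes "integrable lborel h"
  shows "integrable lborel (\<lambda>u. cis (u \<bullet> \<xi>) * h u)"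
  by (rule Bochner_Integration.integrable_bound[OF assms]) (use assms in \<open>auto simp: norm_mult\<close>)

lemma fourier_measurable [measurable]:
  assumes [measurable]: "h \<in> borel_measurable borel"
  shows "fourier h \<in> borel_measurable borel"
  unfolding fourier_def by measurable

lemma norm_fourier_le: "integrable lborel h \<Longrightarrow> norm (fourier h \<xi>) \<le> (LINT u|lborel. norm (h u))"
  unfolding fourier_def
  by (rule order_trans[OF integral_norm_bound]) (simp add: norm_mult)

text \<open>The standard normal density on the whole space; its Fourier transform is known from the theory
  of characteristic functions.\<close>

definition gauss :: "'a::euclidean_space \<Rightarrow> real"
  where "gauss x = (\<Prod>b\<in>Basis. std_normal_density (x \<bullet> b))"

lemma gauss_eq: "gauss x = exp (- (norm x)\<^sup>2 / 2) / sqrt (2 * pi) ^ DIM('a)" for x :: "'a::euclidean_space"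
proof -
  have "(norm x)\<^sup>2 = (\<Sum>b\<in>Basis. (x \<bullet> b)\<^sup>2)"
    unfolding power2_norm_eq_inner by (subst euclidean_inner) (simp add: power2_eq_square)
  then show ?thesis
    unfolding gauss_def std_normal_density_def
    by (simp add: prod_dividef exp_sum[symmetric] sum_negf sum_divide_distrib prod.distrib power_one_over)
qed

lemma lborel_integral_prod:
  fixes f :: "'a::euclidean_space \<Rightarrow> real \<Rightarrow> complex"
  assumes f: "\<And>b. b \<in> Basis \<Longrightarrow> integrable lborel (f b)"
  shows "integrable lborel (\<lambda>x. \<Prod>b\<in>Basis. f b (x \<bullet> b))"
    and "(LINT x|lborel. (\<Prod>b\<in>Basis. f b (x \<bullet> b))) = (\<Prod>b\<in>Basis. (LINT x|lborel. f b x))"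
proof -
  interpret product_sigma_finite "\<lambda>_ :: 'a. lborel :: real measure" ..
  have [measurable]: "f b \<in> borel_measurable borel" if "b \<in> Basis" for b
    using f[OF that] by auto
  have m: "(\<lambda>x :: 'a. \<Prod>b\<in>Basis. f b (x \<bullet> b)) \<in> borel_measurable borel" by measurable
  have c: "(\<Sum>b\<in>Basis. g b *\<^sub>R b) \<bullet> b' = g b'" if "b' \<in> Basis" for g and b' :: 'a
    using that by simp
  have eq: "(\<Prod>b\<in>Basis. f b ((\<Sum>b\<in>Basis. g b *\<^sub>R b) \<bullet> b)) = (\<Prod>b\<in>Basis. f b (g b))" for g
    by (intro prod.cong refl) simp
  have i: "integrable (\<Pi>\<^sub>M b\<in>(Basis :: 'a set). lborel) (\<lambda>x. \<Prod>b\<in>Basis. f b (x b))"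
    using f by (intro product_integrable_prod) auto
  then show "integrable lborel (\<lambda>x. \<Prod>b\<in>Basis. f b (x \<bullet> b))"
    unfolding lborel_eq[where 'a = 'a] by (subst integrable_distr_eq[OF _ m]) (simp_all only: eq, measurable)
  have "(LINT x|lborel. (\<Prod>b\<in>Basis. f b (x \<bullet> b)))
    = (LINT g|(\<Pi>\<^sub>M b\<in>(Basis :: 'a set). lborel). (\<Prod>b\<in>Basis. f b (g b)))"
    unfolding lborel_eq[where 'a = 'a] by (subst integral_distr[OF _ m]) (simp_all only: eq, measurable)
  also have "\<dots> = (\<Prod>b\<in>Basis. (LINT x|lborel. f b x))"
    using f by (intro product_integral_prod) auto
  finally show "(LINT x|lborel. (\<Prod>b\<in>Basis. f b (x \<bullet> b))) = (\<Prod>b\<in>Basis. (LINT x|lborel. f b x))" .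
qed

lemma std_normal_fourier:
  "integrable lborel (\<lambda>x. cis (t * x) * of_real (std_normal_density x))"
  "(LINT x|lborel. cis (t * x) * of_real (std_normal_density x)) = of_real (exp (- t\<^sup>2 / 2))"
proof -
  have i: "integrable lborel (\<lambda>x. complex_of_real (std_normal_density x))"
    by (simp add: integrable_normal_density)
  show "integrable lborel (\<lambda>x. cis (t * x) * of_real (std_normal_density x))"
    by (rule Bochner_Integration.integrable_bound[OF i])
       (auto simp: norm_mult intro!: borel_measurable_times borel_measurable_continuous_onI[of cis]
          borel_measurable_continuous_onI[of "\<lambda>x. cis (t * x)"] continuous_intros)
  have "char std_normal_distribution t = (LINT x|lborel. std_normal_density x *\<^sub>R cis (t * x))"
    unfolding char_def by (subst integral_density) (auto simp: normal_density_nonneg cis_conv_exp mult_ac)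
  then show "(LINT x|lborel. cis (t * x) * of_real (std_normal_density x)) = of_real (exp (- t\<^sup>2 / 2))"
    by (simp add: char_std_normal_distribution scaleR_conv_of_real mult.commute)
qed

lemma gauss_fourier:
  fixes y :: "'a::euclidean_space"
  shows "integrable lborel (\<lambda>x. cis (x \<bullet> y) * of_real (gauss x))"
    "(LINT x|lborel. cis (x \<bullet> y) * of_real (gauss x)) = of_real (sqrt (2 * pi) ^ DIM('a) * gauss y)"
proof -
  let ?f = "\<lambda>b x. cis ((y \<bullet> b) * x) * complex_of_real (std_normal_density x)"
  have cis_sum: "(\<Prod>b\<in>B. cis (g b)) = cis (\<Sum>b\<in>B. g b)" if "finite B" for g and B :: "'a set"
    using that by (induction B) (auto simp: cis_mult)
  have eq: "cis (x \<bullet> y) * of_real (gauss x) = (\<Prod>b\<in>Basis. ?f b (x \<bullet> b))" for x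
    unfolding prod.distrib cis_sum[OF finite_Basis] gauss_def
    by (simp add: euclidean_inner[of x y] mult.commute)
  show "integrable lborel (\<lambda>x. cis (x \<bullet> y) * of_real (gauss x))"
    unfolding eq by (rule lborel_integral_prod(1)) (rule std_normal_fourier)
  have "(LINT x|lborel. cis (x \<bullet> y) * of_real (gauss x)) = (\<Prod>b\<in>Basis. of_real (exp (- (y \<bullet> b)\<^sup>2 / 2)))"
    unfolding eq by (subst lborel_integral_prod(2)) (simp_all only: std_normal_fourier)
  also have "\<dots> = of_real (sqrt (2 * pi) ^ DIM('a) * gauss y)"
  proof -
    have "(norm y)\<^sup>2 = (\<Sum>b\<in>Basis. (y \<bullet> b)\<^sup>2)"
      unfolding power2_norm_eq_inner by (subst euclidean_inner) (simp add: power2_eq_square)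
    then have "(\<Prod>b\<in>Basis. exp (- (y \<bullet> b)\<^sup>2 / 2)) = exp (- (norm y)\<^sup>2 / 2)"
      by (simp add: exp_sum[symmetric] sum_negf sum_divide_distrib)
    then show ?thesis by (simp add: gauss_eq flip: of_real_prod)
  qed
  finally show "(LINT x|lborel. cis (x \<bullet> y) * of_real (gauss x)) = of_real (sqrt (2 * pi) ^ DIM('a) * gauss y)" .
qed

lemma gauss_minus [simp]: "gauss (- x) = gauss x"
  by (simp add: gauss_eq)

lemma gauss_nonneg [simp]: "0 \<le> gauss x"
  by (simp add: gauss_eq)

lemma gauss_continuous [continuous_intros]:
  "continuous_on A f \<Longrightarrow> continuous_on A (\<lambda>x. gauss (f x))"
  unfolding gauss_eq by (intro continuous_intros) auto

lemma gauss_measurable [measurable]: "gauss \<in> borel_measurable borel"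
  by (intro borel_measurable_continuous_onI continuous_intros)

lemma gauss_le: "gauss x \<le> gauss (0 :: 'a)" for x :: "'a::euclidean_space"
  unfolding gauss_eq by (intro divide_right_mono) auto

lemma gauss_integrable: "integrable lborel (gauss :: 'a::euclidean_space \<Rightarrow> real)"
proof -
  have "integrable lborel (\<lambda>x. Re (cis (x \<bullet> (0::'a)) * of_real (gauss x)))"
    by (rule integrable_Re[OF gauss_fourier(1)])
  then show ?thesis by simp
qed

lemma gauss_integral: "integral\<^sup>L (lborel :: 'a::euclidean_space measure) gauss = 1"
proof -
  have "(LINT x|lborel. complex_of_real (gauss (x :: 'a))) = of_real (sqrt (2 * pi) ^ DIM('a) * gauss (0 :: 'a))"
    using gauss_fourier(2)[of "0 :: 'a"] by simp
  also have "sqrt (2 * pi) ^ DIM('a) * gauss (0 :: 'a) = 1" by (simp add: gauss_eq)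
  finally show ?thesis by (simp add: integral_complex_of_real)
qed

lemma cancel_dilation:
  fixes K s :: real and X :: complex
  assumes "0 < K"
  shows "inverse K ^ n *\<^sub>R (of_real (K ^ n * s) * X) = of_real s * X"
proof -
  have "inverse K ^ n * (K ^ n * s) = s" using assms by (simp add: power_inverse)
  then have "(inverse K ^ n * (K ^ n * s)) *\<^sub>R X = s *\<^sub>R X" by (rule arg_cong[where f = "\<lambda>c. c *\<^sub>R X"])
  then show ?thesis by (simp only: scaleR_scaleR[symmetric] scaleR_conv_of_real[symmetric])
qed

text \<open>Fubini's theorem cannot be applied directly to the double integral. Multiplying the transform
  by a wide Gaussian makes it absolutely convergent, and the inner integral becomes a narrow
  Gaussian around \<open>t\<close>. As the Gaussian widens, one side tends to the inversion integral, the other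
  averages \<open>h\<close> over shrinking neighbourhoods of \<open>t\<close>.\<close>

theorem fourier_inversion:
  fixes h :: "'a::euclidean_space \<Rightarrow> complex"
  assumes cont: "continuous_on UNIV h" and bdd: "\<And>x. cmod (h x) \<le> B"
    and h: "integrable lborel h" and fh: "integrable lborel (fourier h)"
  shows "(LINT \<xi>|lborel. cis (t \<bullet> \<xi>) * fourier h \<xi>) = of_real ((2 * pi) ^ DIM('a)) * h t"
proof (rule LIMSEQ_unique)
  let ?n = "DIM('a)"
  let ?k = "\<lambda>k. real (Suc k)"
  have [measurable]: "h \<in> borel_measurable borel" using h by auto
  \<comment> \<open>the regularised inversion integrals\<close>
  define A where "A k = (LINT \<xi>|lborel. cis (t \<bullet> \<xi>) * fourier h \<xi> * of_real (gauss (\<xi> /\<^sub>R ?k k)))" for k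
  have "A \<longlonglongrightarrow> (LINT \<xi>|lborel. cis (t \<bullet> \<xi>) * fourier h \<xi> * of_real (gauss (0::'a)))"
    unfolding A_def
  proof (rule integral_dominated_convergence[where w = "\<lambda>\<xi>. norm (fourier h \<xi>) * gauss (0::'a)"])
    show "AE \<xi> in lborel. (\<lambda>k. cis (t \<bullet> \<xi>) * fourier h \<xi> * of_real (gauss (\<xi> /\<^sub>R ?k k)))
      \<longlonglongrightarrow> cis (t \<bullet> \<xi>) * fourier h \<xi> * of_real (gauss (0::'a))"
    proof (rule AE_I2)
      fix \<xi> :: 'a
      have "(\<lambda>k. \<xi> /\<^sub>R ?k k) \<longlonglongrightarrow> 0 *\<^sub>R \<xi>" by (intro tendsto_scaleR LIMSEQ_inverse_real_of_nat tendsto_const)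
      then have "(\<lambda>k. gauss (\<xi> /\<^sub>R ?k k)) \<longlonglongrightarrow> gauss (0 :: 'a)"
        using gauss_continuous[OF continuous_on_id, of UNIV]
        by (auto intro: continuous_on_tendsto_compose[where f = gauss])
      then show "(\<lambda>k. cis (t \<bullet> \<xi>) * fourier h \<xi> * of_real (gauss (\<xi> /\<^sub>R ?k k)))
        \<longlonglongrightarrow> cis (t \<bullet> \<xi>) * fourier h \<xi> * of_real (gauss (0::'a))"
        by (intro tendsto_intros)
    qed
    show "integrable lborel (\<lambda>\<xi>. norm (fourier h \<xi>) * gauss (0::'a))" using fh by simp
  qed (auto simp: norm_mult intro!: mult_left_mono gauss_le)
  then have "(\<lambda>k. of_real (sqrt (2 * pi) ^ ?n) * A k) \<longlonglongrightarrow>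
      of_real (sqrt (2 * pi) ^ ?n) * ((LINT \<xi>|lborel. cis (t \<bullet> \<xi>) * fourier h \<xi>) * of_real (gauss (0::'a)))"
    using fh by (intro tendsto_intros) simp
  also have "of_real (sqrt (2 * pi) ^ ?n) * ((LINT \<xi>|lborel. cis (t \<bullet> \<xi>) * fourier h \<xi>) * of_real (gauss (0::'a)))
    = (LINT \<xi>|lborel. cis (t \<bullet> \<xi>) * fourier h \<xi>)"
    by (simp add: gauss_eq)
  finally show "(\<lambda>k. of_real (sqrt (2 * pi) ^ ?n) * A k) \<longlonglongrightarrow> (LINT \<xi>|lborel. cis (t \<bullet> \<xi>) * fourier h \<xi>)" .

  have A: "A k = of_real (sqrt (2 * pi) ^ ?n) * (LINT v|lborel. h (t + v /\<^sub>R ?k k) * of_real (gauss v))" for k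
  proof -
    have "A k = (LINT \<xi>|lborel. (LINT u|lborel. cis ((t - u) \<bullet> \<xi>) * h u * of_real (gauss (\<xi> /\<^sub>R ?k k))))"
    proof -
      have "cis (t \<bullet> \<xi>) * fourier h \<xi> * of_real (gauss (\<xi> /\<^sub>R ?k k))
        = (LINT u|lborel. cis ((t - u) \<bullet> \<xi>) * h u * of_real (gauss (\<xi> /\<^sub>R ?k k)))" for \<xi>
      proof -
        have "(LINT u|lborel. cis ((t - u) \<bullet> \<xi>) * h u * of_real (gauss (\<xi> /\<^sub>R ?k k)))
          = (LINT u|lborel. (cis (t \<bullet> \<xi>) * of_real (gauss (\<xi> /\<^sub>R ?k k))) * (cis (u \<bullet> (- \<xi>)) * h u))"
        proof (intro Bochner_Integration.integral_cong refl)
          fix u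
          have "cis ((t - u) \<bullet> \<xi>) = cis (t \<bullet> \<xi>) * cis (u \<bullet> (- \<xi>))" by (simp add: cis_mult inner_diff_left)
          then show "cis ((t - u) \<bullet> \<xi>) * h u * of_real (gauss (\<xi> /\<^sub>R ?k k))
            = (cis (t \<bullet> \<xi>) * of_real (gauss (\<xi> /\<^sub>R ?k k))) * (cis (u \<bullet> (- \<xi>)) * h u)"
            by (simp only: mult_ac)
        qed
        then show ?thesis unfolding fourier_def by (simp only: integral_mult_right_zero) (simp only: mult_ac)
      qed
      then show ?thesis unfolding A_def by (simp only:)
    qed
    also have "\<dots> = (LINT u|lborel. (LINT \<xi>|lborel. cis ((t - u) \<bullet> \<xi>) * h u * of_real (gauss (\<xi> /\<^sub>R ?k k))))"
    proof (rule lborel_Fubini(2))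
      have gi: "integrable lborel (\<lambda>\<xi> :: 'a. gauss (\<xi> /\<^sub>R ?k k))"
      proof -
        have "(\<integral>\<^sup>+\<xi>. ennreal (gauss (\<xi> /\<^sub>R ?k k)) \<partial>(lborel :: 'a measure)) = ennreal (?k k ^ ?n) * (\<integral>\<^sup>+\<xi>. ennreal (gauss \<xi>) \<partial>(lborel :: 'a measure))"
          using nn_integral_lborel_affine[of "\<lambda>\<xi> :: 'a. ennreal (gauss (\<xi> /\<^sub>R ?k k))" "?k k" 0] by simp
        also have "\<dots> < top" using gauss_integrable[where 'a = 'a] by (simp add: integrable_iff_bounded ennreal_mult_less_top)
        finally show ?thesis by (intro integrableI_bounded) auto
      qed
      have "(\<integral>\<^sup>+\<xi>. (\<integral>\<^sup>+u. ennreal (norm (cis ((t - u) \<bullet> \<xi>) * h u * of_real (gauss (\<xi> /\<^sub>R ?k k)))) \<partial>lborel) \<partial>lborel)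
        = (\<integral>\<^sup>+\<xi>. (\<integral>\<^sup>+u. ennreal (norm (h u)) * ennreal (gauss (\<xi> /\<^sub>R ?k k)) \<partial>lborel) \<partial>(lborel :: 'a measure))"
        by (simp add: norm_mult ennreal_mult)
      also have "\<dots> = (\<integral>\<^sup>+u. ennreal (norm (h u)) \<partial>lborel) * (\<integral>\<^sup>+\<xi>. ennreal (gauss (\<xi> /\<^sub>R ?k k)) \<partial>(lborel :: 'a measure))"
        by (simp add: nn_integral_multc nn_integral_cmult)
      also have "\<dots> < top" using h gi by (simp add: integrable_iff_bounded ennreal_mult_less_top)
      finally show "(\<integral>\<^sup>+\<xi>. (\<integral>\<^sup>+u. ennreal (norm (cis ((t - u) \<bullet> \<xi>) * h u * of_real (gauss (\<xi> /\<^sub>R ?k k)))) \<partial>lborel) \<partial>lborel) < top" .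
    qed measurable
    also have "\<dots> = (LINT u|lborel. h u * (of_real (?k k ^ ?n * sqrt (2 * pi) ^ ?n * gauss (?k k *\<^sub>R (t - u)))))"
    proof (intro Bochner_Integration.integral_cong refl)
      fix u
      have "(LINT \<xi>|lborel. cis ((t - u) \<bullet> \<xi>) * h u * of_real (gauss (\<xi> /\<^sub>R ?k k)))
        = ?k k ^ ?n *\<^sub>R (LINT \<eta>|lborel. cis ((t - u) \<bullet> (0 + ?k k *\<^sub>R \<eta>)) * h u * of_real (gauss ((0 + ?k k *\<^sub>R \<eta>) /\<^sub>R ?k k)))"
        by (subst integral_lborel_affine[where c = "?k k" and a = 0]) (auto simp del: of_nat_Suc)
      also have "(LINT \<eta>|lborel. cis ((t - u) \<bullet> (0 + ?k k *\<^sub>R \<eta>)) * h u * of_real (gauss ((0 + ?k k *\<^sub>R \<eta>) /\<^sub>R ?k k)))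
        = (LINT \<eta>|lborel. h u * (cis (\<eta> \<bullet> (?k k *\<^sub>R (t - u))) * of_real (gauss \<eta>)))"
        by (intro Bochner_Integration.integral_cong refl)
           (simp add: inner_commute[of "t - u"] mult_ac del: of_nat_Suc)
      also have "\<dots> = h u * of_real (sqrt (2 * pi) ^ ?n * gauss (?k k *\<^sub>R (t - u)))"
        by (simp only: integral_mult_right_zero gauss_fourier)
      finally show "(LINT \<xi>|lborel. cis ((t - u) \<bullet> \<xi>) * h u * of_real (gauss (\<xi> /\<^sub>R ?k k)))
        = h u * (of_real (?k k ^ ?n * sqrt (2 * pi) ^ ?n * gauss (?k k *\<^sub>R (t - u))))"
        by (simp add: scaleR_conv_of_real del: of_nat_Suc)
    qed
    also have "\<dots> = inverse (?k k) ^ ?n *\<^sub>R (LINT v|lborel. h (t + v /\<^sub>R ?k k) *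
        (of_real (?k k ^ ?n * sqrt (2 * pi) ^ ?n * gauss (?k k *\<^sub>R (t - (t + v /\<^sub>R ?k k))))))"
      by (subst integral_lborel_affine[where c = "inverse (?k k)" and a = t]) (auto simp del: of_nat_Suc)
    also have "(LINT v|lborel. h (t + v /\<^sub>R ?k k) * (of_real (?k k ^ ?n * sqrt (2 * pi) ^ ?n * gauss (?k k *\<^sub>R (t - (t + v /\<^sub>R ?k k))))))
      = (LINT v|lborel. of_real (?k k ^ ?n * sqrt (2 * pi) ^ ?n) * (h (t + v /\<^sub>R ?k k) * of_real (gauss v)))"
      by (intro Bochner_Integration.integral_cong refl) (simp del: of_nat_Suc add: mult_ac)
    also have "\<dots> = of_real (?k k ^ ?n * sqrt (2 * pi) ^ ?n) * (LINT v|lborel. h (t + v /\<^sub>R ?k k) * of_real (gauss v))"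
      by (simp only: integral_mult_right_zero)
    finally have fin: "A k = inverse (?k k) ^ ?n *\<^sub>R (of_real (?k k ^ ?n * sqrt (2 * pi) ^ ?n) *
      (LINT v|lborel. h (t + v /\<^sub>R ?k k) * of_real (gauss v)))" .
    show ?thesis unfolding fin by (rule cancel_dilation) simp
  qed
  have "(\<lambda>k. LINT v|lborel. h (t + v /\<^sub>R ?k k) * of_real (gauss v)) \<longlonglongrightarrow> (LINT v|lborel. h t * of_real (gauss (v :: 'a)))"
  proof (rule integral_dominated_convergence[where w = "\<lambda>v. B * gauss v"])
    show "AE v in lborel. (\<lambda>k. h (t + v /\<^sub>R ?k k) * of_real (gauss v)) \<longlonglongrightarrow> h t * of_real (gauss (v :: 'a))"
    proof (rule AE_I2)
      fix v :: 'a
      have "(\<lambda>k. t + v /\<^sub>R ?k k) \<longlonglongrightarrow> t + 0 *\<^sub>R v" by (intro tendsto_intros LIMSEQ_inverse_real_of_nat)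
      then have "(\<lambda>k. h (t + v /\<^sub>R ?k k)) \<longlonglongrightarrow> h t"
        by (intro continuous_on_tendsto_compose[OF cont]) auto
      then show "(\<lambda>k. h (t + v /\<^sub>R ?k k) * of_real (gauss v)) \<longlonglongrightarrow> h t * of_real (gauss v)"
        by (intro tendsto_intros)
    qed
    show "integrable lborel (\<lambda>v :: 'a. B * gauss v)" using gauss_integrable[where 'a = 'a] by simp
  qed (auto simp: norm_mult intro!: mult_right_mono bdd)
  also have "(LINT v|lborel. h t * of_real (gauss (v :: 'a))) = h t"
    by (simp add: gauss_integral)
  finally have "(\<lambda>k. of_real (sqrt (2 * pi) ^ ?n) * (of_real (sqrt (2 * pi) ^ ?n) * (LINT v|lborel. h (t + v /\<^sub>R ?k k) * of_real (gauss v))))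
     \<longlonglongrightarrow> of_real (sqrt (2 * pi) ^ ?n) * (of_real (sqrt (2 * pi) ^ ?n) * h t)"
    by (intro tendsto_intros)
  moreover have "of_real (sqrt (2 * pi) ^ ?n) * (of_real (sqrt (2 * pi) ^ ?n) * h t) = of_real ((2 * pi) ^ ?n) * h t"
  proof -
    have "sqrt (2 * pi) ^ ?n * sqrt (2 * pi) ^ ?n = (sqrt (2 * pi) * sqrt (2 * pi)) ^ ?n"
      by (rule power_mult_distrib[symmetric])
    also have "sqrt (2 * pi) * sqrt (2 * pi) = 2 * pi" by simp
    finally show ?thesis by (simp only: mult.assoc[symmetric] of_real_mult[symmetric])
  qed
  ultimately show "(\<lambda>k. of_real (sqrt (2 * pi) ^ ?n) * A k) \<longlonglongrightarrow> of_real ((2 * pi) ^ ?n) * h t"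
    unfolding A by (simp only:)
qed

text \<open>Multiplication by a superposition of characters is the same superposition of modulations. The
  dilation factor \<open>c\<close> is there for cut-offs, whose amplitude \<open>a\<close> then does not depend on their
  width.\<close>

lemma fourier_mult:
  fixes a k :: "'a::euclidean_space \<Rightarrow> complex"
  assumes a: "integrable lborel a" and k: "integrable lborel k"
    and A: "\<And>t. A t = (LINT \<eta>|lborel. cis (t \<bullet> (c *\<^sub>R \<eta>)) * a \<eta>)"
  shows "fourier (\<lambda>t. A t * k t) \<xi> = (LINT \<eta>|lborel. a \<eta> * fourier k (\<xi> - c *\<^sub>R \<eta>))"
proof -
  have [measurable]: "a \<in> borel_measurable borel" "k \<in> borel_measurable borel" using a k by auto
  have "fourier (\<lambda>t. A t * k t) \<xi> = (LINT t|lborel. (LINT \<eta>|lborel. a \<eta> * (cis (t \<bullet> (- (\<xi> - c *\<^sub>R \<eta>))) * k t)))"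
    unfolding fourier_def
  proof (intro Bochner_Integration.integral_cong refl)
    fix t
    have "cis (t \<bullet> (- \<xi>)) * (A t * k t) = (LINT \<eta>|lborel. (cis (t \<bullet> (- \<xi>)) * k t) * (cis (t \<bullet> (c *\<^sub>R \<eta>)) * a \<eta>))"
      unfolding A by (simp only: integral_mult_right_zero) (simp only: mult_ac)
    also have "\<dots> = (LINT \<eta>|lborel. a \<eta> * (cis (t \<bullet> (- (\<xi> - c *\<^sub>R \<eta>))) * k t))"
    proof (intro Bochner_Integration.integral_cong refl)
      fix \<eta>
      have "cis (t \<bullet> (- (\<xi> - c *\<^sub>R \<eta>))) = cis (t \<bullet> (- \<xi>)) * cis (t \<bullet> (c *\<^sub>R \<eta>))" by (simp add: cis_mult inner_diff_right)
      then show "(cis (t \<bullet> (- \<xi>)) * k t) * (cis (t \<bullet> (c *\<^sub>R \<eta>)) * a \<eta>) = a \<eta> * (cis (t \<bullet> (- (\<xi> - c *\<^sub>R \<eta>))) * k t)"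
        by (simp only: mult_ac)
    qed
    finally show "cis (t \<bullet> (- \<xi>)) * (A t * k t) = (LINT \<eta>|lborel. a \<eta> * (cis (t \<bullet> (- (\<xi> - c *\<^sub>R \<eta>))) * k t))" .
  qed
  also have "\<dots> = (LINT \<eta>|lborel. (LINT t|lborel. a \<eta> * (cis (t \<bullet> (- (\<xi> - c *\<^sub>R \<eta>))) * k t)))"
  proof (rule lborel_Fubini(2))
    have "(\<integral>\<^sup>+t. (\<integral>\<^sup>+\<eta>. ennreal (norm (a \<eta> * (cis (t \<bullet> (- (\<xi> - c *\<^sub>R \<eta>))) * k t))) \<partial>lborel) \<partial>lborel)
      = (\<integral>\<^sup>+t. (\<integral>\<^sup>+\<eta>. ennreal (norm (a \<eta>)) * ennreal (norm (k t)) \<partial>lborel) \<partial>lborel)"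
      by (simp add: norm_mult ennreal_mult)
    also have "\<dots> = (\<integral>\<^sup>+\<eta>. ennreal (norm (a \<eta>)) \<partial>lborel) * (\<integral>\<^sup>+t. ennreal (norm (k t)) \<partial>lborel)"
      by (simp add: nn_integral_multc nn_integral_cmult)
    also have "\<dots> < top" using a k by (simp add: integrable_iff_bounded ennreal_mult_less_top)
    finally show "(\<integral>\<^sup>+t. (\<integral>\<^sup>+\<eta>. ennreal (norm (a \<eta> * (cis (t \<bullet> (- (\<xi> - c *\<^sub>R \<eta>))) * k t))) \<partial>lborel) \<partial>lborel) < top" .
  qed measurable
  also have "\<dots> = (LINT \<eta>|lborel. a \<eta> * fourier k (\<xi> - c *\<^sub>R \<eta>))" by (simp add: fourier_def)
  finally show ?thesis .
qed

section \<open>Decay of the Fourier transform of a Schwartz function\<close>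

lemma schwartz_iter_deriv:
  assumes "h \<in> schwartz" "set bs \<subseteq> Basis"
  shows "iter_deriv bs h \<in> schwartz"
proof -
  have *: "iter_deriv cs (iter_deriv bs h) = iter_deriv (cs @ bs) h" for cs
    by (simp add: iter_deriv_append)
  show ?thesis using assms unfolding schwartz_iff smooth_def * by simp
qed

text \<open>The derivative is evaluated at distance at most 1 from \<open>t\<close>. There \<open>\<langle>\<cdot>\<rangle> \<le> 2\<close>, and Peetre's
  inequality costs the factor \<open>4\<^sup>N\<close>.\<close>

lemma difference_quotient_bound:
  assumes h: "h \<in> schwartz" and b: "b \<in> Basis" and \<delta>: "0 < \<delta>" "\<delta> \<le> 1"
    and B: "\<And>x. cmod (iter_deriv [b] h x) \<le> B * decay N x"
  shows "cmod ((h (t + \<delta> *\<^sub>R b) - h t) / of_real \<delta>) \<le> B * 4 ^ N * decay N t"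
proof -
  have B0: "0 \<le> B" using order_trans[OF norm_ge_zero B[of 0]] decay_pos[of N "0 :: 'a"]
    by (metis mult_less_0_iff not_le)
  have "norm (h (t + \<delta> *\<^sub>R b) - h (t + 0 *\<^sub>R b)) \<le> (B * 4 ^ N * decay N t) * norm (\<delta> - 0)"
  proof (rule differentiable_bound[where S = "{0..1}" and f = "\<lambda>v. h (t + v *\<^sub>R b)"
        and f' = "\<lambda>v w. w *\<^sub>R iter_deriv [b] h (t + v *\<^sub>R b)"])
    fix v :: real assume v: "v \<in> {0..1}"
    let ?D = "frechet_derivative h (at (t + v *\<^sub>R b))"
    have D: "(h has_derivative ?D) (at (t + v *\<^sub>R b))"
      using smooth_has_derivative[OF schwartz_smooth[OF h], of "[]"] by simp
    have "((\<lambda>v. h (t + v *\<^sub>R b)) has_derivative (\<lambda>w. ?D (w *\<^sub>R b))) (at v within {0..1})"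
    proof (rule has_derivative_compose[where f = "\<lambda>v. t + v *\<^sub>R b" and g = h, OF _ D])
      show "((\<lambda>v. t + v *\<^sub>R b) has_derivative (\<lambda>w. w *\<^sub>R b)) (at v within {0..1})"
        by (auto intro!: derivative_eq_intros)
    qed
    then show "((\<lambda>v. h (t + v *\<^sub>R b)) has_derivative (\<lambda>w. w *\<^sub>R iter_deriv [b] h (t + v *\<^sub>R b))) (at v within {0..1})"
      using linear_cmul[OF has_derivative_linear[OF D]] by simp
    have "cmod (iter_deriv [b] h (t + v *\<^sub>R b)) \<le> B * 4 ^ N * decay N t"
    proof -
      have "(norm (v *\<^sub>R b))\<^sup>2 \<le> 1" using v b by (simp add: power_le_one)
      then have "japanese (v *\<^sub>R b) \<le> sqrt (2\<^sup>2)" unfolding japanese_def by (intro real_sqrt_le_mono) simp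
      then have "(2 * japanese (v *\<^sub>R b)) ^ N \<le> 4 ^ N" by (intro power_mono) auto
      then have "(2 * japanese (v *\<^sub>R b)) ^ N * decay N t \<le> 4 ^ N * decay N t" by (rule mult_right_mono) simp
      then have "decay N (t + v *\<^sub>R b) \<le> 4 ^ N * decay N t"
        using order_trans[OF decay_peetre[of N "t + v *\<^sub>R b" "- (v *\<^sub>R b)"]] by simp
      then have "B * decay N (t + v *\<^sub>R b) \<le> B * (4 ^ N * decay N t)" using B0 by (rule mult_left_mono)
      then show ?thesis using B[of "t + v *\<^sub>R b"] by (simp add: mult.assoc)
    qed
    then show "onorm (\<lambda>w. w *\<^sub>R iter_deriv [b] h (t + v *\<^sub>R b)) \<le> B * 4 ^ N * decay N t"
      using B0 by (intro onorm_bound) (auto simp: mult.commute intro!: mult_left_mono)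
  qed (use \<delta> in auto)
  then show ?thesis using \<delta> by (simp add: norm_divide divide_le_eq)
qed

lemma fourier_translate:
  assumes h: "integrable lborel h"
  shows "fourier (\<lambda>t. h (t + a)) \<xi> = cis (a \<bullet> \<xi>) * fourier h \<xi>"
proof -
  have [measurable]: "h \<in> borel_measurable borel" using h by auto
  have "fourier (\<lambda>t. h (t + a)) \<xi> = (LINT t|lborel. cis (a \<bullet> \<xi>) * (cis ((t + a) \<bullet> (- \<xi>)) * h (t + a)))"
    unfolding fourier_def
    by (intro Bochner_Integration.integral_cong refl)
       (simp add: mult.assoc[symmetric] cis_mult inner_add_left)
  also have "\<dots> = cis (a \<bullet> \<xi>) * (LINT t|lborel. cis ((t + a) \<bullet> (- \<xi>)) * h (t + a))"
    by (simp only: integral_mult_right_zero)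
  also have "(LINT t|lborel. cis ((t + a) \<bullet> (- \<xi>)) * h (t + a)) = fourier h \<xi>"
    unfolding fourier_def by (rule integral_lborel_shift) measurable
  finally show ?thesis .
qed

lemma vector_derivative_sequential:
  fixes f :: "real \<Rightarrow> complex"
  assumes f: "(f has_vector_derivative D) (at 0)" and \<delta>: "\<delta> \<longlonglongrightarrow> 0" "\<And>k. 0 < \<delta> k"
  shows "(\<lambda>k. (f (\<delta> k) - f 0) / of_real (\<delta> k)) \<longlonglongrightarrow> D"
proof -
  have "((\<lambda>h. norm (f h - f 0 - h *\<^sub>R D) / norm h) \<longlongrightarrow> 0) (at 0)"
    using f unfolding has_vector_derivative_def has_derivative_at by simp
  moreover have "filterlim \<delta> (at 0) sequentially"
    unfolding filterlim_at using \<delta> by (auto simp: less_imp_neq[symmetric])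
  ultimately have "(\<lambda>k. norm (f (\<delta> k) - f 0 - \<delta> k *\<^sub>R D) / norm (\<delta> k)) \<longlonglongrightarrow> 0"
    by (rule filterlim_compose)
  moreover have "norm (f (\<delta> k) - f 0 - \<delta> k *\<^sub>R D) / norm (\<delta> k) = norm ((f (\<delta> k) - f 0) / of_real (\<delta> k) - D)" for k
  proof -
    have "(f (\<delta> k) - f 0) / of_real (\<delta> k) - D = (f (\<delta> k) - f 0 - \<delta> k *\<^sub>R D) / of_real (\<delta> k)"
      using \<delta>(2)[of k] by (simp add: field_simps scaleR_conv_of_real)
    then show ?thesis by (simp add: norm_divide)
  qed
  ultimately have "(\<lambda>k. norm ((f (\<delta> k) - f 0) / of_real (\<delta> k) - D)) \<longlonglongrightarrow> 0" by simp
  then show ?thesis by (simp add: tendsto_norm_zero_iff LIM_zero_iff)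
qed

lemma difference_quotient_tendsto:
  assumes h: "smooth h" and b: "b \<in> Basis" and \<delta>: "\<delta> \<longlonglongrightarrow> 0" "\<And>k. 0 < \<delta> k"
  shows "(\<lambda>k. (h (t + \<delta> k *\<^sub>R b) - h t) / of_real (\<delta> k)) \<longlonglongrightarrow> iter_deriv [b] h t"
proof -
  let ?D = "frechet_derivative h (at t)"
  have D: "(h has_derivative ?D) (at (t + 0 *\<^sub>R b))"
    using smooth_has_derivative[OF h, of "[]"] by simp
  have "((\<lambda>v. h (t + v *\<^sub>R b)) has_derivative (\<lambda>w. ?D (w *\<^sub>R b))) (at 0)"
  proof (rule has_derivative_compose[where f = "\<lambda>v. t + v *\<^sub>R b" and g = h, OF _ D])
    show "((\<lambda>v. t + v *\<^sub>R b) has_derivative (\<lambda>w. w *\<^sub>R b)) (at 0)"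
      by (auto intro!: derivative_eq_intros)
  qed
  then have "((\<lambda>v. h (t + v *\<^sub>R b)) has_vector_derivative iter_deriv [b] h t) (at 0)"
    unfolding has_vector_derivative_def using linear_cmul[OF has_derivative_linear[OF D]] by simp
  from vector_derivative_sequential[OF this \<delta>] show ?thesis by simp
qed

text \<open>Difference quotients replace integration by parts: their transforms are known from translation
  invariance, and dominated convergence passes to the limit.\<close>

lemma fourier_deriv:
  fixes h :: "'a::euclidean_space \<Rightarrow> complex"
  assumes h: "h \<in> schwartz" and b: "b \<in> Basis"
  shows "fourier (iter_deriv [b] h) \<xi> = \<i> * of_real (b \<bullet> \<xi>) * fourier h \<xi>"
proof (rule LIMSEQ_unique)
  define \<delta> where "\<delta> k = inverse (real (Suc k))" for k
  have \<delta>: "0 < \<delta> k" "\<delta> k \<le> 1" for k by (auto simp: \<delta>_def field_simps)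
  have \<delta>lim: "\<delta> \<longlonglongrightarrow> 0" unfolding \<delta>_def by (rule LIMSEQ_inverse_real_of_nat)
  define q where "q k t = (h (t + \<delta> k *\<^sub>R b) - h t) / of_real (\<delta> k)" for k t
  have [measurable]: "h \<in> borel_measurable borel" by (rule schwartz_measurable[OF h])
  let ?N = "2 * DIM('a)"
  have dh: "iter_deriv [b] h \<in> schwartz" using b by (intro schwartz_iter_deriv h) auto
  obtain B where B: "\<And>x. cmod (iter_deriv [b] h x) \<le> B * decay ?N x"
    using schwartz_bound0[OF dh] by metis
  show "(\<lambda>k. fourier (q k) \<xi>) \<longlonglongrightarrow> fourier (iter_deriv [b] h) \<xi>"
    unfolding fourier_def
  proof (rule integral_dominated_convergence[where w = "\<lambda>t. B * 4 ^ ?N * decay ?N t"])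
    show "(\<lambda>u. cis (u \<bullet> - \<xi>) * iter_deriv [b] h u) \<in> borel_measurable lborel"
      using schwartz_measurable[OF dh] by measurable
    show "(\<lambda>u. cis (u \<bullet> - \<xi>) * q k u) \<in> borel_measurable lborel" for k unfolding q_def by measurable
    show "integrable lborel (\<lambda>t :: 'a. B * 4 ^ ?N * decay ?N t)"
      using decay_integrable[OF order_refl, where 'a = 'a] by simp
    show "AE u in lborel. norm (cis (u \<bullet> - \<xi>) * q k u) \<le> B * 4 ^ ?N * decay ?N u" for k
    proof (rule AE_I2)
      fix u
      have "cmod (q k u) \<le> B * 4 ^ ?N * decay ?N u"
        unfolding q_def by (rule difference_quotient_bound[OF h b \<delta> B])
      then show "norm (cis (u \<bullet> - \<xi>) * q k u) \<le> B * 4 ^ ?N * decay ?N u" by (simp add: norm_mult)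
    qed
    show "AE u in lborel. (\<lambda>k. cis (u \<bullet> - \<xi>) * q k u) \<longlonglongrightarrow> cis (u \<bullet> - \<xi>) * iter_deriv [b] h u"
    proof (rule AE_I2)
      fix u
      have "(\<lambda>k. q k u) \<longlonglongrightarrow> iter_deriv [b] h u"
        unfolding q_def by (rule difference_quotient_tendsto[OF schwartz_smooth[OF h] b \<delta>lim \<delta>(1)])
      then show "(\<lambda>k. cis (u \<bullet> - \<xi>) * q k u) \<longlonglongrightarrow> cis (u \<bullet> - \<xi>) * iter_deriv [b] h u"
        by (intro tendsto_intros)
    qed
  qed
  have "fourier (q k) \<xi> = (cis (\<delta> k * (b \<bullet> \<xi>)) - 1) / of_real (\<delta> k) * fourier h \<xi>" for k
  proof -
    have i: "integrable lborel h" by (rule schwartz_integrable[OF h])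
    then have i': "integrable lborel (\<lambda>t. h (t + \<delta> k *\<^sub>R b))" by (rule integrable_lborel_shift)
    have "fourier (q k) \<xi> = (LINT u|lborel. (cis (u \<bullet> (- \<xi>)) * h (u + \<delta> k *\<^sub>R b) - cis (u \<bullet> (- \<xi>)) * h u) / of_real (\<delta> k))"
      unfolding fourier_def q_def by (intro Bochner_Integration.integral_cong) (auto simp: right_diff_distrib)
    also have "\<dots> = (fourier (\<lambda>t. h (t + \<delta> k *\<^sub>R b)) \<xi> - fourier h \<xi>) / of_real (\<delta> k)"
      unfolding fourier_def using integrable_cis_mult[OF i, of "- \<xi>"] integrable_cis_mult[OF i', of "- \<xi>"] by simp
    also have "\<dots> = (cis (\<delta> k * (b \<bullet> \<xi>)) - 1) / of_real (\<delta> k) * fourier h \<xi>"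
      by (simp add: fourier_translate[OF i] left_diff_distrib)
    finally show ?thesis .
  qed
  moreover have "(\<lambda>k. (cis (\<delta> k * (b \<bullet> \<xi>)) - 1) / of_real (\<delta> k)) \<longlonglongrightarrow> \<i> * of_real (b \<bullet> \<xi>)"
  proof -
    have "((\<lambda>v. cis (v * (b \<bullet> \<xi>))) has_vector_derivative \<i> * of_real (b \<bullet> \<xi>)) (at 0)"
      unfolding has_vector_derivative_def
      by (auto intro!: derivative_eq_intros simp: scaleR_conv_of_real mult_ac)
    from vector_derivative_sequential[OF this \<delta>lim \<delta>(1)] show ?thesis by simp
  qed
  ultimately show "(\<lambda>k. fourier (q k) \<xi>) \<longlonglongrightarrow> \<i> * of_real (b \<bullet> \<xi>) * fourier h \<xi>"
    by (simp only:) (intro tendsto_mult tendsto_const)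
qed

lemma fourier_deriv_iterated:
  assumes h: "h \<in> schwartz" and b: "b \<in> Basis"
  shows "fourier (iter_deriv (replicate k b) h) \<xi> = (\<i> * of_real (b \<bullet> \<xi>)) ^ k * fourier h \<xi>"
proof (induction k)
  case (Suc k)
  have "iter_deriv (replicate k b) h \<in> schwartz" using b by (intro schwartz_iter_deriv h) auto
  from fourier_deriv[OF this b, of \<xi>] show ?case by (simp add: Suc mult_ac)
qed simp

text \<open>Derivatives along one coordinate direction, chosen according to \<open>\<xi>\<close>, suffice for decay in \<open>\<xi>\<close>.\<close>

lemma japanese_le_coordinate:
  fixes \<xi> :: "'a::euclidean_space"
  shows "japanese \<xi> \<le> sqrt (real (DIM('a) + 1)) \<or>
    (\<exists>b\<in>Basis. japanese \<xi> \<le> sqrt (real (DIM('a) + 1)) * \<bar>b \<bullet> \<xi>\<bar>)"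
proof -
  let ?n = "DIM('a)"
  define m where "m = Max (insert 1 ((\<lambda>b. (\<xi> \<bullet> b)\<^sup>2) ` Basis))"
  have m1: "1 \<le> m" unfolding m_def by (rule Max_ge) auto
  have mb: "(\<xi> \<bullet> b)\<^sup>2 \<le> m" if "b \<in> Basis" for b unfolding m_def by (rule Max_ge) (use that in auto)
  have "(norm \<xi>)\<^sup>2 = (\<Sum>b\<in>Basis. (\<xi> \<bullet> b)\<^sup>2)"
    unfolding power2_norm_eq_inner by (subst euclidean_inner) (simp add: power2_eq_square)
  also have "\<dots> \<le> real ?n * m" using sum_bounded_above[of Basis "\<lambda>b. (\<xi> \<bullet> b)\<^sup>2" m] mb by simp
  finally have "1 + (norm \<xi>)\<^sup>2 \<le> real (?n + 1) * m" using m1 by (simp add: algebra_simps)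
  then have J: "japanese \<xi> \<le> sqrt (real (?n + 1)) * sqrt m"
    unfolding japanese_def real_sqrt_mult[symmetric] by (rule real_sqrt_le_mono)
  have "m \<in> insert 1 ((\<lambda>b. (\<xi> \<bullet> b)\<^sup>2) ` Basis)" unfolding m_def by (rule Max_in) auto
  then show ?thesis
  proof
    assume "m = 1" then show ?thesis using J by simp
  next
    assume "m \<in> (\<lambda>b. (\<xi> \<bullet> b)\<^sup>2) ` Basis"
    then obtain b where "b \<in> Basis" "sqrt m = \<bar>b \<bullet> \<xi>\<bar>" by (auto simp: inner_commute)
    then show ?thesis using J by auto
  qed
qed

lemma le_decayI: "japanese x ^ N * c \<le> K \<Longrightarrow> c \<le> K * decay N x"
  by (simp add: decay_def field_simps)

text \<open>Depends on the dimension and the order only, which makes \<open>fourier_decay\<close> uniform over families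
  of functions. The argument of type \<open>itself\<close> carries the dimension.\<close>

definition fourier_decay_const :: "'a::euclidean_space itself \<Rightarrow> nat \<Rightarrow> real"
  where "fourier_decay_const T N =
    sqrt (real (DIM('a) + 1)) ^ N * (LINT u|lborel. decay (2 * DIM('a)) (u :: 'a))"

lemma fourier_decay:
  fixes h :: "'a::euclidean_space \<Rightarrow> complex"
  assumes h: "h \<in> schwartz"
    and B: "\<And>bs u. set bs \<subseteq> Basis \<Longrightarrow> length bs \<le> N \<Longrightarrow> cmod (iter_deriv bs h u) \<le> B * decay (2 * DIM('a)) u"
  shows "cmod (fourier h \<xi>) \<le> fourier_decay_const TYPE('a) N * B * decay N \<xi>"
proof -
  let ?D = "LINT u|lborel. decay (2 * DIM('a)) (u :: 'a)" and ?s = "sqrt (real (DIM('a) + 1))"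
  have s1: "1 \<le> ?s" by simp
  have bound: "cmod (fourier (iter_deriv bs h) \<xi>) \<le> B * ?D" if "set bs \<subseteq> Basis" "length bs \<le> N" for bs
  proof -
    have "iter_deriv bs h \<in> schwartz" by (intro schwartz_iter_deriv h that)
    then have i: "integrable lborel (iter_deriv bs h)" by (rule schwartz_integrable)
    have "cmod (fourier (iter_deriv bs h) \<xi>) \<le> (LINT u|lborel. norm (iter_deriv bs h u))"
      by (rule norm_fourier_le[OF i])
    also have "\<dots> \<le> (LINT u|lborel. B * decay (2 * DIM('a)) (u :: 'a))"
      using i decay_integrable[OF order_refl, where 'a = 'a] B[OF that]
      by (intro integral_mono integrable_norm) auto
    finally show ?thesis by simp
  qed
  have "japanese \<xi> ^ N * cmod (fourier h \<xi>) \<le> ?s ^ N * (B * ?D)"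
    using japanese_le_coordinate[of \<xi>]
  proof
    assume "japanese \<xi> \<le> ?s"
    then have "japanese \<xi> ^ N \<le> ?s ^ N" by (intro power_mono) auto
    then show ?thesis using bound[of "[]"] by (intro mult_mono) auto
  next
    assume "\<exists>b\<in>Basis. japanese \<xi> \<le> ?s * \<bar>b \<bullet> \<xi>\<bar>"
    then obtain b where b: "b \<in> Basis" "japanese \<xi> \<le> ?s * \<bar>b \<bullet> \<xi>\<bar>" by blast
    have "japanese \<xi> ^ N \<le> (?s * \<bar>b \<bullet> \<xi>\<bar>) ^ N" using b(2) by (intro power_mono) auto
    then have "japanese \<xi> ^ N * cmod (fourier h \<xi>) \<le> (?s * \<bar>b \<bullet> \<xi>\<bar>) ^ N * cmod (fourier h \<xi>)"
      by (intro mult_right_mono) auto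
    also have "\<dots> = ?s ^ N * cmod (fourier (iter_deriv (replicate N b) h) \<xi>)"
      by (simp add: fourier_deriv_iterated[OF h b(1)] norm_mult norm_power power_mult_distrib)
    also have "\<dots> \<le> ?s ^ N * (B * ?D)"
    proof (rule mult_left_mono[OF bound])
      show "set (replicate N b) \<subseteq> Basis" using b(1) by auto
    qed (use s1 in auto)
    finally show ?thesis .
  qed
  then have "cmod (fourier h \<xi>) \<le> ?s ^ N * (B * ?D) * decay N \<xi>" by (rule le_decayI)
  then show ?thesis unfolding fourier_decay_const_def by (simp only: mult_ac)
qed

text \<open>Every derivative of the windowed function is small of order \<open>N\<close> in \<open>x\<close>, because one factor is
  concentrated near \<open>x\<close> and the other near 0; Peetre's inequality makes this precise. Decay in \<open>\<xi>\<close>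
  then comes with a constant that decays in \<open>x\<close>.\<close>

lemma windowed_fourier_decay:
  fixes \<phi> \<theta> :: "'a::euclidean_space \<Rightarrow> complex"
  assumes \<phi>: "\<phi> \<in> schwartz" and \<theta>: "\<theta> \<in> schwartz"
  obtains C where "0 \<le> C"
    "\<And>x \<xi>. cmod (fourier (\<lambda>u. \<phi> (u - x) * \<theta> u) \<xi>) \<le> C * decay N x * decay N \<xi>"
proof -
  obtain B1 where B1: "0 \<le> B1"
    "\<And>bs x. set bs \<subseteq> Basis \<Longrightarrow> length bs \<le> N \<Longrightarrow> cmod (iter_deriv bs \<phi> x) \<le> B1 * decay N x"
    using schwartz_bound[OF \<phi>] by blast
  obtain B2 where B2: "0 \<le> B2"
    "\<And>bs x. set bs \<subseteq> Basis \<Longrightarrow> length bs \<le> N \<Longrightarrow> cmod (iter_deriv bs \<theta> x) \<le> B2 * decay (N + 2 * DIM('a)) x"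
    using schwartz_bound[OF \<theta>] by blast
  let ?B = "2 ^ N * (B1 * B2 * 2 ^ N)"
  have "cmod (fourier (\<lambda>u. \<phi> (u - x) * \<theta> u) \<xi>) \<le> fourier_decay_const TYPE('a) N * (?B * decay N x) * decay N \<xi>" for x \<xi>
  proof (rule fourier_decay)
    have tr: "(\<lambda>u. \<phi> (u - x)) \<in> schwartz" by (rule schwartz_translate[OF \<phi>])
    show "(\<lambda>u. \<phi> (u - x) * \<theta> u) \<in> schwartz" by (intro schwartz_mult tr \<theta>)
    fix bs :: "'a list" and u assume bs: "set bs \<subseteq> Basis" "length bs \<le> N"
    have dec: "decay N (u - x) * decay N u \<le> 2 ^ N * decay N x"
    proof -
      have "decay N (x - u) * decay N u \<le> (2 * japanese u) ^ N * decay N x * decay N u"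
        using decay_peetre[of N "x - u" u] by (intro mult_right_mono) auto
      also have "\<dots> = 2 ^ N * decay N x * (japanese u ^ N * decay N u)" by (simp only: power_mult_distrib mult_ac)
      finally show ?thesis by (simp add: decay_commute[of N u])
    qed
    have "cmod (iter_deriv bs (\<lambda>u. \<phi> (u - x) * \<theta> u) u)
      \<le> real (length (leibniz_splits bs)) * (B1 * B2 * (2 ^ N * decay N x) * decay (2 * DIM('a)) u)"
      unfolding iter_deriv_mult[OF schwartz_smooth[OF tr] schwartz_smooth[OF \<theta>] bs(1)]
    proof (rule norm_sum_list_le, clarify)
      fix as cs assume "(as, cs) \<in> set (leibniz_splits bs)"
      from leibniz_splits_sub[OF this] bs
      have as: "set as \<subseteq> Basis" "length as \<le> N" and cs: "set cs \<subseteq> Basis" "length cs \<le> N" by auto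
      have "iter_deriv as (\<lambda>u. \<phi> (u - x)) u = iter_deriv as \<phi> (u - x)"
        using iter_deriv_affine[OF schwartz_smooth[OF \<phi>] as(1), of 1 "- x"] by simp
      then have "cmod (iter_deriv as (\<lambda>u. \<phi> (u - x)) u * iter_deriv cs \<theta> u)
        \<le> (B1 * decay N (u - x)) * (B2 * decay (N + 2 * DIM('a)) u)"
        unfolding norm_mult using B1 B2 as cs by (intro mult_mono) auto
      also have "\<dots> = B1 * B2 * (decay N (u - x) * decay N u) * decay (2 * DIM('a)) u"
        by (simp add: decay_add)
      also have "\<dots> \<le> B1 * B2 * (2 ^ N * decay N x) * decay (2 * DIM('a)) u"
        using dec B1 B2 by (intro mult_right_mono mult_left_mono) auto
      finally show "cmod (iter_deriv as (\<lambda>u. \<phi> (u - x)) u * iter_deriv cs \<theta> u)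
        \<le> B1 * B2 * (2 ^ N * decay N x) * decay (2 * DIM('a)) u" .
    qed
    also have "\<dots> \<le> 2 ^ N * (B1 * B2 * (2 ^ N * decay N x) * decay (2 * DIM('a)) u)"
      using bs B1 B2 by (intro mult_right_mono) (auto simp: length_leibniz_splits)
    finally show "cmod (iter_deriv bs (\<lambda>u. \<phi> (u - x) * \<theta> u) u) \<le> ?B * decay N x * decay (2 * DIM('a)) u"
      by (simp only: mult_ac)
  qed
  moreover have "0 \<le> fourier_decay_const TYPE('a) N * ?B"
    using B1 B2 unfolding fourier_decay_const_def by (intro mult_nonneg_nonneg) (auto intro: integral_nonneg)
  ultimately show ?thesis
    using that[of "fourier_decay_const TYPE('a) N * ?B"] by (simp add: mult.assoc)
qed

lemma fourier_schwartz_decay: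
  fixes h :: "'a::euclidean_space \<Rightarrow> complex"
  assumes h: "h \<in> schwartz"
  obtains C where "0 \<le> C" "\<And>\<xi>. cmod (fourier h \<xi>) \<le> C * decay N \<xi>"
proof -
  obtain B where B: "0 \<le> B"
    "\<And>bs x. set bs \<subseteq> Basis \<Longrightarrow> length bs \<le> N \<Longrightarrow> cmod (iter_deriv bs h x) \<le> B * decay (2 * DIM('a)) x"
    using schwartz_bound[OF h] by blast
  show ?thesis
  proof (rule that)
    show "0 \<le> fourier_decay_const TYPE('a) N * B"
      using B unfolding fourier_decay_const_def by (intro mult_nonneg_nonneg) (auto intro: integral_nonneg)
  qed (rule fourier_decay[OF h B(2)])
qed

lemma fourier_schwartz_integrable:
  fixes h :: "'a::euclidean_space \<Rightarrow> complex"
  assumes h: "h \<in> schwartz"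
  shows "integrable lborel (fourier h)"
proof -
  obtain C where "\<And>\<xi>. cmod (fourier h \<xi>) \<le> C * decay (2 * DIM('a)) \<xi>"
    using fourier_schwartz_decay[OF h] by blast
  then show ?thesis
    using integrable_decay_bound[of "fourier h" "2 * DIM('a)" C 0] schwartz_measurable[OF h] by simp
qed

lemma schwartz_fourier_inversion:
  fixes h :: "'a::euclidean_space \<Rightarrow> complex"
  assumes h: "h \<in> schwartz"
  shows "(LINT \<xi>|lborel. cis (t \<bullet> \<xi>) * fourier h \<xi>) = of_real ((2 * pi) ^ DIM('a)) * h t"
proof -
  obtain B where "\<And>x. cmod (h x) \<le> B * decay 0 x" using schwartz_bound0[OF h] by blast
  then have "\<And>x. cmod (h x) \<le> B" by (simp add: decay_def)
  then show ?thesis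
    by (intro fourier_inversion schwartz_continuous schwartz_integrable fourier_schwartz_integrable h)
qed

section \<open>Approximation of integrals by finite sums\<close>

text \<open>Each point of a compact set is replaced by a nearby sample point, in a measurable way and with
  only finitely many values. Points outside the balls of a finite cover are sent to 0.\<close>

lemma compact_finite_range_selection:
  fixes S :: "'b::euclidean_space set"
  assumes S: "compact S" and P: "\<And>z. \<exists>\<delta>>0. \<forall>z'. dist z' z < \<delta> \<longrightarrow> P z' z"
  obtains \<pi> Z where "finite Z" "\<pi> \<in> borel \<rightarrow>\<^sub>M borel" "\<And>z. \<pi> z \<in> Z" "\<And>z. z \<in> S \<Longrightarrow> P z (\<pi> z)"
proof -
  obtain \<delta> where \<delta>: "\<And>z. 0 < \<delta> z" "\<And>z z'. dist z' z < \<delta> z \<Longrightarrow> P z' z" using P by metis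
  have "S \<subseteq> (\<Union>z\<in>S. ball z (\<delta> z))" using \<delta>(1) by auto
  then obtain C where C: "C \<subseteq> S" "finite C" "S \<subseteq> (\<Union>z\<in>C. ball z (\<delta> z))"
    using compactE_image[OF S, of S "\<lambda>z. ball z (\<delta> z)"] by auto
  have "\<exists>\<pi> :: 'b \<Rightarrow> 'b. \<pi> \<in> borel \<rightarrow>\<^sub>M borel \<and> (\<forall>z. \<pi> z \<in> insert 0 C) \<and> (\<forall>z \<in> (\<Union>c\<in>C. ball c (\<delta> c)). P z (\<pi> z))"
    using C(2)
  proof (induction C)
    case empty
    show ?case by (intro exI[of _ "\<lambda>_. 0"]) auto
  next
    case (insert c C)
    then obtain \<pi> :: "'b \<Rightarrow> 'b" where \<pi>[measurable]: "\<pi> \<in> borel \<rightarrow>\<^sub>M borel"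
      and \<pi>': "\<forall>z. \<pi> z \<in> insert 0 C" "\<forall>z \<in> (\<Union>c\<in>C. ball c (\<delta> c)). P z (\<pi> z)" by blast
    have "{z. z \<in> ball c (\<delta> c)} \<in> sets borel" by simp
    then have "(\<lambda>z. if z \<in> ball c (\<delta> c) then c else \<pi> z) \<in> borel \<rightarrow>\<^sub>M borel"
      by (intro measurable_If) (auto intro: \<pi>)
    moreover have "P z c" if "z \<in> ball c (\<delta> c)" for z using that \<delta>(2)[of z c] by (simp add: dist_commute)
    ultimately show ?case using \<pi>' by (intro exI[of _ "\<lambda>z. if z \<in> ball c (\<delta> c) then c else \<pi> z"]) auto
  qed
  then show ?thesis using that[of "insert 0 C"] C by blast
qed

lemma nn_integral_tail:
  fixes m :: "'b::euclidean_space \<Rightarrow> ennreal"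
  assumes [measurable]: "m \<in> borel_measurable borel" and fin: "(\<integral>\<^sup>+z. m z \<partial>lborel) < top" and \<epsilon>: "0 < \<epsilon>"
  obtains R where "(\<integral>\<^sup>+z. m z * indicator (- cball 0 R) z \<partial>lborel) \<le> ennreal \<epsilon>"
proof -
  have "(\<lambda>k. \<integral>\<^sup>+z. m z * indicator (- cball 0 (real k)) z \<partial>lborel) \<longlonglongrightarrow> (\<integral>\<^sup>+z. 0 \<partial>(lborel :: 'b measure))"
  proof (rule nn_integral_dominated_convergence[where w = m])
    show "AE z in lborel. (\<lambda>k. m z * indicator (- cball 0 (real k)) z) \<longlonglongrightarrow> 0"
    proof (rule AE_I2)
      fix z :: 'b
      have "eventually (\<lambda>k. m z * indicator (- cball 0 (real k)) z = 0) sequentially"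
        using eventually_ge_at_top[of "nat \<lceil>norm z\<rceil>"]
      proof eventually_elim
        case (elim k)
        then have "norm z \<le> real k" by linarith
        then show ?case by simp
      qed
      then show "(\<lambda>k. m z * indicator (- cball 0 (real k)) z) \<longlonglongrightarrow> 0" by (rule tendsto_eventually)
    qed
    show "AE z in lborel. m z * indicator (- cball 0 (real k)) z \<le> m z" for k
      by (auto simp: indicator_def)
  qed (use fin in auto)
  then have "eventually (\<lambda>k. (\<integral>\<^sup>+z. m z * indicator (- cball 0 (real k)) z \<partial>lborel) < ennreal \<epsilon>) sequentially"
    using \<epsilon> by (intro order_tendstoD) auto
  then obtain k where "(\<integral>\<^sup>+z. m z * indicator (- cball 0 (real k)) z \<partial>lborel) < ennreal \<epsilon>"
    unfolding eventually_sequentially by blast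
  then show ?thesis by (intro that[of "real k"] less_imp_le)
qed

text \<open>The sample points and the weights do not depend on \<open>G\<close>. Therefore one finite sum approximates
  the integrals of a whole family of functions \<open>G\<close> at the same time.\<close>

lemma finite_sum_approximation:
  fixes W G :: "'b::euclidean_space \<Rightarrow> complex"
  assumes Z: "finite Z" and \<pi>: "\<pi> \<in> borel \<rightarrow>\<^sub>M borel" "\<And>z. \<pi> z \<in> Z" and Q: "Q \<in> sets borel"
    and W: "integrable lborel W" and WG: "integrable lborel (\<lambda>z. W z * G z)"
  shows "ennreal (cmod ((LINT z|lborel. W z * G z) - (\<Sum>\<zeta>\<in>Z. (LINT z|lborel. W z * indicator (Q \<inter> {z. \<pi> z = \<zeta>}) z) * G \<zeta>)))
    \<le> (\<integral>\<^sup>+z. ennreal (cmod (W z)) * (if z \<in> Q then ennreal (cmod (G z - G (\<pi> z))) else ennreal (cmod (G z))) \<partial>lborel)"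
proof -
  have S: "Q \<inter> {z. \<pi> z = \<zeta>} \<in> sets borel" for \<zeta>
  proof -
    have "\<pi> -` {\<zeta>} \<inter> space borel \<in> sets borel" by (rule measurable_sets[OF \<pi>(1)]) simp
    moreover have "\<pi> -` {\<zeta>} \<inter> space borel = {z. \<pi> z = \<zeta>}" by auto
    ultimately show ?thesis using Q by auto
  qed
  have i: "integrable lborel (\<lambda>z. W z * indicator (Q \<inter> {z. \<pi> z = \<zeta>}) z)" for \<zeta>
    using integrable_mult_indicator[of "Q \<inter> {z. \<pi> z = \<zeta>}" lborel W] S W
    by (simp add: indicator_scaleR_eq_if mult.commute) (simp add: indicator_def of_bool_def if_distrib mult_ac cong: if_cong)
  have sum: "(\<Sum>\<zeta>\<in>Z. W z * indicator (Q \<inter> {z. \<pi> z = \<zeta>}) z * G \<zeta>) = (if z \<in> Q then W z * G (\<pi> z) else 0)" for z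
  proof -
    have "(\<Sum>\<zeta>\<in>Z. W z * indicator (Q \<inter> {z. \<pi> z = \<zeta>}) z * G \<zeta>) = (\<Sum>\<zeta>\<in>Z. if \<pi> z = \<zeta> then (if z \<in> Q then W z * G \<zeta> else 0) else 0)"
      by (intro sum.cong) (auto simp: indicator_def)
    also have "\<dots> = (if z \<in> Q then W z * G (\<pi> z) else 0)" using Z \<pi>(2)[of z] by (subst sum.delta') auto
    finally show ?thesis .
  qed
  have "(LINT z|lborel. W z * G z) - (\<Sum>\<zeta>\<in>Z. (LINT z|lborel. W z * indicator (Q \<inter> {z. \<pi> z = \<zeta>}) z) * G \<zeta>)
    = (LINT z|lborel. W z * G z - (\<Sum>\<zeta>\<in>Z. W z * indicator (Q \<inter> {z. \<pi> z = \<zeta>}) z * G \<zeta>))"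
    using WG i by (simp add: Bochner_Integration.integral_sum Bochner_Integration.integrable_sum)
  also have "ennreal (cmod \<dots>) \<le> (\<integral>\<^sup>+z. cmod (W z * G z - (\<Sum>\<zeta>\<in>Z. W z * indicator (Q \<inter> {z. \<pi> z = \<zeta>}) z * G \<zeta>)) \<partial>lborel)"
    using WG i by (intro integral_norm_bound_ennreal) (auto intro!: Bochner_Integration.integrable_diff Bochner_Integration.integrable_sum)
  also have "\<dots> = (\<integral>\<^sup>+z. ennreal (cmod (W z)) * (if z \<in> Q then ennreal (cmod (G z - G (\<pi> z))) else ennreal (cmod (G z))) \<partial>lborel)"
    unfolding sum
    by (intro nn_integral_cong) (auto simp: norm_mult ennreal_mult right_diff_distrib[symmetric])
  finally show ?thesis .
qed

section \<open>Reconstruction of a tempered distribution from its short-time Fourier transform\<close>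

lemma integral_pos_on_ball:
  fixes f :: "'a::euclidean_space \<Rightarrow> real"
  assumes f: "integrable lborel f" "\<And>x. 0 \<le> f x" and \<epsilon>: "0 < \<epsilon>" "\<And>x. x \<in> ball a \<epsilon> \<Longrightarrow> 0 < f x"
  shows "0 < (LINT x|lborel. f x)"
proof (rule ccontr)
  assume "\<not> 0 < (LINT x|lborel. f x)"
  moreover have "0 \<le> (LINT x|lborel. f x)" using f(2) by simp
  ultimately have "(LINT x|lborel. f x) = 0" by linarith
  then have "AE x in lborel. f x = 0" using f by (subst (asm) integral_nonneg_eq_0_iff_AE) auto
  then have "AE x in lborel. x \<notin> ball a \<epsilon>" using \<epsilon>(2) by (auto elim!: eventually_mono) fastforce
  then have "emeasure lborel (ball a \<epsilon>) = 0" by (subst (asm) AE_iff_measurable[where N = "ball a \<epsilon>"]) auto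
  moreover have "0 < measure lborel (ball a \<epsilon>)" using \<epsilon>(1) by (rule content_ball_pos)
  ultimately show False by (simp add: measure_def)
qed

text \<open>The normalising constant \<open>(2\<pi>)\<^sup>n \<parallel>\<phi>\<parallel>\<^sup>2\<close> of the reconstruction formula.\<close>

definition energy :: "('a::euclidean_space \<Rightarrow> complex) \<Rightarrow> real"
  where "energy \<phi> = (2 * pi) ^ DIM('a) * (LINT x|lborel. (cmod (\<phi> x))\<^sup>2)"

lemma schwartz_square_integrable:
  assumes "\<phi> \<in> schwartz"
  shows "integrable lborel (\<lambda>x. (cmod (\<phi> x))\<^sup>2)"
  using integrable_norm[OF schwartz_integrable[OF schwartz_mult[OF assms assms]]]
  by (simp add: norm_mult power2_eq_square)

lemma energy_pos:
  assumes \<phi>: "\<phi> \<in> schwartz" "\<phi> \<noteq> (\<lambda>_. 0)"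
  shows "0 < energy \<phi>"
proof -
  obtain a where a: "\<phi> a \<noteq> 0" using \<phi>(2) by auto
  have "open {x. \<phi> x \<noteq> 0}"
    by (intro open_Collect_neq schwartz_continuous[OF \<phi>(1)] continuous_on_const)
  then obtain \<epsilon> where \<epsilon>: "0 < \<epsilon>" "ball a \<epsilon> \<subseteq> {x. \<phi> x \<noteq> 0}"
    using a unfolding open_contains_ball by blast
  then have "0 < (LINT x|lborel. (cmod (\<phi> x))\<^sup>2)"
    by (intro integral_pos_on_ball[of _ \<epsilon> a] schwartz_square_integrable \<phi>) auto
  then show ?thesis by (simp add: energy_def)
qed

lemma iter_deriv_atom_measurable:
  assumes "\<phi> \<in> schwartz" "set bs \<subseteq> Basis"
  shows "(\<lambda>z. iter_deriv bs (atom \<phi> z) t) \<in> borel_measurable borel"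
proof (rule borel_measurable_continuous_onI)
  have "continuous_on UNIV (\<lambda>z. (\<lambda>(z, t). iter_deriv bs (atom \<phi> z) t) (z, t))"
    by (intro continuous_on_compose2[OF iter_deriv_atom_continuous[OF assms]] continuous_intros) auto
  then show "continuous_on UNIV (\<lambda>z. iter_deriv bs (atom \<phi> z) t)" by simp
qed

text \<open>The short-time Fourier transform of \<open>\<theta>\<close> with respect to the conjugate of \<open>\<phi>\<close>, at \<open>(x, -\<xi>)\<close>:
  the coefficient of \<open>\<theta>\<close> at the atom with parameter \<open>(x, \<xi>)\<close>.\<close>

definition reconstruction_kernel :: "('a::euclidean_space \<Rightarrow> complex) \<Rightarrow> ('a \<Rightarrow> complex) \<Rightarrow> 'a \<times> 'a \<Rightarrow> complex"
  where "reconstruction_kernel \<phi> \<theta> z = fourier (\<lambda>u. \<phi> (u - fst z) * \<theta> u) (- snd z)"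

lemma decay_pair_integrable:
  "integrable lborel (\<lambda>z :: 'a::euclidean_space \<times> 'a. decay (2 * DIM('a)) (fst z) * decay (2 * DIM('a)) (snd z))"
proof (rule integrableI_bounded)
  have "(\<integral>\<^sup>+z. ennreal (norm (decay (2 * DIM('a)) (fst z) * decay (2 * DIM('a)) (snd z))) \<partial>(lborel :: ('a \<times> 'a) measure))
    = (\<integral>\<^sup>+x. (\<integral>\<^sup>+\<xi>. ennreal (decay (2 * DIM('a)) x) * ennreal (decay (2 * DIM('a)) \<xi>) \<partial>(lborel :: 'a measure)) \<partial>(lborel :: 'a measure))"
    by (subst nn_integral_lborel_pair(1)[symmetric]) (auto simp: ennreal_mult)
  also have "\<dots> = (\<integral>\<^sup>+x. ennreal (decay (2 * DIM('a)) x) \<partial>(lborel :: 'a measure)) * (\<integral>\<^sup>+x. ennreal (decay (2 * DIM('a)) x) \<partial>(lborel :: 'a measure))"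
    by (simp add: nn_integral_cmult nn_integral_multc)
  also have "\<dots> < top"
    using decay_integrable[OF order_refl, where 'a = 'a] by (simp add: integrable_iff_bounded ennreal_mult_less_top)
  finally show "(\<integral>\<^sup>+z. ennreal (norm (decay (2 * DIM('a)) (fst z) * decay (2 * DIM('a)) (snd z))) \<partial>(lborel :: ('a \<times> 'a) measure)) < \<infinity>" by simp
qed measurable

context
  fixes \<phi> \<theta> :: "'a::euclidean_space \<Rightarrow> complex"
  assumes \<phi>: "\<phi> \<in> schwartz" and \<theta>: "\<theta> \<in> schwartz"
begin

lemma reconstruction_kernel_decay:
  obtains C where "0 \<le> C"
    "\<And>z. cmod (reconstruction_kernel \<phi> \<theta> z) \<le> C * decay N (fst z) * decay N (snd z)"
proof -
  obtain C where C: "0 \<le> C"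
    "\<And>x \<xi>. cmod (fourier (\<lambda>u. \<phi> (u - x) * \<theta> u) \<xi>) \<le> C * decay N x * decay N \<xi>"
    using windowed_fourier_decay[OF \<phi> \<theta>] by blast
  show ?thesis
  proof (rule that[OF C(1)])
    fix z :: "'a \<times> 'a"
    show "cmod (reconstruction_kernel \<phi> \<theta> z) \<le> C * decay N (fst z) * decay N (snd z)"
      using C(2)[of "fst z" "- snd z"] by (simp add: reconstruction_kernel_def)
  qed
qed

lemma reconstruction_kernel_measurable [measurable]: "reconstruction_kernel \<phi> \<theta> \<in> borel_measurable borel"
proof -
  note [measurable] = schwartz_measurable[OF \<phi>] schwartz_measurable[OF \<theta>]
  show ?thesis unfolding reconstruction_kernel_def fourier_def by measurable
qed

lemma reconstruction_kernel_integrable: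
  "integrable lborel (\<lambda>z. japanese (fst z) ^ n * japanese (snd z) ^ n * cmod (reconstruction_kernel \<phi> \<theta> z))"
proof -
  let ?m = "2 * DIM('a)"
  obtain C where C: "0 \<le> C" "\<And>z. cmod (reconstruction_kernel \<phi> \<theta> z) \<le> C * decay (n + ?m) (fst z) * decay (n + ?m) (snd z)"
    using reconstruction_kernel_decay by blast
  show ?thesis
  proof (rule Bochner_Integration.integrable_bound)
    show "integrable lborel (\<lambda>z :: 'a \<times> 'a. C * (decay ?m (fst z) * decay ?m (snd z)))"
      using decay_pair_integrable[where 'a = 'a] by simp
    show "AE z in lborel. norm (japanese (fst z) ^ n * japanese (snd z) ^ n * cmod (reconstruction_kernel \<phi> \<theta> z))
       \<le> norm (C * (decay ?m (fst z) * decay ?m (snd z)))"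
    proof (rule AE_I2)
      fix z :: "'a \<times> 'a"
      have "japanese (fst z) ^ n * japanese (snd z) ^ n * cmod (reconstruction_kernel \<phi> \<theta> z)
        \<le> japanese (fst z) ^ n * japanese (snd z) ^ n * (C * decay (n + ?m) (fst z) * decay (n + ?m) (snd z))"
        by (intro mult_left_mono C) auto
      also have "\<dots> = C * (japanese (fst z) ^ n * decay n (fst z)) * (japanese (snd z) ^ n * decay n (snd z)) * (decay ?m (fst z) * decay ?m (snd z))"
        unfolding decay_add by (simp only: mult_ac)
      finally show "norm (japanese (fst z) ^ n * japanese (snd z) ^ n * cmod (reconstruction_kernel \<phi> \<theta> z))
         \<le> norm (C * (decay ?m (fst z) * decay ?m (snd z)))"
        using C(1) by simp
    qed
  qed measurable
qed

lemma reconstruction_kernel_mult_integrable: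
  assumes [measurable]: "G \<in> borel_measurable borel"
    and G: "\<And>z. cmod (G z) \<le> B * japanese (fst z) ^ n * japanese (snd z) ^ n"
  shows "integrable lborel (\<lambda>z. reconstruction_kernel \<phi> \<theta> z * G z)"
proof (rule Bochner_Integration.integrable_bound)
  show "integrable lborel (\<lambda>z. B * (japanese (fst z) ^ n * japanese (snd z) ^ n * cmod (reconstruction_kernel \<phi> \<theta> z)))"
    using reconstruction_kernel_integrable[of n] by simp
  show "AE z in lborel. norm (reconstruction_kernel \<phi> \<theta> z * G z)
     \<le> norm (B * (japanese (fst z) ^ n * japanese (snd z) ^ n * cmod (reconstruction_kernel \<phi> \<theta> z)))"
  proof (rule AE_I2)
    fix z
    have "cmod (reconstruction_kernel \<phi> \<theta> z * G z) \<le> cmod (reconstruction_kernel \<phi> \<theta> z) * (B * japanese (fst z) ^ n * japanese (snd z) ^ n)"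
      unfolding norm_mult by (intro mult_left_mono G) auto
    then have "cmod (reconstruction_kernel \<phi> \<theta> z * G z) \<le> B * (japanese (fst z) ^ n * japanese (snd z) ^ n * cmod (reconstruction_kernel \<phi> \<theta> z))"
      by (simp only: mult_ac)
    then show "norm (reconstruction_kernel \<phi> \<theta> z * G z) \<le> norm (B * (japanese (fst z) ^ n * japanese (snd z) ^ n * cmod (reconstruction_kernel \<phi> \<theta> z)))"
      unfolding real_norm_def by (rule order_trans[OF _ abs_ge_self])
  qed
qed measurable

text \<open>Fourier inversion in the frequency gives \<open>\<bar>\<phi>(t - x)\<bar>\<^sup>2 \<theta>(t)\<close>, and integration over \<open>x\<close> gives
  the energy. Derivatives in \<open>t\<close> are taken under the integral by dominated convergence of difference
  quotients.\<close>

lemma reconstruction_pointwise: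
  assumes "set bs \<subseteq> Basis"
  shows "of_real (energy \<phi>) * iter_deriv bs \<theta> t
    = (LINT z|lborel. reconstruction_kernel \<phi> \<theta> z * iter_deriv bs (atom \<phi> z) t)"
  using assms
proof (induction bs arbitrary: t)
  case Nil
  let ?W = "reconstruction_kernel \<phi> \<theta>"
  note [measurable] = schwartz_measurable[OF \<phi>] schwartz_measurable[OF \<theta>]
  have am[measurable]: "(\<lambda>z. atom \<phi> z t) \<in> borel_measurable borel"
    using iter_deriv_atom_measurable[OF \<phi>, of "[]" t] by simp
  obtain B where B: "0 \<le> B" "\<And>x. cmod (\<phi> x) \<le> B * decay 0 x" using schwartz_bound0[OF \<phi>] by blast
  have i: "integrable lborel (\<lambda>z. ?W z * atom \<phi> z t)"
    by (rule reconstruction_kernel_mult_integrable[where B = B and n = 0, OF am])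
       (use B in \<open>auto simp: atom_def norm_mult decay_def\<close>)
  have "(LINT z|lborel. ?W z * atom \<phi> z t) = (LINT z|(lborel \<Otimes>\<^sub>M lborel). ?W z * atom \<phi> z t)"
    by (simp add: lborel_prod)
  also have "\<dots> = (LINT x|lborel. (LINT \<xi>|lborel. ?W (x, \<xi>) * atom \<phi> (x, \<xi>) t))"
    using i by (intro lborel_pair.integral_fst'[symmetric]) (simp add: lborel_prod)
  also have "\<dots> = (LINT x|lborel. (LINT \<xi>|lborel. cnj (\<phi> (t - x)) * (cis (t \<bullet> \<xi>) * fourier (\<lambda>u. \<phi> (u - x) * \<theta> u) \<xi>)))"
  proof (rule Bochner_Integration.integral_cong[OF refl])
    fix x
    have "(LINT \<xi>|lborel. ?W (x, \<xi>) * atom \<phi> (x, \<xi>) t) = (LINT \<xi>|lborel. ?W (x, 0 + (- 1) *\<^sub>R \<xi>) * atom \<phi> (x, 0 + (- 1) *\<^sub>R \<xi>) t)"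
      by (subst integral_lborel_affine[where c = "- 1" and a = 0]) auto
    then show "(LINT \<xi>|lborel. ?W (x, \<xi>) * atom \<phi> (x, \<xi>) t) = (LINT \<xi>|lborel. cnj (\<phi> (t - x)) * (cis (t \<bullet> \<xi>) * fourier (\<lambda>u. \<phi> (u - x) * \<theta> u) \<xi>))"
      by (simp add: reconstruction_kernel_def atom_def mult_ac)
  qed
  also have "\<dots> = (LINT x|lborel. of_real ((2 * pi) ^ DIM('a)) * \<theta> t * of_real ((cmod (\<phi> (t - x)))\<^sup>2))"
  proof (intro Bochner_Integration.integral_cong refl)
    fix x
    have "(\<lambda>u. \<phi> (u - x) * \<theta> u) \<in> schwartz" by (intro schwartz_mult schwartz_translate \<phi> \<theta>)
    from schwartz_fourier_inversion[OF this, of t]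
    have "(LINT \<xi>|lborel. cnj (\<phi> (t - x)) * (cis (t \<bullet> \<xi>) * fourier (\<lambda>u. \<phi> (u - x) * \<theta> u) \<xi>))
      = cnj (\<phi> (t - x)) * (of_real ((2 * pi) ^ DIM('a)) * (\<phi> (t - x) * \<theta> t))"
      by (simp only: integral_mult_right_zero)
    also have "\<dots> = of_real ((2 * pi) ^ DIM('a)) * \<theta> t * (\<phi> (t - x) * cnj (\<phi> (t - x)))" by (simp only: mult_ac)
    finally show "(LINT \<xi>|lborel. cnj (\<phi> (t - x)) * (cis (t \<bullet> \<xi>) * fourier (\<lambda>u. \<phi> (u - x) * \<theta> u) \<xi>))
      = of_real ((2 * pi) ^ DIM('a)) * \<theta> t * of_real ((cmod (\<phi> (t - x)))\<^sup>2)"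
      by (simp only: complex_norm_square)
  qed
  also have "\<dots> = of_real ((2 * pi) ^ DIM('a)) * \<theta> t * (LINT x|lborel. of_real ((cmod (\<phi> (t + (- 1) *\<^sub>R x)))\<^sup>2))"
    by (simp only: integral_mult_right_zero) simp
  also have "(LINT x|lborel. complex_of_real ((cmod (\<phi> (t + (- 1) *\<^sub>R x)))\<^sup>2)) = (LINT x|lborel. of_real ((cmod (\<phi> x))\<^sup>2))"
    by (subst integral_lborel_affine[where c = "- 1" and a = t and F = "\<lambda>x. of_real ((cmod (\<phi> x))\<^sup>2)"]) auto
  also have "\<dots> = of_real (LINT x|lborel. (cmod (\<phi> x))\<^sup>2)" by (rule integral_complex_of_real)
  finally show ?case by (simp add: energy_def)
next
  case (Cons b bs)
  let ?W = "reconstruction_kernel \<phi> \<theta>"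
  from Cons.prems have b: "b \<in> Basis" and bs: "set bs \<subseteq> Basis" by auto
  define \<delta> where "\<delta> k = inverse (real (Suc k))" for k
  have \<delta>: "0 < \<delta> k" "\<delta> k \<le> 1" for k by (auto simp: \<delta>_def field_simps)
  have \<delta>lim: "\<delta> \<longlonglongrightarrow> 0" unfolding \<delta>_def by (rule LIMSEQ_inverse_real_of_nat)
  define g where "g cs z t = iter_deriv cs (atom \<phi> z) t" for cs z t
  have gm: "(\<lambda>z. g cs z t) \<in> borel_measurable borel" if "set cs \<subseteq> Basis" for cs t
    unfolding g_def by (rule iter_deriv_atom_measurable[OF \<phi> that])
  note [measurable] = gm[OF bs] gm[OF Cons.prems]
  have gi: "integrable lborel (\<lambda>z. ?W z * g cs z t)" if cs: "set cs \<subseteq> Basis" for cs t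
  proof -
    obtain B where B: "0 \<le> B" "\<And>z bs t. set bs \<subseteq> Basis \<Longrightarrow> length bs \<le> length cs \<Longrightarrow>
      cmod (iter_deriv bs (atom \<phi> z) t) \<le> B * japanese (fst z) ^ length cs * japanese (snd z) ^ length cs * decay (length cs) t"
      using atom_bound[OF \<phi>] by blast
    show ?thesis
    proof (rule reconstruction_kernel_mult_integrable[OF gm[OF cs]])
      fix z
      have "cmod (g cs z t) \<le> B * japanese (fst z) ^ length cs * japanese (snd z) ^ length cs * decay (length cs) t"
        unfolding g_def by (rule B(2)[OF cs order_refl])
      also have "\<dots> \<le> B * japanese (fst z) ^ length cs * japanese (snd z) ^ length cs * 1"
        using B(1) by (intro mult_left_mono decay_le_1) auto
      finally show "cmod (g cs z t) \<le> B * japanese (fst z) ^ length cs * japanese (snd z) ^ length cs" by simp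
    qed
  qed
  obtain B where B: "0 \<le> B" "\<And>z cs t. set cs \<subseteq> Basis \<Longrightarrow> length cs \<le> Suc (length bs) \<Longrightarrow>
      cmod (iter_deriv cs (atom \<phi> z) t) \<le> B * japanese (fst z) ^ 0 * japanese (snd z) ^ Suc (length bs) * decay 0 t"
    using atom_bound[OF \<phi>] by blast
  define w where "w z = B * (japanese (fst z) ^ Suc (length bs) * japanese (snd z) ^ Suc (length bs) * cmod (?W z))" for z
  have wi: "integrable lborel w"
    unfolding w_def by (rule integrable_mult_right[OF reconstruction_kernel_integrable])
  have "(\<lambda>k. LINT z|lborel. ?W z * ((g bs z (t + \<delta> k *\<^sub>R b) - g bs z t) / of_real (\<delta> k)))
    \<longlonglongrightarrow> (LINT z|lborel. ?W z * g (b # bs) z t)"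
  proof (rule integral_dominated_convergence[OF _ _ wi])
    show "AE z in lborel. (\<lambda>k. ?W z * ((g bs z (t + \<delta> k *\<^sub>R b) - g bs z t) / of_real (\<delta> k))) \<longlonglongrightarrow> ?W z * g (b # bs) z t"
    proof (rule AE_I2)
      fix z
      have "iter_deriv bs (atom \<phi> z) \<in> schwartz" by (intro schwartz_iter_deriv atom_schwartz \<phi> bs)
      from difference_quotient_tendsto[OF schwartz_smooth[OF this] b \<delta>lim \<delta>(1), of t]
      have "(\<lambda>k. (g bs z (t + \<delta> k *\<^sub>R b) - g bs z t) / of_real (\<delta> k)) \<longlonglongrightarrow> g (b # bs) z t" by (simp add: g_def)
      then show "(\<lambda>k. ?W z * ((g bs z (t + \<delta> k *\<^sub>R b) - g bs z t) / of_real (\<delta> k))) \<longlonglongrightarrow> ?W z * g (b # bs) z t"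
        by (intro tendsto_intros)
    qed
    show "AE z in lborel. norm (?W z * ((g bs z (t + \<delta> k *\<^sub>R b) - g bs z t) / of_real (\<delta> k))) \<le> w z" for k
    proof (rule AE_I2)
      fix z
      have s: "iter_deriv bs (atom \<phi> z) \<in> schwartz" by (intro schwartz_iter_deriv atom_schwartz \<phi> bs)
      let ?M = "japanese (fst z) ^ Suc (length bs) * japanese (snd z) ^ Suc (length bs)"
      have "cmod ((g bs z (t + \<delta> k *\<^sub>R b) - g bs z t) / of_real (\<delta> k)) \<le> B * ?M * 4 ^ 0 * decay 0 t"
        unfolding g_def
      proof (rule difference_quotient_bound[OF s b \<delta>])
        fix t
        have "cmod (iter_deriv [b] (iter_deriv bs (atom \<phi> z)) t) \<le> B * japanese (fst z) ^ 0 * japanese (snd z) ^ Suc (length bs) * decay 0 t"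
          using B(2)[OF Cons.prems, of z t] by simp
        also have "\<dots> \<le> B * ?M * decay 0 t"
          unfolding mult.assoc[of B] using B(1)
          by (intro mult_left_mono mult_right_mono power_increasing japanese_ge_1) auto
        finally show "cmod (iter_deriv [b] (iter_deriv bs (atom \<phi> z)) t) \<le> B * ?M * decay 0 t" .
      qed
      then have "cmod ((g bs z (t + \<delta> k *\<^sub>R b) - g bs z t) / of_real (\<delta> k)) \<le> B * ?M" by (simp add: decay_def)
      then have "norm (?W z * ((g bs z (t + \<delta> k *\<^sub>R b) - g bs z t) / of_real (\<delta> k))) \<le> cmod (?W z) * (B * ?M)"
        unfolding norm_mult[of "?W z"] by (rule mult_left_mono) simp
      then show "norm (?W z * ((g bs z (t + \<delta> k *\<^sub>R b) - g bs z t) / of_real (\<delta> k))) \<le> w z"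
        unfolding w_def by (simp only: mult_ac)
    qed
  qed measurable
  moreover have "(LINT z|lborel. ?W z * ((g bs z (t + \<delta> k *\<^sub>R b) - g bs z t) / of_real (\<delta> k)))
     = of_real (energy \<phi>) * ((iter_deriv bs \<theta> (t + \<delta> k *\<^sub>R b) - iter_deriv bs \<theta> t) / of_real (\<delta> k))" for k
  proof -
    have "(LINT z|lborel. ?W z * ((g bs z (t + \<delta> k *\<^sub>R b) - g bs z t) / of_real (\<delta> k)))
      = (LINT z|lborel. (?W z * g bs z (t + \<delta> k *\<^sub>R b) - ?W z * g bs z t) / of_real (\<delta> k))"
      by (simp add: right_diff_distrib)
    also have "\<dots> = ((LINT z|lborel. ?W z * g bs z (t + \<delta> k *\<^sub>R b)) - (LINT z|lborel. ?W z * g bs z t)) / of_real (\<delta> k)"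
      using gi[OF bs] by simp
    also have "\<dots> = (of_real (energy \<phi>) * iter_deriv bs \<theta> (t + \<delta> k *\<^sub>R b) - of_real (energy \<phi>) * iter_deriv bs \<theta> t) / of_real (\<delta> k)"
      unfolding g_def Cons.IH[OF bs] ..
    finally show ?thesis by (simp add: right_diff_distrib)
  qed
  moreover have "(\<lambda>k. of_real (energy \<phi>) * ((iter_deriv bs \<theta> (t + \<delta> k *\<^sub>R b) - iter_deriv bs \<theta> t) / of_real (\<delta> k)))
     \<longlonglongrightarrow> of_real (energy \<phi>) * iter_deriv (b # bs) \<theta> t"
    using difference_quotient_tendsto[OF schwartz_smooth[OF schwartz_iter_deriv[OF \<theta> bs]] b \<delta>lim \<delta>(1), of t]
    by (intro tendsto_mult tendsto_const) simp
  ultimately show ?case unfolding g_def by (simp only:) (rule LIMSEQ_unique)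
qed

end

lemma tempered_lincomb:
  "f \<in> tempered_distr \<Longrightarrow> \<theta>\<^sub>1 \<in> schwartz \<Longrightarrow> \<theta>\<^sub>2 \<in> schwartz \<Longrightarrow>
    f (\<lambda>x. a * \<theta>\<^sub>1 x + b * \<theta>\<^sub>2 x) = a * f \<theta>\<^sub>1 + b * f \<theta>\<^sub>2"
  unfolding tempered_distr_def by blast

lemma schwartz_zero: "(\<lambda>_. 0) \<in> schwartz"
  using schwartz_lincomb[OF bump_schwartz[of 1 0] bump_schwartz[of 1 0], of 0 0] by simp

lemma schwartz_sum:
  fixes g :: "'i \<Rightarrow> 'a::euclidean_space \<Rightarrow> complex"
  assumes "finite Z" "\<And>\<zeta>. \<zeta> \<in> Z \<Longrightarrow> g \<zeta> \<in> schwartz"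
  shows "(\<lambda>t. \<Sum>\<zeta>\<in>Z. c \<zeta> * g \<zeta> t) \<in> schwartz \<and>
    (\<forall>bs. set bs \<subseteq> Basis \<longrightarrow> iter_deriv bs (\<lambda>t. \<Sum>\<zeta>\<in>Z. c \<zeta> * g \<zeta> t) = (\<lambda>t. \<Sum>\<zeta>\<in>Z. c \<zeta> * iter_deriv bs (g \<zeta>) t)) \<and>
    (\<forall>f\<in>tempered_distr. f (\<lambda>t. \<Sum>\<zeta>\<in>Z. c \<zeta> * g \<zeta> t) = (\<Sum>\<zeta>\<in>Z. c \<zeta> * f (g \<zeta>)))"
  using assms
proof (induction Z)
  case empty
  have "iter_deriv bs (\<lambda>_. 0) = (\<lambda>_. 0)" if "set bs \<subseteq> Basis" for bs :: "'a list"
    using iter_deriv_lincomb[OF schwartz_smooth[OF schwartz_zero] schwartz_smooth[OF schwartz_zero] that, of 0 0] by simp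
  moreover have "f (\<lambda>_. 0) = 0" if "f \<in> tempered_distr" for f :: "'a distr"
    using tempered_lincomb[OF that schwartz_zero schwartz_zero, of 0 0] by simp
  ultimately show ?case by (auto simp: schwartz_zero)
next
  case (insert \<zeta> Z)
  let ?r = "\<lambda>t. \<Sum>\<zeta>\<in>Z. c \<zeta> * g \<zeta> t"
  have g: "g \<zeta> \<in> schwartz" and r: "?r \<in> schwartz" using insert by auto
  have eq: "(\<lambda>t. \<Sum>\<zeta>\<in>insert \<zeta> Z. c \<zeta> * g \<zeta> t) = (\<lambda>t. c \<zeta> * g \<zeta> t + 1 * ?r t)" using insert by simp
  have "iter_deriv bs (\<lambda>t. c \<zeta> * g \<zeta> t + 1 * ?r t) = (\<lambda>t. \<Sum>\<zeta>\<in>insert \<zeta> Z. c \<zeta> * iter_deriv bs (g \<zeta>) t)"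
    if "set bs \<subseteq> Basis" for bs
    using iter_deriv_lincomb[OF schwartz_smooth[OF g] schwartz_smooth[OF r] that, of "c \<zeta>" 1] insert that by simp
  moreover have "f (\<lambda>t. c \<zeta> * g \<zeta> t + 1 * ?r t) = (\<Sum>\<zeta>\<in>insert \<zeta> Z. c \<zeta> * f (g \<zeta>))" if "f \<in> tempered_distr" for f
    using tempered_lincomb[OF that g r, of "c \<zeta>" 1] insert that by simp
  ultimately show ?case unfolding eq using schwartz_lincomb[OF g r, of "c \<zeta>" 1] by blast
qed

lemma tempered_atom_bound:
  assumes f: "f \<in> tempered_distr" and \<phi>: "\<phi> \<in> schwartz"
  obtains B n where "0 \<le> B" "\<And>z. cmod (f (atom \<phi> z)) \<le> B * japanese (fst z) ^ n * japanese (snd z) ^ n"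
proof -
  obtain C N where C: "0 \<le> C" "\<And>\<theta> B. \<theta> \<in> schwartz \<Longrightarrow>
    (\<And>bs x. set bs \<subseteq> Basis \<Longrightarrow> length bs \<le> N \<Longrightarrow> cmod (iter_deriv bs \<theta> x) \<le> B * decay N x) \<Longrightarrow> cmod (f \<theta>) \<le> C * B"
    using tempered_bound[OF f] by metis
  obtain B where B: "0 \<le> B" "\<And>z bs t. set bs \<subseteq> Basis \<Longrightarrow> length bs \<le> N \<Longrightarrow>
      cmod (iter_deriv bs (atom \<phi> z) t) \<le> B * japanese (fst z) ^ N * japanese (snd z) ^ N * decay N t"
    using atom_bound[OF \<phi>] by blast
  show ?thesis
  proof (rule that[of "C * B" N])
    show "0 \<le> C * B" using B C by simp
    show "cmod (f (atom \<phi> z)) \<le> C * B * japanese (fst z) ^ N * japanese (snd z) ^ N" for z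
      using C(2)[OF atom_schwartz[OF \<phi>] B(2), of z] by (simp add: mult.assoc)
  qed
qed

lemma tempered_atom_continuous:
  assumes f: "f \<in> tempered_distr" and \<phi>: "\<phi> \<in> schwartz"
  shows "continuous_on UNIV (\<lambda>z. f (atom \<phi> z))"
  unfolding continuous_on_iff
proof (intro ballI allI impI)
  fix z :: "'a \<times> 'a" and e :: real assume e: "0 < e"
  obtain C N where C: "0 \<le> C" "\<And>\<theta> B. \<theta> \<in> schwartz \<Longrightarrow>
    (\<And>bs x. set bs \<subseteq> Basis \<Longrightarrow> length bs \<le> N \<Longrightarrow> cmod (iter_deriv bs \<theta> x) \<le> B * decay N x) \<Longrightarrow> cmod (f \<theta>) \<le> C * B"
    using tempered_bound[OF f] by metis
  have e': "0 < e / (C + 1)" using e C by simp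
  obtain \<delta> where \<delta>: "0 < \<delta>" "\<And>z' bs t. dist z' z < \<delta> \<Longrightarrow> set bs \<subseteq> Basis \<Longrightarrow> length bs \<le> N \<Longrightarrow>
      cmod (iter_deriv bs (atom \<phi> z') t - iter_deriv bs (atom \<phi> z) t) \<le> e / (C + 1) * decay N t"
    using atom_continuous[OF \<phi> e'] by metis
  have "dist (f (atom \<phi> z')) (f (atom \<phi> z)) < e" if "dist z' z < \<delta>" for z'
  proof -
    note s = atom_schwartz[OF \<phi>, of z'] atom_schwartz[OF \<phi>, of z]
    have "cmod (f (\<lambda>t. 1 * atom \<phi> z' t + (- 1) * atom \<phi> z t)) \<le> C * (e / (C + 1))"
      using \<delta>(2)[OF that] by (intro C(2) schwartz_lincomb s) (simp only: iter_deriv_lincomb[OF s[THEN schwartz_smooth]], simp)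
    also have "\<dots> < e" using C(1) e by (simp add: field_simps)
    finally show ?thesis by (simp only: tempered_lincomb[OF f s]) (simp add: dist_norm)
  qed
  then show "\<exists>d>0. \<forall>x'\<in>UNIV. dist x' z < d \<longrightarrow> dist (f (atom \<phi> x')) (f (atom \<phi> z)) < e"
    using \<delta>(1) by blast
qed

lemma tempered_atom_measurable:
  "f \<in> tempered_distr \<Longrightarrow> \<phi> \<in> schwartz \<Longrightarrow> (\<lambda>z. f (atom \<phi> z)) \<in> borel_measurable borel"
  by (intro borel_measurable_continuous_onI tempered_atom_continuous)

text \<open>The pointwise formula, with all its derivatives, holds in the limit of finite sums in a
  seminorm that controls \<open>f\<close>. Such a sum \<open>\<theta>'\<close> is a test function on which \<open>f\<close> acts termwise, and the
  same sample points and weights also approximate the integral of \<open>f\<close> over the atoms.\<close>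

theorem distr_reconstruction:
  fixes \<phi> \<theta> :: "'a::euclidean_space \<Rightarrow> complex"
  assumes f: "f \<in> tempered_distr" and \<phi>: "\<phi> \<in> schwartz" and \<theta>: "\<theta> \<in> schwartz"
  shows "integrable lborel (\<lambda>z. reconstruction_kernel \<phi> \<theta> z * f (atom \<phi> z))"
    and "of_real (energy \<phi>) * f \<theta> = (LINT z|lborel. reconstruction_kernel \<phi> \<theta> z * f (atom \<phi> z))"
proof -
  let ?W = "reconstruction_kernel \<phi> \<theta>" and ?J = "\<lambda>n z :: 'a \<times> 'a. japanese (fst z) ^ n * japanese (snd z) ^ n"
  note W[measurable] = reconstruction_kernel_measurable[OF \<phi> \<theta>]
  note fm[measurable] = tempered_atom_measurable[OF f \<phi>]
  obtain A m where A: "0 \<le> A" "\<And>z. cmod (f (atom \<phi> z)) \<le> A * japanese (fst z) ^ m * japanese (snd z) ^ m"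
    using tempered_atom_bound[OF f \<phi>] by blast
  show fi: "integrable lborel (\<lambda>z. ?W z * f (atom \<phi> z))"
    by (rule reconstruction_kernel_mult_integrable[OF \<phi> \<theta> fm A(2)])
  obtain C N where C: "0 \<le> C" "\<And>\<theta> B. \<theta> \<in> schwartz \<Longrightarrow>
    (\<And>bs x. set bs \<subseteq> Basis \<Longrightarrow> length bs \<le> N \<Longrightarrow> cmod (iter_deriv bs \<theta> x) \<le> B * decay N x) \<Longrightarrow> cmod (f \<theta>) \<le> C * B"
    using tempered_bound[OF f] by metis
  obtain B where B: "0 \<le> B" "\<And>z bs t. set bs \<subseteq> Basis \<Longrightarrow> length bs \<le> N \<Longrightarrow>
      cmod (iter_deriv bs (atom \<phi> z) t) \<le> B * japanese (fst z) ^ N * japanese (snd z) ^ N * decay N t"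
    using atom_bound[OF \<phi>] by blast
  have Wi: "integrable lborel ?W"
    using reconstruction_kernel_mult_integrable[OF \<phi> \<theta>, of "\<lambda>_. 1" 1 0] by simp
  define w where "w = (LINT z|lborel. cmod (?W z))"
  have w: "0 \<le> w" "(\<integral>\<^sup>+z. ennreal (cmod (?W z)) \<partial>lborel) = ennreal w"
    using Wi by (auto simp: w_def nn_integral_eq_integral)
  define T where "T z = ennreal (cmod (?W z)) * ennreal (B * ?J N z)" for z
  have Tfin: "(\<integral>\<^sup>+z. T z \<partial>lborel) < top"
  proof -
    have "integrable lborel (\<lambda>z. B * (?J N z * cmod (?W z)))" using reconstruction_kernel_integrable[OF \<phi> \<theta>, of N] by simp
    then have "(\<integral>\<^sup>+z. ennreal (norm (B * (?J N z * cmod (?W z)))) \<partial>lborel) < top"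
      by (simp only: integrable_iff_bounded infinity_ennreal_def)
    moreover have "T z = ennreal (norm (B * (?J N z * cmod (?W z))))" for z
    proof -
      have "norm (B * (?J N z * cmod (?W z))) = cmod (?W z) * (B * ?J N z)" using B(1) by (simp add: abs_mult mult_ac)
      then show ?thesis unfolding T_def using B(1) by (subst ennreal_mult[symmetric]) auto
    qed
    ultimately show ?thesis by (simp only:)
  qed
  define K where "K = (LINT z|lborel. ?W z * f (atom \<phi> z))"
  have main: "cmod (of_real (energy \<phi>) * f \<theta> - K) \<le> 2 * C * (w + 1) * \<epsilon>" if \<epsilon>: "0 < \<epsilon>" for \<epsilon>
  proof -
    let ?P = "\<lambda>z' z. \<forall>bs t. set bs \<subseteq> Basis \<longrightarrow> length bs \<le> N \<longrightarrow>
        cmod (iter_deriv bs (atom \<phi> z') t - iter_deriv bs (atom \<phi> z) t) \<le> \<epsilon> * decay N t"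
    have P: "\<exists>\<delta>>0. \<forall>z'. dist z' z < \<delta> \<longrightarrow> ?P z' z" for z
      using atom_continuous[OF \<phi> \<epsilon>, of z N N] by metis
    obtain R where R: "(\<integral>\<^sup>+z. T z * indicator (- cball 0 R) z \<partial>lborel) \<le> ennreal \<epsilon>"
      using nn_integral_tail[OF _ Tfin \<epsilon>] unfolding T_def by auto
    obtain \<pi> Z where Z: "finite Z" and \<pi>: "\<pi> \<in> borel \<rightarrow>\<^sub>M borel" "\<And>z. \<pi> z \<in> Z"
      and \<pi>P: "\<And>z. z \<in> cball 0 R \<Longrightarrow> ?P z (\<pi> z)"
      using compact_finite_range_selection[OF compact_cball P] by metis
    define c where "c \<zeta> = (LINT z|lborel. ?W z * indicator (cball 0 R \<inter> {z. \<pi> z = \<zeta>}) z)" for \<zeta>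
    define \<theta>' where "\<theta>' t = (\<Sum>\<zeta>\<in>Z. c \<zeta> * atom \<phi> \<zeta> t)" for t
    have \<theta>': "\<theta>' \<in> schwartz" "\<And>bs. set bs \<subseteq> Basis \<Longrightarrow> iter_deriv bs \<theta>' = (\<lambda>t. \<Sum>\<zeta>\<in>Z. c \<zeta> * iter_deriv bs (atom \<phi> \<zeta>) t)"
      "f \<theta>' = (\<Sum>\<zeta>\<in>Z. c \<zeta> * f (atom \<phi> \<zeta>))"
      unfolding \<theta>'_def using schwartz_sum[OF Z, of "atom \<phi>" c] atom_schwartz[OF \<phi>] f by blast+
    \<comment> \<open>The factor \<open>D\<close> will be the decay in \<open>t\<close> for the atoms and the bound \<open>C\<close> of \<open>f\<close> for its values at the atoms.\<close>
    have approx: "cmod ((LINT z|lborel. ?W z * G z) - (\<Sum>\<zeta>\<in>Z. c \<zeta> * G \<zeta>)) \<le> D * (w + 1) * \<epsilon>"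
      if Gi: "integrable lborel (\<lambda>z. ?W z * G z)" and D: "0 \<le> D"
        and 1: "\<And>z. z \<in> cball 0 R \<Longrightarrow> cmod (G z - G (\<pi> z)) \<le> D * \<epsilon>"
        and 2: "\<And>z. cmod (G z) \<le> D * (B * ?J N z)" for G D
    proof -
      have "ennreal (cmod ((LINT z|lborel. ?W z * G z) - (\<Sum>\<zeta>\<in>Z. c \<zeta> * G \<zeta>)))
        \<le> (\<integral>\<^sup>+z. ennreal (cmod (?W z)) * (if z \<in> cball 0 R then ennreal (cmod (G z - G (\<pi> z))) else ennreal (cmod (G z))) \<partial>lborel)"
        unfolding c_def by (rule finite_sum_approximation[OF Z \<pi> _ Wi Gi]) simp
      also have "\<dots> \<le> (\<integral>\<^sup>+z. ennreal (D * \<epsilon>) * ennreal (cmod (?W z)) + ennreal D * (T z * indicator (- cball 0 R) z) \<partial>lborel)"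
      proof (rule nn_integral_mono)
        fix z
        show "ennreal (cmod (?W z)) * (if z \<in> cball 0 R then ennreal (cmod (G z - G (\<pi> z))) else ennreal (cmod (G z)))
          \<le> ennreal (D * \<epsilon>) * ennreal (cmod (?W z)) + ennreal D * (T z * indicator (- cball 0 R) z)"
        proof (cases "z \<in> cball 0 R")
          case True
          have "ennreal (cmod (?W z)) * ennreal (cmod (G z - G (\<pi> z))) \<le> ennreal (cmod (?W z)) * ennreal (D * \<epsilon>)"
            by (intro mult_left_mono ennreal_leI 1 True) auto
          then show ?thesis using True by (simp add: mult.commute)
        next
          case False
          have "ennreal (cmod (?W z)) * ennreal (cmod (G z)) \<le> ennreal (cmod (?W z)) * ennreal (D * (B * ?J N z))"
            by (intro mult_left_mono ennreal_leI 2) auto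
          also have "\<dots> = ennreal D * T z" using D B(1) by (simp add: T_def ennreal_mult mult_ac)
          finally show ?thesis using False by (simp add: add_increasing)
        qed
      qed
      also have "\<dots> = ennreal (D * \<epsilon>) * (\<integral>\<^sup>+z. ennreal (cmod (?W z)) \<partial>lborel) + ennreal D * (\<integral>\<^sup>+z. T z * indicator (- cball 0 R) z \<partial>lborel)"
        unfolding T_def by (subst nn_integral_add) (auto simp: nn_integral_cmult)
      also have "\<dots> \<le> ennreal (D * \<epsilon>) * ennreal w + ennreal D * ennreal \<epsilon>"
        unfolding w(2) by (intro add_left_mono mult_left_mono R) auto
      also have "\<dots> = ennreal (D * (w + 1) * \<epsilon>)"
        using D \<epsilon> w(1) by (simp add: ennreal_mult[symmetric] ennreal_plus[symmetric] algebra_simps del: ennreal_plus)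
      finally show ?thesis using D \<epsilon> w(1) by (subst (asm) ennreal_le_iff) auto
    qed
    have 1: "cmod (f (\<lambda>t. of_real (energy \<phi>) * \<theta> t + (- 1) * \<theta>' t)) \<le> C * ((w + 1) * \<epsilon>)"
    proof (rule C(2)[OF schwartz_lincomb[OF \<theta> \<theta>'(1)]])
      fix bs :: "'a list" and t assume bs: "set bs \<subseteq> Basis" "length bs \<le> N"
      note gm = iter_deriv_atom_measurable[OF \<phi> bs(1), of t]
      have b1: "cmod (iter_deriv bs (atom \<phi> z) t) \<le> decay N t * (B * ?J N z)" for z
        using B(2)[OF bs, of z t] by (simp add: mult_ac)
      have b2: "cmod (iter_deriv bs (atom \<phi> z) t) \<le> B * japanese (fst z) ^ N * japanese (snd z) ^ N" for z
      proof -
        have "decay N t * (B * ?J N z) \<le> 1 * (B * ?J N z)" using B(1) by (intro mult_right_mono decay_le_1) auto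
        then show ?thesis using b1[of z] by (simp add: mult_ac)
      qed
      have "cmod ((LINT z|lborel. ?W z * iter_deriv bs (atom \<phi> z) t) - (\<Sum>\<zeta>\<in>Z. c \<zeta> * iter_deriv bs (atom \<phi> \<zeta>) t)) \<le> decay N t * (w + 1) * \<epsilon>"
      proof (rule approx[where G = "\<lambda>z. iter_deriv bs (atom \<phi> z) t", OF _ decay_nonneg])
        show "integrable lborel (\<lambda>z. ?W z * iter_deriv bs (atom \<phi> z) t)"
          by (rule reconstruction_kernel_mult_integrable[OF \<phi> \<theta> gm b2])
        show "cmod (iter_deriv bs (atom \<phi> z) t) \<le> decay N t * (B * ?J N z)" for z by (rule b1)
        show "cmod (iter_deriv bs (atom \<phi> z) t - iter_deriv bs (atom \<phi> (\<pi> z)) t) \<le> decay N t * \<epsilon>" if "z \<in> cball 0 R" for z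
          using \<pi>P[OF that] bs by (simp add: mult.commute)
      qed
      then show "cmod (iter_deriv bs (\<lambda>t. of_real (energy \<phi>) * \<theta> t + (- 1) * \<theta>' t) t) \<le> (w + 1) * \<epsilon> * decay N t"
        unfolding iter_deriv_lincomb[OF schwartz_smooth[OF \<theta>] schwartz_smooth[OF \<theta>'(1)] bs(1)]
          reconstruction_pointwise[OF \<phi> \<theta> bs(1), symmetric] \<theta>'(2)[OF bs(1)]
        by (simp add: mult_ac)
    qed
    have 2: "cmod (K - f \<theta>') \<le> C * (w + 1) * \<epsilon>"
      unfolding K_def \<theta>'(3)
    proof (rule approx[where G = "\<lambda>z. f (atom \<phi> z)", OF fi C(1)])
      show "cmod (f (atom \<phi> z)) \<le> C * (B * ?J N z)" for z
        by (rule C(2)[OF atom_schwartz[OF \<phi>]]) (use B(2) in \<open>simp add: mult.assoc\<close>)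
      fix z :: "'a \<times> 'a" assume z: "z \<in> cball 0 R"
      note s = atom_schwartz[OF \<phi>, of z] atom_schwartz[OF \<phi>, of "\<pi> z"]
      have "cmod (f (\<lambda>t. 1 * atom \<phi> z t + (- 1) * atom \<phi> (\<pi> z) t)) \<le> C * \<epsilon>"
        using \<pi>P[OF z] by (intro C(2) schwartz_lincomb s) (simp only: iter_deriv_lincomb[OF s[THEN schwartz_smooth]], simp)
      then show "cmod (f (atom \<phi> z) - f (atom \<phi> (\<pi> z))) \<le> C * \<epsilon>"
        by (simp only: tempered_lincomb[OF f s]) simp
    qed
    have "cmod (of_real (energy \<phi>) * f \<theta> - f \<theta>') \<le> C * (w + 1) * \<epsilon>"
      using 1 by (simp only: tempered_lincomb[OF f \<theta> \<theta>'(1)]) (simp add: mult.assoc)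
    then have "cmod ((of_real (energy \<phi>) * f \<theta> - f \<theta>') - (K - f \<theta>')) \<le> C * (w + 1) * \<epsilon> + C * (w + 1) * \<epsilon>"
      using 2 norm_triangle_ineq4[of "of_real (energy \<phi>) * f \<theta> - f \<theta>'" "K - f \<theta>'"] by linarith
    then have "cmod (of_real (energy \<phi>) * f \<theta> - K) \<le> C * (w + 1) * \<epsilon> + C * (w + 1) * \<epsilon>" by simp
    also have "\<dots> = 2 * C * (w + 1) * \<epsilon>" by (simp add: algebra_simps)
    finally show ?thesis .
  qed
  have "cmod (of_real (energy \<phi>) * f \<theta> - K) \<le> 0"
  proof (rule field_le_epsilon)
    fix e :: real assume e: "0 < e"
    let ?c = "2 * C * (w + 1) + 1"
    have c: "0 < ?c" using C(1) w(1) by (intro add_nonneg_pos mult_nonneg_nonneg) auto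
    have "cmod (of_real (energy \<phi>) * f \<theta> - K) \<le> 2 * C * (w + 1) * (e / ?c)" using e c by (intro main) simp
    also have "\<dots> \<le> ?c * (e / ?c)" using e c by (intro mult_right_mono) auto
    also have "\<dots> = e" using c by simp
    finally show "cmod (of_real (energy \<phi>) * f \<theta> - K) \<le> 0 + e" by simp
  qed
  then show "of_real (energy \<phi>) * f \<theta> = K" by simp
qed

text \<open>The reconstruction formula is applied to the atom of \<open>\<psi>\<close> at \<open>(y, \<omega>)\<close>. Up to a phase, its
  kernel depends only on the difference of the two phase space points and decays rapidly in it.\<close>

theorem STFT_change_of_window:
  fixes \<phi> \<psi> :: "'a::euclidean_space \<Rightarrow> complex"
  assumes \<phi>: "\<phi> \<in> schwartz" "\<phi> \<noteq> (\<lambda>_. 0)" and \<psi>: "\<psi> \<in> schwartz"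
  obtains C where "C < top"
    "\<And>f y \<omega>. f \<in> tempered_distr \<Longrightarrow>
      ennreal (cmod (STFT \<psi> f y \<omega>)) \<le> C * smear N (\<lambda>x \<xi>. ennreal (cmod (STFT \<phi> f x \<xi>))) y \<omega>"
proof -
  obtain C where C: "0 \<le> C"
    "\<And>x \<xi>. cmod (fourier (\<lambda>u. \<phi> (u - x) * cnj (\<psi> u)) \<xi>) \<le> C * decay N x * decay N \<xi>"
    using windowed_fourier_decay[OF \<phi>(1) schwartz_cnj[OF \<psi>]] by blast
  have W: "cmod (reconstruction_kernel \<phi> (atom \<psi> (y, \<omega>)) z) \<le> C * decay N (fst z - y) * decay N (snd z - \<omega>)" for y \<omega> z
  proof -
    let ?F = "\<lambda>u. cis (u \<bullet> (snd z - \<omega>)) * (\<phi> (u - (fst z - y)) * cnj (\<psi> u))"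
    note [measurable] = schwartz_measurable[OF \<phi>(1)] schwartz_measurable[OF \<psi>]
    have m: "?F \<in> borel_measurable borel"
      using schwartz_measurable[OF schwartz_mult[OF schwartz_translate[OF \<phi>(1)] schwartz_cnj[OF \<psi>]], of "fst z - y"] by measurable
    have "reconstruction_kernel \<phi> (atom \<psi> (y, \<omega>)) z = (LINT u|lborel. cis (y \<bullet> (snd z - \<omega>)) * ?F (u + - y))"
      unfolding reconstruction_kernel_def fourier_def atom_def
    proof (intro Bochner_Integration.integral_cong refl)
      fix u
      have "cis (u \<bullet> (snd z)) * cis (u \<bullet> (- \<omega>)) = cis (y \<bullet> (snd z - \<omega>)) * cis ((u + - y) \<bullet> (snd z - \<omega>))"
        by (simp add: cis_mult algebra_simps)
      then show "cis (u \<bullet> (- (- snd z))) * (\<phi> (u - fst z) * (cis (u \<bullet> (- snd (y, \<omega>))) * cnj (\<psi> (u - fst (y, \<omega>)))))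
        = cis (y \<bullet> (snd z - \<omega>)) * ?F (u + - y)"
        by (simp add: mult_ac)
    qed
    also have "\<dots> = cis (y \<bullet> (snd z - \<omega>)) * (LINT u|lborel. ?F (u + - y))" by (rule integral_mult_right_zero)
    also have "(LINT u|lborel. ?F (u + - y)) = fourier (\<lambda>u. \<phi> (u - (fst z - y)) * cnj (\<psi> u)) (- (snd z - \<omega>))"
      unfolding fourier_def using integral_lborel_shift[OF m, of "- y"] by simp
    finally have "cmod (reconstruction_kernel \<phi> (atom \<psi> (y, \<omega>)) z) = cmod (fourier (\<lambda>u. \<phi> (u - (fst z - y)) * cnj (\<psi> u)) (- (snd z - \<omega>)))"
      by (simp add: norm_mult)
    then show ?thesis using C(2)[of "fst z - y" "- (snd z - \<omega>)"] by (simp only: decay_minus)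
  qed
  have e: "0 < energy \<phi>" by (rule energy_pos[OF \<phi>])
  show ?thesis
  proof (rule that[of "ennreal (C / energy \<phi>)"])
    fix f :: "'a distr" and y \<omega> assume f: "f \<in> tempered_distr"
    note [measurable] = tempered_atom_measurable[OF f \<phi>(1)]
    let ?S = "\<lambda>x \<xi>. ennreal (cmod (STFT \<phi> f x \<xi>))"
    let ?R = "\<lambda>z. reconstruction_kernel \<phi> (atom \<psi> (y, \<omega>)) z * f (atom \<phi> z)"
    have "ennreal (energy \<phi> * cmod (STFT \<psi> f y \<omega>)) = ennreal (cmod (LINT z|lborel. ?R z))"
      using distr_reconstruction(2)[OF f \<phi>(1) atom_schwartz[OF \<psi>], of "(y, \<omega>)"] e
      by (simp add: STFT_atom norm_mult[symmetric] flip: norm_of_real) (metis abs_of_pos norm_mult norm_of_real)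
    also have "\<dots> \<le> (\<integral>\<^sup>+z. cmod (?R z) \<partial>lborel)"
      by (rule integral_norm_bound_ennreal[OF distr_reconstruction(1)[OF f \<phi>(1) atom_schwartz[OF \<psi>]]])
    also have "\<dots> \<le> (\<integral>\<^sup>+z. ennreal C * (?S (fst z) (snd z) * ennreal (decay N (fst z - y) * decay N (snd z - \<omega>))) \<partial>lborel)"
    proof (rule nn_integral_mono)
      fix z :: "'a \<times> 'a"
      have "cmod (?R z) \<le> (C * decay N (fst z - y) * decay N (snd z - \<omega>)) * cmod (f (atom \<phi> z))"
        unfolding norm_mult by (intro mult_right_mono W) auto
      then have "ennreal (cmod (?R z)) \<le> ennreal (C * (cmod (f (atom \<phi> z)) * (decay N (fst z - y) * decay N (snd z - \<omega>))))"
        by (intro ennreal_leI) (simp only: mult_ac)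
      then show "ennreal (cmod (?R z)) \<le> ennreal C * (?S (fst z) (snd z) * ennreal (decay N (fst z - y) * decay N (snd z - \<omega>)))"
        using C(1) by (simp add: ennreal_mult STFT_atom)
    qed
    also have "\<dots> = ennreal C * smear N ?S y \<omega>"
      unfolding smear_def STFT_atom prod.collapse by (rule nn_integral_cmult) measurable
    finally have "ennreal (1 / energy \<phi>) * ennreal (energy \<phi> * cmod (STFT \<psi> f y \<omega>)) \<le> ennreal (1 / energy \<phi>) * (ennreal C * smear N ?S y \<omega>)"
      by (rule mult_left_mono) simp
    moreover have "ennreal (1 / energy \<phi>) * ennreal (energy \<phi> * cmod (STFT \<psi> f y \<omega>)) = ennreal (cmod (STFT \<psi> f y \<omega>))"
      using e by (subst ennreal_mult[symmetric]) auto
    moreover have "ennreal (1 / energy \<phi>) * ennreal C = ennreal (C / energy \<phi>)"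
      using e C(1) by (subst ennreal_mult[symmetric]) auto
    ultimately show "ennreal (cmod (STFT \<psi> f y \<omega>)) \<le> ennreal (C / energy \<phi>) * smear N ?S y \<omega>"
      by (simp add: mult.assoc[symmetric])
  qed simp
qed

lemma STFT_measurable:
  assumes "f \<in> tempered_distr" "\<phi> \<in> schwartz"
  shows "case_prod (STFT \<phi> f) \<in> borel_measurable (borel \<Otimes>\<^sub>M borel)"
  using tempered_atom_measurable[OF assms] by (simp add: borel_prod STFT_atom case_prod_beta')

section \<open>Continuous representatives\<close>

lemma continuous_mult_bump_integrable:
  assumes F: "continuous_on UNIV F" and \<epsilon>: "0 < \<epsilon>"
  shows "integrable lborel (\<lambda>x. F x * of_real (bump a \<epsilon> x) :: complex)"
proof -
  have "bounded (F ` cball a \<epsilon>)"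
    by (intro compact_imp_bounded compact_continuous_image compact_cball continuous_on_subset[OF F]) auto
  then obtain C where "\<forall>x \<in> cball a \<epsilon>. cmod (F x) \<le> C" unfolding bounded_iff by auto
  then have C: "\<And>x. x \<in> cball a \<epsilon> \<Longrightarrow> cmod (F x) \<le> C" by blast
  have [measurable]: "F \<in> borel_measurable borel" by (rule borel_measurable_continuous_onI[OF F])
  note b = bump_schwartz[OF \<epsilon>, of a]
  have [measurable]: "(\<lambda>x. complex_of_real (bump a \<epsilon> x)) \<in> borel_measurable borel" by (rule schwartz_measurable[OF b])
  show ?thesis
  proof (rule Bochner_Integration.integrable_bound)
    show "integrable lborel (\<lambda>x. of_real C * complex_of_real (bump a \<epsilon> x))"
      using schwartz_integrable[OF b] by simp
    show "AE x in lborel. norm (F x * of_real (bump a \<epsilon> x)) \<le> norm (of_real C * complex_of_real (bump a \<epsilon> x))"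
    proof (rule AE_I2)
      fix x
      show "norm (F x * of_real (bump a \<epsilon> x)) \<le> norm (of_real C * complex_of_real (bump a \<epsilon> x))"
      proof (cases "x \<in> cball a \<epsilon>")
        case True
        then show ?thesis using C[OF True] by (auto simp: norm_mult bump_nonneg intro!: mult_right_mono order_trans[OF _ abs_ge_self])
      next
        case False
        then have "bump a \<epsilon> x = 0" using \<epsilon> by (intro bump_eq_0) (auto simp: dist_commute)
        then show ?thesis by simp
      qed
    qed
  qed measurable
qed

text \<open>A divergent integral has value 0, so that pairings of a fast growing function with general
  test functions say nothing about it. Compactly supported test functions do: a bump at a point
  where \<open>F\<close> and \<open>G\<close> differ separates them.\<close>

lemma distr_of_fun_inj:
  assumes F: "continuous_on UNIV F" and G: "continuous_on UNIV G" and eq: "distr_of_fun F = distr_of_fun G"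
  shows "F = G"
proof (rule ccontr)
  assume "F \<noteq> G"
  then obtain a where a: "F a \<noteq> G a" by auto
  \<comment> \<open>rotated so that the difference is real and positive at \<open>a\<close>\<close>
  define h where "h x = Re (cnj (F a - G a) * (F x - G x))" for x
  have h: "continuous_on UNIV h" unfolding h_def by (intro continuous_intros F G)
  have "h a = (cmod (F a - G a))\<^sup>2"
    unfolding h_def using complex_norm_square[of "F a - G a"] by (metis Re_complex_of_real mult.commute)
  then have "0 < h a" using a by simp
  moreover have "open {x. 0 < h x}" by (intro open_Collect_less h continuous_on_const)
  ultimately obtain \<epsilon> where \<epsilon>: "0 < \<epsilon>" "ball a \<epsilon> \<subseteq> {x. 0 < h x}" unfolding open_contains_ball by blast
  note b = bump_schwartz[OF \<epsilon>(1), of a]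
  note i = continuous_mult_bump_integrable[OF F \<epsilon>(1), of a] continuous_mult_bump_integrable[OF G \<epsilon>(1), of a]
  have "(LINT x|lborel. F x * of_real (bump a \<epsilon> x)) = (LINT x|lborel. G x * of_real (bump a \<epsilon> x))"
    using fun_cong[OF eq, of "\<lambda>x. of_real (bump a \<epsilon> x)"] b by (simp add: distr_of_fun_def)
  then have "(LINT x|lborel. F x * of_real (bump a \<epsilon> x) - G x * of_real (bump a \<epsilon> x)) = 0"
    using i by simp
  then have "(LINT x|lborel. cnj (F a - G a) * (F x * of_real (bump a \<epsilon> x) - G x * of_real (bump a \<epsilon> x))) = 0"
    by (simp only: integral_mult_right_zero) simp
  moreover have i': "integrable lborel (\<lambda>x. cnj (F a - G a) * (F x * of_real (bump a \<epsilon> x) - G x * of_real (bump a \<epsilon> x)))"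
    using i by (intro integrable_mult_right Bochner_Integration.integrable_diff)
  moreover have eq: "Re (cnj (F a - G a) * (F x * of_real (bump a \<epsilon> x) - G x * of_real (bump a \<epsilon> x))) = h x * bump a \<epsilon> x" for x
    unfolding h_def by (simp add: algebra_simps)
  ultimately have "(LINT x|lborel. h x * bump a \<epsilon> x) = 0"
    using integral_Re[OF i'] by (simp only: eq) simp
  moreover have "0 < (LINT x|lborel. h x * bump a \<epsilon> x)"
  proof (rule integral_pos_on_ball[OF _ _ \<epsilon>(1)])
    show "integrable lborel (\<lambda>x. h x * bump a \<epsilon> x)" using integrable_Re[OF i'] by (simp only: eq)
    show pos: "0 < h x * bump a \<epsilon> x" if "x \<in> ball a \<epsilon>" for x
      using that \<epsilon> bump_pos_iff[OF \<epsilon>(1), of a x] by (auto simp: dist_commute)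
    show "0 \<le> h x * bump a \<epsilon> x" for x
    proof (cases "x \<in> ball a \<epsilon>")
      case False
      then have "bump a \<epsilon> x = 0" using \<epsilon> by (intro bump_eq_0) (auto simp: dist_commute)
      then show ?thesis by simp
    qed (use pos in \<open>simp add: less_imp_le\<close>)
  qed
  ultimately show False by simp
qed

lemma cont_fun_distr_of_fun: "continuous_on UNIV F \<Longrightarrow> cont_fun (distr_of_fun F) = F"
  unfolding cont_fun_def by (rule the_equality) (auto dest: distr_of_fun_inj)

lemma bounded_mult_integrable:
  fixes F h :: "'a::euclidean_space \<Rightarrow> complex"
  assumes F: "continuous_on UNIV F" and B: "\<And>x. cmod (F x) \<le> B" and h: "integrable lborel h"
  shows "integrable lborel (\<lambda>x. F x * h x)"
proof (rule Bochner_Integration.integrable_bound)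
  have [measurable]: "F \<in> borel_measurable borel" by (rule borel_measurable_continuous_onI[OF F])
  have [measurable]: "h \<in> borel_measurable borel" using h by auto
  show "integrable lborel (\<lambda>x. of_real B * h x)" using h by simp
  show "(\<lambda>x. F x * h x) \<in> borel_measurable lborel" by measurable
  show "AE x in lborel. norm (F x * h x) \<le> norm (of_real B * h x)"
    using order_trans[OF B abs_ge_self] by (auto simp: norm_mult intro!: mult_right_mono)
qed

lemma distr_of_fun_tempered:
  fixes F :: "'a::euclidean_space \<Rightarrow> complex"
  assumes F: "continuous_on UNIV F" and B: "\<And>x. cmod (F x) \<le> B"
  shows "distr_of_fun F \<in> tempered_distr"
  unfolding tempered_distr_def
proof (intro CollectI conjI allI ballI impI)
  note i = bounded_mult_integrable[OF F B schwartz_integrable]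
  have B0: "0 \<le> B" by (rule order_trans[OF norm_ge_zero B[of 0]])
  show "distr_of_fun F \<theta> = 0" if "\<theta> \<notin> schwartz" for \<theta> using that by (simp add: distr_of_fun_def)
  show "distr_of_fun F (\<lambda>x. a * \<theta>\<^sub>1 x + b * \<theta>\<^sub>2 x) = a * distr_of_fun F \<theta>\<^sub>1 + b * distr_of_fun F \<theta>\<^sub>2"
    if "\<theta>\<^sub>1 \<in> schwartz" "\<theta>\<^sub>2 \<in> schwartz" for \<theta>\<^sub>1 \<theta>\<^sub>2 a b
  proof -
    have "(LINT x|lborel. F x * (a * \<theta>\<^sub>1 x + b * \<theta>\<^sub>2 x)) = (LINT x|lborel. a * (F x * \<theta>\<^sub>1 x) + b * (F x * \<theta>\<^sub>2 x))"
      by (simp add: algebra_simps)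
    also have "\<dots> = a * (LINT x|lborel. F x * \<theta>\<^sub>1 x) + b * (LINT x|lborel. F x * \<theta>\<^sub>2 x)"
      using i[OF that(1)] i[OF that(2)] by simp
    finally show ?thesis using that schwartz_lincomb[OF that, of a b] by (simp add: distr_of_fun_def)
  qed
  let ?N = "2 * DIM('a)"
  show "\<exists>C N. \<forall>\<theta>\<in>schwartz. cmod (distr_of_fun F \<theta>) \<le> C * schwartz_seminorm N \<theta>"
  proof (intro exI ballI)
    fix \<theta> :: "'a \<Rightarrow> complex" assume \<theta>: "\<theta> \<in> schwartz"
    obtain K where K: "\<And>bs x. set bs \<subseteq> Basis \<Longrightarrow> length bs \<le> ?N \<Longrightarrow> cmod (iter_deriv bs \<theta> x) \<le> K * decay ?N x"
      using schwartz_bound[OF \<theta>] by metis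
    have le: "cmod (\<theta> x) \<le> schwartz_seminorm ?N \<theta> * decay ?N x" for x
    proof -
      have "japanese x ^ ?N * cmod (iter_deriv [] \<theta> x) \<le> schwartz_seminorm ?N \<theta>"
        unfolding schwartz_seminorm_def
      proof (rule cSUP_upper2[where x = "([], x)"])
        have "japanese x ^ ?N * cmod (iter_deriv bs \<theta> x) \<le> K" if "set bs \<subseteq> Basis" "length bs \<le> ?N" for bs x
        proof -
          have "japanese x ^ ?N * cmod (iter_deriv bs \<theta> x) \<le> japanese x ^ ?N * (K * decay ?N x)"
            by (intro mult_left_mono K that) auto
          also have "\<dots> = K * (japanese x ^ ?N * decay ?N x)" by (rule mult.left_commute)
          finally show ?thesis by (simp only: japanese_power_mult_decay mult_1_right)
        qed
        then show "bdd_above ((\<lambda>(bs, x). japanese x ^ ?N * cmod (iter_deriv bs \<theta> x)) ` ({bs. set bs \<subseteq> Basis \<and> length bs \<le> ?N} \<times> UNIV))"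
          by (intro bdd_aboveI[of _ K]) auto
      qed auto
      then show ?thesis using le_decayI by (metis iter_deriv.simps(1))
    qed
    have "cmod (distr_of_fun F \<theta>) \<le> (LINT x|lborel. cmod (F x * \<theta> x))"
      using \<theta> by (simp add: distr_of_fun_def integral_norm_bound)
    also have "\<dots> \<le> (LINT x|lborel. (B * schwartz_seminorm ?N \<theta>) * decay ?N (x :: 'a))"
    proof (rule integral_mono)
      show "integrable lborel (\<lambda>x. cmod (F x * \<theta> x))" by (rule integrable_norm[OF i[OF \<theta>]])
      show "integrable lborel (\<lambda>x :: 'a. (B * schwartz_seminorm ?N \<theta>) * decay ?N x)"
        using decay_integrable[OF order_refl, where 'a = 'a] by simp
      show "cmod (F x * \<theta> x) \<le> (B * schwartz_seminorm ?N \<theta>) * decay ?N x" for x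
        using mult_mono[OF B le B0, of x x] by (simp add: norm_mult mult.assoc)
    qed
    also have "\<dots> = (B * (LINT x|lborel. decay ?N (x :: 'a))) * schwartz_seminorm ?N \<theta>" by (simp add: mult_ac)
    finally show "cmod (distr_of_fun F \<theta>) \<le> (B * (LINT x|lborel. decay ?N (x :: 'a))) * schwartz_seminorm ?N \<theta>" .
  qed
qed

lemma STFT_distr_of_fun:
  assumes "\<phi> \<in> schwartz"
  shows "STFT \<phi> (distr_of_fun F) x \<xi> = fourier (\<lambda>t. F t * cnj (\<phi> (t - x))) \<xi>"
  using atom_schwartz[OF assms, of "(x, \<xi>)"]
  by (simp add: STFT_atom distr_of_fun_def fourier_def atom_def mult_ac)

lemma STFT_diff: "STFT \<phi> (\<lambda>\<theta>. f \<theta> - g \<theta>) x \<xi> = STFT \<phi> f x \<xi> - STFT \<phi> g x \<xi>"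
  by (simp add: STFT_atom)

lemma STFT_distr_modulate: "STFT \<phi> (distr_modulate \<eta> f) x \<xi> = STFT \<phi> f x (\<xi> - \<eta>)"
proof -
  have "modulate \<eta> (atom \<phi> (x, \<xi>)) = atom \<phi> (x, \<xi> - \<eta>)"
    by (simp add: modulate_def atom_def fun_eq_iff mult.assoc[symmetric] cis_mult inner_diff_right)
  then show ?thesis by (simp add: STFT_atom distr_modulate_def)
qed

lemma modulate_schwartz_iff: "modulate \<eta> \<theta> \<in> schwartz \<longleftrightarrow> \<theta> \<in> schwartz"
proof
  assume "modulate \<eta> \<theta> \<in> schwartz"
  then have "(\<lambda>t. cis (t \<bullet> (- \<eta>)) * modulate \<eta> \<theta> t) \<in> schwartz" by (rule schwartz_modulate)
  then show "\<theta> \<in> schwartz" by (simp add: modulate_def mult.assoc[symmetric] cis_mult)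
qed (simp add: modulate_def schwartz_modulate)

lemma distr_modulate_of_fun: "distr_modulate \<eta> (distr_of_fun F) = distr_of_fun (\<lambda>t. cis (t \<bullet> \<eta>) * F t)"
  by (rule ext) (simp add: distr_modulate_def distr_of_fun_def modulate_schwartz_iff, simp add: modulate_def mult_ac)

section \<open>Modulation spaces\<close>

lemma japanese_le_1_plus_norm: "japanese x \<le> 1 + norm x"
  unfolding japanese_def by (rule real_le_lsqrt) (auto simp: power2_sum)

lemma norm_LINT_le:
  fixes f :: "'a \<Rightarrow> complex"
  shows "ennreal (cmod (integral\<^sup>L N f)) \<le> (\<integral>\<^sup>+x. ennreal (cmod (f x)) \<partial>N)"
  by (cases "integrable N f") (auto intro: integral_norm_bound_ennreal simp: not_integrable_integral_eq)

locale modulation_window =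
  fixes \<phi>\<^sub>0 :: "'a::euclidean_space \<Rightarrow> complex" and r s :: real
  assumes \<phi>\<^sub>0: "\<phi>\<^sub>0 \<in> schwartz" "\<phi>\<^sub>0 \<noteq> (\<lambda>_. 0)" and r: "1 \<le> r" and s: "0 \<le> s"
begin

abbreviation V :: "'a distr \<Rightarrow> 'a \<Rightarrow> 'a \<Rightarrow> ennreal"
  where "V f x \<xi> \<equiv> ennreal (cmod (STFT \<phi>\<^sub>0 f x \<xi>))"

definition M :: "'a distr set" where "M = modulation_space \<phi>\<^sub>0 (ennreal r) 1 s"

text \<open>The number of powers of decay that make the smearing operator bounded in the norm of weight
  \<open>s\<close>.\<close>

definition smoothing_order :: nat where "smoothing_order = 2 * DIM('a) + nat \<lceil>s\<rceil>"

lemma M_iff: "f \<in> M \<longleftrightarrow> f \<in> tempered_distr \<and> mixed_norm r s (V f) < top"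
  by (simp add: M_def modulation_space_def modulation_norm_eq)

lemma V_measurable:
  assumes "f \<in> tempered_distr"
  shows "case_prod (V f) \<in> borel_measurable (borel \<Otimes>\<^sub>M borel)"
proof -
  note STFT_measurable[OF assms \<phi>\<^sub>0(1), measurable]
  show ?thesis by measurable
qed

lemma mixed_norm_smear_finite:
  fixes K :: "'a \<Rightarrow> 'a \<Rightarrow> ennreal"
  assumes [measurable]: "case_prod K \<in> borel_measurable (borel \<Otimes>\<^sub>M borel)" and "mixed_norm r s K < top"
  shows "mixed_norm r s (smear smoothing_order K) < top"
proof -
  have "2 * DIM('a) + nat \<lceil>s\<rceil> \<le> smoothing_order" by (simp add: smoothing_order_def)
  then show ?thesis
  proof (rule mixed_norm_smear[OF r s])
    fix C :: ennreal
    assume C: "C < top" and *: "\<And>K :: 'a \<Rightarrow> 'a \<Rightarrow> ennreal. case_prod K \<in> borel_measurable (borel \<Otimes>\<^sub>M borel) \<Longrightarrow>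
      mixed_norm r s (smear smoothing_order K) \<le> C * mixed_norm r s K"
    from C assms(2) have "C * mixed_norm r s K < top" by (simp add: ennreal_mult_less_top)
    then show ?thesis by (rule le_less_trans[OF *[OF assms(1)]])
  qed
qed

lemma one_le_japanese_powr: "1 \<le> japanese \<xi> powr s"
  using s japanese_ge_1[of \<xi>] by (simp add: ge_one_powr_ge_zero)

lemma nn_integral_Lebesgue_norm_finite:
  fixes K :: "'a \<Rightarrow> 'a \<Rightarrow> ennreal"
  assumes "mixed_norm r s K < top"
  shows "(\<integral>\<^sup>+\<xi>. Lebesgue_norm (ennreal r) (\<lambda>x. K x \<xi>) \<partial>lborel) < top"
proof (rule le_less_trans[OF _ assms])
  show "(\<integral>\<^sup>+\<xi>. Lebesgue_norm (ennreal r) (\<lambda>x. K x \<xi>) \<partial>lborel) \<le> mixed_norm r s K"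
    unfolding mixed_norm_def
  proof (rule nn_integral_mono)
    fix \<xi> :: 'a
    have "ennreal 1 \<le> ennreal (japanese \<xi> powr s)" by (intro ennreal_leI one_le_japanese_powr)
    then have "1 * Lebesgue_norm (ennreal r) (\<lambda>x. K x \<xi>) \<le> ennreal (japanese \<xi> powr s) * Lebesgue_norm (ennreal r) (\<lambda>x. K x \<xi>)"
      by (intro mult_right_mono) auto
    then show "Lebesgue_norm (ennreal r) (\<lambda>x. K x \<xi>) \<le> ennreal (japanese \<xi> powr s) * Lebesgue_norm (ennreal r) (\<lambda>x. K x \<xi>)" by simp
  qed
qed

text \<open>The change of window followed by the supremum bound for smeared functions. The majorant is the
  convolution in frequency of the norms of the slices with \<open>\<langle>\<xi>\<rangle>\<^sup>-\<^sup>N\<close>, which keeps their weighted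
  integrability.\<close>

lemma STFT_frequency_majorant:
  assumes f: "f \<in> M" and \<psi>: "\<psi> \<in> schwartz"
  obtains \<sigma> :: "'a \<Rightarrow> ennreal" where "\<sigma> \<in> borel_measurable borel"
    "(\<integral>\<^sup>+\<omega>. \<sigma> \<omega> * ennreal ((2 * japanese \<omega>) powr s) \<partial>lborel) < top"
    "\<And>y \<omega>. ennreal (cmod (STFT \<psi> f y \<omega>)) \<le> \<sigma> \<omega>"
proof -
  have ft: "f \<in> tempered_distr" and fin: "mixed_norm r s (V f) < top" using f by (auto simp: M_iff)
  note Vm[measurable] = V_measurable[OF ft]
  let ?G = "\<lambda>\<xi>. Lebesgue_norm (ennreal r) (\<lambda>x. V f x \<xi>)"
  note [measurable] = Lebesgue_norm_slice_measurable[OF r Vm]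
  obtain C1 where C1: "C1 < top" "\<And>y \<omega>. ennreal (cmod (STFT \<psi> f y \<omega>)) \<le> C1 * smear smoothing_order (V f) y \<omega>"
    using STFT_change_of_window[OF \<phi>\<^sub>0 \<psi>] ft by metis
  obtain C2 where C2: "C2 < top" "\<And>y \<omega>. smear smoothing_order (V f) y \<omega> \<le> C2 * (\<integral>\<^sup>+\<xi>. ?G \<xi> * ennreal (decay smoothing_order (\<xi> - \<omega>)) \<partial>lborel)"
  proof (rule smear_sup_bound[OF r])
    show "2 * DIM('a) \<le> smoothing_order" by (simp add: smoothing_order_def)
    fix C2 :: ennreal
    assume "C2 < top" and *: "\<And>(K :: 'a \<Rightarrow> 'a \<Rightarrow> ennreal) y \<omega>. case_prod K \<in> borel_measurable (borel \<Otimes>\<^sub>M borel) \<Longrightarrow>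
      smear smoothing_order K y \<omega> \<le> C2 * (\<integral>\<^sup>+\<xi>. Lebesgue_norm (ennreal r) (\<lambda>x. K x \<xi>) * ennreal (decay smoothing_order (\<xi> - \<omega>)) \<partial>lborel)"
    then show thesis using that[OF _ *[OF Vm]] by simp
  qed
  define \<sigma> where "\<sigma> \<omega> = C1 * (C2 * (\<integral>\<^sup>+\<xi>. ?G \<xi> * ennreal (decay smoothing_order (\<xi> - \<omega>)) \<partial>lborel))" for \<omega>
  show ?thesis
  proof (rule that[of \<sigma>])
    show m: "\<sigma> \<in> borel_measurable borel" unfolding \<sigma>_def by measurable
    show "ennreal (cmod (STFT \<psi> f y \<omega>)) \<le> \<sigma> \<omega>" for y \<omega>
      unfolding \<sigma>_def by (rule order_trans[OF C1(2)[of y \<omega>]]) (intro mult_left_mono C2, simp)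
    let ?w = "\<lambda>\<omega> :: 'a. ennreal ((2 * japanese \<omega>) powr s)"
    let ?c = "\<integral>\<^sup>+\<xi>. ennreal (decay smoothing_order \<xi> * (2 * japanese \<xi>) powr s) \<partial>(lborel :: 'a measure)"
    have c: "?c < top" unfolding smoothing_order_def by (rule nn_integral_decay_powr[OF s order_refl])
    have "(\<integral>\<^sup>+\<omega>. \<sigma> \<omega> * ?w \<omega> \<partial>lborel) = (\<integral>\<^sup>+\<omega>. (C1 * C2) * (\<integral>\<^sup>+\<xi>. ?G \<xi> * ennreal (decay smoothing_order (\<xi> - \<omega>)) * ?w \<omega> \<partial>lborel) \<partial>lborel)"
    proof (rule nn_integral_cong)
      fix \<omega>
      have inner: "(\<integral>\<^sup>+\<xi>. ?G \<xi> * ennreal (decay smoothing_order (\<xi> - \<omega>)) * ?w \<omega> \<partial>lborel)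
        = (\<integral>\<^sup>+\<xi>. ?G \<xi> * ennreal (decay smoothing_order (\<xi> - \<omega>)) \<partial>lborel) * ?w \<omega>"
        by (rule nn_integral_multc) measurable
      show "\<sigma> \<omega> * ?w \<omega> = (C1 * C2) * (\<integral>\<^sup>+\<xi>. ?G \<xi> * ennreal (decay smoothing_order (\<xi> - \<omega>)) * ?w \<omega> \<partial>lborel)"
        unfolding inner \<sigma>_def by (simp only: mult.assoc)
    qed
    also have "\<dots> = C1 * (C2 * (\<integral>\<^sup>+\<omega>. (\<integral>\<^sup>+\<xi>. ?G \<xi> * ennreal (decay smoothing_order (\<xi> - \<omega>)) * ?w \<omega> \<partial>lborel) \<partial>lborel))"
      by (subst nn_integral_cmult) (auto simp: mult.assoc)
    also have "(\<integral>\<^sup>+\<omega>. (\<integral>\<^sup>+\<xi>. ?G \<xi> * ennreal (decay smoothing_order (\<xi> - \<omega>)) * ?w \<omega> \<partial>lborel) \<partial>lborel)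
      = (\<integral>\<^sup>+\<xi>. (\<integral>\<^sup>+\<omega>. ?G \<xi> * ennreal (decay smoothing_order (\<xi> - \<omega>)) * ?w \<omega> \<partial>lborel) \<partial>lborel)"
      by (rule lborel_pair.Fubini'[symmetric]) measurable
    also have "\<dots> \<le> (\<integral>\<^sup>+\<xi>. ennreal (2 powr s) * (ennreal (japanese \<xi> powr s) * ?G \<xi>) * ?c \<partial>lborel)"
    proof (rule nn_integral_mono)
      fix \<xi>
      have "(\<integral>\<^sup>+\<omega>. ?G \<xi> * ennreal (decay smoothing_order (\<xi> - \<omega>)) * ?w \<omega> \<partial>lborel)
        \<le> (\<integral>\<^sup>+\<omega>. (ennreal (2 powr s) * (ennreal (japanese \<xi> powr s) * ?G \<xi>)) * ennreal (decay smoothing_order (\<omega> + - \<xi>) * (2 * japanese (\<omega> + - \<xi>)) powr s) \<partial>lborel)"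
      proof (rule nn_integral_mono)
        fix \<omega>
        have "japanese \<omega> \<le> 2 * japanese \<xi> * japanese (\<omega> - \<xi>)" using japanese_add_le[of \<xi> "\<omega> - \<xi>"] by simp
        then have "(2 * japanese \<omega>) powr s \<le> (2 * (2 * japanese \<xi> * japanese (\<omega> - \<xi>))) powr s" using s by (intro powr_mono2) auto
        also have "\<dots> = 2 powr s * japanese \<xi> powr s * (2 * japanese (\<omega> - \<xi>)) powr s" by (simp add: powr_mult[symmetric] mult_ac)
        finally have "decay smoothing_order (\<xi> - \<omega>) * (2 * japanese \<omega>) powr s \<le> decay smoothing_order (\<xi> - \<omega>) * (2 powr s * japanese \<xi> powr s * (2 * japanese (\<omega> - \<xi>)) powr s)"
          by (intro mult_left_mono) auto
        also have "\<dots> = 2 powr s * japanese \<xi> powr s * (decay smoothing_order (\<omega> - \<xi>) * (2 * japanese (\<omega> - \<xi>)) powr s)"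
          by (simp add: decay_commute[of smoothing_order \<xi>] mult_ac)
        finally have "ennreal (decay smoothing_order (\<xi> - \<omega>)) * ?w \<omega> \<le> ennreal (2 powr s) * ennreal (japanese \<xi> powr s) * ennreal (decay smoothing_order (\<omega> + - \<xi>) * (2 * japanese (\<omega> + - \<xi>)) powr s)"
          by (simp add: ennreal_mult[symmetric] ennreal_leI)
        then have "?G \<xi> * (ennreal (decay smoothing_order (\<xi> - \<omega>)) * ?w \<omega>) \<le> ?G \<xi> * (ennreal (2 powr s) * ennreal (japanese \<xi> powr s) * ennreal (decay smoothing_order (\<omega> + - \<xi>) * (2 * japanese (\<omega> + - \<xi>)) powr s))"
          by (rule mult_left_mono) simp
        then show "?G \<xi> * ennreal (decay smoothing_order (\<xi> - \<omega>)) * ?w \<omega>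
          \<le> (ennreal (2 powr s) * (ennreal (japanese \<xi> powr s) * ?G \<xi>)) * ennreal (decay smoothing_order (\<omega> + - \<xi>) * (2 * japanese (\<omega> + - \<xi>)) powr s)"
          by (simp only: mult_ac)
      qed
      also have "\<dots> = (ennreal (2 powr s) * (ennreal (japanese \<xi> powr s) * ?G \<xi>)) * (\<integral>\<^sup>+\<omega>. ennreal (decay smoothing_order (\<omega> + - \<xi>) * (2 * japanese (\<omega> + - \<xi>)) powr s) \<partial>lborel)"
        by (rule nn_integral_cmult) measurable
      also have "(\<integral>\<^sup>+\<omega>. ennreal (decay smoothing_order (\<omega> + - \<xi>) * (2 * japanese (\<omega> + - \<xi>)) powr s) \<partial>lborel) = ?c"
        by (rule nn_integral_lborel_shift) measurable
      finally show "(\<integral>\<^sup>+\<omega>. ?G \<xi> * ennreal (decay smoothing_order (\<xi> - \<omega>)) * ?w \<omega> \<partial>lborel)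
        \<le> ennreal (2 powr s) * (ennreal (japanese \<xi> powr s) * ?G \<xi>) * ?c" .
    qed
    also have "\<dots> = ennreal (2 powr s) * mixed_norm r s (V f) * ?c"
      unfolding mixed_norm_def by (simp add: nn_integral_cmult nn_integral_multc)
    finally have "(\<integral>\<^sup>+\<omega>. \<sigma> \<omega> * ?w \<omega> \<partial>lborel) \<le> C1 * (C2 * (ennreal (2 powr s) * mixed_norm r s (V f) * ?c))"
      by (simp add: mult_left_mono)
    also have "\<dots> < top" using C1 C2 c fin by (simp add: ennreal_mult_less_top)
    finally show "(\<integral>\<^sup>+\<omega>. \<sigma> \<omega> * ?w \<omega> \<partial>lborel) < top" .
  qed
qed

lemma majorant_integrable:
  assumes \<sigma>: "\<sigma> \<in> borel_measurable borel" "(\<integral>\<^sup>+\<omega>. \<sigma> \<omega> * ennreal ((2 * japanese \<omega>) powr s) \<partial>lborel) < top"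
    and h: "h \<in> borel_measurable borel" "\<And>\<omega>. ennreal (cmod (h \<omega>)) \<le> \<sigma> \<omega>"
  shows "integrable lborel (h :: 'a \<Rightarrow> complex)"
proof (rule integrableI_bounded)
  have "(\<integral>\<^sup>+\<omega>. ennreal (norm (h \<omega>)) \<partial>lborel) \<le> (\<integral>\<^sup>+\<omega>. \<sigma> \<omega> * ennreal ((2 * japanese \<omega>) powr s) \<partial>lborel)"
  proof (rule nn_integral_mono)
    fix \<omega> :: 'a
    have "1 \<le> (2 * japanese \<omega>) powr s" using s japanese_ge_1[of \<omega>] by (intro ge_one_powr_ge_zero) auto
    then have "ennreal 1 \<le> ennreal ((2 * japanese \<omega>) powr s)" by (rule ennreal_leI)
    then have "\<sigma> \<omega> * 1 \<le> \<sigma> \<omega> * ennreal ((2 * japanese \<omega>) powr s)" by (intro mult_left_mono) auto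
    then show "ennreal (norm (h \<omega>)) \<le> \<sigma> \<omega> * ennreal ((2 * japanese \<omega>) powr s)" using h(2)[of \<omega>] by simp
  qed
  then show "(\<integral>\<^sup>+\<omega>. ennreal (norm (h \<omega>)) \<partial>lborel) < \<infinity>" using \<sigma>(2) by simp
qed (use h in simp)

text \<open>In the reconstruction formula the kernel is itself an integral over \<open>u\<close>. Exchanging the two
  integrals exhibits \<open>f\<close> as integration against the continuous function \<open>F\<close> given by the integral
  over phase space. That integral converges absolutely although \<open>V f\<close> is only in \<open>L\<^sup>p\<close> as a function
  of \<open>x\<close>, since the window decays in \<open>x\<close>; the bound \<open>D\<close> is uniform in \<open>u\<close>.\<close>

theorem continuous_representative:
  assumes f: "f \<in> M"
  obtains F B where "continuous_on UNIV F" "\<And>x. cmod (F x) \<le> B" "f = distr_of_fun F"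
proof -
  have ft: "f \<in> tempered_distr" and fin: "mixed_norm r s (V f) < top" using f by (auto simp: M_iff)
  note Vm[measurable] = V_measurable[OF ft]
  note Sm[measurable] = STFT_measurable[OF ft \<phi>\<^sub>0(1)] and \<phi>m[measurable] = schwartz_measurable[OF \<phi>\<^sub>0(1)]
  let ?N = "2 * DIM('a)"
  let ?G = "\<lambda>\<xi>. Lebesgue_norm (ennreal r) (\<lambda>x. V f x \<xi>)"
  obtain B0 where B0: "0 \<le> B0" "\<And>x. cmod (\<phi>\<^sub>0 x) \<le> B0 * decay ?N x" using schwartz_bound0[OF \<phi>\<^sub>0(1)] by blast
  let ?W = "\<integral>\<^sup>+x. ennreal (decay ?N x) \<partial>(lborel :: 'a measure)"
  have W: "?W < top" by (rule nn_integral_decay[OF order_refl])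
  obtain C where C: "C < top" and
    *: "\<And>w k :: 'a \<Rightarrow> ennreal. w \<in> borel_measurable lborel \<Longrightarrow> k \<in> borel_measurable lborel \<Longrightarrow>
      (\<And>x. w x \<le> 1) \<Longrightarrow> (\<integral>\<^sup>+x. w x \<partial>lborel) \<le> ?W \<Longrightarrow>
      (\<integral>\<^sup>+x. k x * w x \<partial>lborel) \<le> C * Lebesgue_norm (ennreal r) k"
    using integral_weight_le_Lebesgue_norm[OF r ennreal_one_less_top W] by blast
  define D where "D = C * (\<integral>\<^sup>+\<xi>. ?G \<xi> \<partial>lborel)"
  have D: "D < top" unfolding D_def using C nn_integral_Lebesgue_norm_finite[OF fin] by (simp add: ennreal_mult_less_top)
  have Dle: "(\<integral>\<^sup>+z. V f (fst z) (snd z) * ennreal (decay ?N (u - fst z)) \<partial>lborel) \<le> D" for u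
  proof -
    have "(\<integral>\<^sup>+z. V f (fst z) (snd z) * ennreal (decay ?N (u - fst z)) \<partial>lborel)
      = (\<integral>\<^sup>+\<xi>. (\<integral>\<^sup>+x. V f x \<xi> * ennreal (decay ?N (u - x)) \<partial>lborel) \<partial>lborel)"
      by (rule nn_integral_lborel_pair(2)) measurable
    also have "\<dots> \<le> (\<integral>\<^sup>+\<xi>. C * ?G \<xi> \<partial>lborel)"
    proof (rule nn_integral_mono)
      fix \<xi>
      note [measurable] = measurable_slices[OF Vm]
      have "(\<integral>\<^sup>+x. ennreal (decay ?N (u - x)) \<partial>lborel) \<le> ?W"
        using nn_integral_lborel_shift[of "\<lambda>x. ennreal (decay ?N x)" "- u"] by (simp add: decay_commute[of _ u])
      moreover have "ennreal (decay ?N (u - x)) \<le> 1" for x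
        using decay_le_1[of ?N "u - x"] by (simp add: ennreal_leI flip: ennreal_1)
      ultimately show "(\<integral>\<^sup>+x. V f x \<xi> * ennreal (decay ?N (u - x)) \<partial>lborel) \<le> C * ?G \<xi>"
        by (intro *) measurable
    qed
    also have "\<dots> = D"
      unfolding D_def using Lebesgue_norm_slice_measurable[OF r Vm] by (intro nn_integral_cmult) simp
    finally show ?thesis .
  qed
  define k where "k u z = cis (u \<bullet> snd z) * \<phi>\<^sub>0 (u - fst z) * STFT \<phi>\<^sub>0 f (fst z) (snd z)" for u z
  have km[measurable]: "case_prod k \<in> borel_measurable (borel \<Otimes>\<^sub>M borel)" unfolding k_def by measurable
  have kb: "ennreal (cmod (k u z)) \<le> ennreal B0 * (V f (fst z) (snd z) * ennreal (decay ?N (u - fst z)))" for u z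
  proof -
    have "cmod (k u z) \<le> B0 * decay ?N (u - fst z) * cmod (STFT \<phi>\<^sub>0 f (fst z) (snd z))"
      unfolding k_def norm_mult norm_cis mult_1 by (intro mult_right_mono B0) simp
    then have "ennreal (cmod (k u z)) \<le> ennreal (B0 * (cmod (STFT \<phi>\<^sub>0 f (fst z) (snd z)) * decay ?N (u - fst z)))"
      by (intro ennreal_leI) (simp only: mult_ac)
    then show ?thesis using B0(1) by (simp add: ennreal_mult)
  qed
  have kD: "(\<integral>\<^sup>+z. ennreal (cmod (k u z)) \<partial>lborel) \<le> ennreal B0 * D" for u
  proof -
    have "(\<integral>\<^sup>+z. ennreal (cmod (k u z)) \<partial>lborel) \<le> (\<integral>\<^sup>+z. ennreal B0 * (V f (fst z) (snd z) * ennreal (decay ?N (u - fst z))) \<partial>lborel)"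
      by (intro nn_integral_mono kb)
    also have "\<dots> = ennreal B0 * (\<integral>\<^sup>+z. V f (fst z) (snd z) * ennreal (decay ?N (u - fst z)) \<partial>lborel)"
      by (rule nn_integral_cmult) measurable
    also have "\<dots> \<le> ennreal B0 * D" by (intro mult_left_mono Dle) simp
    finally show ?thesis .
  qed
  have ki: "integrable lborel (k u)" for u
  proof (rule integrableI_bounded)
    show "(\<integral>\<^sup>+z. ennreal (norm (k u z)) \<partial>lborel) < \<infinity>"
      using le_less_trans[OF kD[of u], of top] D by (simp add: ennreal_mult_less_top)
  qed measurable
  obtain B1 where B1: "ennreal B0 * D = ennreal B1" "0 \<le> B1" using D by (cases "ennreal B0 * D") (auto simp: ennreal_mult_eq_top_iff)
  let ?e = "of_real (energy \<phi>\<^sub>0) :: complex"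
  have e: "0 < energy \<phi>\<^sub>0" by (rule energy_pos[OF \<phi>\<^sub>0])
  define F where "F u = (LINT z|lborel. k u z) / ?e" for u
  show ?thesis
  proof (rule that[of F "B1 / energy \<phi>\<^sub>0"])
    show "cmod (F u) \<le> B1 / energy \<phi>\<^sub>0" for u
    proof -
      have "ennreal (cmod (LINT z|lborel. k u z)) \<le> ennreal B1"
        using order_trans[OF integral_norm_bound_ennreal[OF ki[of u]] kD[of u]] by (simp only: B1)
      then have "cmod (LINT z|lborel. k u z) \<le> B1" using B1(2) by (simp add: ennreal_le_iff)
      then show ?thesis using e by (simp add: F_def norm_divide divide_right_mono)
    qed
    have "(\<lambda>i. LINT z|lborel. k (u i) z) \<longlonglongrightarrow> (LINT z|lborel. k a z)" if lim: "u \<longlonglongrightarrow> a" for u a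
    proof -
      obtain R where R: "\<And>i. norm (u i - a) \<le> R"
        using Bseq_eq_bounded[of "\<lambda>i. u i - a"] convergent_imp_Bseq[of "\<lambda>i. u i - a"] lim
        by (metis BseqE LIM_zero convergentI)
      \<comment> \<open>Peetre's inequality compares the windows at \<open>u i\<close> and at the limit \<open>a\<close>\<close>
      define L where "L = (2 * (1 + R)) ^ ?N"
      have R0: "0 \<le> R" using R[of 0] norm_ge_zero order_trans by blast
      define w where "w z = L * B0 * (cmod (STFT \<phi>\<^sub>0 f (fst z) (snd z)) * decay ?N (a - fst z))" for z
      show ?thesis
      proof (rule integral_dominated_convergence[where w = w])
        show "integrable lborel w"
        proof (rule integrableI_bounded)
          have "(\<integral>\<^sup>+z. ennreal (norm (w z)) \<partial>lborel) = (\<integral>\<^sup>+z. ennreal (L * B0) * (V f (fst z) (snd z) * ennreal (decay ?N (a - fst z))) \<partial>lborel)"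
            unfolding w_def L_def using B0(1) R0 by (intro nn_integral_cong) (simp add: ennreal_mult abs_mult)
          also have "\<dots> = ennreal (L * B0) * (\<integral>\<^sup>+z. V f (fst z) (snd z) * ennreal (decay ?N (a - fst z)) \<partial>lborel)"
            by (rule nn_integral_cmult) measurable
          also have "\<dots> < top" using le_less_trans[OF Dle D] by (simp add: ennreal_mult_less_top)
          finally show "(\<integral>\<^sup>+z. ennreal (norm (w z)) \<partial>lborel) < \<infinity>" by simp
        qed (unfold w_def, measurable)
        show "AE z in lborel. norm (k (u i) z) \<le> w z" for i
        proof (rule AE_I2)
          fix z :: "'a \<times> 'a"
          have "(2 * japanese (a - u i)) ^ ?N \<le> L"
            unfolding L_def using japanese_le_1_plus_norm[of "a - u i"] R[of i]
            by (intro power_mono mult_left_mono) (auto simp: norm_minus_commute)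
          moreover have "decay ?N (u i - fst z) \<le> (2 * japanese (a - u i)) ^ ?N * decay ?N (a - fst z)"
            using decay_peetre[of ?N "u i - fst z" "a - u i"] by simp
          ultimately have "decay ?N (u i - fst z) \<le> L * decay ?N (a - fst z)"
            using mult_right_mono[OF _ decay_nonneg] order_trans by blast
          then have "B0 * decay ?N (u i - fst z) \<le> B0 * (L * decay ?N (a - fst z))" using B0(1) by (rule mult_left_mono)
          then have "cmod (\<phi>\<^sub>0 (u i - fst z)) \<le> B0 * (L * decay ?N (a - fst z))" using B0(2)[of "u i - fst z"] by linarith
          then have "norm (k (u i) z) \<le> B0 * (L * decay ?N (a - fst z)) * cmod (STFT \<phi>\<^sub>0 f (fst z) (snd z))"
            unfolding k_def norm_mult norm_cis mult_1 by (rule mult_right_mono) simp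
          then show "norm (k (u i) z) \<le> w z" unfolding w_def by (simp only: mult_ac)
        qed
        show "AE z in lborel. (\<lambda>i. k (u i) z) \<longlonglongrightarrow> k a z"
        proof (rule AE_I2)
          fix z :: "'a \<times> 'a"
          have "(\<lambda>i. \<phi>\<^sub>0 (u i - fst z)) \<longlonglongrightarrow> \<phi>\<^sub>0 (a - fst z)"
            by (rule continuous_on_tendsto_compose[OF schwartz_continuous[OF \<phi>\<^sub>0(1), of UNIV]]) (auto intro!: tendsto_intros lim)
          then show "(\<lambda>i. k (u i) z) \<longlonglongrightarrow> k a z" unfolding k_def by (intro tendsto_intros lim)
        qed
      qed measurable
    qed
    then have "(\<lambda>i. F (u i)) \<longlonglongrightarrow> F a" if "u \<longlonglongrightarrow> a" for u a
      unfolding F_def using e that by (intro tendsto_divide tendsto_const) auto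
    then show cF: "continuous_on UNIV F"
      by (simp add: continuous_on_sequentially o_def)
    show "f = distr_of_fun F"
    proof
      fix \<theta>
      show "f \<theta> = distr_of_fun F \<theta>"
      proof (cases "\<theta> \<in> schwartz")
        case False
        then show ?thesis using ft by (simp add: tempered_distr_def distr_of_fun_def)
      next
        case True
        note \<theta>m[measurable] = schwartz_measurable[OF True]
        have "?e * f \<theta> = (LINT z|lborel. reconstruction_kernel \<phi>\<^sub>0 \<theta> z * f (atom \<phi>\<^sub>0 z))"
          by (rule distr_reconstruction(2)[OF ft \<phi>\<^sub>0(1) True])
        also have "\<dots> = (LINT z|lborel. (LINT u|lborel. k u z * \<theta> u))"
        proof (intro Bochner_Integration.integral_cong refl)
          fix z :: "'a \<times> 'a"
          have "reconstruction_kernel \<phi>\<^sub>0 \<theta> z * f (atom \<phi>\<^sub>0 z) = f (atom \<phi>\<^sub>0 z) * (LINT u|lborel. cis (u \<bullet> snd z) * (\<phi>\<^sub>0 (u - fst z) * \<theta> u))"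
            by (simp add: reconstruction_kernel_def fourier_def)
          also have "\<dots> = (LINT u|lborel. f (atom \<phi>\<^sub>0 z) * (cis (u \<bullet> snd z) * (\<phi>\<^sub>0 (u - fst z) * \<theta> u)))"
            by (rule integral_mult_right_zero[symmetric])
          also have "\<dots> = (LINT u|lborel. k u z * \<theta> u)"
            by (simp add: k_def STFT_atom mult_ac)
          finally show "reconstruction_kernel \<phi>\<^sub>0 \<theta> z * f (atom \<phi>\<^sub>0 z) = (LINT u|lborel. k u z * \<theta> u)" .
        qed
        also have "\<dots> = (LINT u|lborel. (LINT z|lborel. k u z * \<theta> u))"
        proof (rule lborel_Fubini(2)[symmetric])
          have "(\<integral>\<^sup>+u. (\<integral>\<^sup>+z. ennreal (norm (k u z * \<theta> u)) \<partial>lborel) \<partial>lborel) = (\<integral>\<^sup>+u. (\<integral>\<^sup>+z. ennreal (norm (k u z)) \<partial>lborel) * ennreal (norm (\<theta> u)) \<partial>lborel)"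
            by (simp add: norm_mult ennreal_mult nn_integral_multc)
          also have "\<dots> \<le> (\<integral>\<^sup>+u. ennreal B1 * ennreal (norm (\<theta> u)) \<partial>lborel)"
            using kD unfolding B1(1) by (intro nn_integral_mono mult_right_mono) auto
          also have "\<dots> = ennreal B1 * (\<integral>\<^sup>+u. ennreal (norm (\<theta> u)) \<partial>lborel)" by (rule nn_integral_cmult) measurable
          also have "\<dots> < top" using schwartz_integrable[OF True] by (simp add: integrable_iff_bounded ennreal_mult_less_top)
          finally show "(\<integral>\<^sup>+u. (\<integral>\<^sup>+z. ennreal (norm (k u z * \<theta> u)) \<partial>lborel) \<partial>lborel) < top" .
        qed measurable
        also have "\<dots> = (LINT u|lborel. ?e * (F u * \<theta> u))"
          using e by (simp add: F_def)
        also have "\<dots> = ?e * distr_of_fun F \<theta>" using True by (simp add: distr_of_fun_def)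
        finally show ?thesis using e by simp
      qed
    qed
  qed
qed

end

lemma windowed_integrable:
  assumes F: "continuous_on UNIV F" and B: "\<And>x. cmod (F x) \<le> B" and \<psi>: "\<psi> \<in> schwartz"
  shows "integrable lborel (\<lambda>t. F t * cnj (\<psi> (t - x)))"
    "continuous_on UNIV (\<lambda>t. F t * cnj (\<psi> (t - x)))"
    "\<exists>B'. \<forall>t. cmod (F t * cnj (\<psi> (t - x))) \<le> B'"
proof -
  have c: "(\<lambda>t. cnj (\<psi> (t - x))) \<in> schwartz" by (intro schwartz_cnj schwartz_translate \<psi>)
  show "integrable lborel (\<lambda>t. F t * cnj (\<psi> (t - x)))"
    by (rule bounded_mult_integrable[OF F B schwartz_integrable[OF c]])
  show "continuous_on UNIV (\<lambda>t. F t * cnj (\<psi> (t - x)))"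
    by (intro continuous_on_mult F schwartz_continuous[OF c])
  obtain D where D: "0 \<le> D" "\<And>t. cmod (cnj (\<psi> (t - x))) \<le> D * decay 0 t" using schwartz_bound0[OF c] by blast
  have "cmod (F t * cnj (\<psi> (t - x))) \<le> B * D" for t
    unfolding norm_mult using D(2)[of t] B[of t] order_trans[OF norm_ge_zero B]
    by (intro mult_mono) (auto simp: decay_def)
  then show "\<exists>B'. \<forall>t. cmod (F t * cnj (\<psi> (t - x))) \<le> B'" by blast
qed

section \<open>Cut-offs\<close>

definition unit_bump :: "'a::euclidean_space \<Rightarrow> complex"
  where "unit_bump t = of_real (bump 0 1 t / bump 0 1 (0 :: 'a))"

definition cutoff :: "nat \<Rightarrow> 'a::euclidean_space \<Rightarrow> complex"
  where "cutoff k t = unit_bump (inverse (real (Suc k)) *\<^sub>R t)"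

lemma unit_bump_0 [simp]: "unit_bump 0 = 1"
proof -
  have "0 < bump 0 1 (0 :: 'a)" by (simp add: bump_pos_iff)
  then show ?thesis by (simp add: unit_bump_def)
qed

lemma unit_bump_schwartz: "unit_bump \<in> schwartz"
proof -
  have "unit_bump = (\<lambda>t :: 'a. (1 / of_real (bump 0 1 (0 :: 'a))) * of_real (bump 0 1 t) + 0 * 0)"
    by (simp add: unit_bump_def fun_eq_iff)
  also have "\<dots> \<in> schwartz" by (rule schwartz_lincomb[OF bump_schwartz schwartz_zero]) simp
  finally show ?thesis .
qed

lemma cutoff_schwartz: "cutoff k \<in> schwartz"
  using schwartz_affine[OF unit_bump_schwartz, of "inverse (real (Suc k))" 0]
  unfolding cutoff_def[abs_def] by simp

lemma cutoff_tendsto: "(\<lambda>k. cutoff k t) \<longlonglongrightarrow> 1"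
proof -
  have "(\<lambda>k. inverse (real (Suc k)) *\<^sub>R t) \<longlonglongrightarrow> 0 *\<^sub>R t" by (intro tendsto_scaleR LIMSEQ_inverse_real_of_nat tendsto_const)
  then have "(\<lambda>k. inverse (real (Suc k)) *\<^sub>R t) \<longlonglongrightarrow> 0" by simp
  from continuous_on_tendsto_compose[OF schwartz_continuous[OF unit_bump_schwartz, of UNIV] this]
  show ?thesis by (simp add: cutoff_def del: of_nat_Suc)
qed

lemma cutoff_bounded: "\<exists>B. \<forall>k t. cmod (cutoff k (t :: 'a::euclidean_space)) \<le> B"
proof -
  obtain B where "\<And>t :: 'a. cmod (unit_bump t) \<le> B * decay 0 t"
    using schwartz_bound0[OF unit_bump_schwartz] by blast
  then have "cmod (cutoff k (t :: 'a)) \<le> B" for k t unfolding cutoff_def by (simp add: decay_def)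
  then show ?thesis by blast
qed

text \<open>Dilating the cut-off moves its frequencies towards 0 and leaves the amplitude \<open>a\<close> fixed. The
  bounds for the multiplication operators are therefore uniform in \<open>k\<close>.\<close>

lemma cutoff_fourier:
  fixes N :: nat
  obtains a :: "'a::euclidean_space \<Rightarrow> complex" where "integrable lborel a" "integrable lborel (\<lambda>\<eta>. cmod (a \<eta>) * japanese \<eta> ^ N)"
    "\<And>k t. cutoff k t = (LINT \<eta>|lborel. cis (t \<bullet> (inverse (real (Suc k)) *\<^sub>R \<eta>)) * a \<eta>)"
proof -
  let ?\<rho> = "unit_bump :: 'a \<Rightarrow> complex" and ?c = "of_real ((2 * pi) ^ DIM('a)) :: complex"
  let ?N = "2 * DIM('a)"
  note [measurable] = schwartz_measurable[OF unit_bump_schwartz[where 'a = 'a]]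
  obtain C where C: "0 \<le> C" "\<And>\<xi>. cmod (fourier ?\<rho> \<xi>) \<le> C * decay (N + ?N) \<xi>"
    using fourier_schwartz_decay[OF unit_bump_schwartz[where 'a = 'a]] by blast
  define a where "a \<eta> = fourier ?\<rho> \<eta> / ?c" for \<eta>
  show ?thesis
  proof (rule that[of a])
    show "integrable lborel a"
      unfolding a_def using fourier_schwartz_integrable[OF unit_bump_schwartz[where 'a = 'a]] by simp
    show "integrable lborel (\<lambda>\<eta>. cmod (a \<eta>) * japanese \<eta> ^ N)"
    proof (rule Bochner_Integration.integrable_bound)
      show "integrable lborel (\<lambda>\<eta> :: 'a. C / (2 * pi) ^ DIM('a) * decay ?N \<eta>)"
        using decay_integrable[OF order_refl, where 'a = 'a] by simp
      show "AE \<eta> in lborel. norm (cmod (a \<eta>) * japanese \<eta> ^ N) \<le> norm (C / (2 * pi) ^ DIM('a) * decay ?N \<eta>)"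
      proof (rule AE_I2)
        fix \<eta> :: 'a
        have "cmod (fourier ?\<rho> \<eta>) * japanese \<eta> ^ N \<le> C * decay (N + ?N) \<eta> * japanese \<eta> ^ N"
          by (intro mult_right_mono C) auto
        also have "\<dots> = C * (japanese \<eta> ^ N * decay N \<eta>) * decay ?N \<eta>" by (simp only: decay_add mult_ac)
        finally have "cmod (fourier ?\<rho> \<eta>) * japanese \<eta> ^ N / (2 * pi) ^ DIM('a) \<le> C * decay ?N \<eta> / (2 * pi) ^ DIM('a)"
          by (intro divide_right_mono) auto
        then show "norm (cmod (a \<eta>) * japanese \<eta> ^ N) \<le> norm (C / (2 * pi) ^ DIM('a) * decay ?N \<eta>)"
          using C(1) by (simp add: a_def norm_divide norm_mult norm_power)
      qed
    qed (unfold a_def, measurable)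
    show "cutoff k t = (LINT \<eta>|lborel. cis (t \<bullet> (inverse (real (Suc k)) *\<^sub>R \<eta>)) * a \<eta>)" for k t
    proof -
      have "(LINT \<eta>|lborel. cis (t \<bullet> (inverse (real (Suc k)) *\<^sub>R \<eta>)) * a \<eta>)
        = (LINT \<eta>|lborel. cis ((inverse (real (Suc k)) *\<^sub>R t) \<bullet> \<eta>) * fourier ?\<rho> \<eta>) / ?c"
        by (simp add: a_def)
      also have "\<dots> = ?\<rho> (inverse (real (Suc k)) *\<^sub>R t)"
        unfolding schwartz_fourier_inversion[OF unit_bump_schwartz[where 'a = 'a]] by simp
      finally show ?thesis by (simp add: cutoff_def)
    qed
  qed
qed

section \<open>The algebra property\<close>

text \<open>A weighted Young inequality for convolution in the frequency.\<close>

lemma (in modulation_window) mixed_norm_convolution_le: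
  fixes K L :: "'a \<Rightarrow> 'a \<Rightarrow> ennreal"
  assumes L[measurable]: "case_prod L \<in> borel_measurable (borel \<Otimes>\<^sub>M borel)"
    and \<sigma>[measurable]: "\<sigma> \<in> borel_measurable borel"
    and le: "\<And>x \<xi>. K x \<xi> \<le> (\<integral>\<^sup>+\<eta>. \<sigma> \<eta> * L x (\<xi> - \<eta>) \<partial>lborel)"
  shows "mixed_norm r s K \<le> (\<integral>\<^sup>+\<eta>. \<sigma> \<eta> * ennreal ((2 * japanese \<eta>) powr s) \<partial>lborel) * mixed_norm r s L"
proof -
  have "mixed_norm r s K \<le> mixed_norm r s (\<lambda>x \<xi>. \<integral>\<^sup>+\<eta>. \<sigma> \<eta> * L x (\<xi> - \<eta>) \<partial>lborel)"
    by (rule mixed_norm_mono[OF r le])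
  also have "\<dots> \<le> (\<integral>\<^sup>+\<eta>. mixed_norm r s (\<lambda>x \<xi>. \<sigma> \<eta> * L x (\<xi> - \<eta>)) \<partial>lborel)"
    by (rule mixed_norm_integral_le[OF r sigma_finite_lborel]) (unfold case_prod_beta', measurable)
  also have "\<dots> \<le> (\<integral>\<^sup>+\<eta>. \<sigma> \<eta> * ennreal ((2 * japanese \<eta>) powr s) * mixed_norm r s L \<partial>lborel)"
  proof (rule nn_integral_mono)
    fix \<eta> :: 'a
    have "mixed_norm r s (\<lambda>x \<xi>. \<sigma> \<eta> * L x (\<xi> - \<eta>)) = \<sigma> \<eta> * mixed_norm r s (\<lambda>x \<xi>. L x (\<xi> - \<eta>))"
      by (rule mixed_norm_cmult[OF r]) measurable
    also have "\<dots> \<le> \<sigma> \<eta> * (ennreal ((2 * japanese \<eta>) powr s) * mixed_norm r s L)"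
      using mixed_norm_shift[OF r s L, of 0 "- \<eta>"] by (intro mult_left_mono) auto
    finally show "mixed_norm r s (\<lambda>x \<xi>. \<sigma> \<eta> * L x (\<xi> - \<eta>)) \<le> \<sigma> \<eta> * ennreal ((2 * japanese \<eta>) powr s) * mixed_norm r s L"
      by (simp add: mult.assoc)
  qed
  also have "\<dots> = (\<integral>\<^sup>+\<eta>. \<sigma> \<eta> * ennreal ((2 * japanese \<eta>) powr s) \<partial>lborel) * mixed_norm r s L"
    by (rule nn_integral_multc) measurable
  finally show ?thesis .
qed

context modulation_window
begin

text \<open>The windowed function has the integrable Fourier transform \<open>V\<^sub>\<psi> F(x, \<cdot>)\<close>, so it is a
  superposition of characters and multiplies as such.\<close>

lemma STFT_product:
  assumes f: "distr_of_fun F \<in> M" and F: "continuous_on UNIV F" "\<And>x. cmod (F x) \<le> B"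
    and \<psi>: "\<psi> \<in> schwartz" and k: "integrable lborel k"
  shows "fourier (\<lambda>t. F t * cnj (\<psi> (t - x)) * k t) \<xi>
    = (LINT \<eta>|lborel. STFT \<psi> (distr_of_fun F) x \<eta> / of_real ((2 * pi) ^ DIM('a)) * fourier k (\<xi> - \<eta>))"
proof -
  let ?c = "of_real ((2 * pi) ^ DIM('a)) :: complex"
  let ?h = "\<lambda>t. F t * cnj (\<psi> (t - x))"
  note h = windowed_integrable[OF F \<psi>, of x]
  obtain B' where B': "\<And>t. cmod (?h t) \<le> B'" using h(3) by blast
  obtain \<sigma> :: "'a \<Rightarrow> ennreal" where \<sigma>: "\<sigma> \<in> borel_measurable borel"
    "(\<integral>\<^sup>+\<omega>. \<sigma> \<omega> * ennreal ((2 * japanese \<omega>) powr s) \<partial>lborel) < top"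
    "\<And>y \<omega>. ennreal (cmod (STFT \<psi> (distr_of_fun F) y \<omega>)) \<le> \<sigma> \<omega>"
    using STFT_frequency_majorant[OF f \<psi>] by metis
  have eq: "STFT \<psi> (distr_of_fun F) x = fourier ?h" by (rule ext) (rule STFT_distr_of_fun[OF \<psi>])
  have fi: "integrable lborel (fourier ?h)"
  proof (rule majorant_integrable[OF \<sigma>(1,2)])
    show "fourier ?h \<in> borel_measurable borel"
      using borel_measurable_continuous_onI[OF h(2)] by (rule fourier_measurable)
    show "ennreal (cmod (fourier ?h \<omega>)) \<le> \<sigma> \<omega>" for \<omega> using \<sigma>(3)[of x \<omega>] unfolding eq .
  qed
  have "?h t = (LINT \<eta>|lborel. cis (t \<bullet> (1 *\<^sub>R \<eta>)) * (fourier ?h \<eta> / ?c))" for t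
  proof -
    have "(LINT \<eta>|lborel. cis (t \<bullet> (1 *\<^sub>R \<eta>)) * (fourier ?h \<eta> / ?c)) = (LINT \<eta>|lborel. cis (t \<bullet> \<eta>) * fourier ?h \<eta>) / ?c"
      by simp
    also have "\<dots> = ?h t" unfolding fourier_inversion[OF h(2) B' h(1) fi] by simp
    finally show ?thesis ..
  qed
  from fourier_mult[OF _ k this, of \<xi>] fi show ?thesis unfolding eq by simp
qed

text \<open>With the window \<open>\<phi>\<^sub>0\<^sup>2\<close> each factor gets a window of its own, and the transform of the product
  is a convolution in frequency. Changing back to \<open>\<phi>\<^sub>0\<close> costs a smearing.\<close>

lemma distr_of_fun_mult_in_M:
  assumes f: "distr_of_fun F \<in> M" and F: "continuous_on UNIV F" "\<And>x. cmod (F x) \<le> B"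
    and g: "distr_of_fun G \<in> M" and G: "continuous_on UNIV G" "\<And>x. cmod (G x) \<le> B'"
  shows "distr_of_fun (\<lambda>x. F x * G x) \<in> M"
proof -
  let ?p = "distr_of_fun (\<lambda>x. F x * G x)" and ?\<psi> = "\<lambda>x. \<phi>\<^sub>0 x * \<phi>\<^sub>0 x" and ?c = "(2 * pi) ^ DIM('a)"
  have \<psi>: "?\<psi> \<in> schwartz" "?\<psi> \<noteq> (\<lambda>_. 0)"
    using \<phi>\<^sub>0 by (auto intro: schwartz_mult simp: fun_eq_iff)
  have FG: "continuous_on UNIV (\<lambda>x. F x * G x)" "cmod (F x * G x) \<le> B * B'" for x
    unfolding norm_mult using F G order_trans[OF norm_ge_zero F(2)]
    by (auto intro!: continuous_on_mult mult_mono)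
  have pt: "?p \<in> tempered_distr" by (rule distr_of_fun_tempered[OF FG])
  have gt: "distr_of_fun G \<in> tempered_distr" using g by (simp add: M_iff)
  obtain \<sigma> :: "'a \<Rightarrow> ennreal" where \<sigma>: "\<sigma> \<in> borel_measurable borel"
    "(\<integral>\<^sup>+\<omega>. \<sigma> \<omega> * ennreal ((2 * japanese \<omega>) powr s) \<partial>lborel) < top"
    "\<And>y \<omega>. V (distr_of_fun F) y \<omega> \<le> \<sigma> \<omega>"
    using STFT_frequency_majorant[OF f \<phi>\<^sub>0(1)] by metis
  note [measurable] = \<sigma>(1) V_measurable[OF gt] STFT_measurable[OF gt \<phi>\<^sub>0(1)]
  have "1 \<le> 2 * pi" using pi_gt3 by linarith
  then have c1: "1 \<le> ?c" by (rule one_le_power)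
  have pb: "ennreal (cmod (STFT ?\<psi> ?p x \<xi>)) \<le> (\<integral>\<^sup>+\<eta>. \<sigma> \<eta> * V (distr_of_fun G) x (\<xi> - \<eta>) \<partial>lborel)" for x \<xi>
  proof -
    have "STFT ?\<psi> ?p x \<xi> = fourier (\<lambda>t. F t * cnj (\<phi>\<^sub>0 (t - x)) * (G t * cnj (\<phi>\<^sub>0 (t - x)))) \<xi>"
      by (simp add: STFT_distr_of_fun[OF \<psi>(1)] mult_ac)
    also have "\<dots> = (LINT \<eta>|lborel. STFT \<phi>\<^sub>0 (distr_of_fun F) x \<eta> / of_real ?c * STFT \<phi>\<^sub>0 (distr_of_fun G) x (\<xi> - \<eta>))"
      unfolding STFT_distr_of_fun[OF \<phi>\<^sub>0(1), of G]
      by (rule STFT_product[OF f F \<phi>\<^sub>0(1) windowed_integrable(1)[OF G \<phi>\<^sub>0(1)]])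
    also have "ennreal (cmod \<dots>) \<le> (\<integral>\<^sup>+\<eta>. ennreal (cmod (STFT \<phi>\<^sub>0 (distr_of_fun F) x \<eta> / of_real ?c * STFT \<phi>\<^sub>0 (distr_of_fun G) x (\<xi> - \<eta>))) \<partial>lborel)"
      by (rule norm_LINT_le)
    also have "\<dots> \<le> (\<integral>\<^sup>+\<eta>. \<sigma> \<eta> * V (distr_of_fun G) x (\<xi> - \<eta>) \<partial>lborel)"
    proof (rule nn_integral_mono)
      fix \<eta>
      have "cmod (STFT \<phi>\<^sub>0 (distr_of_fun F) x \<eta> / of_real ?c) \<le> cmod (STFT \<phi>\<^sub>0 (distr_of_fun F) x \<eta>) / 1"
        using c1 unfolding norm_divide norm_of_real by (intro divide_left_mono) auto
      then have "ennreal (cmod (STFT \<phi>\<^sub>0 (distr_of_fun F) x \<eta> / of_real ?c)) \<le> \<sigma> \<eta>"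
        using order_trans[OF ennreal_leI \<sigma>(3)[of x \<eta>]] by simp
      then show "ennreal (cmod (STFT \<phi>\<^sub>0 (distr_of_fun F) x \<eta> / of_real ?c * STFT \<phi>\<^sub>0 (distr_of_fun G) x (\<xi> - \<eta>))) \<le> \<sigma> \<eta> * V (distr_of_fun G) x (\<xi> - \<eta>)"
        unfolding norm_mult by (subst ennreal_mult) (auto intro!: mult_right_mono)
    qed
    finally show ?thesis .
  qed
  have fin: "mixed_norm r s (\<lambda>x \<xi>. ennreal (cmod (STFT ?\<psi> ?p x \<xi>))) < top"
  proof (rule le_less_trans)
    show "mixed_norm r s (\<lambda>x \<xi>. ennreal (cmod (STFT ?\<psi> ?p x \<xi>)))
      \<le> (\<integral>\<^sup>+\<eta>. \<sigma> \<eta> * ennreal ((2 * japanese \<eta>) powr s) \<partial>lborel) * mixed_norm r s (V (distr_of_fun G))"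
      by (rule mixed_norm_convolution_le[OF V_measurable[OF gt] \<sigma>(1) pb])
    show "\<dots> < top" using \<sigma>(2) g by (simp add: M_iff ennreal_mult_less_top)
  qed
  show ?thesis
  proof (rule STFT_change_of_window[OF \<psi> \<phi>\<^sub>0(1)])
    fix C assume C: "C < top" and *: "\<And>f y \<omega>. f \<in> tempered_distr \<Longrightarrow>
      V f y \<omega> \<le> C * smear smoothing_order (\<lambda>x \<xi>. ennreal (cmod (STFT ?\<psi> f x \<xi>))) y \<omega>"
    let ?P = "\<lambda>x \<xi>. ennreal (cmod (STFT ?\<psi> ?p x \<xi>))"
    note STFT_measurable[OF pt \<psi>(1), measurable]
    have Pm: "case_prod ?P \<in> borel_measurable (borel \<Otimes>\<^sub>M borel)" by measurable
    have "mixed_norm r s (V ?p) \<le> mixed_norm r s (\<lambda>y \<omega>. C * smear smoothing_order ?P y \<omega>)"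
      by (rule mixed_norm_mono[OF r *[OF pt]])
    also have "\<dots> = C * mixed_norm r s (smear smoothing_order ?P)"
      by (rule mixed_norm_cmult[OF r smear_measurable[OF Pm]])
    also have "\<dots> < top" using C mixed_norm_smear_finite[OF Pm fin] by (simp add: ennreal_mult_less_top)
    finally show "?p \<in> M" using pt by (simp add: M_iff)
  qed
qed

lemma schwartz_in_M:
  assumes \<rho>: "\<rho> \<in> schwartz"
  shows "distr_of_fun \<rho> \<in> M"
proof -
  obtain B where B: "\<And>x. cmod (\<rho> x) \<le> B * decay 0 x" using schwartz_bound0[OF \<rho>] by blast
  have t: "distr_of_fun \<rho> \<in> tempered_distr"
    by (rule distr_of_fun_tempered[OF schwartz_continuous[OF \<rho>]]) (use B in \<open>simp add: decay_def\<close>)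
  obtain C where C: "0 \<le> C"
    "\<And>x \<xi>. cmod (fourier (\<lambda>u. cnj (\<phi>\<^sub>0 (u - x)) * \<rho> u) \<xi>) \<le> C * decay smoothing_order x * decay smoothing_order \<xi>"
    using windowed_fourier_decay[OF schwartz_cnj[OF \<phi>\<^sub>0(1)] \<rho>] by blast
  let ?d = "\<lambda>x :: 'a. ennreal (decay smoothing_order x)"
  have V: "V (distr_of_fun \<rho>) x \<xi> \<le> (ennreal C * ?d \<xi>) * ?d x" for x \<xi>
  proof -
    have "STFT \<phi>\<^sub>0 (distr_of_fun \<rho>) x \<xi> = fourier (\<lambda>u. cnj (\<phi>\<^sub>0 (u - x)) * \<rho> u) \<xi>"
      by (simp add: STFT_distr_of_fun[OF \<phi>\<^sub>0(1)] mult_ac)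
    then have "V (distr_of_fun \<rho>) x \<xi> \<le> ennreal (C * decay smoothing_order x * decay smoothing_order \<xi>)"
      using C(2)[of x \<xi>] by (simp add: ennreal_leI)
    also have "\<dots> = (ennreal C * ?d \<xi>) * ?d x" using C(1) by (simp add: ennreal_mult mult_ac)
    finally show ?thesis .
  qed
  have "(\<integral>\<^sup>+x. ennreal_powr (?d x) r \<partial>lborel) \<le> (\<integral>\<^sup>+x. ?d x \<partial>lborel)"
  proof (rule nn_integral_mono)
    fix x :: 'a
    have "decay smoothing_order x powr r \<le> decay smoothing_order x powr 1"
      using r decay_le_1[of smoothing_order x] by (intro powr_mono') auto
    then show "ennreal_powr (?d x) r \<le> ?d x" by (simp add: ennreal_powr_ennreal ennreal_leI)
  qed
  also have "\<dots> < top" by (rule nn_integral_decay) (simp add: smoothing_order_def)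
  finally have dfin: "Lebesgue_norm (ennreal r) ?d < top"
    unfolding Lebesgue_norm_eq[OF r] by (simp add: less_top[symmetric])
  have "mixed_norm r s (V (distr_of_fun \<rho>)) \<le> (\<integral>\<^sup>+\<xi>. ennreal (japanese \<xi> powr s) * (ennreal C * ?d \<xi> * Lebesgue_norm (ennreal r) ?d) \<partial>lborel)"
    unfolding mixed_norm_def
  proof (intro nn_integral_mono mult_left_mono)
    fix \<xi>
    have "Lebesgue_norm (ennreal r) (\<lambda>x. V (distr_of_fun \<rho>) x \<xi>) \<le> Lebesgue_norm (ennreal r) (\<lambda>x. (ennreal C * ?d \<xi>) * ?d x)"
      by (rule Lebesgue_norm_mono[OF r V])
    also have "\<dots> = ennreal C * ?d \<xi> * Lebesgue_norm (ennreal r) ?d" by (rule Lebesgue_norm_cmult[OF r]) measurable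
    finally show "Lebesgue_norm (ennreal r) (\<lambda>x. V (distr_of_fun \<rho>) x \<xi>) \<le> ennreal C * ?d \<xi> * Lebesgue_norm (ennreal r) ?d" .
  qed simp
  also have "\<dots> \<le> (\<integral>\<^sup>+\<xi>. (ennreal C * Lebesgue_norm (ennreal r) ?d) * ennreal (decay smoothing_order \<xi> * (2 * japanese \<xi>) powr s) \<partial>(lborel :: 'a measure))"
  proof (rule nn_integral_mono)
    fix \<xi> :: 'a
    have "japanese \<xi> powr s \<le> (2 * japanese \<xi>) powr s" using s by (intro powr_mono2) auto
    then have "?d \<xi> * ennreal (japanese \<xi> powr s) \<le> ennreal (decay smoothing_order \<xi> * (2 * japanese \<xi>) powr s)"
      by (subst ennreal_mult[symmetric]) (auto intro!: ennreal_leI mult_left_mono)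
    then have "(ennreal C * Lebesgue_norm (ennreal r) ?d) * (?d \<xi> * ennreal (japanese \<xi> powr s))
       \<le> (ennreal C * Lebesgue_norm (ennreal r) ?d) * ennreal (decay smoothing_order \<xi> * (2 * japanese \<xi>) powr s)"
      by (rule mult_left_mono) simp
    then show "ennreal (japanese \<xi> powr s) * (ennreal C * ?d \<xi> * Lebesgue_norm (ennreal r) ?d)
       \<le> (ennreal C * Lebesgue_norm (ennreal r) ?d) * ennreal (decay smoothing_order \<xi> * (2 * japanese \<xi>) powr s)"
      by (simp only: mult_ac)
  qed
  also have "\<dots> = (ennreal C * Lebesgue_norm (ennreal r) ?d) * (\<integral>\<^sup>+\<xi>. ennreal (decay smoothing_order \<xi> * (2 * japanese \<xi>) powr s) \<partial>(lborel :: 'a measure))"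
    by (rule nn_integral_cmult) measurable
  also have "\<dots> < top"
    using dfin nn_integral_decay_powr[OF s, of smoothing_order, where 'a = 'a] by (simp add: ennreal_mult_less_top smoothing_order_def)
  finally show ?thesis using t by (simp add: M_iff)
qed

section \<open>Approximation by cut-offs\<close>

lemma V_shift_le_smear:
  obtains C where "C < top"
    "\<And>f x \<xi> \<zeta>. f \<in> tempered_distr \<Longrightarrow>
      V f x (\<xi> - \<zeta>) \<le> C * ennreal ((2 * japanese \<zeta>) ^ smoothing_order) * smear smoothing_order (V f) x \<xi>"
proof (rule STFT_change_of_window[OF \<phi>\<^sub>0 \<phi>\<^sub>0(1)])
  fix C assume C: "C < top" "\<And>f y \<omega>. f \<in> tempered_distr \<Longrightarrow> V f y \<omega> \<le> C * smear smoothing_order (V f) y \<omega>"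
  show thesis
  proof (rule that[OF C(1)])
    fix f :: "'a distr" and x \<xi> \<zeta> assume f: "f \<in> tempered_distr"
    have "V f x (\<xi> - \<zeta>) \<le> C * smear smoothing_order (V f) x (\<xi> - \<zeta>)" by (rule C(2)[OF f])
    also have "\<dots> \<le> C * (ennreal ((2 * japanese \<zeta>) ^ smoothing_order) * smear smoothing_order (V f) x \<xi>)"
      by (intro mult_left_mono smear_shift_le V_measurable f) simp
    finally show "V f x (\<xi> - \<zeta>) \<le> C * ennreal ((2 * japanese \<zeta>) ^ smoothing_order) * smear smoothing_order (V f) x \<xi>"
      by (simp add: mult.assoc)
  qed
qed

lemma V_diff_measurable:
  assumes "f \<in> tempered_distr" "g \<in> tempered_distr"
  shows "case_prod (\<lambda>x \<xi>. ennreal (cmod (STFT \<phi>\<^sub>0 f x (\<xi> - \<zeta>) - STFT \<phi>\<^sub>0 g x (\<xi> - \<zeta>')))) \<in> borel_measurable (borel \<Otimes>\<^sub>M borel)"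
proof -
  note [measurable] = STFT_measurable[OF assms(1) \<phi>\<^sub>0(1)] STFT_measurable[OF assms(2) \<phi>\<^sub>0(1)]
  show ?thesis by measurable
qed

text \<open>The transforms converge pointwise, by dominated convergence in \<open>t\<close>. They are dominated by a
  multiple of the smeared transform of \<open>F\<close>, uniformly in \<open>k\<close>: a cut-off acts by frequency shifts,
  each shift costs a polynomial factor, and the amplitude of the cut-offs integrates this factor.\<close>

theorem cutoff_approximation:
  assumes f: "distr_of_fun F \<in> M" and F: "continuous_on UNIV F" "\<And>x. cmod (F x) \<le> B"
  shows "(\<lambda>k. mixed_norm r s (\<lambda>x \<xi>. ennreal (cmod (STFT \<phi>\<^sub>0 (distr_of_fun F) x \<xi> - STFT \<phi>\<^sub>0 (distr_of_fun (\<lambda>t. cutoff k t * F t)) x \<xi>)))) \<longlonglongrightarrow> 0"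
proof -
  let ?f = "distr_of_fun F" and ?p = "\<lambda>k. distr_of_fun (\<lambda>t. cutoff k t * F t)"
  have ft: "?f \<in> tempered_distr" and fin: "mixed_norm r s (V ?f) < top" using f by (auto simp: M_iff)
  note [measurable] = V_measurable[OF ft] STFT_measurable[OF ft \<phi>\<^sub>0(1)]
  obtain a :: "'a \<Rightarrow> complex" where a: "integrable lborel a" "integrable lborel (\<lambda>\<eta>. cmod (a \<eta>) * japanese \<eta> ^ smoothing_order)"
    "\<And>k t. cutoff k t = (LINT \<eta>|lborel. cis (t \<bullet> (inverse (real (Suc k)) *\<^sub>R \<eta>)) * a \<eta>)"
    by (rule cutoff_fourier[where N = smoothing_order]) (rule that, assumption, assumption, simp only:)
  have [measurable]: "a \<in> borel_measurable borel" using a(1) by auto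
  obtain Bc where Bc: "\<And>k. \<And>t :: 'a. cmod (cutoff k t) \<le> Bc" using cutoff_bounded by blast
  have pt: "?p k \<in> tempered_distr" for k
  proof (rule distr_of_fun_tempered)
    show "continuous_on UNIV (\<lambda>t. cutoff k t * F t)" by (intro continuous_on_mult schwartz_continuous[OF cutoff_schwartz] F)
    show "cmod (cutoff k t * F t) \<le> Bc * B" for t
      unfolding norm_mult using F(2) Bc order_trans[OF norm_ge_zero Bc] by (intro mult_mono) auto
  qed
  let ?A = "\<integral>\<^sup>+\<eta>. ennreal (cmod (a \<eta>) * japanese \<eta> ^ smoothing_order) \<partial>lborel"
  have A: "?A < top" using a(2) by (simp add: integrable_iff_bounded abs_mult)
  show ?thesis
  proof (rule V_shift_le_smear)
    fix C assume C: "C < top" "\<And>f x \<xi> \<zeta>. f \<in> tempered_distr \<Longrightarrow>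
      V f x (\<xi> - \<zeta>) \<le> C * ennreal ((2 * japanese \<zeta>) ^ smoothing_order) * smear smoothing_order (V f) x \<xi>"
    let ?H = "smear smoothing_order (V ?f)"
    note Hm = smear_measurable[OF V_measurable[OF ft], of smoothing_order]
    have C0: "V ?f x \<xi> \<le> C * ennreal (2 ^ smoothing_order) * ?H x \<xi>" for x \<xi>
      using C(2)[OF ft, of x \<xi> 0] by (simp add: japanese_def)
    have bound: "V (?p k) x \<xi> \<le> ?A * (C * ennreal (2 ^ smoothing_order)) * ?H x \<xi>" for k x \<xi>
    proof -
      let ?q = "inverse (real (Suc k))"
      have "STFT \<phi>\<^sub>0 (?p k) x \<xi> = fourier (\<lambda>t. cutoff k t * (F t * cnj (\<phi>\<^sub>0 (t - x)))) \<xi>"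
        by (simp add: STFT_distr_of_fun[OF \<phi>\<^sub>0(1)] mult.assoc)
      also have "\<dots> = (LINT \<eta>|lborel. a \<eta> * fourier (\<lambda>t. F t * cnj (\<phi>\<^sub>0 (t - x))) (\<xi> - ?q *\<^sub>R \<eta>))"
        by (rule fourier_mult[OF a(1) windowed_integrable(1)[OF F \<phi>\<^sub>0(1)] a(3)])
      also have "ennreal (cmod \<dots>) \<le> (\<integral>\<^sup>+\<eta>. ennreal (cmod (a \<eta> * fourier (\<lambda>t. F t * cnj (\<phi>\<^sub>0 (t - x))) (\<xi> - ?q *\<^sub>R \<eta>))) \<partial>lborel)"
        by (rule norm_LINT_le)
      also have "\<dots> \<le> (\<integral>\<^sup>+\<eta>. ennreal (cmod (a \<eta>) * japanese \<eta> ^ smoothing_order) * (C * ennreal (2 ^ smoothing_order) * ?H x \<xi>) \<partial>lborel)"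
      proof (rule nn_integral_mono)
        fix \<eta> :: 'a
        have "japanese (?q *\<^sub>R \<eta>) \<le> japanese \<eta>"
          unfolding japanese_def by (intro real_sqrt_le_mono add_left_mono power_mono) (auto simp: divide_simps mult_le_cancel_left1)
        then have "(2 * japanese (?q *\<^sub>R \<eta>)) ^ smoothing_order \<le> (2 * japanese \<eta>) ^ smoothing_order" by (intro power_mono) auto
        then have q: "ennreal ((2 * japanese (?q *\<^sub>R \<eta>)) ^ smoothing_order) \<le> ennreal (2 ^ smoothing_order) * ennreal (japanese \<eta> ^ smoothing_order)"
          by (subst ennreal_mult[symmetric]) (auto simp: power_mult_distrib intro!: ennreal_leI)
        have "V ?f x (\<xi> - ?q *\<^sub>R \<eta>) \<le> C * ennreal ((2 * japanese (?q *\<^sub>R \<eta>)) ^ smoothing_order) * ?H x \<xi>" by (rule C(2)[OF ft])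
        also have "\<dots> \<le> C * (ennreal (2 ^ smoothing_order) * ennreal (japanese \<eta> ^ smoothing_order)) * ?H x \<xi>"
          by (intro mult_right_mono mult_left_mono q) auto
        finally have "ennreal (cmod (a \<eta>)) * V ?f x (\<xi> - ?q *\<^sub>R \<eta>) \<le> ennreal (cmod (a \<eta>)) * (C * (ennreal (2 ^ smoothing_order) * ennreal (japanese \<eta> ^ smoothing_order)) * ?H x \<xi>)"
          by (rule mult_left_mono) simp
        then show "ennreal (cmod (a \<eta> * fourier (\<lambda>t. F t * cnj (\<phi>\<^sub>0 (t - x))) (\<xi> - ?q *\<^sub>R \<eta>)))
          \<le> ennreal (cmod (a \<eta>) * japanese \<eta> ^ smoothing_order) * (C * ennreal (2 ^ smoothing_order) * ?H x \<xi>)"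
          unfolding STFT_distr_of_fun[OF \<phi>\<^sub>0(1), symmetric] norm_mult
          by (subst (1 2) ennreal_mult) (auto simp only: mult_ac norm_ge_zero japanese_nonneg zero_le_power)
      qed
      also have "\<dots> = ?A * (C * ennreal (2 ^ smoothing_order) * ?H x \<xi>)"
        by (rule nn_integral_multc) measurable
      finally show ?thesis by (simp add: mult.assoc)
    qed
    let ?D = "C * ennreal (2 ^ smoothing_order) + ?A * (C * ennreal (2 ^ smoothing_order))"
    show ?thesis
    proof (rule mixed_norm_tendsto_0[OF r, where H = "\<lambda>x \<xi>. ?D * ?H x \<xi>"])
      show "case_prod (\<lambda>x \<xi>. ennreal (cmod (STFT \<phi>\<^sub>0 ?f x \<xi> - STFT \<phi>\<^sub>0 (?p k) x \<xi>))) \<in> borel_measurable (borel \<Otimes>\<^sub>M borel)" for k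
        using V_diff_measurable[OF ft pt, of 0 k 0] by simp
      note [measurable] = Hm
      show "case_prod (\<lambda>x \<xi>. ?D * ?H x \<xi>) \<in> borel_measurable (borel \<Otimes>\<^sub>M borel)" by measurable
      show "ennreal (cmod (STFT \<phi>\<^sub>0 ?f x \<xi> - STFT \<phi>\<^sub>0 (?p k) x \<xi>)) \<le> ?D * ?H x \<xi>" for k x \<xi>
      proof -
        have "ennreal (cmod (STFT \<phi>\<^sub>0 ?f x \<xi> - STFT \<phi>\<^sub>0 (?p k) x \<xi>)) \<le> ennreal (cmod (STFT \<phi>\<^sub>0 ?f x \<xi>) + cmod (STFT \<phi>\<^sub>0 (?p k) x \<xi>))"
          by (intro ennreal_leI norm_triangle_ineq4)
        also have "\<dots> = V ?f x \<xi> + V (?p k) x \<xi>" by simp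
        also have "\<dots> \<le> ?D * ?H x \<xi>" unfolding distrib_right by (intro add_mono C0 bound)
        finally show ?thesis .
      qed
      have "mixed_norm r s (\<lambda>x \<xi>. ?D * ?H x \<xi>) = ?D * mixed_norm r s ?H" by (rule mixed_norm_cmult[OF r Hm])
      also have "\<dots> < top"
        using C(1) A mixed_norm_smear_finite[OF V_measurable[OF ft] fin] by (simp add: ennreal_mult_less_top)
      finally show "mixed_norm r s (\<lambda>x \<xi>. ?D * ?H x \<xi>) < top" .
      show "(\<lambda>k. ennreal (cmod (STFT \<phi>\<^sub>0 ?f x \<xi> - STFT \<phi>\<^sub>0 (?p k) x \<xi>))) \<longlonglongrightarrow> 0" for x \<xi>
      proof -
        let ?h = "\<lambda>t. F t * cnj (\<phi>\<^sub>0 (t - x))"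
        have hi: "integrable lborel ?h" by (rule windowed_integrable(1)[OF F \<phi>\<^sub>0(1)])
        have [measurable]: "?h \<in> borel_measurable borel" using hi by auto
        have [measurable]: "cutoff k \<in> borel_measurable borel" for k by (rule schwartz_measurable[OF cutoff_schwartz])
        have "(\<lambda>k. LINT t|lborel. cis (t \<bullet> (- \<xi>)) * (cutoff k t * ?h t)) \<longlonglongrightarrow> (LINT t|lborel. cis (t \<bullet> (- \<xi>)) * (1 * ?h t))"
        proof (rule integral_dominated_convergence[where w = "\<lambda>t. Bc * cmod (?h t)"])
          show "integrable lborel (\<lambda>t. Bc * cmod (?h t))" using hi by simp
          show "AE t in lborel. norm (cis (t \<bullet> (- \<xi>)) * (cutoff k t * ?h t)) \<le> Bc * cmod (?h t)" for k
            by (rule AE_I2) (simp only: norm_mult norm_cis mult_1, intro mult_right_mono Bc, simp)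
          show "AE t in lborel. (\<lambda>k. cis (t \<bullet> (- \<xi>)) * (cutoff k t * ?h t)) \<longlonglongrightarrow> cis (t \<bullet> (- \<xi>)) * (1 * ?h t)"
            by (rule AE_I2) (intro tendsto_mult tendsto_const cutoff_tendsto)
        qed measurable
        then have "(\<lambda>k. STFT \<phi>\<^sub>0 (?p k) x \<xi>) \<longlonglongrightarrow> STFT \<phi>\<^sub>0 ?f x \<xi>"
          unfolding STFT_distr_of_fun[OF \<phi>\<^sub>0(1)] fourier_def by (simp add: mult.assoc)
        then have "(\<lambda>k. cmod (STFT \<phi>\<^sub>0 ?f x \<xi> - STFT \<phi>\<^sub>0 (?p k) x \<xi>)) \<longlonglongrightarrow> cmod (STFT \<phi>\<^sub>0 ?f x \<xi> - STFT \<phi>\<^sub>0 ?f x \<xi>)"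
          by (intro tendsto_norm tendsto_diff tendsto_const)
        then show ?thesis using tendsto_ennrealI by fastforce
      qed
    qed
  qed
qed

end

context modulation_window
begin

section \<open>Closed ideals are the closed modulation invariant subspaces\<close>

lemma M_continuous_representative:
  assumes "f \<in> M"
  obtains F B where "continuous_on UNIV F" "\<And>x. cmod (F x) \<le> B" "f = distr_of_fun F" "cont_fun f = F"
  using continuous_representative[OF assms] cont_fun_distr_of_fun by metis

lemma modulate_bounded_continuous:
  assumes "continuous_on UNIV F" "\<And>x. cmod (F x) \<le> B"
  shows "continuous_on UNIV (\<lambda>t. cis (t \<bullet> \<eta>) * F t)" "\<And>x. cmod (cis (x \<bullet> \<eta>) * F x) \<le> B"
  using assms by (auto intro!: continuous_intros simp: norm_mult)

lemma distr_modulate_tempered: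
  assumes "f \<in> M"
  shows "distr_modulate \<eta> f \<in> tempered_distr"
proof -
  obtain F B where F: "continuous_on UNIV F" "\<And>x. cmod (F x) \<le> B" "f = distr_of_fun F"
    using M_continuous_representative[OF assms] by metis
  show ?thesis unfolding F(3) distr_modulate_of_fun
    by (rule distr_of_fun_tempered[OF modulate_bounded_continuous[OF F(1,2)]])
qed

lemma distr_modulate_in_M:
  assumes f: "f \<in> M"
  shows "distr_modulate \<eta> f \<in> M"
proof -
  have ft: "f \<in> tempered_distr" using f by (simp add: M_iff)
  have "mixed_norm r s (V (distr_modulate \<eta> f)) = mixed_norm r s (\<lambda>x \<xi>. V f (x + 0) (\<xi> + - \<eta>))"
    by (simp add: STFT_distr_modulate)
  also have "\<dots> \<le> ennreal ((2 * japanese (- \<eta>)) powr s) * mixed_norm r s (V f)"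
    by (rule mixed_norm_shift[OF r s V_measurable[OF ft]])
  also have "\<dots> < top" using f by (simp add: M_iff ennreal_mult_less_top)
  finally show ?thesis using distr_modulate_tempered[OF f] by (simp add: M_iff)
qed

lemma norm_closedD:
  assumes I: "norm_closed \<phi>\<^sub>0 (ennreal r) s I" and f: "f \<in> M"
    and g: "\<And>\<epsilon>. 0 < \<epsilon> \<Longrightarrow> \<exists>g\<in>I. mixed_norm r s (\<lambda>x \<xi>. ennreal (cmod (STFT \<phi>\<^sub>0 f x \<xi> - STFT \<phi>\<^sub>0 g x \<xi>))) < \<epsilon>"
  shows "f \<in> I"
  using I f g unfolding norm_closed_def M_def[symmetric] modulation_norm_eq STFT_diff by blast

text \<open>The functions \<open>M\<^sub>\<eta> (\<chi>\<^sub>k f) = (M\<^sub>\<eta> \<chi>\<^sub>k) f\<close> belong to the ideal, and they converge to \<open>M\<^sub>\<eta> f\<close>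
  because \<open>M\<^sub>\<eta>\<close> is bounded.\<close>

theorem closed_ideal_modulation_invariant:
  assumes I: "ideal \<phi>\<^sub>0 (ennreal r) s I" and cl: "norm_closed \<phi>\<^sub>0 (ennreal r) s I"
  shows "modulation_invariant I"
  unfolding modulation_invariant_def
proof (intro ballI allI)
  fix f \<eta> assume fI: "f \<in> I"
  have f: "f \<in> M" using I fI unfolding ideal_def linear_subspace_def M_def by blast
  obtain F B where F: "continuous_on UNIV F" "\<And>x. cmod (F x) \<le> B" "f = distr_of_fun F" "cont_fun f = F"
    using M_continuous_representative[OF f] by metis
  show "distr_modulate \<eta> f \<in> I"
  proof (rule norm_closedD[OF cl distr_modulate_in_M[OF f]])
    fix \<epsilon> :: ennreal assume \<epsilon>: "0 < \<epsilon>"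
    let ?D = "\<lambda>k x \<xi>. ennreal (cmod (STFT \<phi>\<^sub>0 (distr_of_fun F) x \<xi> - STFT \<phi>\<^sub>0 (distr_of_fun (\<lambda>t. cutoff k t * F t)) x \<xi>))"
    let ?c = "ennreal ((2 * japanese (- \<eta>)) powr s)"
    have "(\<lambda>k. ?c * mixed_norm r s (?D k)) \<longlonglongrightarrow> ?c * 0"
      using f F by (intro tendsto_mult_ennreal tendsto_const cutoff_approximation[of F B]) auto
    then have "eventually (\<lambda>k. ?c * mixed_norm r s (?D k) < \<epsilon>) sequentially" using \<epsilon> by (intro order_tendstoD) auto
    then obtain k where k: "?c * mixed_norm r s (?D k) < \<epsilon>" unfolding eventually_sequentially by blast
    \<comment> \<open>the modulated cut-off stands in for the character, which lies outside the algebra\<close>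
    let ?u = "\<lambda>t. cis (t \<bullet> \<eta>) * cutoff k t"
    let ?g = "pointwise_mult (distr_of_fun ?u) f"
    have u: "?u \<in> schwartz" by (rule schwartz_modulate[OF cutoff_schwartz])
    then have "?g \<in> I" using I fI schwartz_in_M[OF u] unfolding ideal_def M_def by blast
    moreover have "mixed_norm r s (\<lambda>x \<xi>. ennreal (cmod (STFT \<phi>\<^sub>0 (distr_modulate \<eta> f) x \<xi> - STFT \<phi>\<^sub>0 ?g x \<xi>))) < \<epsilon>"
    proof -
      have g: "?g = distr_modulate \<eta> (distr_of_fun (\<lambda>t. cutoff k t * F t))"
        unfolding pointwise_mult_def cont_fun_distr_of_fun[OF schwartz_continuous[OF u]] F(4) distr_modulate_of_fun
        by (simp add: mult.assoc)
      obtain Bc where Bc: "\<And>t :: 'a. cmod (cutoff k t) \<le> Bc" using cutoff_bounded by blast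
      have p: "continuous_on UNIV (\<lambda>t. cutoff k t * F t)" "cmod (cutoff k t * F t) \<le> Bc * B" for t
        unfolding norm_mult using F(1,2) Bc order_trans[OF norm_ge_zero Bc]
        by (auto intro!: continuous_on_mult schwartz_continuous[OF cutoff_schwartz] mult_mono)
      have "mixed_norm r s (\<lambda>x \<xi>. ?D k (x + 0) (\<xi> + - \<eta>)) \<le> ?c * mixed_norm r s (?D k)"
      proof (rule mixed_norm_shift[OF r s])
        show "case_prod (?D k) \<in> borel_measurable (borel \<Otimes>\<^sub>M borel)"
          using V_diff_measurable[of "distr_of_fun F" "distr_of_fun (\<lambda>t. cutoff k t * F t)" 0 0] distr_of_fun_tempered[OF p]
            distr_of_fun_tempered[OF F(1,2)] by simp
      qed
      also have "\<dots> < \<epsilon>" by (rule k)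
      finally show ?thesis unfolding g unfolding STFT_distr_modulate F(3) by simp
    qed
    ultimately show "\<exists>g\<in>I. mixed_norm r s (\<lambda>x \<xi>. ennreal (cmod (STFT \<phi>\<^sub>0 (distr_modulate \<eta> f) x \<xi> - STFT \<phi>\<^sub>0 g x \<xi>))) < \<epsilon>"
      by blast
  qed
qed

lemma linear_subspace_sum:
  assumes I: "linear_subspace \<phi>\<^sub>0 (ennreal r) s I" and Z: "finite Z" "\<And>\<zeta>. \<zeta> \<in> Z \<Longrightarrow> g \<zeta> \<in> I"
  shows "(\<lambda>\<theta>. \<Sum>\<zeta>\<in>Z. c \<zeta> * g \<zeta> \<theta>) \<in> I"
  using Z
proof (induction Z)
  case empty
  then show ?case using I by (simp add: linear_subspace_def)
next
  case (insert \<zeta> Z)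
  then have *: "g \<zeta> \<in> I" "(\<lambda>\<theta>. \<Sum>\<zeta>\<in>Z. c \<zeta> * g \<zeta> \<theta>) \<in> I" by auto
  have "\<forall>f\<in>I. \<forall>g\<in>I. \<forall>a b. (\<lambda>\<theta>. a * f \<theta> + b * g \<theta>) \<in> I" using I by (simp add: linear_subspace_def)
  from this[rule_format, OF *, of "c \<zeta>" 1] show ?case using insert by simp
qed

text \<open>The transform of a tempered distribution is continuous, and a multiple of its smeared version
  dominates all frequency shifts by at most \<open>\<bar>\<zeta>\<bar> + 1\<close>.\<close>

lemma modulation_continuous:
  assumes g: "g \<in> M" and \<epsilon>: "0 < \<epsilon>"
  shows "\<exists>\<delta>>0. \<forall>\<zeta>'. dist \<zeta>' \<zeta> < \<delta> \<longrightarrow>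
    mixed_norm r s (\<lambda>x \<xi>. ennreal (cmod (STFT \<phi>\<^sub>0 g x (\<xi> - \<zeta>') - STFT \<phi>\<^sub>0 g x (\<xi> - \<zeta>)))) \<le> ennreal \<epsilon>"
proof (rule ccontr)
  let ?N = "\<lambda>\<zeta>'. mixed_norm r s (\<lambda>x \<xi>. ennreal (cmod (STFT \<phi>\<^sub>0 g x (\<xi> - \<zeta>') - STFT \<phi>\<^sub>0 g x (\<xi> - \<zeta>))))"
  assume no_\<delta>: "\<not> (\<exists>\<delta>>0. \<forall>\<zeta>'. dist \<zeta>' \<zeta> < \<delta> \<longrightarrow> ?N \<zeta>' \<le> ennreal \<epsilon>)"
  have *: "\<exists>\<zeta>'. dist \<zeta>' \<zeta> < \<delta> \<and> \<not> ?N \<zeta>' \<le> ennreal \<epsilon>" if "0 < \<delta>" for \<delta>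
  proof (rule ccontr)
    assume "\<not> ?thesis"
    then have "\<forall>\<zeta>'. dist \<zeta>' \<zeta> < \<delta> \<longrightarrow> ?N \<zeta>' \<le> ennreal \<epsilon>" by simp
    with no_\<delta> that show False by blast
  qed
  have "\<forall>k. \<exists>\<zeta>'. dist \<zeta>' \<zeta> < inverse (real (Suc k)) \<and> \<not> ?N \<zeta>' \<le> ennreal \<epsilon>"
    by (intro allI *) simp
  from choice[OF this] obtain z where "\<forall>k. dist (z k) \<zeta> < inverse (real (Suc k)) \<and> \<not> ?N (z k) \<le> ennreal \<epsilon>" ..
  then have z: "\<And>k. dist (z k) \<zeta> < inverse (real (Suc k))" "\<And>k. \<not> ?N (z k) \<le> ennreal \<epsilon>" by simp_all
  have gt: "g \<in> tempered_distr" and fin: "mixed_norm r s (V g) < top" using g by (auto simp: M_iff)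
  have "(\<lambda>k. dist (z k) \<zeta>) \<longlonglongrightarrow> 0"
  proof (rule Lim_null_comparison[OF always_eventually LIMSEQ_inverse_real_of_nat], rule allI)
    show "norm (dist (z k) \<zeta>) \<le> inverse (real (Suc k))" for k
      using less_imp_le[OF z(1)[of k]] by (simp only: real_norm_def abs_of_nonneg[OF zero_le_dist])
  qed
  then have zlim: "z \<longlonglongrightarrow> \<zeta>" by (rule tendsto_dist_iff[THEN iffD2])

  have "(\<lambda>k. ?N (z k)) \<longlonglongrightarrow> 0"
  proof (rule V_shift_le_smear)
    fix C assume C: "C < top" "\<And>f x \<xi> \<zeta>. f \<in> tempered_distr \<Longrightarrow>
      V f x (\<xi> - \<zeta>) \<le> C * ennreal ((2 * japanese \<zeta>) ^ smoothing_order) * smear smoothing_order (V f) x \<xi>"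
    let ?H = "smear smoothing_order (V g)" and ?R = "(2 * (2 + norm \<zeta>)) ^ smoothing_order"
    note Hm[measurable] = smear_measurable[OF V_measurable[OF gt], of smoothing_order]
    have b: "V g x (\<xi> - \<zeta>') \<le> C * ennreal ?R * ?H x \<xi>" if "dist \<zeta>' \<zeta> \<le> 1" for x \<xi> \<zeta>'
    proof -
      have "norm \<zeta>' \<le> norm \<zeta> + 1" using that norm_triangle_sub[of \<zeta>' \<zeta>] by (simp add: dist_norm)
      then have "(2 * japanese \<zeta>') ^ smoothing_order \<le> ?R"
        using japanese_le_1_plus_norm[of \<zeta>'] by (intro power_mono) auto
      then have "C * ennreal ((2 * japanese \<zeta>') ^ smoothing_order) * ?H x \<xi> \<le> C * ennreal ?R * ?H x \<xi>"
        by (intro mult_right_mono mult_left_mono ennreal_leI) auto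
      then show ?thesis using C(2)[OF gt, of x \<xi> \<zeta>'] by (rule order_trans[rotated])
    qed
    let ?D = "C * ennreal ?R + C * ennreal ?R"
    show ?thesis
    proof (rule mixed_norm_tendsto_0[OF r, where H = "\<lambda>x \<xi>. ?D * ?H x \<xi>"])
      show "case_prod (\<lambda>x \<xi>. ennreal (cmod (STFT \<phi>\<^sub>0 g x (\<xi> - z k) - STFT \<phi>\<^sub>0 g x (\<xi> - \<zeta>)))) \<in> borel_measurable (borel \<Otimes>\<^sub>M borel)" for k
        by (rule V_diff_measurable[OF gt gt])
      show "case_prod (\<lambda>x \<xi>. ?D * ?H x \<xi>) \<in> borel_measurable (borel \<Otimes>\<^sub>M borel)" by measurable
      show "ennreal (cmod (STFT \<phi>\<^sub>0 g x (\<xi> - z k) - STFT \<phi>\<^sub>0 g x (\<xi> - \<zeta>))) \<le> ?D * ?H x \<xi>" for k x \<xi>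
      proof -
        have "inverse (real (Suc k)) \<le> 1" by (simp add: field_simps)
        then have zk: "dist (z k) \<zeta> \<le> 1" using z(1)[of k] by linarith
        have "ennreal (cmod (STFT \<phi>\<^sub>0 g x (\<xi> - z k) - STFT \<phi>\<^sub>0 g x (\<xi> - \<zeta>))) \<le> ennreal (cmod (STFT \<phi>\<^sub>0 g x (\<xi> - z k)) + cmod (STFT \<phi>\<^sub>0 g x (\<xi> - \<zeta>)))"
          by (intro ennreal_leI norm_triangle_ineq4)
        also have "\<dots> = V g x (\<xi> - z k) + V g x (\<xi> - \<zeta>)" by simp
        also have "\<dots> \<le> ?D * ?H x \<xi>" unfolding distrib_right by (intro add_mono b zk) simp
        finally show ?thesis .
      qed
      have "mixed_norm r s (\<lambda>x \<xi>. ?D * ?H x \<xi>) = ?D * mixed_norm r s ?H" by (rule mixed_norm_cmult[OF r Hm])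
      also have "\<dots> < top"
        using C(1) mixed_norm_smear_finite[OF V_measurable[OF gt] fin] by (simp add: ennreal_mult_less_top)
      finally show "mixed_norm r s (\<lambda>x \<xi>. ?D * ?H x \<xi>) < top" .
      show "(\<lambda>k. ennreal (cmod (STFT \<phi>\<^sub>0 g x (\<xi> - z k) - STFT \<phi>\<^sub>0 g x (\<xi> - \<zeta>)))) \<longlonglongrightarrow> 0" for x \<xi>
      proof -
        have "(\<lambda>k. (x, \<xi> - z k)) \<longlonglongrightarrow> (x, \<xi> - \<zeta>)" by (intro tendsto_intros zlim)
        from continuous_on_tendsto_compose[OF tempered_atom_continuous[OF gt \<phi>\<^sub>0(1)] this]
        have "(\<lambda>k. STFT \<phi>\<^sub>0 g x (\<xi> - z k)) \<longlonglongrightarrow> STFT \<phi>\<^sub>0 g x (\<xi> - \<zeta>)" by (simp add: STFT_atom)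
        then have "(\<lambda>k. cmod (STFT \<phi>\<^sub>0 g x (\<xi> - z k) - STFT \<phi>\<^sub>0 g x (\<xi> - \<zeta>))) \<longlonglongrightarrow> cmod (STFT \<phi>\<^sub>0 g x (\<xi> - \<zeta>) - STFT \<phi>\<^sub>0 g x (\<xi> - \<zeta>))"
          by (intro tendsto_norm tendsto_diff tendsto_const)
        then show ?thesis using tendsto_ennrealI by fastforce
      qed
    qed
  qed
  then have "eventually (\<lambda>k. ?N (z k) < ennreal \<epsilon>) sequentially" using \<epsilon> by (intro order_tendstoD) auto
  then obtain k where "?N (z k) < ennreal \<epsilon>" unfolding eventually_sequentially by blast
  then show False using z(2)[of k] by simp
qed

text \<open>If \<open>h = \<integral> a(\<eta>) M\<^sub>\<eta> g d\<eta>\<close>, the integral is replaced by a finite sum of modulations \<open>M\<^sub>\<zeta> g \<in> I\<close>.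
  On a large ball the error is small because modulations act continuously on \<open>g\<close>; outside of it, the
  weighted integrability of \<open>a\<close> beats the growth of the norm of \<open>M\<^sub>\<eta> g\<close>. Minkowski's inequality
  turns these into an estimate of the norm.\<close>

theorem frequency_superposition_in_closed_subspace:
  fixes a :: "'a \<Rightarrow> complex"
  assumes I: "linear_subspace \<phi>\<^sub>0 (ennreal r) s I" and cl: "norm_closed \<phi>\<^sub>0 (ennreal r) s I"
    and mi: "modulation_invariant I" and g: "g \<in> I" and h: "h \<in> M"
    and a: "integrable lborel a"
    and aw: "(\<integral>\<^sup>+\<eta>. ennreal (cmod (a \<eta>)) * ennreal ((2 * japanese \<eta>) powr s) \<partial>lborel) < top"
    and hg: "\<And>x \<xi>. STFT \<phi>\<^sub>0 h x \<xi> = (LINT \<eta>|lborel. a \<eta> * STFT \<phi>\<^sub>0 g x (\<xi> - \<eta>))"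
  shows "h \<in> I"
proof (rule norm_closedD[OF cl h])
  fix e :: ennreal assume e: "0 < e"
  obtain \<epsilon>' :: real where \<epsilon>': "0 < \<epsilon>'" "ennreal \<epsilon>' < e" 
  proof -
    obtain c where c: "0 < c" "c < e" using dense[OF e] by blast
    then obtain x where "c = ennreal x" "0 \<le> x" by (cases c) auto
    then show thesis using c by (intro that[of x]) auto
  qed
  have gM: "g \<in> M" using I g unfolding linear_subspace_def M_def by blast
  have gt: "g \<in> tempered_distr" and fin: "mixed_norm r s (V g) < top" using gM by (auto simp: M_iff)
  note [measurable] = V_measurable[OF gt] STFT_measurable[OF gt \<phi>\<^sub>0(1)]
  have [measurable]: "a \<in> borel_measurable borel" using a by auto
  define w where "w = (LINT \<eta>|lborel. cmod (a \<eta>))"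
  have w: "0 \<le> w" "(\<integral>\<^sup>+\<eta>. ennreal (cmod (a \<eta>)) \<partial>lborel) = ennreal w"
    using a by (auto simp: w_def nn_integral_eq_integral)
  define \<epsilon> where "\<epsilon> = \<epsilon>' / (w + 1)"
  have \<epsilon>: "0 < \<epsilon>" using \<epsilon>' w by (simp add: \<epsilon>_def)
  let ?P = "\<lambda>\<zeta>' \<zeta>. mixed_norm r s (\<lambda>x \<xi>. ennreal (cmod (STFT \<phi>\<^sub>0 g x (\<xi> - \<zeta>') - STFT \<phi>\<^sub>0 g x (\<xi> - \<zeta>)))) \<le> ennreal \<epsilon>"
  let ?T = "\<lambda>\<eta>. ennreal (cmod (a \<eta>)) * ennreal ((2 * japanese \<eta>) powr s) * mixed_norm r s (V g)"
  have "(\<integral>\<^sup>+\<eta>. ?T \<eta> \<partial>lborel) = (\<integral>\<^sup>+\<eta>. ennreal (cmod (a \<eta>)) * ennreal ((2 * japanese \<eta>) powr s) \<partial>lborel) * mixed_norm r s (V g)"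
    by (rule nn_integral_multc) measurable
  also have "\<dots> < top" using aw fin by (simp add: ennreal_mult_less_top)
  finally have Tfin: "(\<integral>\<^sup>+\<eta>. ?T \<eta> \<partial>lborel) < top" .
  have Tm: "?T \<in> borel_measurable borel" by measurable
  obtain R where R: "(\<integral>\<^sup>+\<eta>. ?T \<eta> * indicator (- cball 0 R) \<eta> \<partial>lborel) \<le> ennreal \<epsilon>"
    using nn_integral_tail[OF Tm Tfin \<epsilon>] by blast
  obtain \<pi> Z where Z: "finite Z" and \<pi>: "\<pi> \<in> borel \<rightarrow>\<^sub>M borel" "\<And>\<eta>. \<pi> \<eta> \<in> Z"
    and \<pi>P: "\<And>\<eta>. \<eta> \<in> cball 0 R \<Longrightarrow> ?P \<eta> (\<pi> \<eta>)"
  proof (rule compact_finite_range_selection[where P = ?P, OF compact_cball[of 0 R]])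
    show "\<exists>\<delta>>0. \<forall>z'. dist z' z < \<delta> \<longrightarrow> ?P z' z" for z by (rule modulation_continuous[OF gM \<epsilon>])
    fix \<pi> :: "'a \<Rightarrow> 'a" and Z :: "'a set"
    assume 1: "finite Z" "\<pi> \<in> borel \<rightarrow>\<^sub>M borel" "\<And>\<eta>. \<pi> \<eta> \<in> Z" and 2: "\<And>\<eta>. \<eta> \<in> cball 0 R \<Longrightarrow> ?P \<eta> (\<pi> \<eta>)"
    show thesis by (rule that[OF 1 2])
  qed
  note \<pi>(1)[measurable]
  define c where "c \<zeta> = (LINT \<eta>|lborel. a \<eta> * indicator (cball 0 R \<inter> {\<eta>. \<pi> \<eta> = \<zeta>}) \<eta>)" for \<zeta>
  define u where "u = (\<lambda>\<theta>. \<Sum>\<zeta>\<in>Z. c \<zeta> * distr_modulate \<zeta> g \<theta>)"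
  have uI: "u \<in> I" unfolding u_def
    using mi g unfolding modulation_invariant_def by (intro linear_subspace_sum[OF I Z]) blast
  have uS: "STFT \<phi>\<^sub>0 u x \<xi> = (\<Sum>\<zeta>\<in>Z. c \<zeta> * STFT \<phi>\<^sub>0 g x (\<xi> - \<zeta>))" for x \<xi>
    unfolding STFT_distr_modulate[symmetric] by (simp add: u_def STFT_atom)
  let ?G = "\<lambda>x \<xi> \<eta>. STFT \<phi>\<^sub>0 g x (\<xi> - \<eta>)"
  let ?K = "\<lambda>x \<xi> \<eta>. ennreal (cmod (a \<eta>)) * (if \<eta> \<in> cball 0 R then ennreal (cmod (?G x \<xi> \<eta> - ?G x \<xi> (\<pi> \<eta>))) else ennreal (cmod (?G x \<xi> \<eta>)))"
  have le: "ennreal (cmod (STFT \<phi>\<^sub>0 h x \<xi> - STFT \<phi>\<^sub>0 u x \<xi>)) \<le> (\<integral>\<^sup>+\<eta>. ?K x \<xi> \<eta> \<partial>lborel)" for x \<xi>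
  proof -
    obtain \<sigma> :: "'a \<Rightarrow> ennreal" where \<sigma>: "\<sigma> \<in> borel_measurable borel"
      "(\<integral>\<^sup>+\<omega>. \<sigma> \<omega> * ennreal ((2 * japanese \<omega>) powr s) \<partial>lborel) < top" "\<And>y \<omega>. V g y \<omega> \<le> \<sigma> \<omega>"
      using STFT_frequency_majorant[OF gM \<phi>\<^sub>0(1)] by metis
    have "integrable lborel (\<lambda>\<eta>. a \<eta> * ?G x \<xi> \<eta>)"
    proof -
      obtain F B where F: "continuous_on UNIV F" "\<And>x. cmod (F x) \<le> B" "g = distr_of_fun F"
        using M_continuous_representative[OF gM] by metis
      let ?h = "\<lambda>t. F t * cnj (\<phi>\<^sub>0 (t - x))"
      have b: "cmod (?G x \<xi> \<eta>) \<le> (LINT t|lborel. norm (?h t))" for \<eta>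
        unfolding F(3) STFT_distr_of_fun[OF \<phi>\<^sub>0(1)] by (rule norm_fourier_le[OF windowed_integrable(1)[OF F(1,2) \<phi>\<^sub>0(1)]])
      show ?thesis
      proof (rule Bochner_Integration.integrable_bound)
        show "integrable lborel (\<lambda>\<eta>. a \<eta> * of_real (LINT t|lborel. norm (?h t)))" using a by simp
        show "AE \<eta> in lborel. norm (a \<eta> * ?G x \<xi> \<eta>) \<le> norm (a \<eta> * of_real (LINT t|lborel. norm (?h t)))"
        proof (rule AE_I2)
          fix \<eta>
          show "norm (a \<eta> * ?G x \<xi> \<eta>) \<le> norm (a \<eta> * of_real (LINT t|lborel. norm (?h t)))"
            unfolding norm_mult[of "a \<eta>"] norm_of_real
            by (rule mult_left_mono[OF order_trans[OF b abs_ge_self] norm_ge_zero])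
        qed
      qed measurable
    qed
    from finite_sum_approximation[OF Z \<pi> _ a this, of "cball 0 R"]
    show ?thesis unfolding hg uS c_def by simp
  qed
  have "mixed_norm r s (\<lambda>x \<xi>. ennreal (cmod (STFT \<phi>\<^sub>0 h x \<xi> - STFT \<phi>\<^sub>0 u x \<xi>))) \<le> mixed_norm r s (\<lambda>x \<xi>. \<integral>\<^sup>+\<eta>. ?K x \<xi> \<eta> \<partial>lborel)"
    by (rule mixed_norm_mono[OF r le])
  also have "\<dots> \<le> (\<integral>\<^sup>+\<eta>. mixed_norm r s (\<lambda>x \<xi>. ?K x \<xi> \<eta>) \<partial>lborel)"
  proof (rule mixed_norm_integral_le[OF r sigma_finite_lborel])
    have [measurable]: "Measurable.pred ((borel \<Otimes>\<^sub>M borel) \<Otimes>\<^sub>M lborel) (\<lambda>w :: ('a \<times> 'a) \<times> 'a. snd w \<in> cball 0 R)"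
      by (intro measurable_compose[OF measurable_snd]) (simp add: pred_def)
    show "(\<lambda>((x, \<xi>), \<eta>). ?K x \<xi> \<eta>) \<in> borel_measurable ((borel \<Otimes>\<^sub>M borel) \<Otimes>\<^sub>M lborel)"
      unfolding case_prod_beta' by measurable
  qed
  also have "\<dots> \<le> (\<integral>\<^sup>+\<eta>. ennreal \<epsilon> * ennreal (cmod (a \<eta>)) + ?T \<eta> * indicator (- cball 0 R) \<eta> \<partial>lborel)"
  proof (rule nn_integral_mono)
    fix \<eta> :: 'a
    show "mixed_norm r s (\<lambda>x \<xi>. ?K x \<xi> \<eta>) \<le> ennreal \<epsilon> * ennreal (cmod (a \<eta>)) + ?T \<eta> * indicator (- cball 0 R) \<eta>"
    proof (cases "\<eta> \<in> cball 0 R")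
      case True
      have "mixed_norm r s (\<lambda>x \<xi>. ?K x \<xi> \<eta>) = ennreal (cmod (a \<eta>)) * mixed_norm r s (\<lambda>x \<xi>. ennreal (cmod (?G x \<xi> \<eta> - ?G x \<xi> (\<pi> \<eta>))))"
        unfolding if_P[OF True] by (rule mixed_norm_cmult[OF r V_diff_measurable[OF gt gt]])
      also have "\<dots> \<le> ennreal (cmod (a \<eta>)) * ennreal \<epsilon>" by (intro mult_left_mono \<pi>P True) simp
      finally show ?thesis using True by (simp add: mult.commute)
    next
      case False
      have "mixed_norm r s (\<lambda>x \<xi>. ?K x \<xi> \<eta>) = ennreal (cmod (a \<eta>)) * mixed_norm r s (\<lambda>x \<xi>. V g (x + 0) (\<xi> + - \<eta>))"
        unfolding if_not_P[OF False] by (subst mixed_norm_cmult[OF r, symmetric]) simp_all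
      also have "\<dots> \<le> ennreal (cmod (a \<eta>)) * (ennreal ((2 * japanese (- \<eta>)) powr s) * mixed_norm r s (V g))"
        by (intro mult_left_mono mixed_norm_shift[OF r s V_measurable[OF gt]]) simp
      also have "\<dots> = ?T \<eta>" by (simp add: mult.assoc)
      finally show ?thesis using False by (simp add: add_increasing)
    qed
  qed
  also have "\<dots> = ennreal \<epsilon> * (\<integral>\<^sup>+\<eta>. ennreal (cmod (a \<eta>)) \<partial>lborel) + (\<integral>\<^sup>+\<eta>. ?T \<eta> * indicator (- cball 0 R) \<eta> \<partial>lborel)"
    by (subst nn_integral_add) (auto simp: nn_integral_cmult)
  also have "\<dots> \<le> ennreal \<epsilon> * ennreal w + ennreal \<epsilon>" unfolding w(2) by (intro add_left_mono R)
  also have "\<dots> = ennreal (\<epsilon> * (w + 1))"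
    using \<epsilon> w(1) by (simp add: ennreal_mult[symmetric] ennreal_plus[symmetric] algebra_simps del: ennreal_plus)
  also have "\<epsilon> * (w + 1) = \<epsilon>'" using w(1) by (simp add: \<epsilon>_def)
  finally show "\<exists>g\<in>I. mixed_norm r s (\<lambda>x \<xi>. ennreal (cmod (STFT \<phi>\<^sub>0 h x \<xi> - STFT \<phi>\<^sub>0 g x \<xi>))) < e"
    using uI \<epsilon>'(2) by (blast intro: le_less_trans)
qed

text \<open>The amplitude of \<open>\<chi>\<^sub>k f\<close> is its Fourier transform up to a constant, that is \<open>V\<^sub>\<psi> f(0, \<cdot>)\<close> for
  the window \<open>\<psi> = cnj \<chi>\<^sub>k\<close>. So the frequency majorant of \<open>f\<close> provides the integrability that
  superpositions require.\<close>

theorem modulation_invariant_closed_ideal: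
  assumes I: "linear_subspace \<phi>\<^sub>0 (ennreal r) s I" and cl: "norm_closed \<phi>\<^sub>0 (ennreal r) s I"
    and mi: "modulation_invariant I"
  shows "ideal \<phi>\<^sub>0 (ennreal r) s I"
  unfolding ideal_def M_def[symmetric]
proof (intro conjI ballI I)
  fix f g assume f: "f \<in> M" and gI: "g \<in> I"
  have g: "g \<in> M" using I gI unfolding linear_subspace_def M_def by blast
  obtain F B where F: "continuous_on UNIV F" "\<And>x. cmod (F x) \<le> B" "f = distr_of_fun F" "cont_fun f = F"
    using M_continuous_representative[OF f] by metis
  obtain G B' where G: "continuous_on UNIV G" "\<And>x. cmod (G x) \<le> B'" "g = distr_of_fun G" "cont_fun g = G"
    using M_continuous_representative[OF g] by metis
  let ?FG = "\<lambda>x. F x * G x"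
  have FG: "continuous_on UNIV ?FG" "cmod (?FG x) \<le> B * B'" for x
    unfolding norm_mult using F(1,2) G(1,2) order_trans[OF norm_ge_zero F(2)]
    by (auto intro!: continuous_on_mult mult_mono)
  have fgM: "distr_of_fun ?FG \<in> M"
    using distr_of_fun_mult_in_M[OF _ F(1,2) _ G(1,2)] f g F(3) G(3) by simp
  have step: "distr_of_fun (\<lambda>t. cutoff k t * ?FG t) \<in> I" for k
  proof -
    obtain Bc where Bc: "\<And>t :: 'a. cmod (cutoff k t) \<le> Bc" using cutoff_bounded by blast
    let ?c = "of_real ((2 * pi) ^ DIM('a)) :: complex" and ?\<psi> = "\<lambda>t. cnj (cutoff k t)"
    have \<psi>: "?\<psi> \<in> schwartz" by (rule schwartz_cnj[OF cutoff_schwartz])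
    \<comment> \<open>the amplitude of the cut-off function\<close>
    define a where "a \<eta> = STFT ?\<psi> f 0 \<eta> / ?c" for \<eta>
    obtain \<sigma> :: "'a \<Rightarrow> ennreal" where \<sigma>: "\<sigma> \<in> borel_measurable borel"
      "(\<integral>\<^sup>+\<omega>. \<sigma> \<omega> * ennreal ((2 * japanese \<omega>) powr s) \<partial>lborel) < top"
      "\<And>y \<omega>. ennreal (cmod (STFT ?\<psi> f y \<omega>)) \<le> \<sigma> \<omega>"
      using STFT_frequency_majorant[OF f \<psi>] by metis
    have ft: "f \<in> tempered_distr" using f by (simp add: M_iff)
    note [measurable] = STFT_measurable[OF ft \<psi>]
    have am[measurable]: "a \<in> borel_measurable borel" unfolding a_def by measurable
    have "1 \<le> 2 * pi" using pi_gt3 by linarith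
    then have c1: "1 \<le> (2 * pi) ^ DIM('a)" by (rule one_le_power)
    have a\<sigma>: "ennreal (cmod (a \<eta>)) \<le> \<sigma> \<eta>" for \<eta>
    proof -
      have "cmod (a \<eta>) \<le> cmod (STFT ?\<psi> f 0 \<eta>) / 1"
        unfolding a_def norm_divide norm_of_real using c1 by (intro divide_left_mono) auto
      then show ?thesis using order_trans[OF ennreal_leI \<sigma>(3)[of 0 \<eta>]] by simp
    qed
    have ai: "integrable lborel a" by (rule majorant_integrable[OF \<sigma>(1,2) am a\<sigma>])
    have aw: "(\<integral>\<^sup>+\<eta>. ennreal (cmod (a \<eta>)) * ennreal ((2 * japanese \<eta>) powr s) \<partial>lborel) < top"
      by (rule le_less_trans[OF nn_integral_mono \<sigma>(2)]) (intro mult_right_mono a\<sigma>, simp)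
    have hM: "distr_of_fun (\<lambda>t. cutoff k t * ?FG t) \<in> M"
      by (rule distr_of_fun_mult_in_M[OF schwartz_in_M[OF cutoff_schwartz] schwartz_continuous[OF cutoff_schwartz] Bc fgM FG])
    show ?thesis
    proof (rule frequency_superposition_in_closed_subspace[OF I cl mi gI hM ai aw])
      fix x \<xi>
      have "STFT \<phi>\<^sub>0 (distr_of_fun (\<lambda>t. cutoff k t * ?FG t)) x \<xi>
        = fourier (\<lambda>t. F t * cnj (?\<psi> (t - 0)) * (G t * cnj (\<phi>\<^sub>0 (t - x)))) \<xi>"
        by (simp add: STFT_distr_of_fun[OF \<phi>\<^sub>0(1)] mult_ac)
      also have "\<dots> = (LINT \<eta>|lborel. STFT ?\<psi> (distr_of_fun F) 0 \<eta> / ?c * fourier (\<lambda>t. G t * cnj (\<phi>\<^sub>0 (t - x))) (\<xi> - \<eta>))"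
        using f F(3) by (intro STFT_product[OF _ F(1,2) \<psi> windowed_integrable(1)[OF G(1,2) \<phi>\<^sub>0(1)]]) simp
      also have "\<dots> = (LINT \<eta>|lborel. a \<eta> * STFT \<phi>\<^sub>0 g x (\<xi> - \<eta>))"
        unfolding a_def F(3) G(3) STFT_distr_of_fun[OF \<phi>\<^sub>0(1)] ..
      finally show "STFT \<phi>\<^sub>0 (distr_of_fun (\<lambda>t. cutoff k t * ?FG t)) x \<xi> = (LINT \<eta>|lborel. a \<eta> * STFT \<phi>\<^sub>0 g x (\<xi> - \<eta>))" .
    qed
  qed
  have "distr_of_fun ?FG \<in> I"
  proof (rule norm_closedD[OF cl fgM])
    fix \<epsilon> :: ennreal assume \<epsilon>: "0 < \<epsilon>"
    from order_tendstoD(2)[OF cutoff_approximation[OF fgM FG] \<epsilon>]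
    obtain k where "mixed_norm r s (\<lambda>x \<xi>. ennreal (cmod (STFT \<phi>\<^sub>0 (distr_of_fun ?FG) x \<xi> - STFT \<phi>\<^sub>0 (distr_of_fun (\<lambda>t. cutoff k t * ?FG t)) x \<xi>))) < \<epsilon>"
      unfolding eventually_sequentially by blast
    then show "\<exists>g\<in>I. mixed_norm r s (\<lambda>x \<xi>. ennreal (cmod (STFT \<phi>\<^sub>0 (distr_of_fun ?FG) x \<xi> - STFT \<phi>\<^sub>0 g x \<xi>))) < \<epsilon>"
      using step by blast
  qed
  then show "pointwise_mult f g \<in> I" by (simp add: pointwise_mult_def F(4) G(4))
qed

section \<open>Orthogonality\<close>

text \<open>Each change to the window \<open>\<phi>\<^sub>0\<close> costs one smearing. Both smearings are put on \<open>f\<close>, where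
  Minkowski's inequality controls them, and the transform of \<open>g\<close> enters Hoelder's inequality as it
  stands.\<close>

theorem STFT_product_integrable:
  assumes f: "f \<in> M" and g: "g \<in> modulation_space \<phi>\<^sub>0 (conj_exponent (ennreal r)) \<infinity> (- s)"
    and \<phi>: "\<phi> \<in> schwartz" and \<psi>: "\<psi> \<in> schwartz"
  shows "integrable (lborel \<Otimes>\<^sub>M lborel) (\<lambda>(x, \<xi>). STFT \<phi> f x \<xi> * cnj (STFT \<psi> g x \<xi>))"
proof -
  let ?N = smoothing_order
  have ft: "f \<in> tempered_distr" and fin: "mixed_norm r s (V f) < top" using f by (auto simp: M_iff)
  have gt: "g \<in> tempered_distr" using g by (simp add: modulation_space_def)
  note [measurable] = STFT_measurable[OF ft \<phi>] STFT_measurable[OF gt \<psi>]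
  have m: "case_prod (\<lambda>x \<xi>. STFT \<phi> f x \<xi> * cnj (STFT \<psi> g x \<xi>)) \<in> borel_measurable (borel \<Otimes>\<^sub>M borel)" by measurable
  obtain C1 where C1: "C1 < top" "\<And>y \<omega>. ennreal (cmod (STFT \<phi> f y \<omega>)) \<le> C1 * smear ?N (V f) y \<omega>"
    using STFT_change_of_window[OF \<phi>\<^sub>0 \<phi>] ft by metis
  obtain C2 where C2: "C2 < top" "\<And>y \<omega>. ennreal (cmod (STFT \<psi> g y \<omega>)) \<le> C2 * smear ?N (V g) y \<omega>"
    using STFT_change_of_window[OF \<phi>\<^sub>0 \<psi>] gt by metis
  note Vf = V_measurable[OF ft] and Vg[measurable] = V_measurable[OF gt]
  note sf[measurable] = smear_measurable[OF Vf, of ?N] and sg[measurable] = smear_measurable[OF Vg, of ?N]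
  \<comment> \<open>one smearing from each of the two changes of window\<close>
  let ?A = "smear ?N (smear ?N (V f))"
  note sA[measurable] = smear_measurable[OF sf, of ?N]
  have Afin: "mixed_norm r s ?A < top" by (intro mixed_norm_smear_finite sf Vf fin)
  let ?q = "conj_exponent (ennreal r)"
  define E where "E = modulation_norm \<phi>\<^sub>0 ?q \<infinity> (- s) g"
  have E: "E < top" using g by (simp add: E_def modulation_space_def)
  have Eae: "AE \<xi> in lborel. ennreal (japanese \<xi> powr (- s)) * Lebesgue_norm ?q (\<lambda>x. V g x \<xi>) \<le> E"
    unfolding E_def modulation_norm_def Lebesgue_norm_def[of "\<infinity>"] by (simp add: esssup_AE)
  note [measurable] = measurable_slices[OF sA] measurable_slices[OF Vg]
  have "(\<integral>\<^sup>+x. (\<integral>\<^sup>+\<xi>. ennreal (norm (STFT \<phi> f x \<xi> * cnj (STFT \<psi> g x \<xi>))) \<partial>lborel) \<partial>lborel)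
    = (\<integral>\<^sup>+z. ennreal (norm (STFT \<phi> f (fst z) (snd z) * cnj (STFT \<psi> g (fst z) (snd z)))) \<partial>lborel)"
    by (rule nn_integral_lborel_pair(1)[symmetric]) measurable
  also have "\<dots> \<le> (\<integral>\<^sup>+z. (C1 * C2) * (smear ?N (V f) (fst z) (snd z) * smear ?N (V g) (fst z) (snd z)) \<partial>lborel)"
  proof (rule nn_integral_mono)
    fix z :: "'a \<times> 'a"
    have "ennreal (norm (STFT \<phi> f (fst z) (snd z) * cnj (STFT \<psi> g (fst z) (snd z))))
      = ennreal (cmod (STFT \<phi> f (fst z) (snd z))) * ennreal (cmod (STFT \<psi> g (fst z) (snd z)))"
      by (simp add: norm_mult ennreal_mult)
    also have "\<dots> \<le> (C1 * smear ?N (V f) (fst z) (snd z)) * (C2 * smear ?N (V g) (fst z) (snd z))"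
      by (intro mult_mono C1 C2) auto
    finally show "ennreal (norm (STFT \<phi> f (fst z) (snd z) * cnj (STFT \<psi> g (fst z) (snd z))))
       \<le> (C1 * C2) * (smear ?N (V f) (fst z) (snd z) * smear ?N (V g) (fst z) (snd z))"
      by (simp only: mult_ac)
  qed
  also have "\<dots> = (C1 * C2) * (\<integral>\<^sup>+z. smear ?N (V f) (fst z) (snd z) * smear ?N (V g) (fst z) (snd z) \<partial>lborel)"
    by (rule nn_integral_cmult) measurable
  also have "(\<integral>\<^sup>+z. smear ?N (V f) (fst z) (snd z) * smear ?N (V g) (fst z) (snd z) \<partial>lborel)
    = (\<integral>\<^sup>+z. ?A (fst z) (snd z) * V g (fst z) (snd z) \<partial>lborel)"
    by (rule smear_selfadjoint[OF Vg sf])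
  also have "\<dots> = (\<integral>\<^sup>+\<xi>. (\<integral>\<^sup>+x. ?A x \<xi> * V g x \<xi> \<partial>lborel) \<partial>lborel)"
    by (rule nn_integral_lborel_pair(2)) measurable
  also have "\<dots> \<le> (\<integral>\<^sup>+\<xi>. (ennreal (japanese \<xi> powr s) * Lebesgue_norm (ennreal r) (\<lambda>x. ?A x \<xi>)) * E \<partial>lborel)"
  proof (rule nn_integral_mono_AE)
    show "AE \<xi> in lborel. (\<integral>\<^sup>+x. ?A x \<xi> * V g x \<xi> \<partial>lborel)
      \<le> (ennreal (japanese \<xi> powr s) * Lebesgue_norm (ennreal r) (\<lambda>x. ?A x \<xi>)) * E"
      using Eae
    proof eventually_elim
      case (elim \<xi>)
      have one: "ennreal (japanese \<xi> powr s) * ennreal (japanese \<xi> powr (- s)) = 1"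
        by (simp add: ennreal_mult[symmetric] powr_add[symmetric])
      have "(\<integral>\<^sup>+x. ?A x \<xi> * V g x \<xi> \<partial>lborel) \<le> Lebesgue_norm (ennreal r) (\<lambda>x. ?A x \<xi>) * Lebesgue_norm ?q (\<lambda>x. V g x \<xi>)"
        by (rule Hoelder_inequality[OF r]) measurable
      also have "\<dots> = (ennreal (japanese \<xi> powr s) * ennreal (japanese \<xi> powr (- s))) * (Lebesgue_norm (ennreal r) (\<lambda>x. ?A x \<xi>) * Lebesgue_norm ?q (\<lambda>x. V g x \<xi>))"
        unfolding one by simp
      also have "\<dots> = (ennreal (japanese \<xi> powr s) * Lebesgue_norm (ennreal r) (\<lambda>x. ?A x \<xi>)) * (ennreal (japanese \<xi> powr (- s)) * Lebesgue_norm ?q (\<lambda>x. V g x \<xi>))"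
        by (simp only: mult_ac)
      also have "\<dots> \<le> (ennreal (japanese \<xi> powr s) * Lebesgue_norm (ennreal r) (\<lambda>x. ?A x \<xi>)) * E"
        by (intro mult_left_mono elim) simp
      finally show ?case .
    qed
  qed
  also have "\<dots> = mixed_norm r s ?A * E"
    unfolding mixed_norm_def using Lebesgue_norm_slice_measurable[OF r sA] by (intro nn_integral_multc) simp
  finally have "(\<integral>\<^sup>+x. (\<integral>\<^sup>+\<xi>. ennreal (norm (STFT \<phi> f x \<xi> * cnj (STFT \<psi> g x \<xi>))) \<partial>lborel) \<partial>lborel) \<le> C1 * C2 * (mixed_norm r s ?A * E)"
    by (simp add: mult_left_mono)
  also have "\<dots> < top" using C1(1) C2(1) Afin E by (simp add: ennreal_mult_less_top)
  finally show ?thesis by (rule lborel_Fubini(1)[OF m])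
qed

lemma STFT_distr_cnj: "STFT (\<lambda>t. cnj (\<psi> t)) (distr_cnj g) x \<omega> = cnj (STFT \<psi> g x (- \<omega>))"
proof -
  have "(\<lambda>t. cnj (atom (\<lambda>t. cnj (\<psi> t)) (x, \<omega>) t)) = atom \<psi> (x, - \<omega>)"
    by (simp add: atom_def fun_eq_iff cis_cnj)
  then show ?thesis by (simp add: STFT_atom distr_cnj_def)
qed

text \<open>Conjugation reflects the frequency, so the convolution at \<open>\<zeta>\<close> pairs \<open>V\<^sub>\<phi> f\<close> with a translate
  of \<open>V\<^sub>\<psi> g\<close>. Shifting the variable moves the translation to \<open>f\<close>, where it is a modulation.\<close>

theorem convolution_pairing_eq:
  assumes f: "f \<in> M" and g: "g \<in> modulation_space \<phi>\<^sub>0 (conj_exponent (ennreal r)) \<infinity> (- s)"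
    and \<phi>: "\<phi> \<in> schwartz" and \<psi>: "\<psi> \<in> schwartz"
  shows "(LINT x|lborel. convol (STFT \<phi> f x) (STFT (\<lambda>t. cnj (\<psi> t)) (distr_cnj g) x) \<zeta>)
    = (LINT (x, \<xi>)|lborel. STFT \<phi> (distr_modulate (- \<zeta>) f) x \<xi> * cnj (STFT \<psi> g x \<xi>))"
proof -
  let ?h = "distr_modulate (- \<zeta>) f"
  have ft: "f \<in> tempered_distr" using f by (auto simp: M_iff)
  have gt: "g \<in> tempered_distr" using g by (simp add: modulation_space_def)
  note [measurable] = STFT_measurable[OF ft \<phi>] STFT_measurable[OF gt \<psi>]
  have i: "integrable (lborel \<Otimes>\<^sub>M lborel) (\<lambda>(x, \<xi>). STFT \<phi> ?h x \<xi> * cnj (STFT \<psi> g x \<xi>))"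
    by (rule STFT_product_integrable[OF distr_modulate_in_M[OF f] g \<phi> \<psi>])
  have "convol (STFT \<phi> f x) (STFT (\<lambda>t. cnj (\<psi> t)) (distr_cnj g) x) \<zeta> = (LINT \<xi>|lborel. STFT \<phi> ?h x \<xi> * cnj (STFT \<psi> g x \<xi>))" for x
  proof -
    have "convol (STFT \<phi> f x) (STFT (\<lambda>t. cnj (\<psi> t)) (distr_cnj g) x) \<zeta> = (LINT \<eta>|lborel. STFT \<phi> f x \<eta> * cnj (STFT \<psi> g x (\<eta> - \<zeta>)))"
      by (simp add: convol_def STFT_distr_cnj)
    also have "\<dots> = (LINT \<eta>|lborel. STFT \<phi> f x (\<eta> + \<zeta>) * cnj (STFT \<psi> g x (\<eta> + \<zeta> - \<zeta>)))"
      by (rule integral_lborel_shift[symmetric]) measurable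
    also have "\<dots> = (LINT \<xi>|lborel. STFT \<phi> ?h x \<xi> * cnj (STFT \<psi> g x \<xi>))"
      by (simp add: STFT_distr_modulate)
    finally show ?thesis .
  qed
  then have "(LINT x|lborel. convol (STFT \<phi> f x) (STFT (\<lambda>t. cnj (\<psi> t)) (distr_cnj g) x) \<zeta>)
    = (LINT x|lborel. (LINT \<xi>|lborel. STFT \<phi> ?h x \<xi> * cnj (STFT \<psi> g x \<xi>)))" by simp
  also have "\<dots> = integral\<^sup>L (lborel \<Otimes>\<^sub>M lborel) (\<lambda>(x, \<xi>). STFT \<phi> ?h x \<xi> * cnj (STFT \<psi> g x \<xi>))"
    by (rule lborel_pair.integral_fst[OF i])
  finally show ?thesis by (simp add: lborel_prod)
qed

end

section \<open>The two equivalences\<close>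

theorem lemma4p4:
  fixes \<phi>\<^sub>0 :: "real ^ 'n \<Rightarrow> complex" and p :: ennreal and s :: real
  assumes "\<phi>\<^sub>0 \<in> schwartz" and "\<phi>\<^sub>0 \<noteq> (\<lambda>_. 0)"
    and "1 \<le> p" and "p < \<infinity>" and "0 \<le> s"
  shows
    "(\<forall>I g. ideal \<phi>\<^sub>0 p s I \<and> norm_closed \<phi>\<^sub>0 p s I \<and>
        g \<in> modulation_space \<phi>\<^sub>0 (conj_exponent p) \<infinity> (- s) \<longrightarrow>
        ((\<forall>\<phi>\<in>schwartz. \<forall>\<psi>\<in>schwartz. L2_pairing \<psi> \<phi> \<noteq> 0 \<longrightarrow>
            (\<forall>f\<in>I. (LINT (x, \<xi>)|lborel. STFT \<phi> f x \<xi> * cnj (STFT \<psi> g x \<xi>)) = 0))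
         \<longleftrightarrow>
         (\<forall>\<phi>\<in>schwartz. \<forall>\<psi>\<in>schwartz. L2_pairing \<psi> \<phi> \<noteq> 0 \<longrightarrow>
            (\<forall>f\<in>I. \<forall>\<xi>. (LINT x|lborel.
               convol (STFT \<phi> f x) (STFT (\<lambda>t. cnj (\<psi> t)) (distr_cnj g) x) \<xi>) = 0))))
     \<and>
     (\<forall>I. linear_subspace \<phi>\<^sub>0 p s I \<and> norm_closed \<phi>\<^sub>0 p s I \<longrightarrow>
        (ideal \<phi>\<^sub>0 p s I \<longleftrightarrow> modulation_invariant I))"
proof -
  obtain r where p: "p = ennreal r" "0 \<le> r" using assms(4) by (cases p) auto
  have r1: "1 \<le> r" using assms(3) p by (simp add: p)
  interpret modulation_window \<phi>\<^sub>0 r s by standard (use assms r1 in auto)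
  have i: "(\<forall>\<phi>\<in>schwartz. \<forall>\<psi>\<in>schwartz. L2_pairing \<psi> \<phi> \<noteq> 0 \<longrightarrow>
            (\<forall>f\<in>I. (LINT (x, \<xi>)|lborel. STFT \<phi> f x \<xi> * cnj (STFT \<psi> g x \<xi>)) = 0))
         \<longleftrightarrow>
         (\<forall>\<phi>\<in>schwartz. \<forall>\<psi>\<in>schwartz. L2_pairing \<psi> \<phi> \<noteq> 0 \<longrightarrow>
            (\<forall>f\<in>I. \<forall>\<xi>. (LINT x|lborel.
               convol (STFT \<phi> f x) (STFT (\<lambda>t. cnj (\<psi> t)) (distr_cnj g) x) \<xi>) = 0))"
      (is "?A \<longleftrightarrow> ?B")
    if H: "ideal \<phi>\<^sub>0 p s I \<and> norm_closed \<phi>\<^sub>0 p s I \<and>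
      g \<in> modulation_space \<phi>\<^sub>0 (conj_exponent p) \<infinity> (- s)" for I g
  proof -
    note H = H[unfolded p(1)]
    have "I \<subseteq> M" using H by (simp add: ideal_def linear_subspace_def M_def)
    then have IM: "f \<in> M" if "f \<in> I" for f using that by (rule subsetD)
    have inv: "distr_modulate \<eta> f \<in> I" if "f \<in> I" for f \<eta>
    proof -
      have "modulation_invariant I" using H by (intro closed_ideal_modulation_invariant) auto
      then show ?thesis using that unfolding modulation_invariant_def by blast
    qed
    have conv: "(LINT x|lborel. convol (STFT \<phi> f x) (STFT (\<lambda>t. cnj (\<psi> t)) (distr_cnj g) x) \<zeta>)
      = (LINT (x, \<xi>)|lborel. STFT \<phi> (distr_modulate (- \<zeta>) f) x \<xi> * cnj (STFT \<psi> g x \<xi>))"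
      if "f \<in> I" "\<phi> \<in> schwartz" "\<psi> \<in> schwartz" for f \<phi> \<psi> \<zeta>
      by (rule convolution_pairing_eq) (use H IM that in auto)
    have zero: "distr_modulate 0 f = f" for f :: "(real ^ 'n) distr"
      by (simp add: distr_modulate_def modulate_def)
    show ?thesis
    proof
      assume ?A
      then show ?B using conv inv by simp
    next
      assume B: ?B
      show ?A
      proof (intro ballI impI)
        fix \<phi> \<psi> :: "real ^ 'n \<Rightarrow> complex" and f
        assume "\<phi> \<in> schwartz" "\<psi> \<in> schwartz" "L2_pairing \<psi> \<phi> \<noteq> 0" "f \<in> I"
        with B conv[of f \<phi> \<psi> 0] show "(LINT (x, \<xi>)|lborel. STFT \<phi> f x \<xi> * cnj (STFT \<psi> g x \<xi>)) = 0"
          by (simp add: zero)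
      qed
    qed
  qed
  have ii: "ideal \<phi>\<^sub>0 p s I \<longleftrightarrow> modulation_invariant I"
    if "linear_subspace \<phi>\<^sub>0 p s I \<and> norm_closed \<phi>\<^sub>0 p s I" for I
    using that closed_ideal_modulation_invariant modulation_invariant_closed_ideal unfolding p(1) by blast
  show ?thesis
    by (rule conjI; intro allI impI; erule i ii)
qed

end
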